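(* There is a deterministic algorithm in the comparison-addition model that, given an undirected graph with $n$ vertices, $m$ edges and non-negative real edge weights, together with a source vertex $s$, computes the distance $d(s,v)$ from $s$ to every vertex $v$ in $O(m\sqrt{\log n\log\log n})$ time.
   Context: In the comparison-addition model, edge weights are real numbers that may only be accessed via comparisons and additions, each costing unit time. $d(u,v)$ denotes the shortest-path distance between $u$ and $v$. *)

theory Defs
  imports "Graph_Theory.Graph_Theory" Complex_Main
begin

section \<open>The comparison-addition model\<close>

text \<open>
  Algorithms are programs for a random access machine whose memory consists of named, unbounded
  arrays (a program mentions only finitely many of them), of two separate kinds.
  Integer arrays hold machine words, on which arithmetic, comparison and addressing
  are available. Real arrays hold edge weights and sums of them; the language offers only copying,
  addition and comparison for reals, there are no real literals, and no real number can be turned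
  into an integer.
\<close>

type_synonym name = string

record state =
  imem :: "name \<Rightarrow> nat \<Rightarrow> nat"
  rmem :: "name \<Rightarrow> nat \<Rightarrow> real"

datatype iexp =
    Lit nat
  | IElem name iexp
  | IPlus iexp iexp
  | IMinus iexp iexp
  | ITimes iexp iexp
  | IDiv iexp iexp

datatype rexp =
    RElem name iexp
  | RPlus rexp rexp

datatype bexp =
    ILess iexp iexp
  | RLess rexp rexp
  | BNot bexp
  | BAnd bexp bexp

datatype com =
    Skip
  | IAssign name iexp iexp
  | RAssign name iexp rexp
  | Seq com com
  | Cond bexp com com
  | While bexp com

primrec ival :: "iexp \<Rightarrow> state \<Rightarrow> nat" where
  "ival (Lit k) \<sigma> = k"
| "ival (IElem a i) \<sigma> = imem \<sigma> a (ival i \<sigma>)"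
| "ival (IPlus e1 e2) \<sigma> = ival e1 \<sigma> + ival e2 \<sigma>"
| "ival (IMinus e1 e2) \<sigma> = ival e1 \<sigma> - ival e2 \<sigma>"
| "ival (ITimes e1 e2) \<sigma> = ival e1 \<sigma> * ival e2 \<sigma>"
| "ival (IDiv e1 e2) \<sigma> = ival e1 \<sigma> div ival e2 \<sigma>"

primrec rval :: "rexp \<Rightarrow> state \<Rightarrow> real" where
  "rval (RElem a i) \<sigma> = rmem \<sigma> a (ival i \<sigma>)"
| "rval (RPlus e1 e2) \<sigma> = rval e1 \<sigma> + rval e2 \<sigma>"

primrec bval :: "bexp \<Rightarrow> state \<Rightarrow> bool" where
  "bval (ILess e1 e2) \<sigma> \<longleftrightarrow> ival e1 \<sigma> < ival e2 \<sigma>"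
| "bval (RLess e1 e2) \<sigma> \<longleftrightarrow> rval e1 \<sigma> < rval e2 \<sigma>"
| "bval (BNot b) \<sigma> \<longleftrightarrow> \<not> bval b \<sigma>"
| "bval (BAnd b1 b2) \<sigma> \<longleftrightarrow> bval b1 \<sigma> \<and> bval b2 \<sigma>"

text \<open>
  Evaluation does not overflow: every integer that occurs, intermediate results and
  array indices included, is at most the largest machine word \<open>W\<close>.
\<close>

primrec iok :: "nat \<Rightarrow> iexp \<Rightarrow> state \<Rightarrow> bool" where
  "iok W (Lit k) \<sigma> \<longleftrightarrow> k \<le> W"
| "iok W (IElem a i) \<sigma> \<longleftrightarrow> iok W i \<sigma> \<and> ival (IElem a i) \<sigma> \<le> W"
| "iok W (IPlus e1 e2) \<sigma> \<longleftrightarrow> iok W e1 \<sigma> \<and> iok W e2 \<sigma> \<and> ival (IPlus e1 e2) \<sigma> \<le> W"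
| "iok W (IMinus e1 e2) \<sigma> \<longleftrightarrow> iok W e1 \<sigma> \<and> iok W e2 \<sigma> \<and> ival (IMinus e1 e2) \<sigma> \<le> W"
| "iok W (ITimes e1 e2) \<sigma> \<longleftrightarrow> iok W e1 \<sigma> \<and> iok W e2 \<sigma> \<and> ival (ITimes e1 e2) \<sigma> \<le> W"
| "iok W (IDiv e1 e2) \<sigma> \<longleftrightarrow> iok W e1 \<sigma> \<and> iok W e2 \<sigma> \<and> ival (IDiv e1 e2) \<sigma> \<le> W"

primrec rok :: "nat \<Rightarrow> rexp \<Rightarrow> state \<Rightarrow> bool" where
  "rok W (RElem a i) \<sigma> \<longleftrightarrow> iok W i \<sigma>"
| "rok W (RPlus e1 e2) \<sigma> \<longleftrightarrow> rok W e1 \<sigma> \<and> rok W e2 \<sigma>"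

primrec bok :: "nat \<Rightarrow> bexp \<Rightarrow> state \<Rightarrow> bool" where
  "bok W (ILess e1 e2) \<sigma> \<longleftrightarrow> iok W e1 \<sigma> \<and> iok W e2 \<sigma>"
| "bok W (RLess e1 e2) \<sigma> \<longleftrightarrow> rok W e1 \<sigma> \<and> rok W e2 \<sigma>"
| "bok W (BNot b) \<sigma> \<longleftrightarrow> bok W b \<sigma>"
| "bok W (BAnd b1 b2) \<sigma> \<longleftrightarrow> bok W b1 \<sigma> \<and> bok W b2 \<sigma>"

primrec icost :: "iexp \<Rightarrow> nat" where
  "icost (Lit k) = 1"
| "icost (IElem a i) = 1 + icost i"
| "icost (IPlus e1 e2) = 1 + icost e1 + icost e2"
| "icost (IMinus e1 e2) = 1 + icost e1 + icost e2"
| "icost (ITimes e1 e2) = 1 + icost e1 + icost e2"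
| "icost (IDiv e1 e2) = 1 + icost e1 + icost e2"

primrec rcost :: "rexp \<Rightarrow> nat" where
  "rcost (RElem a i) = 1 + icost i"
| "rcost (RPlus e1 e2) = 1 + rcost e1 + rcost e2"

primrec bcost :: "bexp \<Rightarrow> nat" where
  "bcost (ILess e1 e2) = 1 + icost e1 + icost e2"
| "bcost (RLess e1 e2) = 1 + rcost e1 + rcost e2"
| "bcost (BNot b) = 1 + bcost b"
| "bcost (BAnd b1 b2) = 1 + bcost b1 + bcost b2"

text \<open>
  \<open>exec W c \<sigma> t \<sigma>'\<close>: started in \<open>\<sigma>\<close>, the program \<open>c\<close> halts in \<open>\<sigma>'\<close> after
  exactly \<open>t\<close> time units, with no integer exceeding \<open>W\<close>. Runs that overflow are stuck, i.e. have
  no final state.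
\<close>

inductive exec :: "nat \<Rightarrow> com \<Rightarrow> state \<Rightarrow> nat \<Rightarrow> state \<Rightarrow> bool" for W :: nat where
  Skip: "exec W Skip \<sigma> 1 \<sigma>"
| IAssign: "\<lbrakk>iok W i \<sigma>; iok W e \<sigma>\<rbrakk> \<Longrightarrow>
    exec W (IAssign a i e) \<sigma> (1 + icost i + icost e)
      (\<sigma>\<lparr>imem := (imem \<sigma>)(a := (imem \<sigma> a)(ival i \<sigma> := ival e \<sigma>))\<rparr>)"
| RAssign: "\<lbrakk>iok W i \<sigma>; rok W e \<sigma>\<rbrakk> \<Longrightarrow>
    exec W (RAssign a i e) \<sigma> (1 + icost i + rcost e)
      (\<sigma>\<lparr>rmem := (rmem \<sigma>)(a := (rmem \<sigma> a)(ival i \<sigma> := rval e \<sigma>))\<rparr>)"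
| Seq: "\<lbrakk>exec W c1 \<sigma> t1 \<sigma>'; exec W c2 \<sigma>' t2 \<sigma>''\<rbrakk> \<Longrightarrow> exec W (Seq c1 c2) \<sigma> (t1 + t2) \<sigma>''"
| CondTrue: "\<lbrakk>bok W b \<sigma>; bval b \<sigma>; exec W c1 \<sigma> t \<sigma>'\<rbrakk> \<Longrightarrow>
    exec W (Cond b c1 c2) \<sigma> (1 + bcost b + t) \<sigma>'"
| CondFalse: "\<lbrakk>bok W b \<sigma>; \<not> bval b \<sigma>; exec W c2 \<sigma> t \<sigma>'\<rbrakk> \<Longrightarrow>
    exec W (Cond b c1 c2) \<sigma> (1 + bcost b + t) \<sigma>'"
| WhileFalse: "\<lbrakk>bok W b \<sigma>; \<not> bval b \<sigma>\<rbrakk> \<Longrightarrow> exec W (While b c) \<sigma> (1 + bcost b) \<sigma>"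
| WhileTrue: "\<lbrakk>bok W b \<sigma>; bval b \<sigma>; exec W c \<sigma> t1 \<sigma>'; exec W (While b c) \<sigma>' t2 \<sigma>''\<rbrakk> \<Longrightarrow>
    exec W (While b c) \<sigma> (1 + bcost b + t1 + t2) \<sigma>''"

inductive_cases Skip_E: "exec W Skip \<sigma> t \<sigma>'"
inductive_cases IAssign_E: "exec W (IAssign a i e) \<sigma> t \<sigma>'"
inductive_cases RAssign_E: "exec W (RAssign a i e) \<sigma> t \<sigma>'"
inductive_cases Seq_E: "exec W (Seq c1 c2) \<sigma> t \<sigma>'"
inductive_cases Cond_E: "exec W (Cond b c1 c2) \<sigma> t \<sigma>'"
inductive_cases While_E: "exec W (While b c) \<sigma> t \<sigma>'"

lemma exec_deterministic:
  assumes "exec W c \<sigma> t \<sigma>'" and "exec W c \<sigma> u \<sigma>''"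
  shows "t = u \<and> \<sigma>' = \<sigma>''"
  using assms
proof (induction arbitrary: u \<sigma>'' rule: exec.induct)
  case (Skip \<sigma>)
  from Skip.prems show ?case by (rule Skip_E) simp
next
  case (IAssign i \<sigma> e a)
  from IAssign.prems show ?case by (rule IAssign_E) simp
next
  case (RAssign i \<sigma> e a)
  from RAssign.prems show ?case by (rule RAssign_E) simp
next
  case (Seq c1 \<sigma> t1 \<sigma>1 c2 t2 \<sigma>2)
  from Seq.prems obtain u1 \<tau> u2
    where "exec W c1 \<sigma> u1 \<tau>" "exec W c2 \<tau> u2 \<sigma>''" and u: "u = u1 + u2"
    by (rule Seq_E)
  with Seq.IH(1)[of u1 \<tau>] Seq.IH(2)[of u2 \<sigma>''] show ?case by simp
next
  case (CondTrue b \<sigma> c1 t \<sigma>1 c2)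
  from CondTrue.prems show ?case
    by (rule Cond_E) (auto simp: CondTrue.hyps dest!: CondTrue.IH)
next
  case (CondFalse b \<sigma> c2 t \<sigma>1 c1)
  from CondFalse.prems show ?case
    by (rule Cond_E) (auto simp: CondFalse.hyps dest!: CondFalse.IH)
next
  case (WhileFalse b \<sigma> c)
  from WhileFalse.prems show ?case
    by (rule While_E) (simp_all add: WhileFalse.hyps)
next
  case (WhileTrue b \<sigma> c t1 \<sigma>1 t2 \<sigma>2)
  from WhileTrue.prems show ?case
    by (rule While_E) (auto simp: WhileTrue.hyps dest!: WhileTrue.IH)
qed


section \<open>Input and output\<close>

text \<open>
  Undirected graphs are symmetric digraphs, so every undirected edge is a pair of opposite arcs.
\<close>

definition num_edges :: "'a pair_pre_digraph \<Rightarrow> nat" where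
  "num_edges G = card ((\<lambda>(u, v). {u, v}) ` parcs G)"

text \<open>
  The condition on the length makes \<open>es\<close> list every undirected edge exactly once, in one of its
  two orientations.
\<close>

definition edge_list :: "'a pair_pre_digraph \<Rightarrow> ('a \<times> 'a) list \<Rightarrow> bool" where
  "edge_list G es \<longleftrightarrow> parcs G = set es \<union> (set es)\<inverse> \<and> length es = num_edges G"

text \<open>All memory not holding input is zero, in particular the arrays for the output.\<close>

definition init_state :: "nat \<Rightarrow> (nat \<times> nat) list \<Rightarrow> (nat \<times> nat \<Rightarrow> real) \<Rightarrow> nat \<Rightarrow> state" where
  "init_state n es w s = \<lparr>
     imem = (\<lambda>_ _. 0)
       (''n'' := (\<lambda>_. 0)(0 := n),
        ''m'' := (\<lambda>_. 0)(0 := length es),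
        ''source'' := (\<lambda>_. 0)(0 := s),
        ''end1'' := (\<lambda>i. if i < length es then fst (es ! i) else 0),
        ''end2'' := (\<lambda>i. if i < length es then snd (es ! i) else 0)),
     rmem = (\<lambda>_ _. 0)
       (''weight'' := (\<lambda>i. if i < length es then w (es ! i) else 0))\<rparr>"

text \<open>
  The distance to an unreachable vertex is infinite, which no real cell can hold; the integer array
  \<open>reached\<close> tells which entries of \<open>dist\<close> are meaningful.
\<close>

definition output_dist :: "state \<Rightarrow> nat \<Rightarrow> ereal" where
  "output_dist \<sigma> v = (if imem \<sigma> ''reached'' v = 0 then \<infinity> else ereal (rmem \<sigma> ''dist'' v))"

definition time_bound :: "nat \<Rightarrow> nat \<Rightarrow> real" where
  "time_bound n m = max 1 (real m * sqrt (log 2 (real n) * log 2 (log 2 (real n))))"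

text \<open>
  The maximum with 1 only matters in the degenerate cases \<open>n \<le> 2\<close> or \<open>m = 0\<close>, where the formula
  is 0 although every program takes at least one step.
\<close>

lemma time_bound_eq:
  assumes "3 \<le> n" and "1 \<le> m"
  shows "time_bound n m = real m * sqrt (log 2 (real n) * log 2 (log 2 (real n)))"
proof -
  have "11 / 7 \<le> log 2 (3::real)"
  proof -
    have "11 = log 2 ((2::real) ^ 11)" by (subst log_pow_cancel) auto
    also have "\<dots> \<le> log 2 (3 ^ 7)" by (subst log_le_cancel_iff) auto
    also have "\<dots> = 7 * log 2 3" by (subst log_nat_power) auto
    finally show ?thesis by simp
  qed
  also have "log 2 3 \<le> log 2 (real n)" using assms by (subst log_le_cancel_iff) auto
  finally have a: "11 / 7 \<le> log 2 (real n)" .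
  have "7 / 11 \<le> log 2 (11 / 7 :: real)"
  proof -
    have "7 = log 2 ((2::real) ^ 7)" by (subst log_pow_cancel) auto
    also have "\<dots> \<le> log 2 ((11 / 7) ^ 11)" by (subst log_le_cancel_iff) (auto simp: field_simps)
    also have "\<dots> = 11 * log 2 (11 / 7)" by (subst log_nat_power) auto
    finally show ?thesis by simp
  qed
  also have "\<dots> \<le> log 2 (log 2 (real n))" using a by (subst log_le_cancel_iff) auto
  finally have b: "7 / 11 \<le> log 2 (log 2 (real n))" .
  have "(11 / 7) * (7 / 11) \<le> log 2 (real n) * log 2 (log 2 (real n))"
    using a b by (intro mult_mono) auto
  then have "1 \<le> sqrt (log 2 (real n) * log 2 (log 2 (real n)))" by simp
  with assms(2) have "1 * 1 \<le> real m * sqrt (log 2 (real n) * log 2 (log 2 (real n)))"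
    by (intro mult_mono) auto
  then show ?thesis by (simp add: time_bound_def)
qed

end

theory Submission
  imports Defs
begin

text \<open>
 Replace every vertex by a path of weight zero through the ends of its edges, so that there are \<open>N = 2 m\<close> vertices, all of degree at
 most three. Dijkstra's algorithm then only has to keep a set \<open>R\<close> of \<open>O(N / k)\<close> centres in its heap. Every other vertex \<open>v\<close> belongs to the
 bundle of a centre \<open>b(v)\<close>, and a truncated run of Dijkstra's algorithm from \<open>v\<close> has produced a table of the vertices at least as close to
 \<open>v\<close> as \<open>b(v)\<close>, together with their neighbours. When a centre is extracted, the members of its bundle take their labels
 from the vertices in their tables, these labels are final, and they are propagated to the tables of the neighbours.

 The centres are found without randomness in stages. In each stage every vertex that has no centre yet lists its \<open>K\<close> nearest vertices, and
 any vertex that occurs in a fair share of the remaining lists becomes a centre of the vertices that listed it; this leaves at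
 most a quarter of the vertices, for which \<open>K\<close> is doubled. Hence the tables have total size \<open>O(N k)\<close>.

 The heap is a quake heap: decreasing a key takes constant and extracting the minimum logarithmic amortised time.
 The tables cost \<open>O(N k log k)\<close> and the centres \<open>O((N / k) log N)\<close>; the two are balanced at \<open>k\<^sup>2 = log N / log log N\<close>.
\<close>

section \<open>Reasoning about programs\<close>

text \<open>The fair share is a quarter of the average. Of the \<open>un * K\<close> list cells an
  average vertex gets \<open>un * K / N\<close>; a vertex is taken if it lies in at least a quarter
  as many unhit lists. So a stage takes at most \<open>4 * N / K\<close> centres, and the lists left
  unhit have at most \<open>un * K / 4\<close> cells. As \<open>un\<close> is quartered when
  \<open>K\<close> doubles, \<open>un * K\<close> halves, and centres, table cells and times of the
  stages form geometric series. The stages stop at \<open>un * k <= N\<close>; until then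
  \<open>K <= k * k\<close>, so the heap of an exploration has \<open>O(k * k)\<close> elements and
  its logarithm is \<open>O(log k)\<close>. Since \<open>log k\<close> is of order
  \<open>log log N\<close>, equating \<open>k * log k\<close> with \<open>(log N) / k\<close> gives
  the stated \<open>k\<close>. Undirectedness matters when a bundle is served, because the walk from
  a vertex to its centre is used in the other direction. A centre may lie in the bundle of another
  centre; its label at extraction is not claimed to be final, only minimal among the labelled
  centres not yet extracted. Times have explicit constants: the heap potential occurs in the
  postconditions, so amortisation passes through all loops.\<close>

notation imem ("_$_" [1000, 1000] 1000)

text \<open>Total correctness with time. As \<open>exec\<close> is deterministic, the existence of
  one run describes the run; the first argument of \<open>Q\<close> is its duration, so time bounds
  are proved as part of the postcondition.\<close>

definition wp :: "nat => com => (nat => state => bool) => state => bool" where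
 "wp W c Q st \<longleftrightarrow> (\<exists>t st'. exec W c st t st' & Q t st')"

text \<open>Single-cell updates as constants: intermediate states stay readable as nested terms and
  are seen only through \<open>imem\<close> and \<open>rmem\<close>.\<close>

definition iu :: "name => nat => nat => state => state" where
 "iu a i v st = st\<lparr>imem := (imem st)(a := (st$a)(i := v))\<rparr>"

definition ru :: "name => nat => real => state => state" where
 "ru a i v st = st\<lparr>rmem := (rmem st)(a := (rmem st a)(i := v))\<rparr>"

lemma mem_iu [simp]:
 "imem (iu a i v st) = (imem st)(a := (st$a)(i := v))" "rmem (iu a i v st) = rmem st"
 by (simp_all add: iu_def)

lemma mem_ru [simp]:
 "rmem (ru a i v st) = (rmem st)(a := (rmem st a)(i := v))" "imem (ru a i v st) = imem st"
 by (simp_all add: ru_def)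

lemma wp_mono:
 assumes "wp W c Q st" and "\<And>t st'. Q t st' ==> Q' t st'"
 shows "wp W c Q' st"
 using assms by (auto simp: wp_def)

lemma wp_Skip: "Q 1 st ==> wp W Skip Q st"
 unfolding wp_def by (blast intro: exec.Skip)

lemma wp_IAssign:
 assumes "iok W i st" "iok W e st" "Q (1 + icost i + icost e) (iu a (ival i st) (ival e st) st)"
 shows "wp W (IAssign a i e) Q st"
 using exec.IAssign[OF assms(1,2)] assms(3) unfolding wp_def iu_def by blast

lemma wp_RAssign:
 assumes "iok W i st" "rok W e st" "Q (1 + icost i + rcost e) (ru a (ival i st) (rval e st) st)"
 shows "wp W (RAssign a i e) Q st"
 using exec.RAssign[OF assms(1,2)] assms(3) unfolding wp_def ru_def by blast

lemma wp_Seq: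
 "wp W c1 (%t1. wp W c2 (%t2. Q (t1 + t2))) st ==> wp W (Seq c1 c2) Q st"
 unfolding wp_def by (blast intro: exec.Seq)

lemma wp_ISeq:
 assumes "iok W i st" "iok W e st"
  "wp W c (%t. Q (1 + icost i + icost e + t)) (iu a (ival i st) (ival e st) st)"
 shows "wp W (Seq (IAssign a i e) c) Q st"
 using assms by (intro wp_Seq wp_IAssign)

lemma wp_RSeq:
 assumes "iok W i st" "rok W e st"
  "wp W c (%t. Q (1 + icost i + rcost e + t)) (ru a (ival i st) (rval e st) st)"
 shows "wp W (Seq (RAssign a i e) c) Q st"
 using assms by (intro wp_Seq wp_RAssign)

lemma wp_Cond:
 assumes "bok W b st"
  and "bval b st ==> wp W c1 (%t. Q (1 + bcost b + t)) st"
  and "\<not> bval b st ==> wp W c2 (%t. Q (1 + bcost b + t)) st"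
 shows "wp W (Cond b c1 c2) Q st"
proof (cases "bval b st")
 case True
 then show ?thesis using assms unfolding wp_def by (blast intro: exec.CondTrue)
next
 case False
 then show ?thesis using assms unfolding wp_def by (blast intro: exec.CondFalse)
qed

text \<open>Assigned names are collected syntactically. With \<open>wp_frame\<close>, everything
  that a called program never assigns survives the call without being carried through its
  specification.\<close>

primrec imods :: "com => name set" where
 "imods Skip = {}"
| "imods (IAssign a i e) = {a}"
| "imods (RAssign a i e) = {}"
| "imods (Seq c1 c2) = imods c1 \<union> imods c2"
| "imods (Cond b c1 c2) = imods c1 \<union> imods c2"
| "imods (While b c) = imods c"

primrec rmods :: "com => name set" where
 "rmods Skip = {}"
| "rmods (IAssign a i e) = {}"
| "rmods (RAssign a i e) = {a}"
| "rmods (Seq c1 c2) = rmods c1 \<union> rmods c2"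
| "rmods (Cond b c1 c2) = rmods c1 \<union> rmods c2"
| "rmods (While b c) = rmods c"

definition unch :: "com => state => state => bool" where
 "unch c st st' \<longleftrightarrow> (\<forall>a. a \<notin> imods c --> st'$a = st$a) &
  (\<forall>a. a \<notin> rmods c --> rmem st' a = rmem st a)"

lemma exec_unch: "exec W c st t st' ==> unch c st st'"
 by (induction rule: exec.induct) (auto simp: unch_def)

lemma unch_refl: "unch c st st"
 by (simp add: unch_def)

lemma unch_trans: "unch c st st' ==> unch c st' st'' ==> unch c st st''"
 by (simp add: unch_def)

lemma wp_frame:
 assumes "wp W c Q st" and "\<And>t st'. Q t st' ==> unch c st st' ==> Q' t st'"
 shows "wp W c Q' st"
 using assms exec_unch unfolding wp_def by blast

text \<open>The potential \<open>\<phi>\<close> bounds the remaining running time, so it also yields termination.\<close>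

lemma wp_While:
 fixes \<phi> :: "state => nat"
 assumes init: "I st"
  and ok: "\<And>st'. I st' ==> unch c st st' ==> bok W b st'"
  and step: "\<And>st'. I st' ==> unch c st st' ==> bval b st' ==>
   wp W c (%t st''. I st'' & \<phi> st'' + t + 1 + bcost b <= \<phi> st') st'"
  and final: "\<And>t st'. I st' ==> unch c st st' ==> \<not> bval b st' ==>
   t + \<phi> st' <= \<phi> st + 1 + bcost b ==> Q t st'"
 shows "wp W (While b c) Q st"
proof -
 have "\<exists>t sv'. exec W (While b c) sv t sv' & I sv' & unch c st sv' & \<not> bval b sv' &
   t + \<phi> sv' <= \<phi> sv + 1 + bcost b" if "I sv" "unch c st sv" for sv
  using that
 proof (induction "\<phi> sv" arbitrary: sv rule: less_induct)
  case less
  show ?case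
  proof (cases "bval b sv")
   case False
   then show ?thesis using exec.WhileFalse ok less.prems by fastforce
  next
   case True
   obtain t1 sv1 where 1: "exec W c sv t1 sv1" "I sv1" "\<phi> sv1 + t1 + 1 + bcost b <= \<phi> sv"
    using step[OF less.prems True] unfolding wp_def by blast
   moreover have "unch c st sv1" using exec_unch[OF 1(1)] less.prems(2) by (rule unch_trans[rotated])
   ultimately obtain t2 sv2 where 2: "exec W (While b c) sv1 t2 sv2" "I sv2" "unch c st sv2"
    "\<not> bval b sv2" "t2 + \<phi> sv2 <= \<phi> sv1 + 1 + bcost b"
    using less.hyps[of sv1] by auto
   have "exec W (While b c) sv (1 + bcost b + t1 + t2) sv2"
    using exec.WhileTrue[OF ok[OF less.prems] True 1(1) 2(1)] .
   moreover have "1 + bcost b + t1 + t2 + \<phi> sv2 <= \<phi> sv + 1 + bcost b" using 1 2 by linarith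
   ultimately show ?thesis using 2 by blast
  qed
 qed
 from this[OF init unch_refl] show ?thesis unfolding wp_def using final by blast
qed

abbreviation V :: "name => iexp" where "V a \<equiv> IElem a (Lit 0)"
abbreviation setv :: "name => iexp => com" (infix "<-" 65) where "a <- e \<equiv> IAssign a (Lit 0) e"
notation Seq (infixr ";;" 60)

abbreviation inc :: "name => com" where "inc a \<equiv> a <- IPlus (V a) (Lit 1)"
abbreviation dec :: "name => com" where "dec a \<equiv> a <- IMinus (V a) (Lit 1)"
abbreviation pos :: "iexp => bexp" where "pos e \<equiv> ILess (Lit 0) e"

lemmas wp_basic = wp_Skip wp_IAssign wp_RAssign wp_Seq

section \<open>Quake heaps\<close>

lemma slot_inj:
 fixes x y N :: nat
 assumes "x < N" "y < N"
 shows "h * N + x = g * N + y \<longleftrightarrow> h = g & x = y"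
proof
 assume *: "h * N + x = g * N + y"
 have "(h * N + x) div N = h" "(g * N + y) div N = g" using assms by simp_all
 with * have "h = g" by simp
 with * show "h = g & x = y" by simp
qed simp

text \<open>Element \<open>x\<close> owns the tree nodes \<open>(h, x)\<close> for
  \<open>h <= ht x\<close>: a winner appears on every level up to its last match. Links are shifted
  by one, with 0 for none. \<open>pa x\<close> is the element that beat \<open>x\<close> on level
  \<open>Suc (ht x)\<close>; the slot \<open>lo (h * N + x)\<close> is the loser that
  \<open>x\<close> beat to reach level \<open>h\<close>, empty if that child was cut off;
  \<open>bk h\<close> is the one registered root of height \<open>h\<close>. \<open>Z\<close> holds
  the roots that are in no bucket at the moment, and \<open>cnt h\<close> is the number of nodes on
  level \<open>h\<close>.\<close>

definition hinv :: "nat => nat set => nat set => (nat => real) => (nat => nat) => (nat => nat) =>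
  (nat => nat) => (nat => nat) => (nat => nat) => bool" where
 "hinv N S Z key ht pa lo bk cnt \<longleftrightarrow>
  S \<subseteq> {..<N} & Z \<subseteq> {x \<in> S. pa x = 0} &
  (\<forall>x\<in>S. pa x ~= 0 --> (\<exists>y\<in>S. pa x = Suc y & ht x < ht y & lo (Suc (ht x) * N + y) = Suc x & key y <= key x)) &
  (\<forall>x\<in>S. \<forall>h. 0 < h --> h <= ht x --> lo (h * N + x) ~= 0 -->
   (\<exists>y\<in>S. lo (h * N + x) = Suc y & pa y = Suc x & h = Suc (ht y))) &
  (\<forall>h. bk h ~= 0 --> (\<exists>x\<in>S. bk h = Suc x & x \<notin> Z & pa x = 0 & ht x = h)) &
  (\<forall>x\<in>S. pa x = 0 --> x \<notin> Z --> bk (ht x) = Suc x) &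
  (\<forall>h. cnt h = card {x \<in> S. h <= ht x})"

lemma hinvI:
 assumes "S \<subseteq> {..<N}" "\<And>x. x \<in> Z ==> x \<in> S & pa x = 0"
  "\<And>x. x \<in> S ==> pa x ~= 0 ==>
   \<exists>y\<in>S. pa x = Suc y & ht x < ht y & lo (Suc (ht x) * N + y) = Suc x & key y <= key x"
  "\<And>x h. x \<in> S ==> 0 < h ==> h <= ht x ==> lo (h * N + x) ~= 0 ==>
   \<exists>y\<in>S. lo (h * N + x) = Suc y & pa y = Suc x & h = Suc (ht y)"
  "\<And>h. bk h ~= 0 ==> \<exists>x\<in>S. bk h = Suc x & x \<notin> Z & pa x = 0 & ht x = h"
  "\<And>x. x \<in> S ==> pa x = 0 ==> x \<notin> Z ==> bk (ht x) = Suc x"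
  "\<And>h. cnt h = card {x \<in> S. h <= ht x}"
 shows "hinv N S Z key ht pa lo bk cnt"
 unfolding hinv_def using assms by blast

context
 fixes N S Z key ht pa lo bk cnt
 assumes H: "hinv N S Z key ht pa lo bk cnt"
begin

lemma hinv_S: "S \<subseteq> {..<N}" using H by (simp add: hinv_def)
lemma hinv_fin: "finite S" using hinv_S finite_subset by blast
lemma hinv_ltN: "x \<in> S ==> x < N" using hinv_S by blast
lemma hinv_Z: "x \<in> Z ==> x \<in> S" "x \<in> Z ==> pa x = 0" using H by (auto simp: hinv_def)
lemma hinv_par: "x \<in> S ==> pa x ~= 0 ==>
   \<exists>y\<in>S. pa x = Suc y & ht x < ht y & lo (Suc (ht x) * N + y) = Suc x & key y <= key x"
 using H by (simp add: hinv_def)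
lemma hinv_los: "x \<in> S ==> 0 < h ==> h <= ht x ==> lo (h * N + x) ~= 0 ==>
   \<exists>y\<in>S. lo (h * N + x) = Suc y & pa y = Suc x & h = Suc (ht y)"
 using H by (simp add: hinv_def)
lemma hinv_bk: "bk h ~= 0 ==> \<exists>x\<in>S. bk h = Suc x & x \<notin> Z & pa x = 0 & ht x = h"
 using H by (simp add: hinv_def)
lemma hinv_root: "x \<in> S ==> pa x = 0 ==> x \<notin> Z ==> bk (ht x) = Suc x"
 using H by (simp add: hinv_def)
lemma hinv_cnt: "cnt h = card {x \<in> S. h <= ht x}"
 using H by (simp add: hinv_def)

lemma hinv_cnt_pos: "0 < cnt h \<longleftrightarrow> (\<exists>x\<in>S. h <= ht x)"
 using hinv_fin by (auto simp: hinv_cnt card_gt_0_iff)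

lemma hinv_cnt_le: "cnt h <= N"
proof -
 have "card {x \<in> S. h <= ht x} <= card {..<N}" using hinv_S by (intro card_mono) auto
 then show ?thesis by (simp add: hinv_cnt)
qed

lemma hinv_bk_le: "bk h <= N"
 using hinv_bk[of h] hinv_ltN by (cases "bk h = 0") (auto simp: Suc_le_eq)

lemma hinv_insert:
 assumes "x \<notin> S" "x < N" and k: "\<And>y. y \<in> S ==> key' y = key y"
 shows "hinv N (insert x S) (insert x Z) key' (ht(x := 0)) (pa(x := 0)) lo bk (cnt(0 := Suc (cnt 0)))"
proof (rule hinvI)
 show "insert x S \<subseteq> {..<N}" using hinv_S assms by auto
 show "y \<in> insert x S & (pa(x := 0)) y = 0" if "y \<in> insert x Z" for y
  using that hinv_Z by auto
next
 fix y assume "y \<in> insert x S" "(pa(x := 0)) y ~= 0"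
 then have y: "y \<in> S" "pa y ~= 0" "y ~= x" by (auto split: if_splits)
 from hinv_par[OF y(1,2)] obtain z where "z\<in>S" "pa y = Suc z" "ht y < ht z"
  "lo (Suc (ht y) * N + z) = Suc y" "key z <= key y" by blast
 then show "\<exists>z\<in>insert x S. (pa(x := 0)) y = Suc z & (ht(x := 0)) y < (ht(x := 0)) z &
   lo (Suc ((ht(x := 0)) y) * N + z) = Suc y & key' z <= key' y"
  using y assms by (intro bexI[of _ z]) auto
next
 fix y h assume "y \<in> insert x S" "0 < h" "h <= (ht(x := 0)) y" and l: "lo (h * N + y) ~= 0"
 then have y: "y \<in> S" "h <= ht y" "y ~= x" by (auto split: if_splits)
 from hinv_los[OF y(1) \<open>0 < h\<close> y(2) l] show
  "\<exists>z\<in>insert x S. lo (h * N + y) = Suc z & (pa(x := 0)) z = Suc y & h = Suc ((ht(x := 0)) z)"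
  using assms(1) by fastforce
next
 fix h assume "bk h ~= 0"
 from hinv_bk[OF this] show "\<exists>y\<in>insert x S. bk h = Suc y & y \<notin> insert x Z & (pa(x := 0)) y = 0 &
   (ht(x := 0)) y = h"
  using assms(1) by fastforce
next
 fix y assume "y \<in> insert x S" "(pa(x := 0)) y = 0" "y \<notin> insert x Z"
 then show "bk ((ht(x := 0)) y) = Suc y" using hinv_root[of y] by auto
next
 fix h
 have "{y \<in> insert x S. h <= (ht(x := 0)) y} = (if h = 0 then insert x {y \<in> S. h <= ht y} else {y \<in> S. h <= ht y})"
  using assms(1) by auto
 then show "(cnt(0 := Suc (cnt 0))) h = card {y \<in> insert x S. h <= (ht(x := 0)) y}"
  using hinv_fin assms(1) by (simp add: hinv_cnt)
qed

lemma hinv_key_root: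
 assumes "pa x = 0" "key' x <= key x" and k: "\<And>y. y \<in> S ==> y ~= x ==> key' y = key y"
 shows "hinv N S Z key' ht pa lo bk cnt"
proof (rule hinvI)
 fix y assume y: "y \<in> S" "pa y ~= 0"
 from hinv_par[OF y] obtain z where z: "z\<in>S" "pa y = Suc z" "ht y < ht z"
  "lo (Suc (ht y) * N + z) = Suc y" "key z <= key y" by blast
 have "y ~= x" using y assms(1) by auto
 then have "key' z <= key' y" using y z k[of y] k[of z] assms(2) by (cases "z = x") auto
 with z show "\<exists>z\<in>S. pa y = Suc z & ht y < ht z & lo (Suc (ht y) * N + z) = Suc y & key' z <= key' y"
  by blast
qed (use hinv_S hinv_Z hinv_los hinv_bk hinv_root hinv_cnt in auto)

text \<open>The node of \<open>y\<close> above \<open>x\<close> is left with one child, the copy of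
  \<open>y\<close> itself. Nothing is rebalanced, which is why decreasing a key is cheap; the thin
  nodes that accumulate are removed later by \<open>quake\<close>.\<close>

lemma hinv_cut:
 assumes x: "x \<in> S" "pa x = Suc y" and kx: "key' x <= key x"
  and k: "\<And>y. y \<in> S ==> y ~= x ==> key' y = key y"
 shows "hinv N S (insert x Z) key' ht (pa(x := 0)) (lo(Suc (ht x) * N + y := 0)) bk cnt"
proof -
 have y: "y \<in> S" "ht x < ht y" "lo (Suc (ht x) * N + y) = Suc x" using hinv_par[of x] x by auto
 show ?thesis
 proof (rule hinvI)
  show "S \<subseteq> {..<N}" by (rule hinv_S)
  show "z \<in> S & (pa(x := 0)) z = 0" if "z \<in> insert x Z" for z using that x hinv_Z by auto
 next
  fix u assume "u \<in> S" "(pa(x := 0)) u ~= 0"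
  then have u: "u \<in> S" "pa u ~= 0" "u ~= x" by (auto split: if_splits)
  from hinv_par[OF u(1,2)] obtain z where z: "z\<in>S" "pa u = Suc z" "ht u < ht z"
   "lo (Suc (ht u) * N + z) = Suc u" "key z <= key u" by blast
  have "key' z <= key' u" using u z k[of u] k[of z] kx by (cases "z = x") auto
  moreover have "Suc (ht u) * N + z ~= Suc (ht x) * N + y" using y(3) z(4) u(3) by (metis nat.inject)
  ultimately show "\<exists>z\<in>S. (pa(x := 0)) u = Suc z & ht u < ht z &
    (lo(Suc (ht x) * N + y := 0)) (Suc (ht u) * N + z) = Suc u & key' z <= key' u"
   using u z by (intro bexI[of _ z]) auto
 next
  fix u h assume u: "u \<in> S" "0 < h" "h <= ht u" "(lo(Suc (ht x) * N + y := 0)) (h * N + u) ~= 0"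
  then have n: "h * N + u ~= Suc (ht x) * N + y" "lo (h * N + u) ~= 0" by (metis fun_upd_apply)+
  from hinv_los[OF u(1-3) n(2)] obtain z where z: "z\<in>S" "lo (h * N + u) = Suc z" "pa z = Suc u" "h = Suc (ht z)"
   by blast
  have "z ~= x" using z n x by auto
  with z n show "\<exists>z\<in>S. (lo(Suc (ht x) * N + y := 0)) (h * N + u) = Suc z & (pa(x := 0)) z = Suc u & h = Suc (ht z)"
   by (intro bexI[of _ z]) auto
 next
  fix h assume "bk h ~= 0"
  from hinv_bk[OF this] show "\<exists>u\<in>S. bk h = Suc u & u \<notin> insert x Z & (pa(x := 0)) u = 0 & ht u = h"
   using x by fastforce
 next
  fix u assume "u \<in> S" "(pa(x := 0)) u = 0" "u \<notin> insert x Z"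
  then show "bk (ht u) = Suc u" using hinv_root by (auto split: if_splits)
 qed (rule hinv_cnt)
qed

lemma hinv_unbk:
 assumes "bk h = Suc x"
 shows "hinv N S (insert x Z) key ht pa lo (bk(h := 0)) cnt" "x \<in> S" "x \<notin> Z" "pa x = 0" "ht x = h"
proof -
 show x: "x \<in> S" "x \<notin> Z" "pa x = 0" "ht x = h" using hinv_bk[of h] assms by auto
 show "hinv N S (insert x Z) key ht pa lo (bk(h := 0)) cnt"
 proof (rule hinvI)
  fix g assume "(bk(h := 0)) g ~= 0"
  then have "bk g ~= 0" "g ~= h" by (auto split: if_splits)
  from hinv_bk[OF this(1)] this show "\<exists>u\<in>S. (bk(h := 0)) g = Suc u & u \<notin> insert x Z & pa u = 0 & ht u = g"
   using x by auto
 next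
  fix u assume "u \<in> S" "pa u = 0" "u \<notin> insert x Z"
  then show "(bk(h := 0)) (ht u) = Suc u" using hinv_root[of u] assms by auto
 qed (use hinv_S hinv_Z hinv_los hinv_par hinv_cnt x in auto)
qed

lemma hinv_tobk:
 assumes x: "x \<in> Z" and b: "bk (ht x) = 0"
 shows "hinv N S (Z - {x}) key ht pa lo (bk(ht x := Suc x)) cnt"
proof (rule hinvI)
 fix g assume *: "(bk(ht x := Suc x)) g ~= 0"
 show "\<exists>u\<in>S. (bk(ht x := Suc x)) g = Suc u & u \<notin> Z - {x} & pa u = 0 & ht u = g"
 proof (cases "g = ht x")
  case True
  then show ?thesis using hinv_Z[OF x] by auto
 next
  case False
  then show ?thesis using * hinv_bk[of g] by auto
 qed
next
 fix u assume "u \<in> S" "pa u = 0" "u \<notin> Z - {x}"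
 then show "(bk(ht x := Suc x)) (ht u) = Suc u" using hinv_root[of u] b by auto
qed (use hinv_S hinv_Z hinv_los hinv_par hinv_cnt x in auto)

lemma hinv_link:
 assumes x: "x \<in> Z" and y: "y \<in> Z" and xy: "x ~= y" "ht x = ht y" "key x <= key y"
 shows "hinv N S (Z - {y}) key (ht(x := Suc (ht x))) (pa(y := Suc x)) (lo(Suc (ht x) * N + x := Suc y)) bk
  (cnt(Suc (ht x) := Suc (cnt (Suc (ht x)))))"
proof -
 have S: "x \<in> S" "y \<in> S" "pa x = 0" "pa y = 0" "x < N" "y < N" using x y hinv_Z hinv_ltN by auto
 show ?thesis
 proof (rule hinvI)
  show "S \<subseteq> {..<N}" by (rule hinv_S)
  show "z \<in> S & (pa(y := Suc x)) z = 0" if "z \<in> Z - {y}" for z using that hinv_Z by auto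
 next
  fix u assume u: "u \<in> S" "(pa(y := Suc x)) u ~= 0"
  show "\<exists>z\<in>S. (pa(y := Suc x)) u = Suc z & (ht(x := Suc (ht x))) u < (ht(x := Suc (ht x))) z &
    (lo(Suc (ht x) * N + x := Suc y)) (Suc ((ht(x := Suc (ht x))) u) * N + z) = Suc u & key z <= key u"
  proof (cases "u = y")
   case True
   then show ?thesis using xy S by (intro bexI[of _ x]) auto
  next
   case False
   with u have p: "pa u ~= 0" "u ~= x" using S by auto
   from hinv_par[OF u(1) p(1)] obtain z where z: "z\<in>S" "pa u = Suc z" "ht u < ht z"
    "lo (Suc (ht u) * N + z) = Suc u" "key z <= key u" by blast
   have "\<not> (Suc (ht u) = Suc (ht x) & z = x)" using z by auto
   then have "Suc (ht u) * N + z ~= Suc (ht x) * N + x"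
    using slot_inj[of z N x "Suc (ht u)" "Suc (ht x)"] hinv_ltN z S by auto
   then show ?thesis using z p False by (intro bexI[of _ z]) auto
  qed
 next
  fix u h assume u: "u \<in> S" "0 < h" "h <= (ht(x := Suc (ht x))) u" "(lo(Suc (ht x) * N + x := Suc y)) (h * N + u) ~= 0"
  show "\<exists>z\<in>S. (lo(Suc (ht x) * N + x := Suc y)) (h * N + u) = Suc z & (pa(y := Suc x)) z = Suc u &
    h = Suc ((ht(x := Suc (ht x))) z)"
  proof (cases "h = Suc (ht x) & u = x")
   case True
   then show ?thesis using xy S by (intro bexI[of _ y]) auto
  next
   case False
   then have ne: "h * N + u ~= Suc (ht x) * N + x"
    using slot_inj[of u N x h "Suc (ht x)"] hinv_ltN u S by auto
   have h: "h <= ht u" "lo (h * N + u) ~= 0" using u ne False by (auto split: if_splits)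
   from hinv_los[OF u(1,2) h] obtain z where z: "z\<in>S" "lo (h * N + u) = Suc z" "pa z = Suc u" "h = Suc (ht z)"
    by blast
   then have "z ~= x" "z ~= y" using S by auto
   then show ?thesis using z ne by (intro bexI[of _ z]) auto
  qed
 next
  fix h assume "bk h ~= 0"
  from hinv_bk[OF this] obtain u where u: "u \<in> S" "bk h = Suc u" "u \<notin> Z" "pa u = 0" "ht u = h" by blast
  have "u ~= x" "u ~= y" using u(3) x y by blast+
  with u show "\<exists>u\<in>S. bk h = Suc u & u \<notin> Z - {y} & (pa(y := Suc x)) u = 0 & (ht(x := Suc (ht x))) u = h"
   by (intro bexI[of _ u]) auto
 next
  fix u assume u: "u \<in> S" "(pa(y := Suc x)) u = 0" "u \<notin> Z - {y}"
  then have "u ~= y" by auto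
  moreover from this u x have "u ~= x" "u \<notin> Z" by blast+
  ultimately show "bk ((ht(x := Suc (ht x))) u) = Suc u" using hinv_root[of u] u by simp
 next
  fix h
  have "{z \<in> S. h <= (ht(x := Suc (ht x))) z} =
    (if h = Suc (ht x) then insert x {z \<in> S. h <= ht z} else {z \<in> S. h <= ht z})"
   using S by auto
  then show "(cnt(Suc (ht x) := Suc (cnt (Suc (ht x))))) h = card {z \<in> S. h <= (ht(x := Suc (ht x))) z}"
   using hinv_fin by (simp add: hinv_cnt)
 qed
qed

lemma card_ht_strip:
 assumes "x \<in> S" "ht x = Suc h"
 shows "(cnt(Suc h := cnt (Suc h) - 1)) g = card {z \<in> S. g <= (ht(x := h)) z}"
proof -
 have "{z \<in> S. g <= (ht(x := h)) z} = (if g = Suc h then {z \<in> S. g <= ht z} - {x} else {z \<in> S. g <= ht z})"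
  using assms by auto
 then show ?thesis using hinv_fin assms by (simp add: hinv_cnt)
qed

lemma hinv_strip_empty:
 assumes x: "x \<in> Z" "ht x = Suc h" and l: "lo (Suc h * N + x) = 0"
 shows "hinv N S Z key (ht(x := h)) pa lo bk (cnt(Suc h := cnt (Suc h) - 1))"
proof -
 have S: "x \<in> S" "pa x = 0" "x < N" using x hinv_Z hinv_ltN by auto
 show ?thesis
 proof (rule hinvI)
  fix u assume u: "u \<in> S" "pa u ~= 0"
  from hinv_par[OF u] obtain z where z: "z\<in>S" "pa u = Suc z" "ht u < ht z"
    "lo (Suc (ht u) * N + z) = Suc u" "key z <= key u" by blast
  have "z ~= x \<or> ht u < h" using z l x by (cases "ht u = h") auto
  then show "\<exists>z\<in>S. pa u = Suc z & (ht(x := h)) u < (ht(x := h)) z &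
    lo (Suc ((ht(x := h)) u) * N + z) = Suc u & key z <= key u"
   using z u S by (intro bexI[of _ z]) auto
 next
  fix u g assume u: "u \<in> S" "0 < g" "g <= (ht(x := h)) u" "lo (g * N + u) ~= 0"
  then have g: "g <= ht u" using x by (auto split: if_splits)
  from hinv_los[OF u(1,2) g u(4)] show "\<exists>y\<in>S. lo (g * N + u) = Suc y & pa y = Suc u & g = Suc ((ht(x := h)) y)"
   using S by fastforce
 next
  fix g assume "bk g ~= 0"
  from hinv_bk[OF this] show "\<exists>xa\<in>S. bk g = Suc xa & xa \<notin> Z & pa xa = 0 & (ht(x := h)) xa = g"
   using x by fastforce
 next
  fix u assume "u \<in> S" "pa u = 0" "u \<notin> Z"
  then show "bk ((ht(x := h)) u) = Suc u" using hinv_root[of u] x by auto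
 qed (use hinv_S hinv_Z card_ht_strip[OF S(1) x(2)] in auto)
qed

text \<open>Deleting the top node of the root \<open>x\<close> undoes its last match, so that
  \<open>x\<close> and the loser \<open>y\<close> both become roots of height
  \<open>h\<close>.\<close>

lemma hinv_strip_child:
 assumes x: "x \<in> Z" "ht x = Suc h" and l: "lo (Suc h * N + x) = Suc y"
 shows "hinv N S (insert y Z) key (ht(x := h)) (pa(y := 0)) lo bk (cnt(Suc h := cnt (Suc h) - 1))"
  "y \<in> S" "y \<notin> Z" "y ~= x" "pa y = Suc x" "ht y = h"
proof -
 have S: "x \<in> S" "pa x = 0" "x < N" using x hinv_Z hinv_ltN by auto
 show y: "y \<in> S" "pa y = Suc x" "ht y = h" using hinv_los[OF S(1), of "Suc h"] x l by auto
 then show yZ: "y \<notin> Z" "y ~= x" using hinv_Z S by force+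
 show "hinv N S (insert y Z) key (ht(x := h)) (pa(y := 0)) lo bk (cnt(Suc h := cnt (Suc h) - 1))"
 proof (rule hinvI)
  show "S \<subseteq> {..<N}" by (rule hinv_S)
  show "z \<in> S & (pa(y := 0)) z = 0" if "z \<in> insert y Z" for z using that hinv_Z y by auto
 next
  fix u assume "u \<in> S" "(pa(y := 0)) u ~= 0"
  then have u: "u \<in> S" "pa u ~= 0" "u ~= y" by (auto split: if_splits)
  from hinv_par[OF u(1,2)] obtain z where z: "z\<in>S" "pa u = Suc z" "ht u < ht z"
    "lo (Suc (ht u) * N + z) = Suc u" "key z <= key u" by blast
  have "z ~= x \<or> ht u < h" using z l x u by (cases "ht u = h") auto
  then show "\<exists>z\<in>S. (pa(y := 0)) u = Suc z & (ht(x := h)) u < (ht(x := h)) z &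
    lo (Suc ((ht(x := h)) u) * N + z) = Suc u & key z <= key u"
   using z u S by (intro bexI[of _ z]) auto
 next
  fix u g assume u: "u \<in> S" "0 < g" "g <= (ht(x := h)) u" "lo (g * N + u) ~= 0"
  then have g: "g <= ht u" "u = x ==> g <= h" using x by (auto split: if_splits)
  from hinv_los[OF u(1,2) g(1) u(4)] obtain z where z: "z\<in>S" "lo (g * N + u) = Suc z" "pa z = Suc u" "g = Suc (ht z)"
   by blast
  moreover have "z ~= y" using z y g by auto
  moreover have "z ~= x" using z S by auto
  ultimately show "\<exists>z\<in>S. lo (g * N + u) = Suc z & (pa(y := 0)) z = Suc u & g = Suc ((ht(x := h)) z)"
   by (intro bexI[of _ z]) auto
 next
  fix g assume "bk g ~= 0"
  from hinv_bk[OF this] show "\<exists>u\<in>S. bk g = Suc u & u \<notin> insert y Z & (pa(y := 0)) u = 0 & (ht(x := h)) u = g"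
   using x y by fastforce
 next
  fix u assume "u \<in> S" "(pa(y := 0)) u = 0" "u \<notin> insert y Z"
  then show "bk ((ht(x := h)) u) = Suc u" using hinv_root[of u] x by (auto split: if_splits)
 qed (use card_ht_strip[OF S(1) x(2)] in auto)
qed

lemma hinv_remove:
 assumes x: "x \<in> Z" "ht x = 0"
 shows "hinv N (S - {x}) (Z - {x}) key ht pa lo bk (cnt(0 := cnt 0 - 1))"
proof -
 have S: "x \<in> S" "pa x = 0" "x < N" using x hinv_Z hinv_ltN by auto
 show ?thesis
 proof (rule hinvI)
  fix u assume "u \<in> S - {x}" "pa u ~= 0"
  then show "\<exists>y\<in>S - {x}. pa u = Suc y & ht u < ht y & lo (Suc (ht u) * N + y) = Suc u & key y <= key u"
   using hinv_par[of u] x by auto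
 next
  fix u h assume u: "u \<in> S - {x}" "0 < h" "h <= ht u" "lo (h * N + u) ~= 0"
  then obtain z where "z\<in>S" "lo (h * N + u) = Suc z" "pa z = Suc u" "h = Suc (ht z)"
   using hinv_los[of u h] by auto
  then show "\<exists>y\<in>S - {x}. lo (h * N + u) = Suc y & pa y = Suc u & h = Suc (ht y)"
   using S by (intro bexI[of _ z]) auto
 next
  fix h assume "bk h ~= 0"
  then show "\<exists>u\<in>S - {x}. bk h = Suc u & u \<notin> Z - {x} & pa u = 0 & ht u = h"
   using hinv_bk[of h] x by auto
 next
  fix u assume "u \<in> S - {x}" "pa u = 0" "u \<notin> Z - {x}"
  then show "bk (ht u) = Suc u" using hinv_root by auto
 next
  fix h
  have "{z \<in> S - {x}. h <= ht z} = (if h = 0 then {z \<in> S. h <= ht z} - {x} else {z \<in> S. h <= ht z})"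
   using x by auto
  then show "(cnt(0 := cnt 0 - 1)) h = card {z \<in> S - {x}. h <= ht z}"
   using hinv_fin S by (simp add: hinv_cnt)
 qed (use hinv_S hinv_Z in auto)
qed

text \<open>Parents are strictly higher, so the distance to the maximal height decreases along
  \<open>pa\<close>. The last conjunct is used when levels are cut off: an element with a parent
  lies strictly below the height of some root.\<close>

lemma hinv_ancestor:
 assumes "x \<in> S"
 shows "\<exists>r\<in>S. pa r = 0 & key r <= key x & ht x <= ht r & (pa x ~= 0 --> ht x < ht r)"
 using assms
proof (induction "Max (ht ` S) - ht x" arbitrary: x rule: less_induct)
 case less
 show ?case
 proof (cases "pa x = 0")
  case True
  then show ?thesis using less.prems by blast
 next
  case False
  from hinv_par[OF less.prems False] obtain y where y: "y \<in> S" "ht x < ht y" "key y <= key x" by blast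
  have "ht y <= Max (ht ` S)" using hinv_fin y by auto
  with y have "Max (ht ` S) - ht y < Max (ht ` S) - ht x" by linarith
  from less.hyps[OF this y(1)] y show ?thesis by force
 qed
qed

end

section \<open>Counting nodes by levels\<close>

definition mh :: "nat set => (nat => nat) => nat" where
 "mh S ht = (if S = {} then 0 else Suc (Max (ht ` S)))"

lemma mh_iff: "finite S ==> h < mh S ht \<longleftrightarrow> (\<exists>x\<in>S. h <= ht x)"
 by (auto simp: mh_def less_Suc_eq_le Max_ge_iff)

lemma mh_le: "finite S ==> mh S ht <= b \<longleftrightarrow> (\<forall>x\<in>S. ht x < b)"
 by (auto simp: mh_def Suc_le_eq)

definition nroots :: "nat set => (nat => nat) => nat" where
 "nroots S pa = card {x \<in> S. pa x = 0}"

text \<open>Removing everything above a level \<open>g\<close> that is too full frees so many nodes that the released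
 potential pays for the nodes at level \<open>g\<close>, all of which become roots.\<close>

lemma hinv_quake_count:
 assumes H: "hinv N S Z key ht pa lo bk cnt" and viol: "3 * cnt g < 4 * cnt (Suc g)"
 defines "Y \<equiv> \<Sum>x\<in>S. ht x - g" and "q \<equiv> card {x \<in> S. g < ht x & pa x ~= 0}"
 shows "cnt (Suc g) + q <= Y" "q <= cnt (Suc g)" "3 * cnt g <= 4 * cnt (Suc g)"
  "3 * (cnt g - card {x \<in> S. g <= ht x & pa x = 0}) <= cnt (Suc g) + 3 * q"
proof -
 note fin = hinv_fin[OF H]
 let ?X = "{x \<in> S. Suc g <= ht x}" and ?Q = "{x \<in> S. g < ht x & pa x ~= 0}"
 let ?P = "SIGMA x:S. {g<..ht x}"
 have Y: "Y = card ?P" unfolding Y_def using fin by (subst card_SigmaI) auto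
 have P: "finite ?P" using fin by auto
 let ?f = "%x. (x, Suc g)" and ?e = "%y. (pa y - 1, Suc (ht y))"
 have par: "pa y - 1 \<in> S & ht y < ht (pa y - 1) & lo (Suc (ht y) * N + (pa y - 1)) = Suc y" if "y \<in> ?Q" for y
  using hinv_par[OF H, of y] that by auto
 \<comment> \<open>The pairs in \<open>?P\<close> are the nodes above level \<open>g\<close>.
   \<open>?f\<close> picks the nodes on level \<open>Suc g\<close>, \<open>?e\<close> the parent
   nodes of the non-roots above \<open>g\<close>; the latter lie at least one level higher, and they
   are distinct because a node records a single loser.\<close>
 have "?f ` ?X \<union> ?e ` ?Q \<subseteq> ?P" using par by (auto simp: Suc_le_eq)
 then have "card (?f ` ?X \<union> ?e ` ?Q) <= Y" unfolding Y by (rule card_mono[OF P])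
 moreover have "card (?f ` ?X \<union> ?e ` ?Q) = card (?f ` ?X) + card (?e ` ?Q)"
  using fin by (intro card_Un_disjoint) auto
 moreover have "card (?f ` ?X) = card ?X" by (intro card_image inj_onI) auto
 moreover have "card (?e ` ?Q) = card ?Q"
 proof (intro card_image inj_onI)
  fix y z assume y: "y \<in> ?Q" and z: "z \<in> ?Q" and e: "?e y = ?e z"
  have "lo (Suc (ht y) * N + (pa y - 1)) = Suc y" "lo (Suc (ht z) * N + (pa z - 1)) = Suc z"
   using par[OF y] par[OF z] by auto
  with e show "y = z" by simp
 qed
 ultimately show "cnt (Suc g) + q <= Y" by (simp add: hinv_cnt[OF H] q_def)
 have "?Q \<subseteq> ?X" by auto
 then show "q <= cnt (Suc g)" unfolding q_def hinv_cnt[OF H] using fin by (intro card_mono) auto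
 show "3 * cnt g <= 4 * cnt (Suc g)" using viol by simp
 let ?E = "{x \<in> S. ht x = g}" and ?R = "{x \<in> S. g <= ht x & pa x = 0}"
 have E: "{x \<in> S. g <= ht x} = ?E \<union> ?X" by auto
 have c: "cnt g = card ?E + cnt (Suc g)"
  unfolding hinv_cnt[OF H] E using fin by (subst card_Un_disjoint) auto
 have "?X \<subseteq> ?Q \<union> ?R" by auto
 then have "card ?X <= card (?Q \<union> ?R)" using fin by (intro card_mono) auto
 also have "\<dots> <= q + card ?R" unfolding q_def by (rule card_Un_le)
 finally have "cnt (Suc g) <= q + card ?R" by (simp add: hinv_cnt[OF H])
 with c viol show "3 * (cnt g - card ?R) <= cnt (Suc g) + 3 * q" by linarith
qed

text \<open>Every node on level \<open>Suc h\<close> has two children, its own copy and its loser,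
  and all these are different nodes of level \<open>h\<close>.\<close>

lemma hinv_full_level:
 assumes H: "hinv N S Z key ht pa lo bk cnt"
  and full: "\<And>x. x \<in> S ==> Suc h <= ht x ==> lo (Suc h * N + x) ~= 0"
 shows "2 * cnt (Suc h) <= cnt h"
proof -
 note fin = hinv_fin[OF H]
 let ?X = "{x \<in> S. Suc h <= ht x}" and ?f = "%x. lo (Suc h * N + x) - 1"
 have l: "?f x \<in> S & pa (?f x) = Suc x & ht (?f x) = h" if "x \<in> ?X" for x
  using hinv_los[OF H, of x "Suc h"] full[of x] that by auto
 have "card (?f ` ?X) = card ?X"
 proof (intro card_image inj_onI)
  fix x y assume "x \<in> ?X" "y \<in> ?X" "?f x = ?f y"
  then show "x = y" using l[of x] l[of y] by simp
 qed
 moreover have "card (?X \<union> ?f ` ?X) = card ?X + card (?f ` ?X)"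
  using fin l by (intro card_Un_disjoint) fastforce+
 moreover have "card (?X \<union> ?f ` ?X) <= card {x \<in> S. h <= ht x}"
  using fin l by (intro card_mono) auto
 ultimately show ?thesis by (simp add: hinv_cnt[OF H])
qed

text \<open>Three levels more than halve the count, since \<open>27 * 2 = 54\<close> is less than
  64. So level \<open>3 * l + 1\<close> of at most \<open>2 ^ l\<close> elements would contain less
  than one node.\<close>

lemma mh_log:
 assumes H: "hinv N S Z key ht pa lo bk cnt" and dec: "\<And>h. 4 * cnt (Suc h) <= 3 * cnt h"
  and size: "card S <= 2 ^ l"
 shows "mh S ht <= Suc (3 * l)"
proof -
 have c: "4 ^ h * cnt h <= 3 ^ h * card S" for h
 proof (induction h)
  case 0
  then show ?case by (simp add: hinv_cnt[OF H])
 next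
  case (Suc h)
  have "4 ^ Suc h * cnt (Suc h) <= 4 ^ h * (3 * cnt h)" using dec[of h] by simp
  also have "\<dots> <= 3 ^ Suc h * card S" using Suc by simp
  finally show ?case .
 qed
 have "ht x < Suc (3 * l)" if x: "x \<in> S" for x
 proof (rule ccontr)
  assume "\<not> ht x < Suc (3 * l)"
  then have "0 < cnt (Suc (3 * l))" using hinv_cnt_pos[OF H, of "Suc (3 * l)"] x by (auto simp: not_less)
  then have "4 ^ Suc (3 * l) <= 4 ^ Suc (3 * l) * cnt (Suc (3 * l))" by simp
  also have "\<dots> <= 3 ^ Suc (3 * l) * card S" by (rule c)
  also have "\<dots> <= 3 ^ Suc (3 * l) * 2 ^ l" using size by simp
  also have "\<dots> = 3 * 54 ^ l" by (simp add: power_mult flip: power_mult_distrib)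
  also have "\<dots> < 4 * 64 ^ l" using power_mono[of "54::nat" 64 l]
   by (intro le_less_trans[OF mult_left_mono[of "54 ^ l" "64 ^ l" "3::nat"]]) (auto simp: mult_less_cancel2)
  also have "\<dots> = 4 ^ Suc (3 * l)" by (simp add: power_mult)
  finally show False by simp
 qed
 then show ?thesis using mh_le[OF hinv_fin[OF H]] by blast
qed

subsection \<open>Linking\<close>

abbreviation HI :: "nat => nat set => nat set => state => bool" where
 "HI N S Z st \<equiv> hinv N S Z (rmem st ''D'') (st$''h'') (st$''p'') (st$''l'') (st$''b'') (st$''c'')"

text \<open>\<open>sum ht S\<close> is the number of nodes above level 0. A link creates one such
  node and uses up one root, so the difference 150 of the coefficients pays for the linking step; a
  destroyed node releases 2000.\<close>

definition pot0 :: "nat set => (nat => nat) => (nat => nat) => nat" where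
 "pot0 S ht pa = 2000 * sum ht S + 2150 * nroots S pa"

abbreviation P0 :: "nat set => state => nat" where
 "P0 S st \<equiv> pot0 S (st$''h'') (st$''p'')"

text \<open>No node above level \<open>g\<close> lacks its loser. Linking preserves this because a
  new node is born with two children.\<close>

definition full :: "nat => nat => nat set => (nat => nat) => (nat => nat) => bool" where
 "full g N S ht lo \<longleftrightarrow> (\<forall>x\<in>S. \<forall>h. g < h --> h <= ht x --> lo (h * N + x) ~= 0)"

abbreviation FL :: "nat => nat => nat set => state => bool" where
 "FL g N S st \<equiv> full g N S (st$''h'') (st$''l'')"

lemma sum_upd:
 fixes f :: "nat => nat"
 assumes "finite S" "x \<in> S"
 shows "sum (f(x := v)) S + f x = sum f S + v"
proof -
 have "sum (f(x := v)) S = v + sum f (S - {x})"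
  using assms by (subst sum.remove[OF assms]) (auto intro!: sum.cong)
 then show ?thesis using sum.remove[OF assms, of f] by simp
qed

lemma nroots_link:
 assumes "finite S" "x \<in> S" "pa x = 0" "0 < v"
 shows "nroots S (pa(x := v)) + 1 = nroots S pa"
proof -
 have "{z \<in> S. (pa(x := v)) z = 0} = {z \<in> S. pa z = 0} - {x}" using assms by auto
 moreover have "0 < card {z \<in> S. pa z = 0}" using assms by (auto simp: card_gt_0_iff)
 ultimately show ?thesis using assms by (simp add: nroots_def)
qed

lemma nroots_cut:
 assumes "finite S" "x \<in> S" "pa x ~= 0"
 shows "nroots S (pa(x := 0)) = nroots S pa + 1"
proof -
 have "{z \<in> S. (pa(x := 0)) z = 0} = insert x {z \<in> S. pa z = 0}" using assms by auto
 then show ?thesis using assms by (simp add: nroots_def)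
qed

definition link1 :: com where
 "link1 = ''y'' <- IMinus (IElem ''b'' (IElem ''h'' (V ''x''))) (Lit 1) ;;
  IAssign ''b'' (IElem ''h'' (V ''x'')) (Lit 0) ;;
  Cond (RLess (RElem ''D'' (V ''y'')) (RElem ''D'' (V ''x'')))
   (''a'' <- V ''x'' ;; ''x'' <- V ''y'' ;; ''y'' <- V ''a'') Skip"

definition link2 :: com where
 "link2 = IAssign ''p'' (V ''y'') (IPlus (V ''x'') (Lit 1)) ;;
  IAssign ''h'' (V ''x'') (IPlus (IElem ''h'' (V ''x'')) (Lit 1)) ;;
  IAssign ''l'' (IPlus (ITimes (IElem ''h'' (V ''x'')) (V ''N'')) (V ''x'')) (IPlus (V ''y'') (Lit 1)) ;;
  IAssign ''c'' (IElem ''h'' (V ''x'')) (IPlus (IElem ''c'' (IElem ''h'' (V ''x''))) (Lit 1))"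

text \<open>Works like a carry in a binary counter: while the bucket of the current height is
  occupied, its root is taken out and linked with the carried one.\<close>

definition addroot :: com where
 "addroot = While (pos (IElem ''b'' (IElem ''h'' (V ''x'')))) (link1 ;; link2) ;;
  IAssign ''b'' (IElem ''h'' (V ''x'')) (IPlus (V ''x'') (Lit 1))"

lemma wp_link1:
 assumes "st$''x'' 0 = x" "st$''b'' (st$''h'' x) = Suc y"
  "st$''h'' x <= W" "x < W" "y < W" "1 <= W"
 shows "wp W link1 (%t st1. t <= 60 & st1$''b'' = (st$''b'')(st$''h'' x := 0) &
  {st1$''x'' 0, st1$''y'' 0} = {x, y} &
  rmem st ''D'' (st1$''x'' 0) <= rmem st ''D'' (st1$''y'' 0)) st"
 unfolding link1_def
 by (intro wp_basic wp_Cond) (use assms in \<open>simp_all add: insert_commute\<close>)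

lemma wp_link2:
 assumes "st$''x'' 0 = x" "st$''y'' 0 = y" "st$''N'' 0 = N"
  "x < N" "y < N" "Suc (Suc (st$''h'' x)) * N <= W" "st$''c'' (Suc (st$''h'' x)) < W" "1 < W" "N < W"
  "Suc (st$''h'' x) <= W"
 shows "wp W link2 (%t st'. t <= 60 & st'$''p'' = (st$''p'')(y := Suc x) &
  st'$''h'' = (st$''h'')(x := Suc (st$''h'' x)) &
  st'$''l'' = (st$''l'')(Suc (st$''h'' x) * N + x := Suc y) &
  st'$''c'' = (st$''c'')(Suc (st$''h'' x) := Suc (st$''c'' (Suc (st$''h'' x))))) st"
 unfolding link2_def
 by (intro wp_basic wp_Cond) (use assms in \<open>simp_all\<close>)

lemma imods_link [simp]:
 "imods link1 = {''y'', ''b'', ''a'', ''x''}" "rmods link1 = {}"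
 "imods link2 = {''p'', ''h'', ''l'', ''c''}" "rmods link2 = {}"
 by (auto simp: link1_def link2_def)

lemma imods_addroot [simp]:
 "imods addroot = {''y'', ''b'', ''a'', ''x'', ''p'', ''h'', ''l'', ''c''}" "rmods addroot = {}"
 by (auto simp: addroot_def)

text \<open>The clauses on heights serve the repeated calls in \<open>readd\<close>: the other
  pending roots keep their heights, only elements at or above the starting height rise, so the
  counts of lower levels are untouched, and at most one new level appears.\<close>

lemma wp_addroot:
 assumes H: "HI N S Z st" and x: "st$''x'' 0 \<in> Z" and N: "st$''N'' 0 = N"
  and W: "(mh S (st$''h'') + 2) * (N + 1) <= W"
 shows "wp W addroot (%t st'. HI N S (Z - {st$''x'' 0}) st' & t + P0 S st' <= P0 S st + 40 &
  mh S (st'$''h'') <= Suc (mh S (st$''h'')) &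
  (\<forall>z\<in>S. st$''h'' z <= st'$''h'' z & (st'$''h'' z ~= st$''h'' z --> st$''h'' (st$''x'' 0) <= st$''h'' z)) &
  (\<forall>z\<in>Z - {st$''x'' 0}. st'$''h'' z = st$''h'' z) &
  (\<forall>g. FL g N S st --> FL g N S st')) st"
proof -
 define x0 where "x0 = st$''x'' 0"
 define Z0 where "Z0 = Z - {x0}"
 define M where "M = mh S (st$''h'')"
 define h0 where "h0 = st$''h'' x0"
 note fin = hinv_fin[OF H]
 let ?h = "st$''h''"
 define I where "I = (%sv. let x = sv$''x'' 0; h = sv$''h'' in
  HI N S (insert x Z0) sv & x \<notin> Z0 & (\<forall>z\<in>S. z ~= x --> h z < M) & h x <= M & h0 <= h x &
  (\<forall>z\<in>S. ?h z <= h z & (h z ~= ?h z --> h0 <= ?h z)) & (\<forall>z\<in>Z0. h z = ?h z) &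
  (\<forall>g. FL g N S st --> FL g N S sv))"
 have x0: "x0 \<in> Z" "insert x0 Z0 = Z" using x by (auto simp: x0_def Z0_def)
 have N0: "0 < N" using hinv_ltN[OF H] hinv_Z[OF H] x0 by fastforce
 have M: "?h z < M" if "z \<in> S" for z using mh_le[OF fin, of ?h M] that by (simp add: M_def)
 have W2: "2 < W" "N < W" using W N0 by (auto simp: algebra_simps)
 show ?thesis
  unfolding addroot_def
 proof (rule wp_Seq, rule wp_While[where I = I and \<phi> = "P0 S"])
  show "I st" using H x0 M hinv_Z[OF H] by (auto simp: I_def Let_def x0_def[symmetric] Z0_def h0_def less_imp_le)
 next
  fix sv assume I: "I sv" and "unch (link1 ;; link2) st sv"
  then have N': "sv$''N'' 0 = N" using N by (simp add: unch_def)
  define x h where "x = sv$''x'' 0" and "h = sv$''h''"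
  have HT: "HI N S (insert x Z0) sv" and xs: "x \<notin> Z0" "h x <= M" "h0 <= h x" "\<forall>z\<in>S. z ~= x --> h z < M"
   and hs: "\<forall>z\<in>S. ?h z <= h z & (h z ~= ?h z --> h0 <= ?h z)" and zs: "\<forall>z\<in>Z0. h z = ?h z"
   and fl: "\<forall>g. FL g N S st --> FL g N S sv"
   using I by (simp_all add: I_def Let_def x_def h_def)
  have xS: "x \<in> S" "sv$''p'' x = 0" "x < N" using hinv_Z[OF HT] hinv_ltN[OF HT] by auto
  have "M <= (M + 2) * (N + 1)" by (simp add: algebra_simps)
  with W xs have hW: "h x <= W" by (simp add: M_def)
  show bok: "bok W (pos (IElem ''b'' (IElem ''h'' (V ''x'')))) sv"
   using hW W2 xS hinv_bk_le[OF HT, of "h x"] by (simp add: x_def h_def)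
  assume "bval (pos (IElem ''b'' (IElem ''h'' (V ''x'')))) sv"
  then obtain y where y: "sv$''b'' (h x) = Suc y" by (auto simp: x_def h_def gr0_conv_Suc)
  note U = hinv_unbk[OF HT y]
  have yx: "y ~= x" "y \<notin> Z0" "y < N" using U hinv_ltN[OF HT] by auto
  \<comment> \<open>\<open>M\<close> can be attained by the carried root only. Its partner from the
    bucket is another element of the same height, so this height is still below \<open>M\<close> and
    linking stays within the claimed bound.\<close>
  have hyM: "h x < M" using xs(4) U yx by (auto simp: h_def)
  have SM: "Suc (h x) * N <= M * N" using hyM by (intro mult_right_mono) auto
  have mult: "M * N + 2 * N + M + 2 <= W" using W by (simp add: M_def algebra_simps)
  show "wp W (link1 ;; link2) (%t st''. I st'' &
    P0 S st'' + t + 1 + bcost (pos (IElem ''b'' (IElem ''h'' (V ''x'')))) <= P0 S sv) sv"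
  proof (rule wp_Seq, rule wp_frame[OF wp_link1])
   show "sv$''x'' 0 = x" "sv$''b'' (sv$''h'' x) = Suc y" "sv$''h'' x <= W"
    "x < W" "y < W" "1 <= W"
    using y hW xS yx W2 by (auto simp: x_def h_def)
  next
   fix t1 :: nat and st1
   assume l1: "t1 <= 60 & st1$''b'' = (sv$''b'')(sv$''h'' x := 0) &
    {st1$''x'' 0, st1$''y'' 0} = {x, y} &
    rmem sv ''D'' (st1$''x'' 0) <= rmem sv ''D'' (st1$''y'' 0)" and "unch link1 sv st1"
   then have same: "st1$''h'' = h" "st1$''p'' = sv$''p''" "st1$''l'' = sv$''l''"
    "st1$''c'' = sv$''c''" "rmem st1 ''D'' = rmem sv ''D''" "st1$''N'' 0 = N"
    using N' by (auto simp: unch_def h_def)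
   define u v where "u = st1$''x'' 0" and "v = st1$''y'' 0"
   have uv: "u = x & v = y \<or> u = y & v = x" "rmem sv ''D'' u <= rmem sv ''D'' v" "u ~= v"
    using l1 yx(1) by (auto simp: u_def v_def doubleton_eq_iff)
   have H1: "HI N S (insert u (insert v Z0)) st1"
    using U(1) l1 uv by (auto simp: same insert_commute h_def[symmetric])
   have huv: "h u = h x" "h v = h x" using uv U(5) by (auto simp: h_def)
   have uvS: "u \<in> S" "v \<in> S" "sv$''p'' u = 0" "sv$''p'' v = 0" "u < N" "v < N" "u \<notin> Z0" "v \<notin> Z0"
    using uv xS U(2,4) yx xs by auto
   show "wp W link2 (%t2 st''. I st'' &
    P0 S st'' + (t1 + t2) + 1 + bcost (pos (IElem ''b'' (IElem ''h'' (V ''x'')))) <= P0 S sv) st1"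
   proof (rule wp_frame[OF wp_link2[where x = u and y = v and N = N]])
    show "Suc (Suc (st1$''h'' u)) * N <= W" "Suc (st1$''h'' u) <= W"
     using SM mult hyM huv by (auto simp: same)
    show "st1$''c'' (Suc (st1$''h'' u)) < W" using hinv_cnt_le[OF H1] W2 by (meson le_less_trans)
   next
    fix t2 :: nat and st2
    assume l2: "t2 <= 60 & st2$''p'' = (st1$''p'')(v := Suc u) &
     st2$''h'' = (st1$''h'')(u := Suc (st1$''h'' u)) &
     st2$''l'' = (st1$''l'')(Suc (st1$''h'' u) * N + u := Suc v) &
     st2$''c'' = (st1$''c'')(Suc (st1$''h'' u) := Suc (st1$''c'' (Suc (st1$''h'' u))))"
     and "unch link2 st1 st2"
    then have same2: "st2$''x'' 0 = u" "st2$''b'' = st1$''b''" "rmem st2 ''D'' = rmem st1 ''D''"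
     by (auto simp: unch_def u_def)
    have "HI N S (insert u (insert v Z0) - {v}) st2"
     using hinv_link[OF H1, of u v] uv huv l2 by (simp add: same same2)
    moreover have "insert u (insert v Z0) - {v} = insert u Z0" using uv(3) uvS by auto
    ultimately have H2: "HI N S (insert u Z0) st2" by simp
    have h2: "st2$''h'' = h(u := Suc (h x))" using l2 same huv by simp
    have f2: "FL g N S st2" if f: "FL g N S sv" for g
     unfolding full_def
    proof (intro ballI allI impI)
     fix z k assume z: "z \<in> S" "g < k" "k <= st2$''h'' z"
     show "st2$''l'' (k * N + z) ~= 0"
     proof (cases "k * N + z = Suc (st1$''h'' u) * N + u")
      case True
      then show ?thesis using l2 by simp
     next
      case False
      then have "k <= h z" using z(3) huv by (auto simp: h2 same split: if_splits simp: le_Suc_eq)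
      with f z have "sv$''l'' (k * N + z) ~= 0" by (auto simp: full_def h_def)
      then show ?thesis using l2 False by (simp add: same)
     qed
    qed
    have "?h u <= h u" "h0 <= ?h u"
     using hs uv xs(3) U(2) uvS huv by (metis order.trans order_refl)+
    then have "I st2"
     using H2 h2 f2 uvS hyM xs(3,4) hs zs fl huv uv by (auto simp: I_def Let_def same2)
    moreover have "sum (st2$''h'') S = Suc (sum h S)"
     using sum_upd[OF fin uvS(1), of h "Suc (h x)"] huv unfolding h2 by simp
    moreover have "nroots S (st2$''p'') + 1 = nroots S (sv$''p'')"
     using nroots_link[OF fin uvS(2), of "sv$''p''" "Suc u"] uvS l2 by (simp add: same)
    ultimately show "I st2 &
     P0 S st2 + (t1 + t2) + 1 + bcost (pos (IElem ''b'' (IElem ''h'' (V ''x'')))) <= P0 S sv"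
     using l1 l2 by (simp add: pot0_def h_def)
   qed (use uvS W2 same in \<open>auto simp: u_def v_def\<close>)
  qed
 next
  fix t :: nat and sv assume I: "I sv" and "unch (link1 ;; link2) st sv"
   and nb: "\<not> bval (pos (IElem ''b'' (IElem ''h'' (V ''x'')))) sv"
   and t: "t + P0 S sv <= P0 S st + 1 + bcost (pos (IElem ''b'' (IElem ''h'' (V ''x''))))"
  define x h where "x = sv$''x'' 0" and "h = sv$''h''"
  have HT: "HI N S (insert x Z0) sv" and xs: "x \<notin> Z0" "h x <= M" "h0 <= h x" "\<forall>z\<in>S. z ~= x --> h z < M"
   and hs: "\<forall>z\<in>S. ?h z <= h z & (h z ~= ?h z --> h0 <= ?h z)" and zs: "\<forall>z\<in>Z0. h z = ?h z"
   and fl: "\<forall>g. FL g N S st --> FL g N S sv"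
   using I by (simp_all add: I_def Let_def x_def h_def)
  have xS: "x \<in> S" "sv$''p'' x = 0" "x < N" using hinv_Z[OF HT] hinv_ltN[OF HT] by auto
  have "M <= (M + 2) * (N + 1)" by (simp add: algebra_simps)
  with W xs have hW: "h x <= W" by (simp add: M_def)
  have b0: "sv$''b'' (h x) = 0" using nb by (simp add: x_def h_def)
  have "insert x Z0 - {x} = Z0" using xs by auto
  with hinv_tobk[OF HT, of x] b0 have HF: "hinv N S Z0 (rmem sv ''D'') (sv$''h'') (sv$''p'') (sv$''l'')
   ((sv$''b'')(h x := Suc x)) (sv$''c'')" by (simp add: h_def)
  have mhS: "mh S h <= Suc M" using mh_le[OF fin] xs by (metis less_Suc_eq less_Suc_eq_le)
  show "wp W (IAssign ''b'' (IElem ''h'' (V ''x'')) (IPlus (V ''x'') (Lit 1)))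
   (%t2 st'. HI N S (Z - {st$''x'' 0}) st' & t + t2 + P0 S st' <= P0 S st + 40 &
  mh S (st'$''h'') <= Suc (mh S (st$''h'')) &
  (\<forall>z\<in>S. st$''h'' z <= st'$''h'' z & (st'$''h'' z ~= st$''h'' z --> st$''h'' (st$''x'' 0) <= st$''h'' z)) &
  (\<forall>z\<in>Z - {st$''x'' 0}. st'$''h'' z = st$''h'' z) &
  (\<forall>g. FL g N S st --> FL g N S st')) sv"
   using HF mhS fl hs zs t hW W2 xS
   by (intro wp_basic) (auto simp: x_def h_def x0_def[symmetric] Z0_def h0_def M_def)
 qed
qed

subsection \<open>Insertion and decrease-key\<close>

text \<open>An extraction visits all levels, however many there are. The last term pays for this,
  because afterwards only logarithmically many levels remain.\<close>

definition pot :: "nat set => state => nat" where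
 "pot S st = P0 S st + 2000 * mh S (st$''h'')"

text \<open>Insertion and decrease-key in one, with the new key already stored in \<open>D\<close>.
  A smaller key of a root keeps the heap order, so only non-roots are cut. A plain \<open>c\<close>
  denotes its cell 0, the count of level 0 and hence the size of the heap.\<close>

definition update :: com where
 "update = Cond (ILess (IElem ''i'' (V ''x'')) (Lit 1))
  (IAssign ''i'' (V ''x'') (Lit 1) ;; IAssign ''h'' (V ''x'') (Lit 0) ;; IAssign ''p'' (V ''x'') (Lit 0) ;;
   inc ''c'' ;; addroot)
  (Cond (pos (IElem ''p'' (V ''x'')))
   (IAssign ''l'' (IPlus (ITimes (IPlus (IElem ''h'' (V ''x'')) (Lit 1)) (V ''N'')) (IMinus (IElem ''p'' (V ''x'')) (Lit 1))) (Lit 0) ;;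
    IAssign ''p'' (V ''x'') (Lit 0) ;; addroot)
   Skip)"

lemma imods_update [simp]:
 "imods update = {''i'', ''y'', ''b'', ''a'', ''x'', ''p'', ''h'', ''l'', ''c''}" "rmods update = {}"
 by (auto simp: update_def)

lemma mh_insert:
 assumes "finite S" "x \<notin> S"
 shows "mh (insert x S) (ht(x := 0)) <= Suc (mh S ht)"
proof -
 have "\<forall>z\<in>S. ht z < mh S ht" using mh_le[OF assms(1)] by blast
 then show ?thesis using assms by (subst mh_le) (auto simp: less_SucI)
qed

lemma wp_update:
 fixes st N S
 defines "x \<equiv> st$''x'' 0"
 assumes H: "hinv N S {} key (st$''h'') (st$''p'') (st$''l'') (st$''b'') (st$''c'')"
  and k: "\<And>y. y \<in> S ==> y ~= x ==> rmem st ''D'' y = key y" "x \<in> S ==> rmem st ''D'' x <= key x"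
  and x: "x < N" "st$''i'' x = (if x \<in> S then 1 else 0)" and N: "st$''N'' 0 = N"
  and W: "(mh S (st$''h'') + 3) * (N + 1) <= W"
 shows "wp W update (%t st'. HI N (insert x S) {} st' & st'$''i'' = (st$''i'')(x := 1) &
  t + pot (insert x S) st' <= pot S st + 7000) st"
proof -
 note fin = hinv_fin[OF H]
 let ?h = "st$''h''" and ?p = "st$''p''"
 have W2: "3 < W" "2 * N + 2 < W" "mh S ?h + 3 <= W" using W x(1) by (auto simp: algebra_simps)
 show ?thesis
 proof (cases "x \<in> S")
  case False
  define st1 where "st1 = iu ''c'' 0 (Suc (st$''c'' 0)) (iu ''p'' x 0 (iu ''h'' x 0 (iu ''i'' x (Suc 0) st)))"
  have HI1: "HI N (insert x S) {x} st1"
   using hinv_insert[OF H False x(1), of "rmem st ''D''"] k False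
   unfolding st1_def by force
  have m1: "mh (insert x S) (st1$''h'') <= Suc (mh S ?h)"
   using mh_insert[OF fin False] by (simp add: st1_def)
  have s1: "sum (st1$''h'') (insert x S) = sum ?h S"
   using fin False by (auto simp: st1_def intro!: sum.cong)
  have "{z. z ~= x --> z \<in> S & ?p z = 0} = insert x {z \<in> S. ?p z = 0}" by auto
  then have r1: "nroots (insert x S) (st1$''p'') = Suc (nroots S ?p)"
   using fin False by (simp add: st1_def nroots_def)
  have W': "(mh (insert x S) (st1$''h'') + 2) * (N + 1) <= W"
   using m1 by (intro order.trans[OF _ W] mult_right_mono) auto
  have ad: "wp W addroot (%t st'. HI N (insert x S) {} st' & st'$''i'' = (st$''i'')(x := 1) &
    t + pot (insert x S) st' <= pot S st + 6500) st1"
  proof (rule wp_frame[OF wp_addroot[OF HI1 _ _ W']], goal_cases)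
   case (3 t st')
   have "pot (insert x S) st' + t <= P0 (insert x S) st1 + 40 + 2000 * Suc (mh (insert x S) (st1$''h''))"
    using 3 by (simp add: pot_def)
   also have "\<dots> <= pot S st + 6500"
    using m1 s1 r1 by (simp add: pot_def pot0_def)
   finally show ?case using 3 by (simp add: st1_def unch_def x_def add.commute)
  qed (use N in \<open>simp_all add: st1_def x_def\<close>)
  show ?thesis unfolding update_def
   apply (rule wp_Cond)
    apply (use x False W2 in \<open>simp add: x_def\<close>)
   apply (intro wp_basic)
       apply (use x W2 hinv_cnt_le[OF H, of 0] in \<open>simp_all add: x_def\<close>)
   apply (rule wp_mono[OF ad[unfolded st1_def x_def]])
   apply simp
   using False x by (simp add: x_def)
 next
  case True
  have hx: "?h x < mh S ?h" using mh_le[OF fin] True by blast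
  have ii: "(st$''i'')(x := 1) = st$''i''" "(st$''i'')(x := Suc 0) = st$''i''" using x True by auto
  show ?thesis
  proof (cases "?p x")
   case 0
   have HI1: "HI N S {} st"
    by (rule hinv_key_root[OF H 0]) (use k True in auto)
   show ?thesis unfolding update_def
    by (intro wp_basic wp_Cond)
     (use x True 0 W2 HI1 ii in \<open>simp_all add: x_def[symmetric] insert_absorb\<close>)
  next
   case (Suc y)
   have y: "y \<in> S" "y < N" using hinv_par[OF H True] Suc hinv_ltN[OF H] by auto
   define st1 where "st1 = iu ''p'' x 0 (iu ''l'' (N + ?h x * N + y) 0 st)"
   have HI1: "HI N S {x} st1"
    using hinv_cut[OF H True Suc, of "rmem st ''D''"] k True unfolding st1_def by simp
   have W': "(mh S (st1$''h'') + 2) * (N + 1) <= W"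
    by (rule order.trans[OF _ W]) (simp add: st1_def algebra_simps)
   have r1: "nroots S (st1$''p'') = Suc (nroots S ?p)"
    using nroots_cut[OF fin True, of ?p] Suc by (simp add: st1_def)
   have ad: "wp W addroot (%t st'. HI N S {} st' & st'$''i'' = st$''i'' &
     t + pot S st' <= pot S st + 6500) st1"
   proof (rule wp_frame[OF wp_addroot[OF HI1 _ _ W']], goal_cases)
    case (3 t st')
    have "pot S st' + t <= P0 S st1 + 40 + 2000 * Suc (mh S (st1$''h''))"
     using 3 by (simp add: pot_def)
    also have "\<dots> <= pot S st + 6500"
     using r1 by (simp add: pot_def pot0_def st1_def)
    finally show ?case using 3 by (simp add: st1_def unch_def x_def add.commute)
   qed (use N in \<open>simp_all add: st1_def x_def\<close>)
   have "Suc (?h x) * N <= mh S ?h * N" using hx by (intro mult_right_mono) auto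
   then have hN: "N + ?h x * N + y <= W" "N + ?h x * N <= W" using W y(2) by (auto simp: algebra_simps)
   show ?thesis unfolding update_def
    apply (rule wp_Cond)
     apply (use x True W2 in \<open>simp add: x_def\<close>)
    apply (use x True in \<open>simp add: x_def\<close>)
    apply (rule wp_Cond)
     apply (use x Suc y W2 in \<open>simp add: x_def\<close>)
    apply (intro wp_basic)
       apply (use x Suc y W2 N hN hx in \<open>simp_all add: x_def\<close>)
    apply (rule wp_mono[OF ad[unfolded st1_def x_def]])
    using ii True by (simp add: x_def insert_absorb)
  qed
 qed
qed

subsection \<open>Removing levels\<close>

text \<open>Programs hold the pending roots \<open>Z\<close> in an array. Injectivity makes
  \<open>n\<close> the cardinality of \<open>Z\<close>, on which the potential and the running times
  depend.\<close>

definition wl :: "(nat => nat) => nat => nat set => bool" where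
 "wl t n Z \<longleftrightarrow> inj_on t {..<n} & t ` {..<n} = Z"

lemma wl_card: "wl t n Z ==> card Z = n"
 by (auto simp: wl_def card_image)

lemma wl_push: "wl t n Z ==> z \<notin> Z ==> wl (t(n := z)) (Suc n) (insert z Z)"
 by (auto simp: wl_def lessThan_Suc inj_on_def)

lemma wl_empty: "wl t 0 {}"
 by (simp add: wl_def)

lemma wl_pop: "wl t (Suc n) Z ==> t n \<in> Z & wl t n (Z - {t n})"
 by (auto simp: wl_def lessThan_Suc inj_on_def)

lemma nroots_zero:
 assumes "finite S" "A \<subseteq> S" "\<And>z. z \<in> A ==> pa z ~= 0"
 shows "nroots S (%z. if z \<in> A then 0 else pa z) = nroots S pa + card A"
proof -
 have "{z \<in> S. (if z \<in> A then 0 else pa z) = 0} = {z \<in> S. pa z = 0} \<union> A" using assms by auto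
 moreover have "card ({z \<in> S. pa z = 0} \<union> A) = card {z \<in> S. pa z = 0} + card A"
  using assms(1) finite_subset[OF assms(2,1)] assms(3) by (intro card_Un_disjoint) fastforce+
 ultimately show ?thesis by (simp add: nroots_def)
qed

definition strip_body :: com where
 "strip_body = ''y'' <- IElem ''l'' (IPlus (ITimes (IElem ''h'' (V ''x'')) (V ''N'')) (V ''x'')) ;;
  Cond (pos (V ''y''))
   (IAssign ''p'' (IMinus (V ''y'') (Lit 1)) (Lit 0) ;;
    IAssign ''t'' (V ''tn'') (IMinus (V ''y'') (Lit 1)) ;; inc ''tn'') Skip ;;
  IAssign ''c'' (IElem ''h'' (V ''x'')) (IMinus (IElem ''c'' (IElem ''h'' (V ''x''))) (Lit 1)) ;;
  IAssign ''h'' (V ''x'') (IMinus (IElem ''h'' (V ''x'')) (Lit 1))"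

definition strip :: com where
 "strip = While (ILess (V ''g'') (IElem ''h'' (V ''x''))) strip_body"

lemma imods_strip [simp]:
 "imods strip_body = {''y'', ''p'', ''t'', ''tn'', ''c'', ''h''}" "rmods strip_body = {}"
 "imods strip = {''y'', ''p'', ''t'', ''tn'', ''c'', ''h''}" "rmods strip = {}"
 by (auto simp: strip_def strip_body_def)

text \<open>\<open>A\<close> consists of the losers set free, at most one for each removed level. A
  loser keeps the height at which it lost, which is at least \<open>g\<close>.\<close>

lemma wp_strip:
 fixes st N S Z1
 defines "x \<equiv> st$''x'' 0" and "g \<equiv> st$''g'' 0"
 assumes H: "HI N S (insert x Z1) st" and g: "g <= st$''h'' x"
  and w: "wl (st$''t'') (st$''tn'' 0) Z1" and N: "st$''N'' 0 = N"
  and W: "(mh S (st$''h'') + 2) * (N + 1) <= W"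
 shows "wp W strip (%t st'. \<exists>A. HI N S (insert x Z1 \<union> A) st' & A \<subseteq> S & A \<inter> insert x Z1 = {} &
   wl (st'$''t'') (st'$''tn'' 0) (Z1 \<union> A) & st'$''tn'' 0 = st$''tn'' 0 + card A &
   (\<forall>j<st$''tn'' 0. st'$''t'' j = st$''t'' j) &
   st'$''h'' = (st$''h'')(x := g) &
   st'$''p'' = (%z. if z \<in> A then 0 else st$''p'' z) &
   (\<forall>z\<in>A. st$''p'' z ~= 0 & g <= st$''h'' z) & card A + g <= st$''h'' x &
   t <= 150 * (st$''h'' x - g) + 20) st"
proof -
 note fin = hinv_fin[OF H]
 let ?h = "st$''h''" and ?p = "st$''p''" and ?tn = "st$''tn'' 0"
 define I where "I = (%A sv. HI N S (insert x Z1 \<union> A) sv & A \<subseteq> S & A \<inter> insert x Z1 = {} &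
   wl (sv$''t'') (sv$''tn'' 0) (Z1 \<union> A) & sv$''tn'' 0 = ?tn + card A &
   (\<forall>j<?tn. sv$''t'' j = st$''t'' j) &
   (\<forall>z. z ~= x --> sv$''h'' z = ?h z) & g <= sv$''h'' x &
   sv$''p'' = (%z. if z \<in> A then 0 else ?p z) &
   (\<forall>z\<in>A. ?p z ~= 0 & g <= ?h z) & card A + sv$''h'' x <= ?h x)"
 have xS: "x \<in> S" "x < N" using hinv_Z[OF H] hinv_ltN[OF H] by auto
 have hx: "?h x < mh S ?h" using mh_le[OF fin] xS by blast
 have W2: "2 * N + 2 <= W" "mh S ?h + 3 <= W" "mh S ?h * N + N + 2 <= W" using W xS by (auto simp: algebra_simps)
 show ?thesis unfolding strip_def
 proof (rule wp_While[where I = "%sv. \<exists>A. I A sv" and \<phi> = "%sv. 150 * (sv$''h'' x - g)"], goal_cases)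
  case 1
  show ?case using H g w by (intro exI[of _ "{}"]) (auto simp: I_def)
 next
  case (2 sv)
  then have sc: "sv$''x'' 0 = x" "sv$''g'' 0 = g" by (auto simp: unch_def x_def g_def)
  moreover have "sv$''h'' x <= ?h x" using 2(1) by (auto simp: I_def)
  ultimately show ?case using hx W2 xS g by simp
 next
  case (3 sv)
  then obtain A where A: "I A sv" by blast
  have sc: "sv$''x'' 0 = x" "sv$''g'' 0 = g" "sv$''N'' 0 = N"
   using 3(2) N by (auto simp: unch_def x_def g_def)
  obtain h where h: "sv$''h'' x = Suc h" "g <= h"
   using 3(3) sc by (auto simp: less_iff_Suc_add)
  have HT: "HI N S (insert x Z1 \<union> A) sv" using A unfolding I_def by blast
  have hle: "Suc h <= ?h x" using A h by (simp add: I_def)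
  have "Suc h * N <= mh S ?h * N" using hle hx by (intro mult_right_mono) auto
  then have hN: "N + h * N + x <= W" "N + h * N <= W" "h + 2 < W" using W2 xS hle hx by auto
  have tn: "sv$''tn'' 0 <= N"
  proof -
   have "sv$''tn'' 0 = card (Z1 \<union> A)" using A wl_card by (fastforce simp: I_def)
   also have "\<dots> <= card {..<N}" using hinv_Z[OF HT] hinv_ltN[OF HT] by (intro card_mono) auto
   finally show ?thesis by simp
  qed
  have c: "sv$''c'' (Suc h) <= N" by (rule hinv_cnt_le[OF HT])
  show ?case
  proof (cases "sv$''l'' (Suc h * N + x)")
   case 0
   define sv' where "sv' = iu ''h'' x h (iu ''c'' (Suc h) (sv$''c'' (Suc h) - 1) (iu ''y'' 0 0 sv))"
   have "HI N S (insert x Z1 \<union> A) sv'"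
    using hinv_strip_empty[OF HT _ h(1) 0] by (simp add: sv'_def)
   then have "I A sv'" using A h unfolding I_def by (auto simp: sv'_def)
   then show ?thesis unfolding strip_body_def
    by (intro wp_basic wp_Cond; (use 0 sc h hN c W2 xS in \<open>simp add: sv'_def\<close>)?)
     (use 0 in \<open>auto simp: Suc_diff_le\<close>)
  next
   case (Suc y)
   note C = hinv_strip_child[OF HT _ h(1) Suc]
   have y: "y \<in> S" "y \<notin> insert x Z1 \<union> A" "sv$''p'' y = Suc x" "sv$''h'' y = h" "y < N"
    using C hinv_ltN[OF HT] by auto
   define sv' where "sv' = iu ''h'' x h (iu ''c'' (Suc h) (sv$''c'' (Suc h) - 1)
    (iu ''tn'' 0 (Suc (sv$''tn'' 0)) (iu ''t'' (sv$''tn'' 0) y (iu ''p'' y 0 (iu ''y'' 0 (Suc y) sv)))))"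
   have "HI N S (insert y (insert x Z1 \<union> A)) sv'" using C(1) by (simp add: sv'_def)
   moreover have "finite A" using A fin finite_subset by (auto simp: I_def)
   moreover have "?p y ~= 0" "g <= ?h y" using A y h by (auto simp: I_def split: if_splits)
   moreover have "wl ((sv$''t'')(sv$''tn'' 0 := y)) (Suc (sv$''tn'' 0)) (insert y (Z1 \<union> A))"
    by (rule wl_push) (use A y in \<open>auto simp: I_def\<close>)
   moreover have "sv'$''p'' = (%z. if z \<in> insert y A then 0 else ?p z)"
    using A by (auto simp: I_def sv'_def)
   ultimately have "I (insert y A) sv'" using A h y unfolding I_def by (auto simp: sv'_def)
   then show ?thesis unfolding strip_body_def
    by (intro wp_basic wp_Cond; (use Suc sc h hN c W2 xS y tn in \<open>simp add: sv'_def\<close>)?)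
     (use Suc in \<open>auto simp: Suc_diff_le\<close>)
  qed
 next
  case (4 t sv)
  then obtain A where A: "I A sv" by blast
  have sc: "sv$''x'' 0 = x" "sv$''g'' 0 = g"
   using 4(2) by (auto simp: unch_def x_def g_def)
  have "sv$''h'' x = g" using 4(3) A sc by (simp add: I_def)
  with A 4(4) show ?case by (intro exI[of _ A]) (auto simp: I_def fun_eq_iff)
 qed
qed

definition readd :: com where
 "readd = While (pos (V ''tn'')) (dec ''tn'' ;; ''x'' <- IElem ''t'' (V ''tn'') ;; addroot)"

lemma imods_readd [simp]:
 "imods readd = {''tn'', ''y'', ''b'', ''a'', ''x'', ''p'', ''h'', ''l'', ''c''}" "rmods readd = {}"
 by (auto simp: readd_def)

lemma wp_readd:
 assumes H: "HI N S Z st" and w: "wl (st$''t'') (st$''tn'' 0) Z" and N: "st$''N'' 0 = N"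
  and g: "\<And>z. z \<in> Z ==> g <= st$''h'' z"
  and W: "(mh S (st$''h'') + st$''tn'' 0 + 2) * (N + 1) <= W"
 shows "wp W readd (%t st'. HI N S {} st' & t + P0 S st' <= P0 S st + 100 * st$''tn'' 0 + 10 &
  mh S (st'$''h'') <= mh S (st$''h'') + st$''tn'' 0 &
  (\<forall>z\<in>S. st$''h'' z <= st'$''h'' z & (st'$''h'' z ~= st$''h'' z --> g <= st$''h'' z)) &
  (\<forall>g. FL g N S st --> FL g N S st')) st"
proof -
 let ?h = "st$''h''" and ?tn = "st$''tn'' 0"
 define I where "I = (%Z sv. HI N S Z sv & wl (sv$''t'') (sv$''tn'' 0) Z & sv$''tn'' 0 <= ?tn &
  mh S (sv$''h'') + sv$''tn'' 0 <= mh S ?h + ?tn & (\<forall>z\<in>Z. g <= sv$''h'' z) &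
  (\<forall>z\<in>S. ?h z <= sv$''h'' z & (sv$''h'' z ~= ?h z --> g <= ?h z)) &
  (\<forall>g. FL g N S st --> FL g N S sv))"
 have W2: "2 <= W" "?tn <= W" "N + 2 <= W" using W by (auto simp: algebra_simps)
 show ?thesis unfolding readd_def
 proof (rule wp_While[where I = "%sv. \<exists>Z. I Z sv" and \<phi> = "%sv. P0 S sv + 100 * sv$''tn'' 0"], goal_cases)
  case 1
  show ?case using H w g by (intro exI[of _ Z]) (auto simp: I_def)
 next
  case (2 sv)
  then show ?case using W2 by (auto simp: I_def)
 next
  case (3 sv)
  then obtain Z' where A: "I Z' sv" by blast
  obtain n where n: "sv$''tn'' 0 = Suc n" using 3(3) by (auto simp: gr0_conv_Suc)
  define x where "x = sv$''t'' n"
  have p: "x \<in> Z'" "wl (sv$''t'') n (Z' - {x})" using wl_pop[of "sv$''t''" n Z'] A n by (auto simp: I_def x_def)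
  define sv1 where "sv1 = iu ''x'' 0 x (iu ''tn'' 0 n sv)"
  have H1: "HI N S Z' sv1" using A by (simp add: I_def sv1_def)
  have xN: "x < N" using hinv_Z[OF H1 p(1)] hinv_ltN[OF H1] by blast
  have tb: "n < ?tn" using A n by (simp add: I_def)
  have W': "(mh S (sv1$''h'') + 2) * (N + 1) <= W"
   using A by (intro order.trans[OF _ W] mult_right_mono) (auto simp: I_def sv1_def)
  have "wp W addroot (%t st''. I (Z' - {x}) st'' & P0 S st'' + 100 * st''$''tn'' 0 + t + 50 <= P0 S sv + 100 * sv$''tn'' 0) sv1"
  proof (rule wp_frame[OF wp_addroot[OF H1 _ _ W']], goal_cases)
   case (3 t st'')
   have s: "st''$''t'' = sv$''t''" "st''$''tn'' 0 = n"
    using 3(2) by (auto simp: unch_def sv1_def)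
   have "g <= sv$''h'' x" using A p by (auto simp: I_def)
   have hh: "?h z <= st''$''h'' z & (st''$''h'' z ~= ?h z --> g <= ?h z)" if z: "z \<in> S" for z
   proof -
    have 1: "?h z <= sv$''h'' z" "sv$''h'' z ~= ?h z --> g <= ?h z"
     using A z by (auto simp: I_def)
    have 2: "sv$''h'' z <= st''$''h'' z"
     "st''$''h'' z ~= sv$''h'' z --> sv$''h'' x <= sv$''h'' z"
     using 3(1) z by (auto simp: sv1_def)
    show ?thesis using 1 2 \<open>g <= sv$''h'' x\<close> by (cases "st''$''h'' z = sv$''h'' z"; cases "sv$''h'' z = ?h z") auto
   qed
   have "I (Z' - {x}) st''"
    using 3(1) A p hh unfolding I_def by (auto simp: s sv1_def n)
   moreover have "P0 S sv1 = P0 S sv" by (simp add: sv1_def)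
   ultimately show ?case using 3(1) by (simp add: s n)
  qed (use 3(2) N p in \<open>auto simp: sv1_def unch_def\<close>)
  then show ?case
   apply (intro wp_basic)
     apply (use W2 n tb xN in \<open>simp_all add: x_def\<close>)
   by (rule wp_mono, unfold sv1_def x_def, assumption) auto
 next
  case (4 t sv)
  then obtain Z' where A: "I Z' sv" by blast
  have "sv$''tn'' 0 = 0" using 4(3) by simp
  moreover from this A have "Z' = {}" by (auto simp: I_def wl_def)
  ultimately show ?case using A 4(4) by (auto simp: I_def)
 qed
qed

subsection \<open>Extracting the minimum\<close>

definition findmin_loop :: com where
 "findmin_loop = While (pos (IElem ''c'' (V ''g'')))
   (Cond (pos (IElem ''b'' (V ''g'')))
     (Cond (pos (V ''bx''))
      (Cond (RLess (RElem ''D'' (IMinus (IElem ''b'' (V ''g'')) (Lit 1))) (RElem ''D'' (IMinus (V ''bx'') (Lit 1))))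
        (''bx'' <- IElem ''b'' (V ''g'')) Skip)
      (''bx'' <- IElem ''b'' (V ''g''))) Skip ;;
    inc ''g'')"

definition findmin :: com where
 "findmin = ''g'' <- Lit 0 ;; ''bx'' <- Lit 0 ;;
  findmin_loop"

lemma imods_findmin [simp]: "imods findmin = {''g'', ''bx''}" "rmods findmin = {}"
 by (auto simp: findmin_def findmin_loop_def)

lemma wp_findmin:
 assumes H: "HI N S {} st" and ne: "S ~= {}" and W: "mh S (st$''h'') + N + 2 <= W"
 shows "wp W findmin (%t st'. \<exists>e\<in>S. st'$''bx'' 0 = Suc e & st$''p'' e = 0 &
  (\<forall>z\<in>S. rmem st ''D'' e <= rmem st ''D'' z) & t <= 100 * mh S (st$''h'') + 20) st"
proof -
 note fin = hinv_fin[OF H]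
 let ?D = "rmem st ''D''" and ?b = "st$''b''" and ?M = "mh S (st$''h'')"
 define I where "I = (%sv :: state. sv$''g'' 0 <= ?M & (sv$''bx'' 0 = 0 --> (\<forall>h<sv$''g'' 0. ?b h = 0)) &
  (sv$''bx'' 0 ~= 0 --> (\<exists>e\<in>S. sv$''bx'' 0 = Suc e & st$''p'' e = 0 &
   (\<forall>h<sv$''g'' 0. ?b h ~= 0 --> ?D e <= ?D (?b h - 1)))))"
 \<comment> \<open>Scans over levels stop at the first zero count. Buckets would not do as a
   criterion: they may be empty in between, whereas counts are positive exactly below
   \<open>?M\<close>.\<close>
 have c: "0 < st$''c'' h \<longleftrightarrow> h < ?M" for h using hinv_cnt_pos[OF H] mh_iff[OF fin] by simp
 have loop: "wp W findmin_loop
  (%t st'. \<exists>e\<in>S. st'$''bx'' 0 = Suc e & st$''p'' e = 0 &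
  (\<forall>z\<in>S. ?D e <= ?D z) & t <= 100 * ?M + 10) (iu ''bx'' 0 0 (iu ''g'' 0 0 st))"
  unfolding findmin_loop_def
 proof (rule wp_While[where I = I and \<phi> = "%sv. 100 * (?M - sv$''g'' 0)"], goal_cases)
  case 1
  show ?case by (simp add: I_def)
 next
  case (2 sv)
  then have "sv$''c'' = st$''c''" by (simp add: unch_def)
  moreover have "st$''c'' h <= W" for h using W hinv_cnt_le[OF H, of h] by linarith
  ultimately show ?case using 2(1) W by (auto simp: I_def)
 next
  case (3 sv)
  then have s: "sv$''c'' = st$''c''" "sv$''b'' = ?b" "rmem sv ''D'' = ?D" by (simp_all add: unch_def)
  have g: "sv$''g'' 0 < ?M" using 3(3) c by (simp add: s)
  let ?g = "sv$''g'' 0"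
  have bb: "?b ?g <= W" "Suc ?g <= W" "2 <= W" using hinv_bk_le[OF H, of ?g] W g by auto
  have bx: "sv$''bx'' 0 <= W" using 3(1) W hinv_ltN[OF H] by (cases "sv$''bx'' 0 = 0") (fastforce simp: I_def)+
  have e: "\<exists>e\<in>S. ?b ?g = Suc e & st$''p'' e = 0" if "?b ?g ~= 0" using hinv_bk[OF H that] by blast
  have "0 < ?M - ?g" using g by simp
  show ?case
   using 3(1) e
   by (intro wp_basic wp_Cond; (use bb bx g in \<open>simp add: s\<close>)?)
    (auto simp: I_def s less_Suc_eq, (meson order.trans less_imp_le)+)
 next
  case (4 t sv)
  then have s: "sv$''c'' = st$''c''" by (simp add: unch_def)
  have g: "sv$''g'' 0 = ?M" using 4(3,1) c by (simp add: s I_def)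
  have anc: "\<exists>h<?M. ?b h ~= 0 & ?D (?b h - 1) <= ?D z" if "z \<in> S" for z
  proof -
   obtain r where "r\<in>S" "st$''p'' r = 0" "?D r <= ?D z" using hinv_ancestor[OF H \<open>z \<in> S\<close>] by blast
   moreover from this have "?b (st$''h'' r) = Suc r" using hinv_root[OF H, of r] by auto
   moreover have "st$''h'' r < ?M" using mh_iff[OF fin] \<open>r \<in> S\<close> by blast
   ultimately show ?thesis by force
  qed
  obtain z where "z \<in> S" using ne by blast
  with anc[OF this] 4(1) have "sv$''bx'' 0 ~= 0" by (auto simp: I_def g)
  then obtain e where e: "e\<in>S" "sv$''bx'' 0 = Suc e" "st$''p'' e = 0"
   "\<forall>h<?M. ?b h ~= 0 --> ?D e <= ?D (?b h - 1)" using 4(1) by (auto simp: I_def g)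
  then have "\<forall>z\<in>S. ?D e <= ?D z" using anc by (meson order.trans)
  then show ?case using e 4(4) by (intro bexI[of _ e]) auto
 qed
 show ?thesis unfolding findmin_def
  apply ((rule wp_ISeq, (use W in \<open>simp; fail\<close>)+)+)
  apply simp
  by (rule wp_mono[OF loop]) auto
qed

definition delmin :: com where
 "delmin = ''x'' <- IMinus (V ''bx'') (Lit 1) ;; IAssign ''b'' (IElem ''h'' (V ''x'')) (Lit 0) ;;
  ''e'' <- V ''x'' ;; ''tn'' <- Lit 0 ;; ''g'' <- Lit 0 ;; strip ;;
  ''c'' <- IMinus (V ''c'') (Lit 1) ;; IAssign ''i'' (V ''x'') (Lit 2) ;; readd"

lemma imods_delmin [simp]:
 "imods delmin = {''x'', ''b'', ''e'', ''tn'', ''g'', ''y'', ''p'', ''t'', ''c'', ''h'', ''i'', ''a'', ''l''}"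
 "rmods delmin = {}"
 by (auto simp: delmin_def)

lemma mh_mono: "finite S ==> T \<subseteq> S ==> (\<And>x. x \<in> T ==> h' x <= h x) ==> mh T h' <= mh S h"
proof (subst mh_le)
 assume *: "finite S" "T \<subseteq> S" "\<And>x. x \<in> T ==> h' x <= h x"
 then show "finite T" using finite_subset by blast
 have "\<forall>x\<in>S. h x < mh S h" using mh_le[OF *(1)] by blast
 with * show "\<forall>x\<in>T. h' x < mh S h" by (meson le_less_trans subsetD)
qed

lemma wp_delmin:
 assumes H: "HI N S {} st" and bx: "st$''bx'' 0 = Suc e" and e: "e \<in> S" "st$''p'' e = 0"
  and N: "st$''N'' 0 = N" and W: "(2 * mh S (st$''h'') + 3) * (N + 1) <= W"
 shows "wp W delmin (%t st'. HI N (S - {e}) {} st' & st'$''e'' 0 = e &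
  st'$''i'' = (st$''i'')(e := 2) &
  t + P0 (S - {e}) st' <= P0 S st + 400 * mh S (st$''h'') + 100 &
  mh (S - {e}) (st'$''h'') <= 2 * mh S (st$''h'')) st"
proof -
 note fin = hinv_fin[OF H]
 let ?h = "st$''h''" and ?p = "st$''p''" and ?M = "mh S (st$''h'')"
 define st1 where "st1 = iu ''g'' 0 0 (iu ''tn'' 0 0 (iu ''e'' 0 e (iu ''b'' (?h e) 0 (iu ''x'' 0 e st))))"
 have be: "st$''b'' (?h e) = Suc e" using hinv_root[OF H e] by simp
 have H1: "HI N S {e} st1" using hinv_unbk(1)[OF H be] by (simp add: st1_def)
 have eN: "e < N" using hinv_ltN[OF H e(1)] .
 have he: "?h e < ?M" using mh_le[OF fin] e by blast
 have W': "(mh S (st1$''h'') + 2) * (N + 1) <= W"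
  by (rule order.trans[OF mult_right_mono W]) (auto simp: st1_def)
 have W2: "2 * N + 3 < W" "?M + 3 <= W" using W eN he by (auto simp: algebra_simps)
 have stp: "wp W (strip ;; ''c'' <- IMinus (V ''c'') (Lit 1) ;; IAssign ''i'' (V ''x'') (Lit 2) ;; readd)
  (%t st'. HI N (S - {e}) {} st' & st'$''e'' 0 = e &
  st'$''i'' = (st$''i'')(e := 2) &
  t + P0 (S - {e}) st' <= P0 S st + 400 * ?M + 50 &
  mh (S - {e}) (st'$''h'') <= 2 * ?M) st1"
 proof (rule wp_Seq, rule wp_frame[OF wp_strip[where ?Z1.0 = "{}" and N = N and S = S, OF _ _ _ _ W']], goal_cases)
  case (5 t1 st2)
  have s1: "st1$''x'' 0 = e" "st1$''g'' 0 = 0" "st1$''h'' = ?h" "st1$''p'' = ?p" "st1$''tn'' 0 = 0"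
   by (simp_all add: st1_def)
  from 5(1)[unfolded s1] obtain A where A: "HI N S (insert e A) st2" "A \<subseteq> S" "e \<notin> A"
   "wl (st2$''t'') (st2$''tn'' 0) A" "st2$''tn'' 0 = card A"
   "st2$''h'' = ?h(e := 0)" "st2$''p'' = (%z. if z \<in> A then 0 else ?p z)"
   "\<forall>z\<in>A. ?p z ~= 0" "card A <= ?h e" "t1 <= 150 * ?h e + 20"
   by auto
  have s2: "st2$''x'' 0 = e" "st2$''e'' 0 = e" "st2$''i'' = st$''i''" "st2$''N'' 0 = N"
   using 5(2) N by (auto simp: unch_def st1_def)
  define st3 where "st3 = iu ''i'' e 2 (iu ''c'' 0 (st2$''c'' 0 - Suc 0) st2)"
  have "insert e A - {e} = A" using A by auto
  with hinv_remove[OF A(1), of e] A(6) have H3: "HI N (S - {e}) A st3" by (simp add: st3_def)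
  have m3: "mh (S - {e}) (st3$''h'') <= ?M" using fin by (intro mh_mono) (auto simp: st3_def A(6))
  have W3: "(mh (S - {e}) (st3$''h'') + st3$''tn'' 0 + 2) * (N + 1) <= W"
   using m3 A(5,9) he by (intro order.trans[OF mult_right_mono W]) (auto simp: st3_def)
  have "sum ?h S = sum (st3$''h'') (S - {e}) + ?h e"
   using sum.remove[OF fin e(1), of ?h] by (simp add: st3_def A(6))
  moreover have "nroots (S - {e}) (st3$''p'') + 1 = nroots S ?p + card A"
  proof -
   have "nroots S (st2$''p'') = nroots S ?p + card A"
    unfolding A(7) using fin A by (intro nroots_zero) auto
   moreover have "nroots S (st2$''p'') = Suc (nroots (S - {e}) (st2$''p''))"
   proof -
    have "{z \<in> S. st2$''p'' z = 0} = insert e {z \<in> S - {e}. st2$''p'' z = 0}"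
     using e A by auto
    then show ?thesis using fin by (simp add: nroots_def)
   qed
   ultimately show ?thesis by (simp add: st3_def)
  qed
  \<comment> \<open>Each level stripped from \<open>e\<close> releases 2000 and creates at most one
    root at 2150, hence the loss of 150 per level.\<close>
  ultimately have P3: "P0 (S - {e}) st3 <= P0 S st + 150 * ?h e"
   using A(9) by (simp add: pot0_def)
  have rd: "wp W readd (%t st'. HI N (S - {e}) {} st' & st'$''e'' 0 = e &
   st'$''i'' = (st$''i'')(e := 2) &
   t1 + t + 25 + P0 (S - {e}) st' <= P0 S st + 400 * ?M + 50 &
   mh (S - {e}) (st'$''h'') <= 2 * ?M) st3"
  proof (rule wp_frame[OF wp_readd[OF H3, where g = 0]], goal_cases)
   case (5 t st')
   have "t + P0 (S - {e}) st' <= P0 S st + 150 * ?h e + 100 * ?h e + 10"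
    using 5(1) P3 A(5,9) by (auto simp: st3_def)
   with A(10) he have "t1 + t + 25 + P0 (S - {e}) st' <= P0 S st + 400 * ?M + 50" by linarith
   moreover have "mh (S - {e}) (st'$''h'') <= 2 * ?M" using 5(1) m3 A(5,9) he by (simp add: st3_def)
   moreover have "st'$''i'' = (st$''i'')(e := 2)" "st'$''e'' 0 = e"
    using 5(2) s2 by (auto simp: unch_def st3_def)
   ultimately show ?case using 5(1) by blast
  qed (use A W3 s2 in \<open>auto simp: st3_def\<close>)
  show ?case
   apply (intro wp_basic; (use s2 W2 eN hinv_cnt_le[OF A(1), of 0] in simp)?)
   by (rule wp_mono[OF rd[unfolded st3_def]]) auto
 qed (use H1 N in \<open>auto simp: st1_def wl_def\<close>)
 show ?thesis unfolding delmin_def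
  apply ((rule wp_ISeq, (use bx W2 eN he in \<open>simp; fail\<close>)+)+)
  apply (simp add: bx)
  by (rule wp_mono[OF stp[unfolded st1_def, simplified]]) auto
qed

text \<open>Empties the buckets from height \<open>g\<close> upwards into the work list, which is
  what lets \<open>stripall\<close> treat all trees reaching that height alike.\<close>

definition collect_loop :: com where
 "collect_loop = While (pos (IElem ''c'' (V ''f'')))
   (Cond (pos (IElem ''b'' (V ''f'')))
     (IAssign ''t'' (V ''tn'') (IMinus (IElem ''b'' (V ''f'')) (Lit 1)) ;; inc ''tn'' ;;
     IAssign ''b'' (V ''f'') (Lit 0)) Skip ;;
    inc ''f'')"

definition collect :: com where
 "collect = ''tn'' <- Lit 0 ;; ''f'' <- V ''g'' ;;
  collect_loop"

lemma imods_collect [simp]: "imods collect = {''tn'', ''f'', ''t'', ''b''}" "rmods collect = {}"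
 by (auto simp: collect_def collect_loop_def)

lemma wp_collect:
 fixes st N S
 defines "g \<equiv> st$''g'' 0"
 assumes H: "HI N S {} st" and g: "g <= mh S (st$''h'')" and W: "mh S (st$''h'') + N + 2 <= W"
 shows "wp W collect (%t st'. \<exists>Z. HI N S Z st' & wl (st'$''t'') (st'$''tn'' 0) Z &
  (\<forall>z\<in>Z. g <= st$''h'' z) & (\<forall>h\<ge>g. st'$''b'' h = 0) & t <= 100 * mh S (st$''h'') + 30) st"
proof -
 note fin = hinv_fin[OF H]
 let ?h = "st$''h''" and ?M = "mh S (st$''h'')"
 define I where "I = (%Z sv. HI N S Z sv & wl (sv$''t'') (sv$''tn'' 0) Z &
  (\<forall>z\<in>Z. g <= ?h z) & g <= sv$''f'' 0 & sv$''f'' 0 <= ?M &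
  (\<forall>h. g <= h --> h < sv$''f'' 0 --> sv$''b'' h = 0))"
 have c: "0 < st$''c'' h \<longleftrightarrow> h < ?M" for h using hinv_cnt_pos[OF H] mh_iff[OF fin] by simp
 have cW: "st$''c'' h <= W" for h using W hinv_cnt_le[OF H, of h] by linarith
 have loop: "wp W collect_loop
   (%t st'. \<exists>Z. HI N S Z st' & wl (st'$''t'') (st'$''tn'' 0) Z &
    (\<forall>z\<in>Z. g <= ?h z) & (\<forall>h\<ge>g. st'$''b'' h = 0) & t <= 100 * ?M + 10) (iu ''f'' 0 g (iu ''tn'' 0 0 st))"
  unfolding collect_loop_def
 proof (rule wp_While[where I = "%sv. \<exists>Z. I Z sv" and \<phi> = "%sv. 100 * (?M - sv$''f'' 0)"], goal_cases)
  case 1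
  show ?case using H g by (intro exI[of _ "{}"]) (auto simp: I_def wl_def)
 next
  case (2 sv)
  then have "sv$''c'' = st$''c''" by (simp add: unch_def)
  with 2 cW W show ?case by (auto simp: I_def)
 next
  case (3 sv)
  then have s: "sv$''c'' = st$''c''" "sv$''h'' = ?h" by (simp_all add: unch_def)
  from 3 obtain Z where A: "I Z sv" by blast
  then have HT: "HI N S Z sv" by (simp add: I_def)
  let ?f = "sv$''f'' 0"
  have f: "?f < ?M" using 3(3) c by (simp add: s)
  have bb: "sv$''b'' ?f <= W" "Suc ?f <= W" "2 <= W" "N + 2 <= W" using hinv_bk_le[OF HT, of ?f] W f by auto
  have tn: "sv$''tn'' 0 <= N"
  proof -
   have "sv$''tn'' 0 = card Z" using A wl_card by (fastforce simp: I_def)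
   also have "\<dots> <= card {..<N}" using hinv_Z[OF HT] hinv_ltN[OF HT] by (intro card_mono) auto
   finally show ?thesis by simp
  qed
  show ?case
  proof (cases "sv$''b'' ?f")
   case 0
   then have "I Z (iu ''f'' 0 (Suc ?f) sv)" using A f by (auto simp: I_def less_Suc_eq)
   then show ?thesis
    by (intro wp_basic wp_Cond; (use bb 0 in simp)?) (use f in \<open>auto simp: 0\<close>)
  next
   case (Suc x)
   note U = hinv_unbk[OF HT Suc]
   define sv' where "sv' = iu ''f'' 0 (Suc ?f) (iu ''b'' ?f 0 (iu ''tn'' 0 (Suc (sv$''tn'' 0)) (iu ''t'' (sv$''tn'' 0) x sv)))"
   have "wl (sv'$''t'') (sv'$''tn'' 0) (insert x Z)"
    using wl_push[of "sv$''t''" "sv$''tn'' 0" Z x] A U(3) by (auto simp: I_def sv'_def)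
   moreover have "HI N S (insert x Z) sv'" using U(1) by (simp add: sv'_def)
   moreover have "?h x = ?f" using U(5) by (simp add: s)
   ultimately have "I (insert x Z) sv'" using A f unfolding I_def by (auto simp: sv'_def less_Suc_eq)
   then show ?thesis
    by (intro wp_basic wp_Cond; (use bb Suc tn in \<open>simp add: sv'_def\<close>)?) (use f in \<open>auto simp: Suc\<close>)
  qed
 next
  case (4 t sv)
  then have s: "sv$''c'' = st$''c''" "sv$''h'' = ?h" by (simp_all add: unch_def)
  from 4 obtain Z where A: "I Z sv" by blast
  then have HT: "HI N S Z sv" by (simp add: I_def)
  have f: "sv$''f'' 0 = ?M" using 4(3) A c by (simp add: s I_def)
  have "sv$''b'' h = 0" if "g <= h" for h
  proof (rule ccontr)
   assume "sv$''b'' h ~= 0"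
   from hinv_bk[OF HT this] obtain x where "x \<in> S" "?h x = h" by (auto simp: s)
   then have "h < ?M" using mh_iff[OF fin] by blast
   then have "sv$''b'' h = 0" using A f that by (simp add: I_def)
   with \<open>sv$''b'' h ~= 0\<close> show False by simp
  qed
  then show ?case using A 4(4) by (intro exI[of _ Z]) (auto simp: I_def)
 qed
 show ?thesis unfolding collect_def
  apply ((rule wp_ISeq, (use W g in \<open>simp add: g_def; fail\<close>)+)+)
  apply simp
  by (rule wp_mono[OF loop[unfolded g_def]]) (auto simp: g_def)
qed

definition stripall_loop :: com where
 "stripall_loop = While (ILess (V ''tq'') (V ''tn'')) (''x'' <- IElem ''t'' (V ''tq'') ;; strip ;; inc ''tq'')"

definition stripall :: com where
 "stripall = ''tq'' <- Lit 0 ;;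
  stripall_loop"

lemma imods_stripall [simp]:
 "imods stripall = {''tq'', ''x'', ''y'', ''p'', ''t'', ''tn'', ''c'', ''h''}" "rmods stripall = {}"
 by (auto simp: stripall_def stripall_loop_def)

text \<open>The list grows while it is processed, as the losers set free by \<open>strip\<close> are
  appended and stripped in their turn. At the end the elements of height at least \<open>g\<close>
  are exactly the listed roots, all of height \<open>g\<close>.\<close>

lemma wp_stripall:
 fixes st N S
 defines "g \<equiv> st$''g'' 0"
 assumes H: "HI N S Z st" and w: "wl (st$''t'') (st$''tn'' 0) Z"
  and g: "\<forall>z\<in>Z. g <= st$''h'' z" and b: "\<forall>h\<ge>g. st$''b'' h = 0" and N: "st$''N'' 0 = N"
  and W: "(mh S (st$''h'') + 3) * (N + 1) <= W"
 shows "wp W stripall (%t st'. HI N S {z \<in> S. g <= st$''h'' z} st' &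
  wl (st'$''t'') (st'$''tn'' 0) {z \<in> S. g <= st$''h'' z} &
  (\<forall>z\<in>S. st'$''h'' z = min (st$''h'' z) g) &
  (\<forall>z\<in>S. st$''h'' z < g --> st'$''p'' z = st$''p'' z) &
  t + 150 * sum (st'$''h'') S <= 150 * sum (st$''h'') S + 100 * card {z \<in> S. g <= st$''h'' z} + 30) st"
proof -
 note fin = hinv_fin[OF H]
 let ?h = "st$''h''" and ?M = "mh S (st$''h'')" and ?C = "{z \<in> S. g <= st$''h'' z}"
 define I where "I = (%Z sv. HI N S Z sv & wl (sv$''t'') (sv$''tn'' 0) Z &
  sv$''tq'' 0 <= sv$''tn'' 0 & (\<forall>j<sv$''tq'' 0. sv$''h'' (sv$''t'' j) = g) &
  (\<forall>z\<in>Z. g <= sv$''h'' z) &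
  (\<forall>z\<in>S. sv$''h'' z <= ?h z & (sv$''h'' z ~= ?h z --> g <= sv$''h'' z)) &
  (\<forall>z\<in>S. ?h z < g --> sv$''p'' z = st$''p'' z))"
 have W2: "N + 3 <= W" using W by (auto simp: algebra_simps)
 have ZC: "Z' \<subseteq> ?C" "card Z' <= card ?C" "sv$''tn'' 0 = card Z'" "card Z' <= N" if I: "I Z' sv" for Z' sv
 proof -
  have HT: "HI N S Z' sv" using I by (simp add: I_def)
  show s: "Z' \<subseteq> ?C"
  proof
   fix z assume z: "z \<in> Z'"
   then have "z \<in> S" using hinv_Z[OF HT] by blast
   moreover have "g <= sv$''h'' z" "sv$''h'' z <= ?h z" using I z \<open>z \<in> S\<close> by (auto simp: I_def)
   ultimately show "z \<in> ?C" by auto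
  qed
  then show "card Z' <= card ?C" using fin by (intro card_mono) auto
  show "sv$''tn'' 0 = card Z'" using I wl_card by (fastforce simp: I_def)
  have "card Z' <= card {..<N}" using s hinv_S[OF H] by (intro card_mono) auto
  then show "card Z' <= N" by simp
 qed
 have loop: "wp W stripall_loop
  (%t st'. HI N S ?C st' & wl (st'$''t'') (st'$''tn'' 0) ?C &
  (\<forall>z\<in>S. st'$''h'' z = min (?h z) g) &
  (\<forall>z\<in>S. ?h z < g --> st'$''p'' z = st$''p'' z) &
  t + 150 * sum (st'$''h'') S <= 150 * sum ?h S + 100 * card ?C + 10) (iu ''tq'' 0 0 st)"
  unfolding stripall_loop_def
 proof (rule wp_While[where I = "%sv. \<exists>Z. I Z sv" and
    \<phi> = "%sv. 150 * sum (sv$''h'') S + 100 * (card ?C - sv$''tq'' 0)"], goal_cases)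
  case 1
  show ?case using H w g by (intro exI[of _ Z]) (auto simp: I_def)
 next
  case (2 sv)
  then obtain Z where A: "I Z sv" by blast
  from ZC[OF A] A W2 show ?case by (auto simp: I_def)
 next
  case (3 sv)
  then obtain Z' where A: "I Z' sv" by blast
  let ?tq = "sv$''tq'' 0"
  define x where "x = sv$''t'' ?tq"
  have s: "sv$''g'' 0 = g" "sv$''N'' 0 = N" "sv$''b'' = st$''b''"
   using 3(2) N by (simp_all add: unch_def g_def)
  have tq: "?tq < sv$''tn'' 0" using 3(3) by simp
  have HT: "HI N S Z' sv" using A by (simp add: I_def)
  have xZ: "x \<in> Z'" using A tq by (auto simp: I_def wl_def x_def)
  have xS: "x \<in> S" "x < N" using hinv_Z[OF HT xZ] hinv_ltN[OF HT] by auto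
  define sv1 where "sv1 = iu ''x'' 0 x sv"
  have W': "(mh S (sv1$''h'') + 2) * (N + 1) <= W"
  proof (rule order.trans[OF mult_right_mono W])
   have "mh S (sv$''h'') <= ?M" using A fin by (intro mh_mono) (auto simp: I_def)
   then show "mh S (sv1$''h'') + 2 <= ?M + 3" by (simp add: sv1_def)
  qed simp
  have s1: "sv1$''x'' 0 = x" "sv1$''g'' 0 = g" "sv1$''h'' = sv$''h''" "sv1$''p'' = sv$''p''"
   "sv1$''tn'' 0 = sv$''tn'' 0" "sv1$''t'' = sv$''t''" "insert x Z' = Z'"
   using xZ by (auto simp: sv1_def s)
  have "wp W (strip ;; inc ''tq'') (%t st''. (\<exists>Z. I Z st'') &
   150 * sum (st''$''h'') S + 100 * (card ?C - st''$''tq'' 0) + t + 40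
   <= 150 * sum (sv$''h'') S + 100 * (card ?C - ?tq)) sv1"
  proof (rule wp_Seq, rule wp_frame[OF wp_strip[where ?Z1.0 = Z' and N = N and S = S, OF _ _ _ _ W', unfolded s1]], goal_cases)
   case (5 t st2)
   then obtain B where B: "HI N S (Z' \<union> B) st2" "B \<subseteq> S" "B \<inter> Z' = {}"
    "wl (st2$''t'') (st2$''tn'' 0) (Z' \<union> B)" "st2$''tn'' 0 = sv$''tn'' 0 + card B"
    "\<forall>j<sv$''tn'' 0. st2$''t'' j = sv$''t'' j"
    "st2$''h'' = (sv$''h'')(x := g)" "st2$''p'' = (%z. if z \<in> B then 0 else sv$''p'' z)"
    "\<forall>z\<in>B. g <= sv$''h'' z" "t <= 150 * (sv$''h'' x - g) + 20"
    by blast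
   have q2: "st2$''tq'' 0 = ?tq" using 5(2) by (simp add: unch_def sv1_def)
   define st3 where "st3 = iu ''tq'' 0 (Suc ?tq) st2"
   have Bh: "g <= ?h z" if "z \<in> B" for z
    using B(2,9) A that unfolding I_def by (meson order.trans subsetD)
   have B0: "\<forall>z\<in>S. ?h z < g --> st2$''p'' z = st$''p'' z"
    using A Bh unfolding B(8) I_def by (auto simp: not_less[symmetric])
   have gx: "g <= sv$''h'' x" "sv$''h'' x <= ?h x" using A xZ xS by (auto simp: I_def)
   have h3: "st3$''h'' = (sv$''h'')(x := g)" using B(7) by (simp add: st3_def)
   have t3: "st3$''t'' j = sv$''t'' j" if "j <= ?tq" for j using B(6) that tq by (simp add: st3_def)
   have "I (Z' \<union> B) st3"
    unfolding I_def
   proof (intro conjI)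
    show "HI N S (Z' \<union> B) st3" "wl (st3$''t'') (st3$''tn'' 0) (Z' \<union> B)" "st3$''tq'' 0 <= st3$''tn'' 0"
     using B(1,4,5) tq by (simp_all add: st3_def)
    show "\<forall>j<st3$''tq'' 0. st3$''h'' (st3$''t'' j) = g"
    proof (intro allI impI)
     fix j assume "j < st3$''tq'' 0"
     then have j: "j <= ?tq" by (simp add: st3_def less_Suc_eq_le)
     show "st3$''h'' (st3$''t'' j) = g"
      using A j unfolding t3[OF j] h3 by (cases "j = ?tq") (auto simp: x_def I_def)
    qed
    show "\<forall>z\<in>Z' \<union> B. g <= st3$''h'' z" using A B(9) by (auto simp: h3 I_def)
    show "\<forall>z\<in>S. st3$''h'' z <= ?h z & (st3$''h'' z ~= ?h z --> g <= st3$''h'' z)"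
     using A gx by (auto simp: h3 I_def)
    show "\<forall>z\<in>S. ?h z < g --> st3$''p'' z = st$''p'' z" using B0 by (simp add: st3_def)
   qed
   moreover have "sum (st2$''h'') S + sv$''h'' x = sum (sv$''h'') S + g"
    unfolding B(7) by (rule sum_upd[OF fin xS(1)])
   moreover have "?tq < card ?C" using ZC[OF A] tq by simp
   ultimately have res: "(\<exists>Z. I Z st3) & 150 * sum (st2$''h'') S + 100 * (card ?C - Suc ?tq) + t + 60
    <= 150 * sum (sv$''h'') S + 100 * (card ?C - ?tq)"
    using B(10) gx by auto
   have "Suc ?tq <= W" using tq ZC[OF A] W2 by simp
   with res show ?case unfolding st3_def
    by (intro wp_basic) (use q2 W2 in simp_all)
  next
   case 3
   then show ?case using A by (simp add: I_def sv1_def)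
  qed (use A HT xZ s s1 in \<open>auto simp: I_def sv1_def\<close>)
  then show ?case
   apply (intro wp_ISeq)
   using tq ZC[OF A] W2 xS apply (simp_all add: x_def)
   by (rule wp_mono, unfold sv1_def x_def, assumption) auto
 next
  case (4 t sv)
  then obtain Z' where A: "I Z' sv" by blast
  have s: "sv$''b'' = st$''b''" using 4(2) by (simp add: unch_def)
  have HT: "HI N S Z' sv" using A by (simp add: I_def)
  have eq: "sv$''tq'' 0 = sv$''tn'' 0" using 4(3) A by (simp add: I_def)
  have Zg: "sv$''h'' z = g" if z: "z \<in> Z'" for z
  proof -
   from z A obtain j where "j < sv$''tn'' 0" "z = sv$''t'' j" by (auto simp: I_def wl_def)
   then show ?thesis using A eq by (simp add: I_def)
  qed
  \<comment> \<open>The buckets from \<open>g\<close> on are empty, so a root that is not in the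
    list is registered in a lower one.\<close>
  have root: "sv$''h'' r < g" if "r \<in> S" "sv$''p'' r = 0" "r \<notin> Z'" for r
  proof -
   have "sv$''b'' (sv$''h'' r) = Suc r" using hinv_root[OF HT that] .
   then show ?thesis using b by (metis s not_less nat.distinct(1))
  qed
  \<comment> \<open>Every element lies below a root, and by now no root is higher than
    \<open>g\<close>; an element that still has a parent is strictly lower than its root.\<close>
  have le: "sv$''h'' z <= g & (sv$''p'' z ~= 0 --> sv$''h'' z < g)" if z: "z \<in> S" for z
  proof -
   obtain r where r: "r\<in>S" "sv$''p'' r = 0" "sv$''h'' z <= sv$''h'' r"
     "sv$''p'' z ~= 0 --> sv$''h'' z < sv$''h'' r"
    using hinv_ancestor[OF HT z] by blast
   have "sv$''h'' r <= g" using Zg[of r] root[OF r(1,2)] by (cases "r \<in> Z'") auto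
   with r show ?thesis by linarith
  qed
  have hmin: "sv$''h'' z = min (?h z) g" if "z \<in> S" for z
  proof -
   have "sv$''h'' z <= ?h z" "sv$''h'' z ~= ?h z --> g <= sv$''h'' z" using A that by (auto simp: I_def)
   with le[OF that] show ?thesis by (cases "sv$''h'' z = ?h z") auto
  qed
  have "?C \<subseteq> Z'"
  proof
   fix z assume z: "z \<in> ?C"
   then have "sv$''h'' z = g" using hmin[of z] by simp
   then have "sv$''p'' z = 0" "\<not> sv$''h'' z < g" using le[of z] z by auto
   then show "z \<in> Z'" using root[of z] z by auto
  qed
  then have "Z' = ?C" using ZC[OF A] by blast
  moreover have "t + 150 * sum (sv$''h'') S <= 150 * sum ?h S + 100 * card ?C + 10"
   using 4(4) by simp
  ultimately show ?case using A hmin by (simp add: I_def)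
 qed
 show ?thesis unfolding stripall_def
  apply ((rule wp_ISeq, (use W2 in \<open>simp; fail\<close>)+)+)
  apply simp
  by (rule wp_mono[OF loop[unfolded g_def]]) (auto simp: g_def)
qed

definition quake :: com where "quake = collect ;; stripall ;; readd"

lemma imods_quake [simp]:
 "imods quake = {''f'', ''tq'', ''x'', ''y'', ''p'', ''t'', ''tn'', ''c'', ''h'', ''b'', ''a'', ''l''}" "rmods quake = {}"
 by (auto simp: quake_def)

lemma wp_quake:
 fixes st N S
 defines "g \<equiv> st$''g'' 0"
 assumes H: "HI N S {} st" and viol: "3 * st$''c'' g < 4 * st$''c'' (Suc g)" and N: "st$''N'' 0 = N"
  and W: "(mh S (st$''h'') + N + 3) * (N + 1) <= W"
 shows "wp W quake (%t st'. HI N S {} st' & t + P0 S st' <= P0 S st + 100 * mh S (st$''h'') + 100 &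
  FL g N S st' & (\<forall>h\<le>g. st'$''c'' h = st$''c'' h)) st"
proof -
 note fin = hinv_fin[OF H]
 let ?h = "st$''h''" and ?M = "mh S (st$''h'')" and ?p = "st$''p''"
 let ?C = "{z \<in> S. g <= st$''h'' z}"
 note Q = hinv_quake_count[OF H viol]
 have "0 < st$''c'' (Suc g)" using viol by simp
 then have g: "g <= ?M" using hinv_cnt_pos[OF H] mh_iff[OF fin] by (metis Suc_le_eq less_imp_le)
 have W1: "?M + N + 2 <= W" using W by (simp add: algebra_simps)
 have W2: "(?M + 3) * (N + 1) <= W" by (rule order.trans[OF mult_right_mono W]) auto
 have CN: "card ?C <= N" using hinv_cnt_le[OF H, of g] by (simp add: hinv_cnt[OF H])
 show ?thesis unfolding quake_def
 proof (rule wp_Seq, rule wp_frame[OF wp_collect[OF H g[unfolded g_def] W1, folded g_def]], goal_cases)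
  case (1 t1 st1)
  then obtain Z where Z: "HI N S Z st1" "wl (st1$''t'') (st1$''tn'' 0) Z"
   "\<forall>z\<in>Z. g <= ?h z" "\<forall>h\<ge>g. st1$''b'' h = 0" "t1 <= 100 * ?M + 30" by blast
  have s1: "st1$''h'' = ?h" "st1$''p'' = ?p" "st1$''g'' 0 = g" "st1$''N'' 0 = N"
   using 1(2) N by (auto simp: unch_def g_def)
  show ?case
  proof (rule wp_Seq, rule wp_frame[OF wp_stripall[OF Z(1,2), unfolded s1, OF Z(3,4)]], goal_cases)
   case (3 t2 st2)
   then have A: "HI N S ?C st2" "wl (st2$''t'') (st2$''tn'' 0) ?C"
    "\<forall>z\<in>S. st2$''h'' z = min (?h z) g" "\<forall>z\<in>S. ?h z < g --> st2$''p'' z = ?p z"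
    "t2 + 150 * sum (st2$''h'') S <= 150 * sum ?h S + 100 * card ?C + 30" by auto
   have N2: "st2$''N'' 0 = N" using 3(2) s1 by (simp add: unch_def)
   have tn: "st2$''tn'' 0 = card ?C" using wl_card[OF A(2)] by simp
   have m2: "mh S (st2$''h'') <= ?M" using fin A(3) by (intro mh_mono) auto
   have W3: "(mh S (st2$''h'') + st2$''tn'' 0 + 2) * (N + 1) <= W"
    using m2 CN tn by (intro order.trans[OF mult_right_mono W]) auto
   have F2: "FL g N S st2" using A(3) by (auto simp: full_def)
   define Y where "Y = (\<Sum>x\<in>S. ?h x - g)"
   define q where "q = card {x \<in> S. g < ?h x & ?p x ~= 0}"
   define X where "X = st$''c'' (Suc g)"
   have sumY: "sum ?h S = sum (st2$''h'') S + Y"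
    unfolding Y_def sum.distrib[symmetric] using A(3) by (intro sum.cong) auto
   let ?Rl = "{z \<in> S. ?h z < g & ?p z = 0}" and ?Rh = "{z \<in> S. g <= ?h z & ?p z = 0}"
   have "nroots S ?p = card (?Rl \<union> ?Rh)" unfolding nroots_def by (rule arg_cong[of _ _ card]) auto
   also have "\<dots> = card ?Rl + card ?Rh" using fin by (intro card_Un_disjoint) auto
   finally have n1: "nroots S ?p = card ?Rl + card ?Rh" .
   have "nroots S (st2$''p'') = card (?Rl \<union> ?C)"
    unfolding nroots_def using A(4) hinv_Z(2)[OF A(1)] by (intro arg_cong[of _ _ card]) (auto simp: not_le[symmetric])
   also have "\<dots> = card ?Rl + card ?C" using fin by (intro card_Un_disjoint) auto
   finally have n2: "nroots S (st2$''p'') = card ?Rl + card ?C" .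
   have cC: "st$''c'' g = card ?C" by (simp add: hinv_cnt[OF H])
   have Q': "X + q <= Y" "q <= X" "3 * card ?C <= 4 * X" "3 * (card ?C - card ?Rh) <= X + 3 * q"
    using Q by (simp_all add: Y_def q_def X_def cC)
   have "card ?Rh <= card ?C" using fin by (intro card_mono) auto
   \<comment> \<open>Of the 2000 released by each of the \<open>Y\<close> destroyed nodes, 150 pay
     for the stripping. The remaining 1850 cover 2150 for every new root and 200 for handling each
     list entry.\<close>
   then have pay: "2150 * nroots S (st2$''p'') + 200 * card ?C <= 2150 * nroots S ?p + 1850 * Y"
    using Q' n1 n2 by linarith
   show ?case
   proof (rule wp_frame[OF wp_readd[OF A(1,2) N2 _ W3, where g = g]], goal_cases)
    case (1 z)
    then show ?case using A(3) by simp
   next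
    case (2 t3 st3)
    have rel: "\<forall>z\<in>S. st2$''h'' z <= st3$''h'' z &
      (st3$''h'' z ~= st2$''h'' z --> g <= st2$''h'' z)" using 2(1) by blast
    have H3: "HI N S {} st3" using 2(1) by blast
    \<comment> \<open>Truncating heights to \<open>g\<close> and then raising only elements of
      height at least \<open>g\<close> does not change who reaches a level up to
      \<open>g\<close>.\<close>
    have "st3$''c'' k = st$''c'' k" if k: "k <= g" for k
    proof -
     have "k <= st3$''h'' z \<longleftrightarrow> k <= ?h z" if z: "z \<in> S" for z
     proof -
      have 1: "st2$''h'' z = min (?h z) g" using A(3) z by blast
      have 2: "st2$''h'' z <= st3$''h'' z" "st3$''h'' z = st2$''h'' z \<or> g <= st2$''h'' z"
       using rel z by auto
      show ?thesis using 1 2 k by (auto simp: min_def split: if_splits)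
     qed
     then have "{z \<in> S. k <= st3$''h'' z} = {z \<in> S. k <= ?h z}" by auto
     then show ?thesis by (simp add: hinv_cnt[OF H3] hinv_cnt[OF H])
    qed
    moreover have "t1 + (t2 + t3) + P0 S st3 <= P0 S st + 100 * ?M + 100"
    proof -
     have "t3 + P0 S st3 <= P0 S st2 + 100 * card ?C + 10" using 2(1) tn by simp
     moreover have "P0 S st2 + 200 * card ?C + 150 * Y <= P0 S st"
      unfolding pot0_def sumY using pay by simp
     moreover have "t2 <= 150 * Y + 100 * card ?C + 30" using A(5) sumY by simp
     ultimately show ?thesis using Z(5) by linarith
    qed
    ultimately show ?case using H3 2(1) F2 by auto
   qed
  qed (use s1 W2 in auto)
 qed
qed

definition check_loop :: com where
 "check_loop = While (BAnd (pos (IElem ''c'' (IPlus (V ''g'') (Lit 1))))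
  (BNot (ILess (ITimes (Lit 3) (IElem ''c'' (V ''g''))) (ITimes (Lit 4) (IElem ''c'' (IPlus (V ''g'') (Lit 1)))))))
  (inc ''g'')"

definition exmin :: com where
 "exmin = findmin ;; delmin ;; ''g'' <- Lit 0 ;; check_loop ;;
  Cond (pos (IElem ''c'' (IPlus (V ''g'') (Lit 1)))) quake Skip"

lemma imods_exmin [simp]:
 "imods exmin = {''g'', ''bx'', ''x'', ''b'', ''e'', ''tn'', ''y'', ''p'', ''t'', ''c'', ''h'', ''i'', ''a'', ''l'', ''f'', ''tq''}"
 "rmods exmin = {}"
 by (auto simp: exmin_def check_loop_def)

lemma wp_check_loop:
 assumes H: "HI N S {} st" and g0: "st$''g'' 0 = 0" and W: "mh S (st$''h'') + 4 * N + 4 <= W"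
 shows "wp W check_loop (%t st'. let g = st'$''g'' 0; c = st$''c'' in
  (\<forall>h<g. 4 * c (Suc h) <= 3 * c h) & (c (Suc g) = 0 \<or> 3 * c g < 4 * c (Suc g)) & g <= mh S (st$''h'') &
  t <= 100 * mh S (st$''h'') + 40) st"
proof -
 note fin = hinv_fin[OF H]
 let ?M = "mh S (st$''h'')" and ?c = "st$''c''"
 have c: "0 < ?c h \<longleftrightarrow> h < ?M" for h using hinv_cnt_pos[OF H] mh_iff[OF fin] by simp
 have cW: "4 * ?c h <= W" for h using W hinv_cnt_le[OF H, of h] by linarith
 show ?thesis unfolding check_loop_def Let_def
 proof (rule wp_While[where I = "%sv. sv$''g'' 0 <= ?M & (\<forall>h<sv$''g'' 0. 4 * ?c (Suc h) <= 3 * ?c h)"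
    and \<phi> = "%sv. 100 * (?M - sv$''g'' 0)"], goal_cases)
  case 1
  show ?case by (simp add: g0)
 next
  case (2 sv)
  then have "sv$''c'' = ?c" by (simp add: unch_def)
  then show ?case using 2(1) W cW[of "sv$''g'' 0"] cW[of "Suc (sv$''g'' 0)"] by auto
 next
  case (3 sv)
  then have s: "sv$''c'' = ?c" by (simp add: unch_def)
  have "Suc (sv$''g'' 0) < ?M" using 3(3) c s by simp
  then show ?case
   by (intro wp_basic; (use W in simp)?) (use 3 s in \<open>auto simp: less_Suc_eq\<close>)
 next
  case (4 t sv)
  then have s: "sv$''c'' = ?c" by (simp add: unch_def)
  then show ?case using 4 by auto
 qed
qed

text \<open>The \<open>2000 * mh\<close> contained in the old potential pays for all scans over the
  levels. At most \<open>3 * l + 1\<close> levels remain, so restoring this term costs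
  \<open>6000 * l + 2000\<close>, whence the coefficient of \<open>l\<close>.\<close>

lemma wp_exmin:
 assumes H: "HI N S {} st" and ne: "S ~= {}" and N: "st$''N'' 0 = N" and size: "card S <= 2 ^ l"
  and W: "(4 * mh S (st$''h'') + 2 * N + 8) * (N + 1) <= W"
 shows "wp W exmin (%t st'. \<exists>e\<in>S. st'$''e'' 0 = e & (\<forall>z\<in>S. rmem st ''D'' e <= rmem st ''D'' z) &
  HI N (S - {e}) {} st' & st'$''i'' = (st$''i'')(e := 2) &
  t + pot (S - {e}) st' <= pot S st + 6000 * l + 3000) st"
proof -
 let ?M = "mh S (st$''h'')"
 note fin = hinv_fin[OF H]
 have W1: "4 * ?M + 4 * N + 8 <= W" using W by (cases N) (auto simp: algebra_simps)
 have W2: "(2 * ?M + 3) * (N + 1) <= W" by (rule order.trans[OF mult_right_mono W]) auto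
 show ?thesis unfolding exmin_def
 proof (rule wp_Seq, rule wp_frame[OF wp_findmin[OF H ne]], goal_cases)
  case (2 t1 st1)
  then obtain e where e: "e \<in> S" "st1$''bx'' 0 = Suc e" "st$''p'' e = 0"
   "\<forall>z\<in>S. rmem st ''D'' e <= rmem st ''D'' z" "t1 <= 100 * ?M + 20" by blast
  have s1: "st1$''h'' = st$''h''" "st1$''p'' = st$''p''" "st1$''N'' 0 = N" "st1$''i'' = st$''i''"
   "st1$''l'' = st$''l''" "st1$''b'' = st$''b''" "st1$''c'' = st$''c''" "rmem st1 ''D'' = rmem st ''D''"
   using 2(2) N by (auto simp: unch_def)
  have H1: "HI N S {} st1" using H by (simp add: s1)
  let ?S = "S - {e}"
  show ?case
  proof (rule wp_Seq, rule wp_frame[OF wp_delmin[OF H1 e(2,1)]], goal_cases)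
   case (4 t2 st2)
   then have A: "HI N ?S {} st2" "st2$''e'' 0 = e" "st2$''i'' = (st$''i'')(e := 2)"
    "t2 + P0 ?S st2 <= P0 S st + 400 * ?M + 100" "mh ?S (st2$''h'') <= 2 * ?M"
    by (auto simp: s1)
   have N2: "st2$''N'' 0 = N" using 4(2) s1 by (simp add: unch_def)
   define st3 where "st3 = iu ''g'' 0 0 st2"
   let ?M3 = "mh ?S (st3$''h'')" and ?c = "st2$''c''"
   have H3: "HI N ?S {} st3" and c3: "st3$''c'' = ?c" "P0 ?S st3 = P0 ?S st2" using A(1) by (simp_all add: st3_def)
   have M3: "?M3 <= 2 * ?M" using A(5) by (simp add: st3_def)
   have size': "card ?S <= 2 ^ l" using size card_Diff1_le[of S e] by linarith
   have tail: "wp W (check_loop ;; Cond (pos (IElem ''c'' (IPlus (V ''g'') (Lit 1)))) quake Skip)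
    (%t st'. HI N ?S {} st' & st'$''e'' 0 = e & st'$''i'' = (st$''i'')(e := 2) &
     t + pot ?S st' <= P0 ?S st3 + 400 * ?M + 6000 * l + 2500) st3"
   proof (rule wp_Seq, rule wp_frame[OF wp_check_loop[OF H3]], goal_cases)
    case (3 t4 st4)
    define g where "g = st4$''g'' 0"
    have C: "\<forall>h<g. 4 * ?c (Suc h) <= 3 * ?c h" "?c (Suc g) = 0 \<or> 3 * ?c g < 4 * ?c (Suc g)"
     "g <= ?M3" "t4 <= 100 * ?M3 + 40" using 3(1) by (auto simp: Let_def g_def c3)
    have s4: "st4$''c'' = ?c" "st4$''h'' = st2$''h''" "st4$''p'' = st2$''p''" "st4$''l'' = st2$''l''"
     "st4$''b'' = st2$''b''" "st4$''e'' 0 = e" "st4$''i'' = st2$''i''" "st4$''N'' 0 = N"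
     "rmem st4 ''D'' = rmem st2 ''D''"
     using 3(2) A N2 by (auto simp: unch_def st3_def check_loop_def)
    have H4: "HI N ?S {} st4" using A(1) by (simp add: s4)
    have P4: "P0 ?S st4 = P0 ?S st3" by (simp add: s4 c3)
    have gW: "Suc g <= W" "1 <= W" "?c (Suc g) <= W"
     using C(3) M3 W1 hinv_cnt_le[OF A(1), of "Suc g"] by linarith+
    show ?case
    proof (rule wp_Cond, goal_cases)
     case 1
     show ?case using gW by (simp add: g_def s4)
    next
     case 2
     then have v: "3 * ?c g < 4 * ?c (Suc g)" using C(2) by (simp add: g_def s4)
     have W4: "(mh ?S (st4$''h'') + N + 3) * (N + 1) <= W"
      using M3 by (intro order.trans[OF mult_right_mono W]) (auto simp: s4 st3_def)
     show ?case
     proof (rule wp_frame[OF wp_quake[OF H4 _ _ W4, folded g_def]], goal_cases)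
      case (3 t5 st5)
      then have B: "HI N ?S {} st5" "t5 + P0 ?S st5 <= P0 ?S st3 + 100 * ?M3 + 100"
       "FL g N ?S st5" "\<forall>h\<le>g. st5$''c'' h = ?c h"
       using P4 by (auto simp: s4 st3_def)
      \<comment> \<open>Below \<open>g\<close> the ratio was verified by \<open>check_loop\<close>
        and is unaffected by the quake; from \<open>g\<close> upwards the rebuilt levels are full,
        so counts even halve.\<close>
      have "4 * st5$''c'' (Suc h) <= 3 * st5$''c'' h" for h
      proof (cases "h < g")
       case True
       then show ?thesis using C(1) B(4) by simp
      next
       case False
       have "2 * st5$''c'' (Suc h) <= st5$''c'' h"
       proof (rule hinv_full_level[OF B(1)])
        fix x assume "x \<in> ?S" "Suc h <= st5$''h'' x"
        moreover have "g < Suc h" using False by simp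
        ultimately show "st5$''l'' (Suc h * N + x) ~= 0" using B(3) unfolding full_def by blast
       qed
       then show ?thesis by simp
      qed
      from mh_log[OF B(1) this size'] have "mh ?S (st5$''h'') <= Suc (3 * l)" .
      moreover have "st5$''e'' 0 = e" "st5$''i'' = (st$''i'')(e := 2)"
       using 3(2) s4 A(3) by (auto simp: unch_def)
      ultimately show ?case using B C(4) M3 by (simp add: pot_def)
     qed (use v s4 in \<open>auto simp: g_def\<close>)
    next
     case 3
     then have z: "?c (Suc g) = 0" by (simp add: g_def s4)
     have "4 * ?c (Suc h) <= 3 * ?c h" for h
     proof (cases "h < g")
      case True
      then show ?thesis using C(1) by simp
     next
      case False
      have "?c (Suc h) <= ?c (Suc g)" unfolding hinv_cnt[OF A(1)] using fin False by (intro card_mono) auto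
      then show ?thesis using z by simp
     qed
     from mh_log[OF A(1) this size'] have "mh ?S (st2$''h'') <= Suc (3 * l)" .
     then show ?case using H4 C(4) M3 A(3) P4 by (intro wp_Skip) (simp add: pot_def s4)
    qed
   qed (use W1 M3 in \<open>auto simp: st3_def\<close>)
   show ?case
    apply (rule wp_ISeq)
    using W1 apply (simp, simp)
    apply (simp only: ival.simps)
    apply (rule wp_mono[OF tail[unfolded st3_def]])
    using A(4) e by (auto simp: pot_def)
  qed (use e s1 W2 in auto)
 qed (use W1 in simp)
qed

section \<open>Graphs of degree three\<close>

text \<open>Vertex \<open>x < N\<close> owns the three slots \<open>q\<close> with \<open>q div 3 = x\<close>; an undirected edge is a pair of slots
 exchanged by the involution \<open>rv\<close>, and a fixed point of \<open>rv\<close> is a harmless loop.\<close>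

locale hgraph =
 fixes N :: nat and rv :: "nat => nat" and wt :: "nat => real"
 assumes rv_lt: "q < 3 * N ==> rv q < 3 * N" and rv_rv: "q < 3 * N ==> rv (rv q) = q"
  and wt_nn: "q < 3 * N ==> 0 <= wt q" and wt_rv: "q < 3 * N ==> wt (rv q) = wt q"
begin

abbreviation nb :: "nat => nat" where "nb q \<equiv> rv q div 3"

text \<open>Distances are handled without infima: a label is correct if it is the length of a walk
  and at most the length of every walk.\<close>

inductive walk :: "nat => nat => real => bool" for x where
 walk_refl: "x < N ==> walk x x 0"
| walk_step: "walk x y d ==> q < 3 * N ==> q div 3 = y ==> walk x (nb q) (d + wt q)"

lemma nb_lt: "q < 3 * N ==> nb q < N"
 using rv_lt[of q] by (simp add: less_mult_imp_div_less mult.commute)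

lemma walk_lt: "walk x y d ==> x < N & y < N"
 by (induction rule: walk.induct) (auto simp: nb_lt)

lemma walk_nn: "walk x y d ==> 0 <= d"
 by (induction rule: walk.induct) (auto simp: wt_nn)

lemma walk_trans: "walk y z d' ==> walk x y d ==> walk x z (d + d')"
proof (induction rule: walk.induct)
 case (walk_step z d' q)
 then have "walk x z (d + d')" by simp
 from walk.walk_step[OF this walk_step(2,3)] show ?case by (simp add: add.assoc)
qed simp

lemma walk_edge: "q < 3 * N ==> walk (q div 3) (nb q) (wt q)"
 using walk.walk_step[OF walk_refl, of "q div 3" q] by (simp add: less_mult_imp_div_less mult.commute)

text \<open>Here the arguments about distances use that the graph is undirected.\<close>

lemma walk_sym: "walk x y d ==> walk y x d"
proof (induction rule: walk.induct)
 case walk_refl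
 then show ?case by (rule walk.walk_refl)
next
 case (walk_step y d q)
 have "walk (nb q) (q div 3) (wt q)"
  using walk_edge[OF rv_lt[OF walk_step(2)]] walk_step(2) by (simp add: rv_rv wt_rv)
 with walk_step have "walk (nb q) y (wt q)" by simp
 from walk_trans[OF walk_step.IH this] show ?case by (simp add: add.commute)
qed

text \<open>The entries \<open>j\<close> with \<open>a <= j < b\<close> of \<open>tz\<close> and \<open>td\<close> form a table of vertices near \<open>v\<close> with upper bounds on
 their distances; it is complete up to \<open>u\<close>, plus one edge.\<close>

definition table :: "(nat => nat) => (nat => real) => nat => nat => nat => bool" where
 "table tz td v a b \<longleftrightarrow> (\<exists>j. a <= j & j < b & tz j = v & td j = 0) &
  (\<forall>j. a <= j --> j < b --> walk v (tz j) (td j))"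

definition reaches :: "(nat => nat) => (nat => real) => nat => nat => nat => nat => bool" where
 "reaches tz td v a b u \<longleftrightarrow> (\<exists>j. a <= j & j < b & tz j = u &
  (\<forall>z l q. walk v z l --> l < td j --> q < 3 * N --> q div 3 = z -->
    (\<exists>i. a <= i & i < b & tz i = nb q & td i <= l + wt q)))"

end

subsection \<open>Truncated Dijkstra\<close>

text \<open>In \<open>i\<close> an untouched vertex has 0, a member of the heap 1 and an extracted
  one 2. The value 2 prevents a second insertion.\<close>

definition SS :: "nat => state => nat set" where "SS N st = {x. x < N & st$''i'' x = 1}"
definition PP :: "nat => state => nat set" where "PP N st = {x. x < N & st$''i'' x = 2}"

text \<open>The first label of a vertex appends it to the table. Its distance is copied into the
  table only when the exploration is over, since the label may still improve.\<close>

definition relaxE :: com where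
 "relaxE = Cond (ILess (IElem ''i'' (V ''x'')) (Lit 2))
  (Cond (ILess (IElem ''r'' (V ''x'')) (Lit 1))
    (IAssign ''r'' (V ''x'') (Lit 1) ;; RAssign ''D'' (V ''x'') (RElem ''nv'' (Lit 0)) ;;
    IAssign ''tz'' (V ''tp'') (V ''x'') ;; inc ''tp'' ;; update)
    (Cond (RLess (RElem ''nv'' (Lit 0)) (RElem ''D'' (V ''x'')))
     (RAssign ''D'' (V ''x'') (RElem ''nv'' (Lit 0)) ;; update) Skip)) Skip"

lemma imods_relaxE [simp]:
 "imods relaxE = {''r'', ''tz'', ''tp'', ''i'', ''y'', ''b'', ''a'', ''x'', ''p'', ''h'', ''l'', ''c''}" "rmods relaxE = {''D''}"
 by (auto simp: relaxE_def)

context hgraph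
begin

text \<open>Every touched vertex has exactly one table cell from \<open>base\<close> on. So the heap
  is no larger than the table, and this is what makes its logarithm small.\<close>

definition einv :: "nat => nat => state => bool" where
 "einv v base st \<longleftrightarrow> HI N (SS N st) {} st &
  (\<forall>x<N. st$''i'' x <= 2 & st$''r'' x = (if st$''i'' x = 0 then 0 else 1)) &
  (\<forall>x<N. st$''i'' x ~= 0 --> walk v x (rmem st ''D'' x)) &
  (\<forall>p\<in>PP N st. \<forall>s\<in>SS N st. rmem st ''D'' p <= rmem st ''D'' s) &
  base <= st$''tp'' 0 &
  wl (%j. st$''tz'' (base + j)) (st$''tp'' 0 - base) {x. x < N & st$''i'' x ~= 0}"

lemma wl_push_off:
 assumes "wl (%j. f (base + j)) (n - base) Z" "z \<notin> Z" "base <= n"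
 shows "wl (%j. (f(n := z)) (base + j)) (Suc n - base) (insert z Z)"
proof -
 have "(%j. (f(n := z)) (base + j)) = (%j. f (base + j))(n - base := z)" using assms(3) by (auto simp: fun_eq_iff)
 then show ?thesis using wl_push[OF assms(1,2)] assms(3) by (simp add: Suc_diff_le)
qed

lemma wp_relaxE:
 fixes st v
 defines "x \<equiv> st$''x'' 0" and "nv \<equiv> rmem st ''nv'' 0"
 assumes E: "einv v base st" and x: "walk v x nv" and P: "\<And>p. p \<in> PP N st ==> rmem st ''D'' p <= nv"
  and N: "st$''N'' 0 = N" and W: "(mh (SS N st) (st$''h'') + 3) * (N + 1) <= W" "Suc (st$''tp'' 0) <= W"
 shows "wp W relaxE (%t st'. einv v base st' & PP N st' = PP N st &
  (\<forall>z<N. st$''i'' z ~= 0 --> st'$''i'' z ~= 0 & rmem st' ''D'' z <= rmem st ''D'' z) &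
  (\<forall>p\<in>PP N st. rmem st' ''D'' p = rmem st ''D'' p) &
  st'$''i'' x ~= 0 & rmem st' ''D'' x <= nv & st'$''tp'' 0 <= Suc (st$''tp'' 0) &
  (\<forall>j<st$''tp'' 0. st'$''tz'' j = st$''tz'' j) &
  t + pot (SS N st') st' <= pot (SS N st) st + 7100) st"
proof -
 let ?i = "st$''i''" and ?D = "rmem st ''D''" and ?tp = "st$''tp'' 0"
 have H: "HI N (SS N st) {} st" and i2: "\<And>z. z < N ==> ?i z <= 2"
  and r: "\<And>z. z < N ==> st$''r'' z = (if ?i z = 0 then 0 else 1)"
  and lab: "\<And>z. z < N ==> ?i z ~= 0 ==> walk v z (?D z)"
  and mono: "\<And>p s. p \<in> PP N st ==> s \<in> SS N st ==> ?D p <= ?D s"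
  and tp: "base <= ?tp" and tz: "wl (%j. st$''tz'' (base + j)) (?tp - base) {x. x < N & ?i x ~= 0}"
  using E unfolding einv_def by auto
 have xN: "x < N" using walk_lt[OF x] by simp
 have W2: "3 < W" "2 * N + 2 < W" using W xN by (auto simp: algebra_simps)
 have i01: "?i x = 0 \<or> ?i x = 1" if "?i x ~= 2" using i2[OF xN] that by linarith
 have upd: "wp W update (%t st'. einv v base st' & PP N st' = PP N st &
  (\<forall>z<N. ?i z ~= 0 --> st'$''i'' z ~= 0 & rmem st' ''D'' z <= ?D z) &
  (\<forall>p\<in>PP N st. rmem st' ''D'' p = ?D p) &
  st'$''i'' x ~= 0 & rmem st' ''D'' x <= nv & st'$''tp'' 0 <= Suc ?tp &
  (\<forall>j<?tp. st'$''tz'' j = st$''tz'' j) &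
  t + pot (SS N st') st' <= pot (SS N st) st + 7000) sv"
  if t: "sv$''x'' 0 = x" "rmem sv ''D'' = ?D(x := nv)" "sv$''i'' = ?i" "sv$''r'' = (st$''r'')(x := 1)"
   "sv$''h'' = st$''h''" "sv$''p'' = st$''p''" "sv$''l'' = st$''l''"
   "sv$''b'' = st$''b''" "sv$''c'' = st$''c''" "sv$''N'' 0 = N"
   and xn: "?i x ~= 2" "?i x = 1 ==> nv <= ?D x"
   and tzp: "?i x = 0 ==> sv$''tp'' 0 = Suc ?tp & sv$''tz'' = (st$''tz'')(?tp := x)"
    "?i x = 1 ==> sv$''tp'' 0 = ?tp & sv$''tz'' = st$''tz''" for sv
 proof (rule wp_frame[OF wp_update[where N = N and S = "SS N st" and key = ?D]], goal_cases)
  case (8 t st')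
  have s: "rmem st' ''D'' = ?D(x := nv)" "st'$''r'' = (st$''r'')(x := 1)" "st'$''tp'' = sv$''tp''"
   "st'$''tz'' = sv$''tz''" using 8(2) t by (auto simp: unch_def)
  have i': "st'$''i'' = ?i(x := 1)" using 8(1) t by simp
  have xc: "?i x = 0 \<or> ?i x = 1" using i2[OF xN] xn by linarith
  have S': "SS N st' = insert x (SS N st)" "PP N st' = PP N st" using xN xn(1) by (auto simp: SS_def PP_def i')
  have xP: "x \<notin> PP N st" using xn by (simp add: PP_def)
  have sub: "(?D(x := nv)) z <= ?D z" if "?i z ~= 0" for z
   using that xc xn(2) by (cases "z = x") auto
  have tz': "wl (%j. sv$''tz'' (base + j)) (sv$''tp'' 0 - base) {z. z < N & st'$''i'' z ~= 0}"
  proof (cases "?i x = 0")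
   case True
   have "{z. z < N & st'$''i'' z ~= 0} = insert x {z. z < N & ?i z ~= 0}" using xN by (auto simp: i')
   then show ?thesis using wl_push_off[OF tz, of x] tzp(1) tp True by simp
  next
   case False
   then have "?i x = 1" using xc by simp
   then have "{z. z < N & st'$''i'' z ~= 0} = {z. z < N & ?i z ~= 0}" using xN by (auto simp: i')
   then show ?thesis using tz tzp(2) \<open>?i x = 1\<close> by simp
  qed
  have E': "einv v base st'"
   unfolding einv_def
  proof (intro conjI)
   show "HI N (SS N st') {} st'" using 8(1) t(1) by (simp add: S')
   show "\<forall>z<N. st'$''i'' z <= 2 & st'$''r'' z = (if st'$''i'' z = 0 then 0 else 1)"
    using i2 r by (auto simp: i' s)
   show "\<forall>z<N. st'$''i'' z ~= 0 --> walk v z (rmem st' ''D'' z)" using lab x by (auto simp: i' s)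
   show "\<forall>p\<in>PP N st'. \<forall>s\<in>SS N st'. rmem st' ''D'' p <= rmem st' ''D'' s"
    using mono P xP by (auto simp: S' s)
   show "base <= st'$''tp'' 0" using tp tzp xc by (auto simp: s)
   show "wl (%j. st'$''tz'' (base + j)) (st'$''tp'' 0 - base) {z. z < N & st'$''i'' z ~= 0}"
    using tz' by (simp add: s)
  qed
  have "t + pot (SS N st') st' <= pot (SS N st) sv + 7000" using 8(1) t(1) by (simp add: S')
  moreover have "pot (SS N st) sv = pot (SS N st) st" by (simp add: pot_def t)
  ultimately show ?case using E' S' xc tzp xP sub by (auto simp: s i')
 qed (use H xn xN W N t i01[OF xn(1)] in \<open>auto simp: SS_def\<close>)
 show ?thesis
 proof (cases "?i x = 2")
  case True
  then have "x \<in> PP N st" using xN by (simp add: PP_def)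
  then show ?thesis unfolding relaxE_def
   by (intro wp_Cond wp_Skip; (use True E P xN W2 in \<open>simp add: x_def[symmetric]\<close>)?)
 next
  case False
  then have c: "?i x = 0 \<or> ?i x = 1" using i2[OF xN] by linarith
  show ?thesis
  proof (cases "?i x = 0")
   case True
   define sv where "sv = iu ''tp'' 0 (Suc ?tp) (iu ''tz'' ?tp x (ru ''D'' x nv (iu ''r'' x (Suc 0) st)))"
   have u: "wp W update (%t st'. einv v base st' & PP N st' = PP N st &
    (\<forall>z<N. ?i z ~= 0 --> st'$''i'' z ~= 0 & rmem st' ''D'' z <= ?D z) &
    (\<forall>p\<in>PP N st. rmem st' ''D'' p = ?D p) &
    st'$''i'' x ~= 0 & rmem st' ''D'' x <= nv & st'$''tp'' 0 <= Suc ?tp &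
    (\<forall>j<?tp. st'$''tz'' j = st$''tz'' j) &
    t + pot (SS N st') st' <= pot (SS N st) st + 7000) sv"
    by (rule upd) (use True N in \<open>auto simp: sv_def x_def[symmetric]\<close>)
   show ?thesis unfolding relaxE_def
    apply (rule wp_Cond)
     apply (use xN W2 True in \<open>simp add: x_def\<close>)
    apply (rule wp_Cond)
     apply (use r[OF xN] xN W2 True in \<open>simp add: x_def\<close>)
     apply (rule wp_ISeq, (use r[OF xN] xN W2 True in \<open>simp add: x_def; fail\<close>)+)
     apply (rule wp_RSeq, (use r[OF xN] xN W2 True in \<open>simp add: x_def; fail\<close>)+)
     apply ((rule wp_ISeq, (use r[OF xN] xN W W2 True in \<open>simp add: x_def; fail\<close>)+)+)
     apply simp
     apply (rule wp_mono[OF u[unfolded sv_def x_def nv_def]])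
     apply (simp add: x_def nv_def)
    using r[OF xN] True by (simp_all add: x_def)
  next
   case False
   then have 1: "?i x = 1" using c by simp
   have u: "wp W update (%t st'. einv v base st' & PP N st' = PP N st &
    (\<forall>z<N. ?i z ~= 0 --> st'$''i'' z ~= 0 & rmem st' ''D'' z <= ?D z) &
    (\<forall>p\<in>PP N st. rmem st' ''D'' p = ?D p) &
    st'$''i'' x ~= 0 & rmem st' ''D'' x <= nv & st'$''tp'' 0 <= Suc ?tp &
    (\<forall>j<?tp. st'$''tz'' j = st$''tz'' j) &
    t + pot (SS N st') st' <= pot (SS N st) st + 7000) (ru ''D'' x nv st)" if "nv < ?D x"
    by (rule upd) (use 1 that N r[OF xN] in \<open>auto simp: x_def[symmetric]\<close>)
   show ?thesis unfolding relaxE_def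
    apply (rule wp_Cond)
     apply (use xN W2 1 in \<open>simp add: x_def\<close>)
    apply (rule wp_Cond)
     apply (use r[OF xN] xN W2 1 in \<open>simp add: x_def\<close>)
     apply (use r[OF xN] xN W2 1 in \<open>simp add: x_def\<close>)
    apply (rule wp_Cond)
     apply (use xN W2 1 in \<open>simp add: x_def\<close>)
     apply (rule wp_RSeq, (use xN W2 in \<open>simp add: x_def; fail\<close>)+)
     apply simp
     apply (rule wp_mono[OF u[unfolded x_def nv_def]])
     apply simp
     apply (simp add: x_def nv_def)
    apply (rule wp_Skip)
    using E 1 by (simp_all add: x_def nv_def)
  qed
 qed
qed

end

definition relax_loop :: com where
 "relax_loop = While (ILess (V ''j'') (Lit 3))
  (''q'' <- IPlus (ITimes (Lit 3) (V ''e'')) (V ''j'') ;; ''x'' <- IDiv (IElem ''rv'' (V ''q'')) (Lit 3) ;;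
   RAssign ''nv'' (Lit 0) (RPlus (RElem ''D'' (V ''e'')) (RElem ''wt'' (V ''q''))) ;; relaxE ;; inc ''j'')"

lemma imods_relax_loop [simp]:
 "imods relax_loop = {''j'', ''q'', ''r'', ''tz'', ''tp'', ''i'', ''y'', ''b'', ''a'', ''x'', ''p'', ''h'', ''l'', ''c''}"
 "rmods relax_loop = {''nv'', ''D''}"
 by (auto simp: relax_loop_def)

lemma mh_pot: "mh S (st$''h'') <= pot S st"
 by (simp add: pot_def)

context hgraph
begin

definition G :: "state => bool" where
 "G st \<longleftrightarrow> st$''N'' 0 = N & st$''rv'' = rv & rmem st ''wt'' = wt"

text \<open>The parameter is a set of slots rather than of vertices because, inside
  \<open>relax_loop\<close>, only some slots of the vertex just extracted have been relaxed.\<close>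

definition rlx :: "nat set => state => bool" where
 "rlx Q st \<longleftrightarrow> (\<forall>q<3 * N. q \<in> Q --> st$''i'' (nb q) ~= 0 & rmem st ''D'' (nb q) <= rmem st ''D'' (q div 3) + wt q)"

abbreviation slots :: "nat set => nat set" where "slots P \<equiv> {q. q div 3 \<in> P}"

lemma wp_relax_loop:
 fixes st v
 defines "e \<equiv> st$''e'' 0"
 assumes E: "einv v base st" and G: "G st" and e: "e \<in> PP N st" "\<And>p. p \<in> PP N st ==> rmem st ''D'' p <= rmem st ''D'' e"
  and R: "rlx (slots (PP N st - {e})) st" and j0: "st$''j'' 0 = 0"
  and W: "(pot (SS N st) st + 23000) * (N + 1) <= W" "st$''tp'' 0 + 4 <= W"
 shows "wp W relax_loop (%t st'. einv v base st' & PP N st' = PP N st & rlx (slots (PP N st)) st' &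
  (\<forall>z<N. st$''i'' z ~= 0 --> st'$''i'' z ~= 0 & rmem st' ''D'' z <= rmem st ''D'' z) &
  st'$''tp'' 0 <= st$''tp'' 0 + 3 & (\<forall>j<st$''tp'' 0. st'$''tz'' j = st$''tz'' j) &
  t + pot (SS N st') st' <= pot (SS N st) st + 22000) st"
proof -
 define P where "P = PP N st"
 let ?D = "rmem st ''D''" and ?tp = "st$''tp'' 0"
 define I where "I = (%sv. einv v base sv & PP N sv = P &
  rlx (slots (P - {e}) \<union> {q. \<exists>j<sv$''j'' 0. q = 3 * e + j}) sv & sv$''j'' 0 <= 3 &
  (\<forall>z<N. st$''i'' z ~= 0 --> sv$''i'' z ~= 0 & rmem sv ''D'' z <= ?D z) &
  (\<forall>p\<in>P. rmem sv ''D'' p = ?D p) &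
  sv$''tp'' 0 <= ?tp + sv$''j'' 0 & (\<forall>j<?tp. sv$''tz'' j = st$''tz'' j) & ?tp <= sv$''tp'' 0 &
  pot (SS N sv) sv <= pot (SS N st) st + 7200 * sv$''j'' 0)"
 have eN: "e < N" using e by (simp add: PP_def)
 have W2: "3 * N + 9 <= W" using W by (simp add: algebra_simps)
 have le: "walk v e (?D e)" using E e eN unfolding einv_def PP_def by auto
 show ?thesis unfolding relax_loop_def
 proof (rule wp_While[where I = I and \<phi> = "%sv. pot (SS N sv) sv + 7200 * (3 - sv$''j'' 0)"], goal_cases)
  case 1
  show ?case using E R j0 by (auto simp: I_def P_def)
 next
  case (2 sv)
  then show ?case using W2 by (simp add: I_def)
 next
  case (3 sv)
  let ?j = "sv$''j'' 0"
  have s: "sv$''e'' 0 = e" "sv$''rv'' = rv" "rmem sv ''wt'' = wt" "sv$''N'' 0 = N"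
   using 3(2) G by (auto simp: unch_def G_def e_def)
  have j: "?j < 3" using 3(3) by simp
  let ?q = "3 * e + ?j"
  have q: "?q < 3 * N" "?q div 3 = e" using j eN by auto
  have Et: "einv v base sv" and Pt: "PP N sv = P" and Dt: "\<forall>p\<in>P. rmem sv ''D'' p = ?D p" using 3(1) by (auto simp: I_def)
  have De: "rmem sv ''D'' e = ?D e" using Dt e by (simp add: P_def)
  define nv where "nv = ?D e + wt ?q"
  have w: "walk v (nb ?q) nv" unfolding nv_def by (rule walk_step[OF le q])
  define sv1 where "sv1 = ru ''nv'' 0 nv (iu ''x'' 0 (nb ?q) (iu ''q'' 0 ?q sv))"
  have inv1: "einv v base sv1 = einv v base sv" "PP N sv1 = PP N sv" "SS N sv1 = SS N sv" "pot S sv1 = pot S sv" for S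
   by (simp_all add: sv1_def einv_def PP_def SS_def pot_def)
  have m1: "sv1$''i'' = sv$''i''" "rmem sv1 ''D'' = rmem sv ''D''" "sv1$''tp'' = sv$''tp''"
   "sv1$''tz'' = sv$''tz''" "sv1$''x'' 0 = nb ?q" "rmem sv1 ''nv'' 0 = nv"
   by (simp_all add: sv1_def)
  have W3: "(mh (SS N sv1) (sv1$''h'') + 3) * (N + 1) <= W"
  proof (rule order.trans[OF mult_right_mono W(1)])
   have "mh (SS N sv1) (sv1$''h'') <= pot (SS N sv) sv" using mh_pot[of "SS N sv1" sv1] by (simp add: inv1)
   then show "mh (SS N sv1) (sv1$''h'') + 3 <= pot (SS N st) st + 23000" using 3(1) j by (simp add: I_def)
  qed simp
  have "wp W relaxE (%t st''. I (iu ''j'' 0 (Suc ?j) st'') & st''$''j'' 0 = ?j &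
    pot (SS N st'') st'' + t <= pot (SS N sv) sv + 7100) sv1"
  proof (rule wp_frame[OF wp_relaxE[where v = v and base = base, OF _ _ _ _ W3]], goal_cases)
   case 1
   show ?case using Et by (simp add: inv1)
  next
   case 2
   show ?case using w by (simp add: sv1_def)
  next
   case (3 p)
   have "?D p <= ?D e" using e(2) 3 Pt by (simp add: inv1 P_def)
   also have "\<dots> <= nv" using wt_nn[OF q(1)] by (simp add: nv_def)
   finally have "?D p <= nv" .
   moreover have "p \<in> P" using 3 Pt by (simp add: inv1)
   ultimately show ?case using Dt by (simp add: sv1_def)
  next
   case 5
   show ?case using 3(1) W j by (simp add: sv1_def I_def)
  next
   case (6 t st'')
   have jj: "st''$''j'' 0 = ?j" using 6(2) by (simp add: unch_def sv1_def)
   have A: "einv v base st''" "PP N st'' = P"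
    "\<And>z. z < N ==> sv$''i'' z ~= 0 ==> st''$''i'' z ~= 0 & rmem st'' ''D'' z <= rmem sv ''D'' z"
    "\<And>p. p \<in> P ==> rmem st'' ''D'' p = rmem sv ''D'' p"
    "st''$''i'' (nb ?q) ~= 0" "rmem st'' ''D'' (nb ?q) <= nv" "st''$''tp'' 0 <= Suc (sv$''tp'' 0)"
    "\<And>j. j < sv$''tp'' 0 ==> st''$''tz'' j = sv$''tz'' j"
    "t + pot (SS N st'') st'' <= pot (SS N sv) sv + 7100"
    using 6(1) Pt unfolding inv1 m1 by auto
   have tpm: "sv$''tp'' 0 <= st''$''tp'' 0"
   proof -
    have b: "base <= sv$''tp'' 0" "base <= st''$''tp'' 0"
     and w: "wl (%j. sv$''tz'' (base + j)) (sv$''tp'' 0 - base) {x. x < N & sv$''i'' x ~= 0}"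
     "wl (%j. st''$''tz'' (base + j)) (st''$''tp'' 0 - base) {x. x < N & st''$''i'' x ~= 0}"
     using Et A(1) by (simp_all add: einv_def)
    have "card {x. x < N & sv$''i'' x ~= 0} <= card {x. x < N & st''$''i'' x ~= 0}"
     using A(3) by (intro card_mono) auto
    with wl_card[OF w(1)] wl_card[OF w(2)] b show ?thesis by linarith
   qed
   have "rlx (slots (P - {e}) \<union> {q. \<exists>j<Suc ?j. q = 3 * e + j}) st''"
    unfolding rlx_def
   proof (intro allI impI)
    fix q assume q': "q < 3 * N" "q \<in> slots (P - {e}) \<union> {q. \<exists>j<Suc ?j. q = 3 * e + j}"
    show "st''$''i'' (nb q) ~= 0 & rmem st'' ''D'' (nb q) <= rmem st'' ''D'' (q div 3) + wt q"
    proof (cases "q = ?q")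
     case True
     then show ?thesis using A(4)[of e] A(5,6) De e q(2) by (simp add: nv_def P_def)
    next
     case False
     with q' have qm: "q \<in> slots (P - {e}) \<union> {q. \<exists>j<?j. q = 3 * e + j}" by (auto simp: less_Suc_eq)
     then have "q div 3 \<in> P" using e j by (auto simp: P_def)
     moreover have "sv$''i'' (nb q) ~= 0 & rmem sv ''D'' (nb q) <= rmem sv ''D'' (q div 3) + wt q"
      using 3(1) q'(1) qm unfolding I_def rlx_def by blast
     ultimately show ?thesis using A(3)[OF nb_lt[OF q'(1)]] A(4)[of "q div 3"] by fastforce
    qed
   qed
   moreover have ji: "einv v base (iu ''j'' 0 n st'') = einv v base st''" "PP N (iu ''j'' 0 n st'') = PP N st''"
    "SS N (iu ''j'' 0 n st'') = SS N st''" "pot S (iu ''j'' 0 n st'') = pot S st''" "rlx Q (iu ''j'' 0 n st'') = rlx Q st''" for n S Q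
    by (simp_all add: einv_def PP_def SS_def pot_def rlx_def)
   moreover have "st''$''i'' z ~= 0 & rmem st'' ''D'' z <= ?D z" if "z < N" "st$''i'' z ~= 0" for z
   proof -
    have "sv$''i'' z ~= 0" "rmem sv ''D'' z <= ?D z" using 3(1) that unfolding I_def by blast+
    with A(3)[OF that(1)] show ?thesis by force
   qed
   moreover have "?tp <= sv$''tp'' 0" "sv$''tp'' 0 <= ?tp + ?j" "\<forall>j<?tp. sv$''tz'' j = st$''tz'' j"
    "pot (SS N sv) sv <= pot (SS N st) st + 7200 * ?j"
    using 3(1) unfolding I_def by blast+
   ultimately have "I (iu ''j'' 0 (Suc ?j) st'')"
    using A(1,2,7,9) A(4,8) tpm j Dt unfolding I_def ji by simp
   then show ?case using A(9) jj by simp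
  qed (use s in \<open>auto simp: sv1_def\<close>)
  note R = this
  have rvW: "rv ?q <= W" "?q <= W" "3 * e <= W" "Suc ?j <= W" "3 <= W" "e <= W" using rv_lt[OF q(1)] q(1) W2 j eN by auto
  show ?case
   apply ((rule wp_ISeq, (use s rvW in \<open>simp; fail\<close>), (use s rvW in \<open>simp add: div_le_dividend[THEN order.trans]; fail\<close>))+)
   apply (rule wp_RSeq, (use s rvW in \<open>simp; fail\<close>)+)
   apply (simp add: s De)
   apply (rule wp_Seq)
   apply (rule wp_mono[OF R[unfolded sv1_def nv_def]])
   apply (rule wp_IAssign)
   subgoal using rvW by simp
   subgoal using rvW by simp
   subgoal for t st''
    using j by (auto simp: Suc_diff_le pot_def SS_def)
   done
 next
  case (4 t sv)
  have j: "sv$''j'' 0 = 3" using 4(1,3) by (simp add: I_def)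
  have "slots P \<subseteq> slots (P - {e}) \<union> {q. \<exists>j<3. q = 3 * e + j}"
  proof
   fix q assume "q \<in> slots P"
   moreover have "\<exists>j<3. q = 3 * (q div 3) + j" by (intro exI[of _ "q mod 3"]) auto
   ultimately show "q \<in> slots (P - {e}) \<union> {q. \<exists>j<3. q = 3 * e + j}" by auto
  qed
  moreover have "rlx (slots (P - {e}) \<union> {q. \<exists>j<3. q = 3 * e + j}) sv" using 4(1) j unfolding I_def by simp
  ultimately have "rlx (slots P) sv" unfolding rlx_def by blast
  then show ?case using 4(1,4) j j0 by (simp add: I_def P_def)
 qed
qed

text \<open>The cut argument behind Dijkstra's algorithm: a walk either stays among extracted
  vertices, whose slots are all relaxed, or the first vertex where it leaves them is in the heap
  with a label at most the length so far.\<close>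

lemma explored:
 assumes E: "einv v base st" and R: "rlx (slots (PP N st)) st" and v: "st$''i'' v ~= 0" "rmem st ''D'' v <= 0"
  and w: "walk v z l"
 shows "z \<in> PP N st & rmem st ''D'' z <= l \<or> (\<exists>s\<in>SS N st. rmem st ''D'' s <= l)"
 using w
proof (induction rule: walk.induct)
 have PS: "x \<in> PP N st \<or> x \<in> SS N st" if "x < N" "st$''i'' x ~= 0" for x
 proof -
  have "st$''i'' x <= 2" using E that by (simp add: einv_def)
  with that show ?thesis by (auto simp: PP_def SS_def)
 qed
 {
  case walk_refl
  then show ?case using PS[of v] v by auto
 next
  case (walk_step y d q)
  show ?case
  proof (cases "\<exists>s\<in>SS N st. rmem st ''D'' s <= d")
   case True
   then show ?thesis using wt_nn[OF walk_step(2)] by force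
  next
   case False
   then have y: "y \<in> PP N st" "rmem st ''D'' y <= d" using walk_step.IH by auto
   then have "st$''i'' (nb q) ~= 0" "rmem st ''D'' (nb q) <= rmem st ''D'' y + wt q"
    using R walk_step(2,3) by (auto simp: rlx_def)
   with PS[OF nb_lt[OF walk_step(2)]] y show ?thesis by force
  qed
 }
qed

end

definition explore_loop :: com where
 "explore_loop = While (BAnd (pos (V ''c'')) (ILess (V ''nx'') (V ''K'')))
  (exmin ;; IAssign ''ls'' (V ''lp'') (V ''e'') ;; inc ''lp'' ;; inc ''nx'' ;; ''j'' <- Lit 0 ;; relax_loop)"

lemma imods_explore_loop [simp]:
 "imods explore_loop = {''ls'', ''lp'', ''nx'', ''j'', ''q'', ''r'', ''tz'', ''tp'', ''g'', ''bx'', ''x'', ''b'', ''e'', ''tn'',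
  ''y'', ''p'', ''t'', ''c'', ''h'', ''i'', ''a'', ''l'', ''f'', ''tq''}"
 "rmods explore_loop = {''nv'', ''D''}"
 by (auto simp: explore_loop_def)

context hgraph
begin

lemma wp_explore_loop:
 fixes st v
 defines "K \<equiv> st$''K'' 0" and "lp \<equiv> st$''lp'' 0"
 assumes E: "einv v base st" and G: "G st" and P: "PP N st = {}" and v: "v < N" "st$''i'' v ~= 0" "rmem st ''D'' v <= 0"
  and z: "st$''nx'' 0 = 0" "st$''tp'' 0 <= base + 1" "pot (SS N st) st <= 7100"
  and l: "3 * K + 4 <= 2 ^ l" and W: "(4 * (8000 + (6000 * l + 26000) * K) + 2 * N + 30000) * (N + 1) <= W"
   "base + 3 * K + 9 <= W" "lp + K + 2 <= W" "K <= W"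
 shows "wp W explore_loop (%t st'. einv v base st' & rlx (slots (PP N st')) st' & st'$''i'' v ~= 0 & rmem st' ''D'' v <= 0 &
  st'$''nx'' 0 <= K & st'$''lp'' 0 = lp + st'$''nx'' 0 &
  wl (%j. st'$''ls'' (lp + j)) (st'$''nx'' 0) (PP N st') &
  (\<forall>j<lp. st'$''ls'' j = st$''ls'' j) & (\<forall>j<base. st'$''tz'' j = st$''tz'' j) &
  st'$''tp'' 0 <= base + 1 + 3 * st'$''nx'' 0 & (SS N st' = {} \<or> st'$''nx'' 0 = K) &
  t + pot (SS N st') st' <= 7200 + (6000 * l + 26000) * K) st"
proof -
 \<comment> \<open>One iteration needs \<open>6000 * l + 3000\<close> for the extraction, 22000 for
   relaxing three slots, and some steps of list keeping.\<close>
 define C where "C = 6000 * l + 26000"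
 note W = W[folded C_def]
 define J where "J = (%sv. einv v base sv & rlx (slots (PP N sv)) sv & sv$''i'' v ~= 0 & rmem sv ''D'' v <= 0 &
  sv$''nx'' 0 <= K & sv$''lp'' 0 = lp + sv$''nx'' 0 &
  wl (%j. sv$''ls'' (lp + j)) (sv$''nx'' 0) (PP N sv) &
  (\<forall>j<lp. sv$''ls'' j = st$''ls'' j) & (\<forall>j<base. sv$''tz'' j = st$''tz'' j) &
  sv$''tp'' 0 <= base + 1 + 3 * sv$''nx'' 0 &
  pot (SS N sv) sv + C * (K - sv$''nx'' 0) <= 7100 + C * K)"
 have HE: "HI N (SS N sv) {} sv" "finite (SS N sv)" "sv$''c'' 0 = card (SS N sv)" if "einv v base sv" for sv
 proof -
  show "HI N (SS N sv) {} sv" using that by (simp add: einv_def)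
  from hinv_fin[OF this] hinv_cnt[OF this] show "finite (SS N sv)" "sv$''c'' 0 = card (SS N sv)" by auto
 qed
 have W2: "3 * N + 9 <= W" using W by (simp add: algebra_simps)
 show ?thesis unfolding explore_loop_def C_def[symmetric]
 proof (rule wp_While[where I = J and \<phi> = "%sv. pot (SS N sv) sv + C * (K - sv$''nx'' 0)"], goal_cases)
  case 1
  show ?case using E P v z by (auto simp: J_def rlx_def wl_def lp_def)
 next
  case (2 sv)
  then have "sv$''K'' 0 = K" by (simp add: unch_def K_def)
  moreover have "sv$''c'' 0 <= N" using hinv_cnt_le[OF HE(1)] 2(1) by (simp add: J_def)
  ultimately show ?case using 2(1) W2 W(4) by (simp add: J_def)
 next
  case (3 sv)
  have s: "sv$''K'' 0 = K" "G sv" using 3(2) G by (simp_all add: unch_def K_def G_def)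
  have Et: "einv v base sv" using 3(1) by (simp add: J_def)
  note Ht = HE[OF Et]
  let ?S = "SS N sv" and ?P = "PP N sv" and ?D = "rmem sv ''D''" and ?n = "sv$''nx'' 0" and ?tp = "sv$''tp'' 0"
  have ne: "?S ~= {}" and nK: "?n < K" using 3(3) s Ht by auto
  have tpb: "base <= ?tp" "?tp <= base + 1 + 3 * ?n" using 3(1) by (simp_all add: J_def einv_def)
  \<comment> \<open>Degree three enters here: \<open>?n\<close> extractions touch at most
    \<open>3 * ?n + 1\<close> vertices, so the heap size depends on \<open>K\<close> and not on
    \<open>N\<close>.\<close>
  have cS: "card ?S <= 2 ^ l"
  proof -
   have "card ?S <= card {x. x < N & sv$''i'' x ~= 0}" by (intro card_mono) (auto simp: SS_def)
   also have "\<dots> = ?tp - base" by (rule wl_card) (use Et in \<open>unfold einv_def, blast\<close>)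
   also have "\<dots> <= 3 * K + 4" using tpb nK by linarith
   finally show ?thesis using l by linarith
  qed
  have potb: "pot ?S sv + C <= 7100 + C * K"
  proof -
   have "C * 1 <= C * (K - ?n)" using nK by (intro mult_left_mono) auto
   moreover have "pot ?S sv + C * (K - ?n) <= 7100 + C * K" using 3(1) unfolding J_def by blast
   ultimately show ?thesis by linarith
  qed
  have W3: "(4 * mh ?S (sv$''h'') + 2 * N + 8) * (N + 1) <= W"
   using mh_pot[of ?S sv] potb by (intro order.trans[OF mult_right_mono W(1)]) auto
  show ?case
  proof (rule wp_Seq, rule wp_frame[OF wp_exmin[OF Ht(1) ne _ cS W3]], goal_cases)
   case (2 t1 st1)
   then obtain e where e: "e \<in> ?S" "st1$''e'' 0 = e" "\<forall>z\<in>?S. ?D e <= ?D z" "HI N (?S - {e}) {} st1"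
    "st1$''i'' = (sv$''i'')(e := 2)" "t1 + pot (?S - {e}) st1 <= pot ?S sv + 6000 * l + 3000" by blast
   have s1: "rmem st1 = rmem sv" "st1$''r'' = sv$''r''" "st1$''tp'' = sv$''tp''" "st1$''tz'' = sv$''tz''"
    "st1$''nx'' = sv$''nx''" "st1$''lp'' = sv$''lp''" "st1$''ls'' = sv$''ls''" "G st1"
    using 2(2) s by (auto simp: unch_def G_def)
   have eN: "e < N" "sv$''i'' e = 1" using e(1) by (auto simp: SS_def)
   have S1: "SS N st1 = ?S - {e}" "PP N st1 = insert e ?P" "e \<notin> ?P"
    using eN by (auto simp: SS_def PP_def e(5))
   have T1: "{x. x < N & st1$''i'' x ~= 0} = {x. x < N & sv$''i'' x ~= 0}" using eN by (auto simp: e(5))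
   have mono: "\<forall>p\<in>?P. \<forall>s\<in>?S. ?D p <= ?D s" using Et by (simp add: einv_def)
   have E1: "einv v base st1"
    using Et eN e(3,4) mono unfolding einv_def T1 S1 s1 by (auto simp: e(5))
   define st2 where "st2 = iu ''j'' 0 0 (iu ''nx'' 0 (Suc ?n) (iu ''lp'' 0 (Suc (lp + ?n)) (iu ''ls'' (lp + ?n) e st1)))"
   have s2: "einv v base st2" "SS N st2 = SS N st1" "PP N st2 = PP N st1" "pot S st2 = pot S st1" "G st2" for S
    using E1 s1 by (simp_all add: st2_def einv_def PP_def SS_def pot_def G_def)
   have m2: "st2$''e'' 0 = e" "rmem st2 ''D'' = ?D" "st2$''tp'' 0 = ?tp" "st2$''i'' = (sv$''i'')(e := 2)"
    "st2$''tz'' = sv$''tz''" "st2$''lp'' 0 = Suc (lp + ?n)" "st2$''nx'' 0 = Suc ?n"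
    "st2$''ls'' = (sv$''ls'')(lp + ?n := e)" "st2$''j'' 0 = 0"
    using e s1 by (simp_all add: st2_def)
   have W4: "(pot (SS N st2) st2 + 23000) * (N + 1) <= W"
    using e(6) potb C_def by (intro order.trans[OF mult_right_mono W(1)]) (auto simp: s2 S1)
   have W5: "?tp + 4 <= W" using tpb nK W(2) by simp
   have R2: "rlx (slots (insert e ?P - {e})) st2"
    using 3(1) S1(3) unfolding J_def rlx_def by (auto simp: m2)
   have pe: "?D p <= ?D e" if "p \<in> insert e ?P" for p using mono e(1) that by auto
   have rel: "wp W relax_loop (%t st'. J st' & pot (SS N st') st' + C * (K - st'$''nx'' 0) + t1 + t + 100
     <= pot ?S sv + C * (K - ?n)) st2"
   proof (rule wp_frame[OF wp_relax_loop[where v = v and base = base and st = st2, unfolded s2 S1 m2]], goal_cases)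
    case (9 t st')
    have A: "einv v base st'" "PP N st' = insert e ?P" "rlx (slots (insert e ?P)) st'"
     "\<forall>z<N. ((sv$''i'')(e := 2)) z ~= 0 --> st'$''i'' z ~= 0 & rmem st' ''D'' z <= ?D z"
     "st'$''tp'' 0 <= ?tp + 3" "\<forall>j<?tp. st'$''tz'' j = sv$''tz'' j"
     "t + pot (SS N st') st' <= pot (?S - {e}) st1 + 22000" using 9(1) by blast+
    have f: "st'$''nx'' 0 = Suc ?n" "st'$''lp'' 0 = Suc (lp + ?n)" "st'$''ls'' = (sv$''ls'')(lp + ?n := e)"
     using 9(2) m2 by (simp_all add: unch_def)
    have wl': "wl (%j. st'$''ls'' (lp + j)) (Suc ?n) (insert e ?P)"
    proof -
     have w: "wl (%j. sv$''ls'' (lp + j)) ?n ?P" using 3(1) by (simp add: J_def)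
     have "(%j. st'$''ls'' (lp + j)) = (%j. sv$''ls'' (lp + j))(?n := e)" by (auto simp: f fun_eq_iff)
     then show ?thesis using wl_push[OF w S1(3)] by simp
    qed
    have pt: "pot (SS N st') st' + C * (K - Suc ?n) + t1 + t + 100 <= pot ?S sv + C * (K - ?n)"
    proof -
     have "K - ?n = Suc (K - Suc ?n)" using nK by simp
     then have "C * (K - ?n) = C + C * (K - Suc ?n)" by (simp only: mult_Suc_right)
     then show ?thesis using A(7) e(6) C_def by linarith
    qed
    have vi: "st'$''i'' v ~= 0" "rmem st' ''D'' v <= 0"
    proof -
     have "sv$''i'' v ~= 0" "?D v <= 0" using 3(1) by (simp_all add: J_def)
     then show "st'$''i'' v ~= 0" "rmem st' ''D'' v <= 0" using A(4) v(1) by fastforce+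
    qed
    have pre: "\<forall>j<lp. sv$''ls'' j = st$''ls'' j" "\<forall>j<base. sv$''tz'' j = st$''tz'' j"
     "pot ?S sv + C * (K - ?n) <= 7100 + C * K"
     using 3(1) unfolding J_def by blast+
    have "J st'"
     unfolding J_def A(2) f(1,2)
    proof (intro conjI)
     show "\<forall>j<base. st'$''tz'' j = st$''tz'' j" using pre(2) A(6) tpb(1) by simp
     show "st'$''tp'' 0 <= base + 1 + 3 * Suc ?n" using A(5) tpb by simp
     show "pot (SS N st') st' + C * (K - Suc ?n) <= 7100 + C * K" using pt pre(3) by linarith
    qed (use A vi nK wl' pre f in auto)
    then show ?case using pt by (simp add: f)
   qed (use s2 m2 R2 W4 W5 pe S1 in auto)
   have b: "lp + ?n < W" "Suc ?n <= W" "e <= W" "1 <= W" using nK W W2 eN by auto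
   have lpe: "sv$''lp'' 0 = lp + ?n" using 3(1) by (simp add: J_def)
   show ?case
    apply ((rule wp_ISeq, (use e(2) s1 b lpe in \<open>simp; fail\<close>)+)+)
    apply (simp add: e(2) s1 lpe)
    apply (rule wp_mono[OF rel[unfolded st2_def]])
    by auto
  qed (use s in \<open>auto simp: G_def\<close>)
 next
  case (4 t sv)
  have s: "sv$''K'' 0 = K" using 4(2) by (simp add: unch_def K_def)
  have Et: "einv v base sv" using 4(1) by (simp add: J_def)
  have "SS N sv = {} \<or> sv$''nx'' 0 = K"
  proof -
   have "sv$''nx'' 0 <= K" using 4(1) by (simp add: J_def)
   moreover have "\<not> 0 < sv$''c'' 0 \<or> \<not> sv$''nx'' 0 < K" using 4(3) s by simp
   ultimately show ?thesis using HE[OF Et] by (auto simp: card_gt_0_iff)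
  qed
  moreover have "t + pot (SS N sv) sv <= 7200 + C * K" using 4(4) z by simp
  ultimately show ?case using 4(1) unfolding J_def by blast
 qed
qed

subsection \<open>Cleaning up\<close>

text \<open>With \<open>S\<close> empty, \<open>hinv\<close> constrains just the buckets and the
  counts. The arrays for heights, parents and losers may keep old contents, so cleaning need not
  visit them.\<close>

definition clean :: "state => bool" where
 "clean st \<longleftrightarrow> HI N {} {} st & (\<forall>x<N. st$''i'' x = 0 & st$''r'' x = 0)"

end

text \<open>The table itself says which cells to reset, so cleaning costs no more than the
  exploration did. At the same time the labels are frozen into \<open>td\<close>.\<close>

definition clear1 :: com where
 "clear1 = While (ILess (V ''q'') (V ''tp''))
  (''x'' <- IElem ''tz'' (V ''q'') ;; RAssign ''td'' (V ''q'') (RElem ''D'' (V ''x'')) ;;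
   IAssign ''r'' (V ''x'') (Lit 0) ;; IAssign ''i'' (V ''x'') (Lit 0) ;; inc ''q'')"

definition clear2 :: com where
 "clear2 = While (pos (IElem ''c'' (V ''g'')))
  (IAssign ''b'' (V ''g'') (Lit 0) ;; IAssign ''c'' (V ''g'') (Lit 0) ;; inc ''g'')"

lemma wp_clear1:
 fixes st
 defines "base \<equiv> st$''q'' 0" and "tp \<equiv> st$''tp'' 0" and "tz \<equiv> st$''tz''"
 assumes tz: "\<And>j. base <= j ==> j < tp ==> tz j <= W" and W: "Suc tp <= W" and b: "base <= tp"
 shows "wp W clear1 (%t st'.
  (\<forall>j. rmem st' ''td'' j = (if base <= j & j < tp then rmem st ''D'' (tz j) else rmem st ''td'' j)) &
  (\<forall>x. st'$''i'' x = (if x \<in> tz ` {base..<tp} then 0 else st$''i'' x)) &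
  (\<forall>x. st'$''r'' x = (if x \<in> tz ` {base..<tp} then 0 else st$''r'' x)) &
  t <= 60 * (tp - base) + 10) st"
 unfolding clear1_def
proof (rule wp_While[where I = "%sv. base <= sv$''q'' 0 & sv$''q'' 0 <= tp &
  (\<forall>j. rmem sv ''td'' j = (if base <= j & j < sv$''q'' 0 then rmem st ''D'' (tz j) else rmem st ''td'' j)) &
  (\<forall>x. sv$''i'' x = (if x \<in> tz ` {base..<sv$''q'' 0} then 0 else st$''i'' x)) &
  (\<forall>x. sv$''r'' x = (if x \<in> tz ` {base..<sv$''q'' 0} then 0 else st$''r'' x))"
   and \<phi> = "%sv. 60 * (tp - sv$''q'' 0)"], goal_cases)
 case 1
 show ?case using b by (auto simp: base_def)
next
 case (2 sv)
 then show ?case using W by (auto simp: unch_def tp_def)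
next
 case (3 sv)
 then have s: "sv$''tp'' 0 = tp" "sv$''tz'' = tz" "rmem sv ''D'' = rmem st ''D''"
  by (auto simp: unch_def tp_def tz_def)
 let ?q = "sv$''q'' 0"
 have q: "?q < tp" "base <= ?q" using 3 s by auto
 have eq: "tz ` {base..<Suc ?q} = insert (tz ?q) (tz ` {base..<?q})" using q by (auto simp: atLeastLessThanSuc)
 show ?case
  by (intro wp_basic; (use s q W tz[OF q(2,1)] in \<open>simp; fail\<close>)?)
   (use 3(1) q in \<open>auto simp: s eq less_Suc_eq Suc_diff_le\<close>)
next
 case (4 t sv)
 then have "sv$''q'' 0 = tp" by (auto simp: unch_def tp_def)
 then show ?case using 4 by (simp add: base_def)
qed

lemma wp_clear2:
 assumes H: "HI N S {} st" and g: "st$''g'' 0 = 0" and W: "mh S (st$''h'') + N + 2 <= W"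
 shows "wp W clear2 (%t st'. HI N {} {} st' & t <= 60 * mh S (st$''h'') + 10) st"
proof -
 note fin = hinv_fin[OF H]
 let ?M = "mh S (st$''h'')" and ?c = "st$''c''" and ?b = "st$''b''"
 have c: "0 < ?c h \<longleftrightarrow> h < ?M" for h using hinv_cnt_pos[OF H] mh_iff[OF fin] by simp
 have c0: "?c h = 0" if "?M <= h" for h using c[of h] that by linarith
 have cW: "?c h <= W" for h using W hinv_cnt_le[OF H, of h] by linarith
 have b0: "?b h = 0" if "?M <= h" for h
 proof (rule ccontr)
  assume "?b h ~= 0"
  from hinv_bk[OF H this] obtain x where "x \<in> S" "st$''h'' x = h" by blast
  then have "h < ?M" using mh_iff[OF fin] by blast
  with that show False by simp
 qed
 show ?thesis unfolding clear2_def
 proof (rule wp_While[where I = "%sv. sv$''g'' 0 <= ?M &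
   (\<forall>h. sv$''b'' h = (if h < sv$''g'' 0 then 0 else ?b h)) &
   (\<forall>h. sv$''c'' h = (if h < sv$''g'' 0 then 0 else ?c h))"
   and \<phi> = "%sv. 60 * (?M - sv$''g'' 0)"], goal_cases)
  case 1
  show ?case using g by simp
 next
  case (2 sv)
  then show ?case using W cW by auto
 next
  case (3 sv)
  let ?g = "sv$''g'' 0"
  have "?g < ?M" using 3(1,3) c[of ?g] by auto
  then show ?case
   by (intro wp_basic; (use W in \<open>simp; fail\<close>)?)
    (use 3(1) in \<open>auto simp: less_Suc_eq Suc_diff_le\<close>)
 next
  case (4 t sv)
  have gM: "sv$''g'' 0 = ?M" using 4(1,3) c by auto
  have "\<forall>h. sv$''b'' h = 0" "\<forall>h. sv$''c'' h = 0" using 4(1) b0 c0 by (auto simp: gM not_less)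
  then show ?case using 4(4) g by (auto simp: hinv_def)
 qed
qed

text \<open>\<open>ex\<close> records that the whole component was exhausted, \<open>hs\<close> that
  the source was met; both have to be read before \<open>clear1\<close> and \<open>clear2\<close>
  erase the evidence.\<close>

definition explore_end :: com where
 "explore_end = Cond (pos (V ''c'')) (''ex'' <- Lit 0) (''ex'' <- Lit 1) ;; ''hs'' <- IElem ''r'' (V ''src'') ;;
  ''q'' <- V ''tb'' ;; clear1 ;; ''g'' <- Lit 0 ;; clear2"

text \<open>The language has no real literals. The number 0 is read from the array
  \<open>zero\<close>, which no program assigns and which is zero in the initial memory.\<close>

definition explore :: com where
 "explore = ''tb'' <- V ''tp'' ;; ''x'' <- V ''ev'' ;; RAssign ''nv'' (Lit 0) (RElem ''zero'' (Lit 0)) ;; relaxE ;;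
  ''nx'' <- Lit 0 ;; explore_loop ;;
  explore_end"

lemma imods_explore [simp]:
 "imods explore = {''tb'', ''ex'', ''hs'', ''ls'', ''lp'', ''nx'', ''j'', ''q'', ''r'', ''tz'', ''tp'', ''g'', ''bx'', ''x'', ''b'', ''e'', ''tn'',
  ''y'', ''p'', ''t'', ''c'', ''h'', ''i'', ''a'', ''l'', ''f'', ''tq''}"
 "rmods explore = {''nv'', ''D'', ''td''}"
 by (auto simp: explore_def explore_end_def clear1_def clear2_def)

context hgraph
begin

text \<open>A vertex strictly closer to \<open>v\<close> than \<open>u\<close> must have been
  extracted: otherwise the heap would contain a label below that of the extracted \<open>u\<close>.
  Its slots are therefore relaxed, which puts its neighbours into the table.\<close>

lemma reaches_popped:
 assumes E: "einv v base st" and R: "rlx (slots (PP N st)) st" and v: "st$''i'' v ~= 0" "rmem st ''D'' v <= 0"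
  and u: "u \<in> PP N st" and td: "\<And>j. base <= j ==> j < st$''tp'' 0 ==> td j = rmem st ''D'' (st$''tz'' j)"
 shows "reaches (st$''tz'') td v base (st$''tp'' 0) u"
proof -
 let ?D = "rmem st ''D''" and ?tz = "st$''tz''" and ?tp = "st$''tp'' 0"
 have w: "wl (%j. ?tz (base + j)) (?tp - base) {x. x < N & st$''i'' x ~= 0}"
  and mono: "\<forall>p\<in>PP N st. \<forall>s\<in>SS N st. ?D p <= ?D s" using E unfolding einv_def by blast+
 have entry: "\<exists>j. base <= j & j < ?tp & ?tz j = x & td j = ?D x" if x: "x < N" "st$''i'' x ~= 0" for x
 proof -
  have "x \<in> (%j. ?tz (base + j)) ` {..<?tp - base}" using w x by (simp add: wl_def)
  then obtain j where "j < ?tp - base" "?tz (base + j) = x" by auto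
  with td[of "base + j"] show ?thesis by (intro exI[of _ "base + j"]) auto
 qed
 have uN: "u < N" "st$''i'' u ~= 0" using u by (auto simp: PP_def)
 from entry[OF uN] obtain j where j: "base <= j" "j < ?tp" "?tz j = u" "td j = ?D u" by blast
 show ?thesis unfolding reaches_def
 proof (rule exI[of _ j], intro conjI allI impI)
  fix z l q assume a: "walk v z l" "l < td j" "q < 3 * N" "q div 3 = z"
  have "z \<in> PP N st & ?D z <= l"
   using explored[OF E R v a(1)] mono u a(2) j(4) by force
  then have "st$''i'' (nb q) ~= 0" "?D (nb q) <= ?D z + wt q" "?D z <= l" using R a(3,4) by (auto simp: rlx_def)
  with entry[OF nb_lt[OF a(3)]] show "\<exists>i. base <= i & i < ?tp & ?tz i = nb q & td i <= l + wt q" by force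
 qed (use j in auto)
qed

lemma pot_empty: "pot {} st = 0"
 by (simp add: pot_def pot0_def nroots_def mh_def)

text \<open>There are two outcomes: a full list of \<open>K\<close> possible centres, or an
  exhausted component, where the source can be the centre or, if it was not met, is
  unreachable.\<close>

definition eres :: "state => state => bool" where
 "eres st st' \<longleftrightarrow> (let K = st$''K'' 0; lp = st$''lp'' 0; tp = st$''tp'' 0; v = st$''ev'' 0;
   tp' = st'$''tp'' 0; lp' = st'$''lp'' 0; tz' = st'$''tz''; td' = rmem st' ''td'';
   ls' = st'$''ls''; R = reaches tz' td' v tp tp' in
  clean st' & tp <= tp' & tp' <= tp + 1 + 3 * K & lp <= lp' & lp' <= lp + K & table tz' td' v tp tp' &
  (\<forall>j<tp. tz' j = st$''tz'' j & td' j = rmem st ''td'' j) & (\<forall>j<lp. ls' j = st$''ls'' j) &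
  inj_on ls' {lp..<lp'} & (\<forall>j\<in>{lp..<lp'}. ls' j < N & R (ls' j)) &
  st'$''ex'' 0 <= 1 & st'$''hs'' 0 <= 1 &
  (st'$''ex'' 0 = 0 --> lp' = lp + K) &
  (st'$''ex'' 0 ~= 0 --> (if st'$''hs'' 0 ~= 0 then R (st$''src'' 0) else \<forall>d. \<not> walk v (st$''src'' 0) d)))"

lemma wp_explore:
 fixes st
 defines "K \<equiv> st$''K'' 0" and "lp \<equiv> st$''lp'' 0" and "tp \<equiv> st$''tp'' 0" and "v \<equiv> st$''ev'' 0"
  and "s \<equiv> st$''src'' 0"
 assumes C: "clean st" and G: "G st" and v: "v < N" and s: "s < N" and z: "rmem st ''zero'' 0 = 0"
  and l: "3 * K + 4 <= 2 ^ l" and K: "1 <= K"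
  and W: "(4 * (8000 + (6000 * l + 26000) * K) + 2 * N + 30000) * (N + 1) <= W"
   "tp + 3 * K + 9 <= W" "lp + K + 2 <= W" "K <= W"
 shows "wp W explore (%t st'. eres st st' & t <= 50000 * (l + 1) * K) st"
proof -
 let ?C = "6000 * l + 26000"
 have W2: "3 * N + 9 <= W" using W by (simp add: algebra_simps)
 have CK: "?C <= ?C * K" using K by (cases K) auto
 define st1 where "st1 = ru ''nv'' 0 0 (iu ''x'' 0 v (iu ''tb'' 0 tp st))"
 have i0: "\<And>x. x < N ==> st$''i'' x = 0" "\<And>x. x < N ==> st$''r'' x = 0" using C by (auto simp: clean_def)
 have S1: "SS N st1 = {}" "PP N st1 = {}" "{x. x < N & st1$''i'' x ~= 0} = {}" using i0 by (auto simp: SS_def PP_def st1_def)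
 have E1: "einv v tp st1"
  unfolding einv_def S1 using C i0 wl_empty by (auto simp: st1_def clean_def tp_def)
 have part1: "wp W relaxE (%t st2. einv v tp st2 & PP N st2 = {} & st2$''i'' v ~= 0 & rmem st2 ''D'' v <= 0 &
  st2$''tp'' 0 <= Suc tp & (\<forall>j<tp. st2$''tz'' j = st$''tz'' j) & t + pot (SS N st2) st2 <= 7100 &
  unch relaxE st1 st2) st1"
  apply (rule wp_frame[OF wp_relaxE[OF E1]])
  using v walk_refl S1 G pot_empty[of st1] W W2 by (auto simp: st1_def G_def tp_def mh_def algebra_simps)
 have part3: "wp W explore_end
  (%t st'. eres st st' & t <= pot (SS N st4) st4 + 180 * K + 200) st4"
  if E4: "einv v tp st4" and R4: "rlx (slots (PP N st4)) st4" and v4: "st4$''i'' v ~= 0" "rmem st4 ''D'' v <= 0"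
   and n4: "st4$''nx'' 0 <= K" "st4$''lp'' 0 = lp + st4$''nx'' 0"
   and w4: "wl (%j. st4$''ls'' (lp + j)) (st4$''nx'' 0) (PP N st4)"
   and f4: "\<forall>j<lp. st4$''ls'' j = st$''ls'' j" "\<forall>j<tp. st4$''tz'' j = st$''tz'' j"
    "rmem st4 ''td'' = rmem st ''td''" "st4$''tb'' 0 = tp" "st4$''src'' 0 = s"
   and t4: "st4$''tp'' 0 <= tp + 1 + 3 * st4$''nx'' 0" and e4: "SS N st4 = {} \<or> st4$''nx'' 0 = K"
   and p4: "pot (SS N st4) st4 <= 7200 + ?C * K" for st4
 proof -
  let ?tz = "st4$''tz''" and ?tp = "st4$''tp'' 0" and ?D = "rmem st4 ''D''" and ?S = "SS N st4"
  have H4: "HI N ?S {} st4" and i4: "\<And>x. x < N ==> st4$''i'' x <= 2"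
   and r4: "\<And>x. x < N ==> st4$''r'' x = (if st4$''i'' x = 0 then 0 else 1)"
   and lab: "\<And>x. x < N ==> st4$''i'' x ~= 0 ==> walk v x (?D x)" and tpl: "tp <= ?tp"
   and w: "wl (%j. ?tz (tp + j)) (?tp - tp) {x. x < N & st4$''i'' x ~= 0}"
   using E4 unfolding einv_def by blast+
  have img: "?tz ` {tp..<?tp} = {x. x < N & st4$''i'' x ~= 0}"
  proof -
   have "{tp..<?tp} = (+) tp ` {..<?tp - tp}" by (force simp: image_iff le_iff_add)
   then have "?tz ` {tp..<?tp} = (%j. ?tz (tp + j)) ` {..<?tp - tp}" by (simp add: image_image)
   then show ?thesis using w by (simp add: wl_def)
  qed
  have c0: "st4$''c'' 0 = card ?S" "finite ?S" using hinv_cnt[OF H4] hinv_fin[OF H4] by auto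
  have cW: "st4$''c'' 0 <= W" using hinv_cnt_le[OF H4, of 0] W2 by linarith
  have mW: "mh ?S (st4$''h'') + N + 2 <= W"
  proof -
   have "mh ?S (st4$''h'') <= 7200 + ?C * K" using mh_pot[of ?S st4] p4 by linarith
   then have "(mh ?S (st4$''h'') + N + 2) * 1 <= (4 * (8000 + ?C * K) + 2 * N + 30000) * (N + 1)"
    by (intro mult_mono) auto
   then show ?thesis using W(1) by simp
  qed
  define ex where "ex = (if ?S = {} then 1 else 0 :: nat)"
  define hs where "hs = st4$''r'' s"
  define st5 where "st5 = iu ''q'' 0 tp (iu ''hs'' 0 hs (iu ''ex'' 0 ex st4))"
  have m5: "st5$''q'' 0 = tp" "st5$''tp'' = st4$''tp''" "st5$''tz'' = ?tz" "rmem st5 = rmem st4"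
   "st5$''i'' = st4$''i''" "st5$''r'' = st4$''r''" "st5$''ex'' 0 = ex" "st5$''hs'' 0 = hs"
   "st5$''lp'' = st4$''lp''" "st5$''ls'' = st4$''ls''"
   "st5$''h'' = st4$''h''" "st5$''p'' = st4$''p''" "st5$''l'' = st4$''l''" "st5$''b'' = st4$''b''"
   "st5$''c'' = st4$''c''"
   by (simp_all add: st5_def)
  have fin: "wp W (clear1 ;; ''g'' <- Lit 0 ;; clear2) (%t st'. eres st st' & t <= pot (SS N st4) st4 + 180 * K + 120) st5"
  proof (rule wp_Seq, rule wp_frame[OF wp_clear1[where st = st5, unfolded m5]], goal_cases)
   case (1 j)
   then have "?tz j \<in> ?tz ` {tp..<?tp}" by auto
   then show ?case using img W2 by auto
  next
   case 2
   show ?case using t4 n4 W by simp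
  next
   case 3
   show ?case by (rule tpl)
  next
   case (4 t6 st6)
   define st7 where "st7 = iu ''g'' 0 0 st6"
   have m6: "st6$a = st5$a" if "a \<notin> {''x'', ''r'', ''i'', ''q''}" for a
    using 4(2) that by (auto simp: unch_def clear1_def)
   have D6: "rmem st6 ''D'' = ?D" using 4(2) by (auto simp: unch_def clear1_def m5)
   have td6: "\<And>j. rmem st6 ''td'' j = (if tp <= j & j < ?tp then ?D (?tz j) else rmem st ''td'' j)"
    and i6: "\<And>x. st6$''i'' x = (if x \<in> ?tz ` {tp..<?tp} then 0 else st4$''i'' x)"
    and r6: "\<And>x. st6$''r'' x = (if x \<in> ?tz ` {tp..<?tp} then 0 else st4$''r'' x)"
    and t6: "t6 <= 60 * (?tp - tp) + 10" using 4(1) f4(3) by auto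
   have H7: "HI N ?S {} st7" using H4 by (simp add: st7_def m6 m5 D6)
   have c2: "wp W clear2 (%t st'. HI N {} {} st' & t <= 60 * mh ?S (st4$''h'') + 10 & unch clear2 st7 st') st7"
    by (rule wp_frame[OF wp_clear2[OF H7]]) (use mW in \<open>auto simp: st7_def m6 m5\<close>)
   have reach: "reaches ?tz (rmem st6 ''td'') v tp ?tp u" if "u \<in> PP N st4" for u
    by (rule reaches_popped[OF E4 R4 v4 that]) (simp add: td6)
   have tab: "table ?tz (rmem st6 ''td'') v tp ?tp"
    unfolding table_def
   proof (intro conjI allI impI)
    have "v \<in> ?tz ` {tp..<?tp}" using img v v4 by simp
    then obtain j where "tp <= j" "j < ?tp" "?tz j = v" by auto
    moreover have "?D v = 0" using walk_nn[OF lab[OF v v4(1)]] v4(2) by simp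
    ultimately show "\<exists>j. tp <= j & j < ?tp & ?tz j = v & rmem st6 ''td'' j = 0" by (auto simp: td6)
   next
    fix j assume j: "tp <= j" "j < ?tp"
    then have "?tz j \<in> ?tz ` {tp..<?tp}" by auto
    then show "walk v (?tz j) (rmem st6 ''td'' j)" using img lab j by (simp add: td6)
   qed
   have lsPP: "st4$''ls'' j \<in> PP N st4" if "j \<in> {lp..<st4$''lp'' 0}" for j
   proof -
    have "st4$''ls'' (lp + (j - lp)) \<in> (%j. st4$''ls'' (lp + j)) ` {..<st4$''nx'' 0}"
     using that n4 by (intro imageI) auto
    then show ?thesis using w4 that by (simp add: wl_def)
   qed
   have inj: "inj_on (st4$''ls'') {lp..<st4$''lp'' 0}"
   proof (rule inj_onI)
    fix a b assume ab: "a \<in> {lp..<st4$''lp'' 0}" "b \<in> {lp..<st4$''lp'' 0}" "st4$''ls'' a = st4$''ls'' b"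
    then have "a - lp = b - lp" using w4 n4 unfolding wl_def by (auto dest!: inj_onD[of _ _ "a - lp" "b - lp"])
    with ab show "a = b" by auto
   qed
   have exh: "if hs ~= 0 then reaches ?tz (rmem st6 ''td'') v tp ?tp s else \<forall>d. \<not> walk v s d" if "?S = {}"
   proof (cases "hs = 0")
    case True
    then have "st4$''i'' s = 0" using r4[OF s] by (auto simp: hs_def split: if_splits)
    then have "s \<notin> PP N st4" by (simp add: PP_def)
    then have "\<not> walk v s d" for d using explored[OF E4 R4 v4, of s d] that by auto
    then show ?thesis using True by simp
   next
    case False
    then have "st4$''i'' s ~= 0" using r4[OF s] by (auto simp: hs_def split: if_splits)
    moreover have "st4$''i'' s ~= 1" using that s by (auto simp: SS_def)
    ultimately have "s \<in> PP N st4" using i4[OF s] s by (auto simp: PP_def)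
    then show ?thesis using reach False by simp
   qed
   have hs1: "hs <= 1" using r4[OF s] by (simp add: hs_def)
   have z6: "st6$''i'' x = 0 & st6$''r'' x = 0" if "x < N" for x
    using that r4[OF that] by (simp add: i6 r6 img)
   have mp: "60 * mh ?S (st4$''h'') <= pot ?S st4" by (simp add: pot_def)
   have tt: "t6 <= 180 * K + 70" using t6 t4 n4 by simp
   have res: "clean st'" if "HI N {} {} st'" "unch clear2 st7 st'" for st'
    using that z6 by (simp add: clean_def unch_def clear2_def st7_def)
   show ?case
    apply (rule wp_ISeq)
    using W2 apply (simp, simp)
    apply (simp only: ival.simps)
    apply (rule wp_mono[OF c2[unfolded st7_def]])
    subgoal premises pr for t8 st8
    proof -
     have m8: "st8$''tp'' = st4$''tp''" "st8$''lp'' = st4$''lp''" "st8$''tz'' = ?tz" "st8$''ls'' = st4$''ls''"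
      "rmem st8 ''td'' = rmem st6 ''td''" "st8$''ex'' 0 = ex" "st8$''hs'' 0 = hs"
      using pr by (auto simp: unch_def clear2_def m6 m5)
     have "clean st8" using pr by (intro res) (auto simp: st7_def)
     then show ?thesis
      unfolding eres_def Let_def m8 K_def[symmetric] lp_def[symmetric] tp_def[symmetric] v_def[symmetric] s_def[symmetric]
      using tpl t4 n4 tab f4 inj lsPP reach hs1 exh e4 pr mp tt
      by (auto simp: td6 ex_def PP_def)
    qed
    done
  qed
  have cond: "wp W (Cond (pos (V ''c'')) (''ex'' <- Lit 0) (''ex'' <- Lit 1)) (%t st'. t <= 10 & st' = iu ''ex'' 0 ex st4) st4"
   by (intro wp_Cond wp_IAssign) (use cW W2 c0 in \<open>auto simp: ex_def card_gt_0_iff\<close>)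
  show ?thesis unfolding explore_end_def
  proof (rule wp_Seq, rule wp_mono[OF cond], elim conjE, hypsubst, goal_cases)
   case (1 t1)
   show ?case
    apply ((rule wp_ISeq, (use s r4[OF s] f4 W W2 in \<open>simp; fail\<close>)+)+)
    apply (simp add: f4)
    apply (rule wp_mono[OF fin[unfolded st5_def hs_def]])
    using 1 by auto
  qed
 qed
 show ?thesis unfolding explore_def
  apply ((rule wp_ISeq, (use W v W2 in \<open>simp add: tp_def[symmetric] v_def[symmetric]; fail\<close>)+)+)
  apply (rule wp_RSeq, (use W2 in \<open>simp; fail\<close>)+)
  apply (simp add: tp_def[symmetric] v_def[symmetric] z)
  apply (rule wp_Seq)
  apply (rule wp_mono[OF part1[unfolded st1_def]])
  apply (elim conjE)
  subgoal premises pr for t1 st2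
  proof -
   define st3 where "st3 = iu ''nx'' 0 0 st2"
   have m2: "st2$''K'' 0 = K" "st2$''lp'' 0 = lp" "st2$''ls'' = st$''ls''" "rmem st2 ''td'' = rmem st ''td''"
    "st2$''tb'' 0 = tp" "st2$''src'' 0 = s" "G st2"
    using pr(8) G by (simp_all add: unch_def K_def lp_def s_def G_def)
   have m3: "st3$''K'' 0 = K" "st3$''lp'' 0 = lp" "st3$''ls'' = st$''ls''" "rmem st3 ''td'' = rmem st ''td''"
    "st3$''tb'' 0 = tp" "st3$''src'' 0 = s" "G st3" "st3$''nx'' 0 = 0" "st3$''tp'' 0 = st2$''tp'' 0"
    "st3$''tz'' = st2$''tz''" "st3$''i'' = st2$''i''" "rmem st3 ''D'' = rmem st2 ''D''"
    "PP N st3 = PP N st2" "SS N st3 = SS N st2" "pot (SS N st2) st3 = pot (SS N st2) st2" "einv v tp st3"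
    using m2 pr(1) by (simp_all add: st3_def G_def PP_def SS_def pot_def einv_def)
   have ex: "wp W (explore_loop ;; explore_end) (%t st'. eres st st' & t <= 7400 + ?C * K + 180 * K) st3"
   proof (rule wp_Seq, rule wp_frame[OF wp_explore_loop[where v = v and base = tp and st = st3 and l = l, unfolded m3]], goal_cases)
    case (15 t4 st4)
    have f: "rmem st4 ''td'' = rmem st ''td''" "st4$''tb'' 0 = tp" "st4$''src'' 0 = s"
     using 15(2) m3 by (simp_all add: unch_def)
    show ?case
     by (rule wp_mono[OF part3]) (use 15(1) f pr(6) in \<open>auto\<close>)
   qed (use pr v l W m3 m2 in \<open>auto simp: st1_def\<close>)
   have tb: "t1 <= 7100" using pr(7) by simp
   have tot: "7400 + ?C * K + 180 * K + 7100 + 30 <= 50000 * (l + 1) * K"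
   proof -
    have "K * l + K \<ge> K" by simp
    then show ?thesis using K by (simp add: algebra_simps)
   qed
   show ?thesis
    apply (rule wp_ISeq)
    using W2 apply (simp, simp)
    apply (simp only: ival.simps)
    apply (rule wp_mono[OF ex[unfolded st3_def]])
    using tb tot by auto
  qed
  done
qed

end

section \<open>Choosing the centres\<close>

text \<open>Only full lists are kept; for an exhausted component \<open>lp\<close> is set back. So
  list \<open>i\<close> occupies the cells \<open>i * K\<close> to \<open>i * K + K - 1\<close>, and
  a cell finds its list by a division.\<close>

definition exall_end :: com where
 "exall_end = Cond (pos (V ''ex''))
  (''lp'' <- ITimes (V ''ln'') (V ''K'') ;;
   Cond (pos (V ''hs'')) (IAssign ''bd'' (V ''ev'') (IPlus (V ''src'') (Lit 1))) Skip)
  (IAssign ''lv'' (V ''ln'') (V ''ev'') ;; IAssign ''hit'' (V ''ln'') (Lit 0) ;; inc ''ln'') ;;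
 inc ''u''"

definition exall :: com where
 "exall = While (ILess (V ''u'') (V ''un''))
  (''ev'' <- IElem ''U'' (V ''u'') ;; IAssign ''ta'' (V ''ev'') (V ''tp'') ;; explore ;;
   IAssign ''te'' (V ''ev'') (V ''tp'') ;; exall_end)"

lemma imods_exall [simp]:
 "imods exall_end = {''lp'', ''bd'', ''lv'', ''hit'', ''ln'', ''u''}" "rmods exall_end = {}"
 "imods exall = {''ev'', ''ta'', ''te'', ''bd'', ''lv'', ''hit'', ''ln'', ''u'', ''tb'', ''ex'', ''hs'', ''ls'', ''lp'', ''nx'', ''j'', ''q'',
  ''r'', ''tz'', ''tp'', ''g'', ''bx'', ''x'', ''b'', ''e'', ''tn'', ''y'', ''p'', ''t'', ''c'', ''h'', ''i'', ''a'', ''l'', ''f'', ''tq''}"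
 "rmods exall = {''nv'', ''D'', ''td''}"
 by (auto simp: exall_def exall_end_def)

context hgraph
begin

definition tab :: "state => nat => bool" where
 "tab st v \<longleftrightarrow> table (st$''tz'') (rmem st ''td'') v (st$''ta'' v) (st$''te'' v) & st$''te'' v <= st$''tp'' 0"

definition rch :: "state => nat => nat => bool" where
 "rch st v u \<longleftrightarrow> reaches (st$''tz'') (rmem st ''td'') v (st$''ta'' v) (st$''te'' v) u"

text \<open>\<open>bd v\<close> is one more than the centre of \<open>v\<close>, or 0 if there is none because the source is unreachable.\<close>

definition res :: "state => nat => bool" where
 "res st v \<longleftrightarrow> st$''bd'' v = 0 & (\<forall>d. \<not> walk v (st$''src'' 0) d) \<or>
  (\<exists>u<N. st$''bd'' v = Suc u & st$''R'' u ~= 0 & tab st v & rch st v u)"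

lemma reaches_cong:
 assumes "\<And>j. a <= j ==> j < b ==> tz j = tz' j & td j = td' j"
 shows "reaches tz td v a b u ==> reaches tz' td' v a b u"
 using assms unfolding reaches_def by (metis (no_types, lifting))

lemma table_cong:
 assumes "\<And>j. a <= j ==> j < b ==> tz j = tz' j & td j = td' j"
 shows "table tz td v a b ==> table tz' td' v a b"
 using assms unfolding table_def by (metis (no_types, lifting))

text \<open>All tables share two arrays that are only ever appended to, so a table is preserved as
  soon as its two end marks are.\<close>

definition keeps :: "nat => state => state => bool" where
 "keeps v st st' \<longleftrightarrow> st'$''ta'' v = st$''ta'' v & st'$''te'' v = st$''te'' v &
  st$''tp'' 0 <= st'$''tp'' 0 &
  (\<forall>j<st$''tp'' 0. st'$''tz'' j = st$''tz'' j & rmem st' ''td'' j = rmem st ''td'' j)"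

lemma keeps_tab:
 assumes "keeps v st st'" "tab st v"
 shows "tab st' v" "rch st v u ==> rch st' v u"
proof -
 have le: "st$''te'' v <= st$''tp'' 0" using assms(2) by (simp add: tab_def)
 then have eq: "st$''tz'' j = st'$''tz'' j & rmem st ''td'' j = rmem st' ''td'' j" if "j < st$''te'' v" for j
  using assms(1) that by (simp add: keeps_def)
 show "tab st' v" using assms le unfolding tab_def keeps_def by (auto elim!: table_cong[rotated] dest: eq)
 show "rch st v u ==> rch st' v u" using assms unfolding rch_def keeps_def by (auto elim!: reaches_cong[rotated] dest: eq)
qed

lemma keeps_res:
 assumes "keeps v st st'" "res st v" "st'$''bd'' v = st$''bd'' v" "\<And>u. st$''R'' u ~= 0 ==> st'$''R'' u ~= 0"
  "st'$''src'' 0 = st$''src'' 0"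
 shows "res st' v"
 using assms keeps_tab[OF assms(1)] unfolding res_def by metis

definition lst_ok :: "state => nat => nat => bool" where
 "lst_ok st K i \<longleftrightarrow> tab st (st$''lv'' i) & st$''bd'' (st$''lv'' i) = 0 & st$''hit'' i = 0 &
  inj_on (st$''ls'') {i * K..<i * K + K} &
  (\<forall>e\<in>{i * K..<i * K + K}. st$''ls'' e < N & rch st (st$''lv'' i) (st$''ls'' e))"

lemma keeps_lst_ok:
 assumes L: "lst_ok st K i" and k: "keeps (st$''lv'' i) st st'"
  and s: "st'$''lv'' i = st$''lv'' i" "st'$''bd'' (st$''lv'' i) = st$''bd'' (st$''lv'' i)"
   "st'$''hit'' i = st$''hit'' i" "\<And>e. e < i * K + K ==> st'$''ls'' e = st$''ls'' e"
 shows "lst_ok st' K i"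
proof -
 note kt = keeps_tab[OF k]
 have t: "tab st (st$''lv'' i)" using L by (simp add: lst_ok_def)
 have "inj_on (st'$''ls'') {i * K..<i * K + K}"
  using L s(4) unfolding lst_ok_def by (auto simp: inj_on_def)
 moreover have "st'$''ls'' e < N & rch st' (st$''lv'' i) (st'$''ls'' e)" if "e \<in> {i * K..<i * K + K}" for e
  using L s(4)[of e] that kt(2)[OF t] unfolding lst_ok_def by auto
 ultimately show ?thesis using L s kt(1)[OF t] unfolding lst_ok_def by auto
qed

lemma wp_exall:
 fixes st
 defines "K \<equiv> st$''K'' 0" and "un \<equiv> st$''un'' 0" and "tp \<equiv> st$''tp'' 0" and "U \<equiv> st$''U''"
 assumes C: "clean st" and G: "G st" and s: "st$''src'' 0 < N" "st$''R'' (st$''src'' 0) ~= 0" and z: "rmem st ''zero'' 0 = 0"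
  and l: "3 * K + 4 <= 2 ^ l" and K: "1 <= K" and U: "inj_on U {..<un}" "\<And>j. j < un ==> U j < N"
  and bd: "\<And>j. j < un ==> st$''bd'' (U j) = 0"
  and i0: "st$''u'' 0 = 0" "st$''ln'' 0 = 0" "st$''lp'' 0 = 0"
  and W: "(4 * (8000 + (6000 * l + 26000) * K) + 2 * N + 30000) * (N + 1) <= W"
   "tp + un * (3 * K + 1) + 3 * K + 9 <= W" "un * K + K + 2 <= W" "K <= W"
 shows "wp W exall (%t st'. let ln = st'$''ln'' 0; lv = st'$''lv'' in
  clean st' & ln <= un & st'$''lp'' 0 = ln * K & inj_on lv {..<ln} & lv ` {..<ln} \<subseteq> U ` {..<un} &
  (\<forall>i<ln. lst_ok st' K i) & (\<forall>v\<in>U ` {..<un} - lv ` {..<ln}. res st' v) &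
  (\<forall>v\<in>U ` {..<un}. st'$''te'' v <= st'$''ta'' v + (3 * K + 1)) &
  (\<forall>v. v \<notin> U ` {..<un} --> keeps v st st' & st'$''bd'' v = st$''bd'' v) &
  st'$''tp'' 0 <= tp + un * (3 * K + 1) & t <= 50100 * (l + 1) * K * un + 20) st"
proof -
 \<comment> \<open>\<open>X\<close> collects the vertices processed so far, \<open>L\<close> those
   among them that own a list and therefore still lack a centre.\<close>
 define X where "X = (%sv :: state. U ` {..<sv$''u'' 0})"
 define L where "L = (%sv :: state. sv$''lv'' ` {..<sv$''ln'' 0})"
 define I where "I = (%sv. clean sv & sv$''u'' 0 <= un & sv$''ln'' 0 <= sv$''u'' 0 & sv$''lp'' 0 = sv$''ln'' 0 * K &
  inj_on (sv$''lv'') {..<sv$''ln'' 0} & L sv \<subseteq> X sv &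
  (\<forall>i<sv$''ln'' 0. lst_ok sv K i) & (\<forall>v\<in>X sv - L sv. res sv v) &
  (\<forall>v\<in>X sv. sv$''te'' v <= sv$''ta'' v + (3 * K + 1)) &
  (\<forall>v. v \<notin> X sv --> keeps v st sv & sv$''bd'' v = st$''bd'' v) &
  sv$''tp'' 0 <= tp + sv$''u'' 0 * (3 * K + 1))"
 let ?T = "50100 * (l + 1) * K"
 have W2: "3 * N + 9 <= W" using W by (simp add: algebra_simps)
 show ?thesis unfolding exall_def Let_def
 proof (rule wp_While[where I = I and \<phi> = "%sv. ?T * (un - sv$''u'' 0)"], goal_cases)
  case 1
  show ?case using C i0 by (auto simp: I_def X_def L_def keeps_def tp_def)
 next
  case (2 sv)
  have "un * 1 <= un * K" using K by (intro mult_left_mono) auto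
  then have "un <= W" using W(3) by linarith
  then show ?case using 2 by (auto simp: I_def unch_def un_def)
 next
  case (3 sv)
  let ?u = "sv$''u'' 0" and ?ln = "sv$''ln'' 0" and ?tp = "sv$''tp'' 0"
  have f: "sv$''K'' 0 = K" "sv$''un'' 0 = un" "sv$''U'' = U" "G sv" "sv$''src'' 0 = st$''src'' 0"
   "sv$''R'' = st$''R''" "rmem sv ''zero'' 0 = 0"
   using 3(2) G z by (simp_all add: unch_def K_def un_def U_def G_def)
  have I: "clean sv" "?ln <= ?u" "sv$''lp'' 0 = ?ln * K" "inj_on (sv$''lv'') {..<?ln}" "L sv \<subseteq> X sv"
   "\<forall>i<?ln. lst_ok sv K i" "\<forall>v\<in>X sv - L sv. res sv v" "\<forall>v\<in>X sv. sv$''te'' v <= sv$''ta'' v + (3 * K + 1)"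
   "\<forall>v. v \<notin> X sv --> keeps v st sv & sv$''bd'' v = st$''bd'' v" "?tp <= tp + ?u * (3 * K + 1)"
   using 3(1) unfolding I_def by blast+
  have u: "?u < un" using 3(3) f by simp
  define v where "v = U ?u"
  have vN: "v < N" using U(2)[OF u] by (simp add: v_def)
  have vX: "v \<notin> X sv" using inj_onD[OF U(1), of ?u] u by (fastforce simp: X_def v_def)
  have bdv: "sv$''bd'' v = 0" using I(9) vX bd[OF u] by (simp add: v_def)
  have lnb: "?ln * K + K <= un * K"
  proof -
   have "Suc ?ln * K <= un * K" using I(2) u by (intro mult_right_mono) auto
   then show ?thesis by simp
  qed
  have tpb: "?tp + (3 * K + 1) <= tp + un * (3 * K + 1)"
  proof -
   have "Suc ?u * (3 * K + 1) <= un * (3 * K + 1)" using u by (intro mult_right_mono) auto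
   then show ?thesis using I(10) by simp
  qed
  define sv1 where "sv1 = iu ''ta'' v ?tp (iu ''ev'' 0 v sv)"
  have f1: "sv1$''K'' 0 = K" "sv1$''lp'' 0 = ?ln * K" "sv1$''tp'' 0 = ?tp" "sv1$''ev'' 0 = v" "sv1$''src'' 0 = st$''src'' 0"
   "clean sv1" "G sv1" "rmem sv1 ''zero'' 0 = 0" "sv1$''tz'' = sv$''tz''" "rmem sv1 = rmem sv" "sv1$''ls'' = sv$''ls''"
   using f I(1,3) by (simp_all add: sv1_def clean_def G_def)
  have un1: "un * 1 <= un * K" using K by (intro mult_left_mono) auto
  have body: "wp W (explore ;; IAssign ''te'' (V ''ev'') (V ''tp'') ;; exall_end)
   (%t st'. I st' & st'$''u'' 0 = Suc ?u & t <= 50000 * (l + 1) * K + 60) sv1"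
  proof (rule wp_Seq, rule wp_frame[OF wp_explore[where st = sv1 and l = l, unfolded f1]], goal_cases)
   case (12 t2 st2)
   let ?tp2 = "st2$''tp'' 0" and ?lp2 = "st2$''lp'' 0"
   have E: "clean st2" "?tp <= ?tp2" "?tp2 <= ?tp + 1 + 3 * K" "table (st2$''tz'') (rmem st2 ''td'') v ?tp ?tp2"
    "\<forall>j<?tp. st2$''tz'' j = sv$''tz'' j & rmem st2 ''td'' j = rmem sv ''td'' j"
    "\<forall>j<?ln * K. st2$''ls'' j = sv$''ls'' j" "inj_on (st2$''ls'') {?ln * K..<?lp2}"
    "\<forall>j\<in>{?ln * K..<?lp2}. st2$''ls'' j < N & reaches (st2$''tz'') (rmem st2 ''td'') v ?tp ?tp2 (st2$''ls'' j)"
    "st2$''ex'' 0 <= 1" "st2$''hs'' 0 <= 1" "st2$''ex'' 0 = 0 --> ?lp2 = ?ln * K + K"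
    "st2$''ex'' 0 ~= 0 --> (if st2$''hs'' 0 ~= 0 then
     reaches (st2$''tz'') (rmem st2 ''td'') v ?tp ?tp2 (st$''src'' 0) else \<forall>d. \<not> walk v (st$''src'' 0) d)"
    and t2: "t2 <= 50000 * (l + 1) * K"
    using 12(1) unfolding eres_def Let_def f1 by blast+
   have g: "st2$''ev'' 0 = v" "st2$''ln'' 0 = ?ln" "st2$''K'' 0 = K" "st2$''u'' 0 = ?u" "st2$''src'' 0 = st$''src'' 0"
    "st2$''bd'' = sv$''bd''" "st2$''lv'' = sv$''lv''" "st2$''hit'' = sv$''hit''" "st2$''R'' = st$''R''"
    "st2$''ta'' = (sv$''ta'')(v := ?tp)" "st2$''te'' = sv$''te''"
    using 12(2) f f1 by (simp_all add: unch_def sv1_def)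
   have main: "I st'" if h: "\<And>a. a \<notin> {''lp'', ''bd'', ''lv'', ''hit'', ''ln'', ''u'', ''te''} ==> st'$a = st2$a" "rmem st' = rmem st2"
     "st'$''te'' = (sv$''te'')(v := ?tp2)" "st'$''u'' 0 = Suc ?u"
     and c: "st2$''ex'' 0 ~= 0 & st'$''ln'' 0 = ?ln & st'$''lp'' 0 = ?ln * K & st'$''lv'' = sv$''lv'' &
       st'$''hit'' = sv$''hit'' &
       st'$''bd'' = (if st2$''hs'' 0 ~= 0 then (sv$''bd'')(v := Suc (st$''src'' 0)) else sv$''bd'') \<or>
      st2$''ex'' 0 = 0 & st'$''ln'' 0 = Suc ?ln & st'$''lp'' 0 = ?ln * K + K & st'$''lv'' = (sv$''lv'')(?ln := v) &
       st'$''hit'' = (sv$''hit'')(?ln := 0) & st'$''bd'' = sv$''bd''" for st'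
   proof -
    have k: "keeps w sv st'" if "w ~= v" for w
     using that E(2,5) unfolding keeps_def h(2,3) by (simp add: h(1) g)
    have bdw: "st'$''bd'' w = sv$''bd'' w" if "w ~= v" for w using c that by auto
    have X': "X st' = insert v (X sv)" by (simp add: X_def h(4) v_def lessThan_Suc)
    have kk: "keeps w st st'" if w: "w \<notin> X st'" for w
     using k[of w] I(9) w unfolding X' keeps_def by (auto intro: order.trans)
    have tv: "tab st' v" using E(4) unfolding tab_def h(2,3) by (simp add: h(1) g)
    have rv': "rch st' v x \<longleftrightarrow> reaches (st2$''tz'') (rmem st2 ''td'') v ?tp ?tp2 x" for x
     unfolding rch_def h(2,3) by (simp add: h(1) g)
    have Rs: "st'$''R'' = st$''R''" "st'$''src'' 0 = st$''src'' 0" by (simp_all add: h(1) g)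
    have lvv: "sv$''lv'' i ~= v" if "i < ?ln" for i using I(5) vX that by (auto simp: L_def)
    have hh: "st'$''lv'' i = sv$''lv'' i" "st'$''hit'' i = sv$''hit'' i" if "i < ?ln" for i
     using c that by auto
    have lo: "lst_ok st' K i" if i: "i < ?ln" for i
    proof (rule keeps_lst_ok[OF I(6)[rule_format, OF i] k[OF lvv[OF i]] hh(1)[OF i] bdw[OF lvv[OF i]] hh(2)[OF i]])
     fix e assume e: "e < i * K + K"
     have "Suc i * K <= ?ln * K" using i by (intro mult_right_mono) auto
     with e have "e < ?ln * K" by simp
     then show "st'$''ls'' e = sv$''ls'' e" using E(6) by (simp add: h(1))
    qed
    have re: "res st' w" if w: "w \<in> X sv - L sv" for w
    proof (rule keeps_res)
     have "w ~= v" using w vX by blast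
     then show "keeps w sv st'" "st'$''bd'' w = sv$''bd'' w" by (rule k, rule bdw)
     show "res sv w" using I(7) w by blast
    qed (use f Rs in auto)
    have cl: "clean st'" using E(1) h(2) unfolding clean_def by (simp add: h(1))
    have te: "\<forall>w\<in>X st'. st'$''te'' w <= st'$''ta'' w + (3 * K + 1)"
     using I(8) E(3) vX unfolding X' h(3) by (auto simp: h(1) g)
    have kb: "\<forall>w. w \<notin> X st' --> keeps w st st' & st'$''bd'' w = st$''bd'' w"
     using kk bdw I(9) X' by auto
    have tp': "st'$''tp'' 0 <= tp + Suc ?u * (3 * K + 1)" using E(3) I(10) by (simp add: h(1))
    from c show ?thesis
    proof (elim disjE conjE)
     assume ex: "st2$''ex'' 0 ~= 0" and q: "st'$''ln'' 0 = ?ln" "st'$''lp'' 0 = ?ln * K" "st'$''lv'' = sv$''lv''"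
      and b: "st'$''bd'' = (if st2$''hs'' 0 ~= 0 then (sv$''bd'')(v := Suc (st$''src'' 0)) else sv$''bd'')"
     have L': "L st' = L sv" by (simp add: L_def q)
     have "res st' v"
     proof (cases "st2$''hs'' 0 = 0")
      case True
      then show ?thesis using E(12) ex b bdv by (simp add: res_def Rs)
     next
      case False
      then show ?thesis using E(12) ex b tv s unfolding res_def rv' Rs by auto
     qed
     then show ?thesis using I(2,4,5) lo re cl te kb tp' q u unfolding I_def L' by (auto simp: h(4) X')
    next
     assume ex: "st2$''ex'' 0 = 0" and q: "st'$''ln'' 0 = Suc ?ln" "st'$''lp'' 0 = ?ln * K + K" "st'$''lv'' = (sv$''lv'')(?ln := v)"
      "st'$''hit'' = (sv$''hit'')(?ln := 0)" "st'$''bd'' = sv$''bd''"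
     have L': "L st' = insert v (L sv)" by (auto simp: L_def q lessThan_Suc)
     have "lst_ok st' K ?ln"
      using tv q bdv E(7,8,11) ex unfolding lst_ok_def by (simp add: rv' h(1))
     then have "\<forall>i<Suc ?ln. lst_ok st' K i" using lo by (simp add: less_Suc_eq)
     moreover have "inj_on (st'$''lv'') {..<Suc ?ln}"
      using I(4) lvv by (auto simp: q lessThan_Suc inj_on_def)
     ultimately show ?thesis using I(2,5) re cl te kb tp' q(1,2) u unfolding I_def L' by (auto simp: h(4) X')
    qed
   qed
   have Wb: "?tp2 <= W" "v <= W" "Suc ?u <= W" "?ln * K <= W" "Suc ?ln <= W" "Suc (st$''src'' 0) <= W" "K <= W" "1 <= W"
    using E(3) tpb W vN W2 u I(2) lnb s un1 by linarith+
   show ?case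
    apply (rule wp_ISeq, (use Wb g in \<open>simp; fail\<close>)+)
    unfolding exall_end_def
    apply (intro wp_Seq wp_Cond wp_IAssign wp_Skip)
           apply (use Wb g E(9,10) in \<open>simp_all\<close>)
    subgoal using t2 g E(11) by (intro conjI main) auto
    subgoal using t2 g E(11) by (intro conjI main) auto
    subgoal using t2 g E(11) by (intro conjI main) auto
    done
  qed (use f1 I s vN l K W tpb lnb in auto)
  have Wb: "?u <= W" "?tp <= W" "v <= W" using u un1 W tpb vN W2 by linarith+
  have tt: "?T * (un - ?u) = ?T + ?T * (un - Suc ?u)" using u by (metis Suc_diff_Suc mult_Suc_right)
  have T: "50000 * (l + 1) * K + 60 + 30 <= ?T" using K by (simp add: algebra_simps)
  show ?case
   apply ((rule wp_ISeq, (use Wb f in \<open>simp add: v_def; fail\<close>)+)+)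
   apply (simp add: f v_def[symmetric])
   apply (rule wp_mono[OF body[unfolded sv1_def]])
   using tt T by auto
 next
  case (4 t sv)
  have "sv$''un'' 0 = un" using 4(2) by (simp add: unch_def un_def)
  then have "sv$''u'' 0 = un" using 4(1,3) by (simp add: I_def)
  then show ?case using 4(1,4) i0 by (simp add: I_def X_def L_def)
 qed
qed

end

section \<open>Inverted lists: from a vertex to the places that mention it\<close>

primrec lst :: "(nat => nat) => nat => nat list => bool" where
 "lst ch h [] \<longleftrightarrow> h = 0"
| "lst ch h (e # xs) \<longleftrightarrow> h = Suc e & lst ch (ch e) xs"

lemma lst_upd: "lst ch h xs ==> e \<notin> set xs ==> lst (ch(e := v)) h xs"
 by (induction xs arbitrary: h) auto

text \<open>Heads and successors are shifted by one, with 0 for the end. The structure is used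
  twice: for list cells sorted by the listed vertex, and later for vertices sorted by their
  centre.\<close>

definition chains :: "nat => (nat => nat) => nat => (nat => nat) => (nat => nat) => bool" where
 "chains N ls n hq ch \<longleftrightarrow> (\<forall>x<N. \<exists>xs. lst ch (hq x) xs & distinct xs & set xs = {e. e < n & ls e = x})"

lemma chains_add:
 assumes "chains N ls n hq ch"
 shows "chains N ls (Suc n) (hq(ls n := Suc n)) (ch(n := hq (ls n)))"
 unfolding chains_def
proof (intro allI impI)
 fix x assume "x < N"
 with assms obtain xs where xs: "lst ch (hq x) xs" "distinct xs" "set xs = {e. e < n & ls e = x}"
  by (auto simp: chains_def)
 have "n \<notin> set xs" using xs by auto
 note l = lst_upd[OF xs(1) this, of "hq (ls n)"]
 show "\<exists>xs. lst (ch(n := hq (ls n))) ((hq(ls n := Suc n)) x) xs & distinct xs & set xs = {e. e < Suc n & ls e = x}"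
 proof (cases "x = ls n")
  case True
  then show ?thesis using l xs \<open>n \<notin> set xs\<close> by (intro exI[of _ "n # xs"]) (auto simp: less_Suc_eq)
 next
  case False
  then show ?thesis using l xs by (intro exI[of _ xs]) (auto simp: less_Suc_eq)
 qed
qed

lemma chains_mono: "chains M ls n hq ch ==> N <= M ==> chains N ls n hq ch"
 by (simp add: chains_def)

definition mkchain :: com where
 "mkchain = ''x'' <- Lit 0 ;; While (ILess (V ''x'') (IPlus (V ''N'') (Lit 1))) (IAssign ''hd'' (V ''x'') (Lit 0) ;; inc ''x'') ;;
  ''e'' <- Lit 0 ;; While (ILess (V ''e'') (V ''lp''))
   (IAssign ''ch'' (V ''e'') (IElem ''hd'' (IElem ''ls'' (V ''e''))) ;;
    IAssign ''hd'' (IElem ''ls'' (V ''e'')) (IPlus (V ''e'') (Lit 1)) ;; inc ''e'')"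

lemma imods_mkchain [simp]: "imods mkchain = {''x'', ''hd'', ''e'', ''ch''}" "rmods mkchain = {}"
 by (auto simp: mkchain_def)

lemma wp_mkchain:
 fixes st
 defines "n \<equiv> st$''lp'' 0" and "ls \<equiv> st$''ls''"
 assumes N: "st$''N'' 0 = N" and ls: "\<And>e. e < n ==> ls e <= N" and W: "N + 2 <= W" "n + 1 <= W"
 shows "wp W mkchain (%t st'. chains (Suc N) ls n (st'$''hd'') (st'$''ch'') & (\<forall>x\<le>N. st'$''hd'' x <= n) &
  (\<forall>e<n. st'$''ch'' e <= n) & t <= 100 * (N + n) + 160) st"
proof -
 have l1: "wp W (While (ILess (V ''x'') (IPlus (V ''N'') (Lit 1))) (IAssign ''hd'' (V ''x'') (Lit 0) ;; inc ''x''))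
   (%t sv. (\<forall>x\<le>N. sv$''hd'' x = 0) & t <= 100 * N + 110) (iu ''x'' 0 0 st)"
 proof (rule wp_While[where I = "%sv. sv$''x'' 0 <= Suc N & (\<forall>x<sv$''x'' 0. sv$''hd'' x = 0)"
    and \<phi> = "%sv. 100 * (Suc N - sv$''x'' 0)"], goal_cases)
  case (3 sv)
  then have "sv$''x'' 0 <= N" using N by (simp add: unch_def)
  with 3(1) show ?case
   by (intro wp_basic) (use W in \<open>auto simp: less_Suc_eq Suc_diff_le\<close>)
 qed (use N W in \<open>auto simp: unch_def\<close>)
 have l2: "wp W (While (ILess (V ''e'') (V ''lp''))
   (IAssign ''ch'' (V ''e'') (IElem ''hd'' (IElem ''ls'' (V ''e''))) ;;
    IAssign ''hd'' (IElem ''ls'' (V ''e'')) (IPlus (V ''e'') (Lit 1)) ;; inc ''e''))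
   (%t st'. chains (Suc N) ls n (st'$''hd'') (st'$''ch'') & (\<forall>x\<le>N. st'$''hd'' x <= n) &
   (\<forall>e<n. st'$''ch'' e <= n) & t <= 100 * n + 10) (iu ''e'' 0 0 sv)"
  if h0: "\<forall>x\<le>N. sv$''hd'' x = 0" and f: "sv$''lp'' 0 = n" "sv$''ls'' = ls" for sv
 proof (rule wp_While[where I = "%sv. sv$''e'' 0 <= n & chains (Suc N) ls (sv$''e'' 0) (sv$''hd'') (sv$''ch'') &
   (\<forall>x\<le>N. sv$''hd'' x <= n) & (\<forall>e<sv$''e'' 0. sv$''ch'' e <= n)"
    and \<phi> = "%sv. 100 * (n - sv$''e'' 0)"], goal_cases)
  case 1
  have "lst ch 0 []" for ch by simp
  then show ?case using h0 by (auto simp: chains_def less_Suc_eq_le intro!: exI[of _ "[]"])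
 next
  case (3 sv')
  then have s: "sv'$''lp'' 0 = n" "sv'$''ls'' = ls" using f by (auto simp: unch_def)
  let ?e = "sv'$''e'' 0"
  have e: "?e < n" "ls ?e <= N" using 3(3) s ls by auto
  have "chains (Suc N) ls (Suc ?e) ((sv'$''hd'')(ls ?e := Suc ?e)) ((sv'$''ch'')(?e := sv'$''hd'' (ls ?e)))"
   using chains_add 3(1) by blast
  moreover have "sv'$''hd'' (ls ?e) <= n" using 3(1) e by blast
  ultimately show ?case
   using 3(1) by (intro wp_basic; (use W e s in \<open>simp; fail\<close>)?) (use e W in \<open>auto simp: s less_Suc_eq\<close>)
 next
  case (2 sv')
  then show ?case using f W by (simp add: unch_def)
 next
  case (4 t sv')
  then have "sv'$''e'' 0 = n" using f by (simp add: unch_def)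
  with 4 show ?case by simp
 qed
 show ?thesis unfolding mkchain_def
  apply (rule wp_ISeq)
  using W apply (simp, simp)
  apply (simp only: ival.simps)
  apply (rule wp_Seq, rule wp_frame[OF l1])
  apply (rule wp_ISeq)
  using W apply (simp, simp)
  apply (simp only: ival.simps)
  apply (rule wp_mono[OF l2])
  by (auto simp: unch_def n_def ls_def)
qed

subsection \<open>Scanning the vertices\<close>

lemma wp_While_unfold:
 assumes "bok W b st" "\<not> bval b st ==> Q (1 + bcost b) st"
  "bval b st ==> wp W c (%t1. wp W (While b c) (%t2. Q (1 + bcost b + t1 + t2))) st"
 shows "wp W (While b c) Q st"
 using assms unfolding wp_def by (blast intro: exec.WhileFalse exec.WhileTrue)

text \<open>Loop rule for following a chain. The position \<open>i\<close> is not stored by the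
  program; termination comes from the finite list \<open>xs\<close>, and \<phi> only bounds the
  time.\<close>

lemma wp_lst:
 fixes \<phi> :: "nat => state => nat"
 assumes l: "lst ch (st$a 0) xs" and init: "I 0 st" and W: "\<And>e. e \<in> set xs ==> Suc e <= W"
  and step: "\<And>i sv. i < length xs ==> I i sv ==> unch c st sv ==> sv$a 0 = Suc (xs ! i) ==>
   wp W c (%t sv'. I (Suc i) sv' & sv'$a 0 = ch (xs ! i) & \<phi> (Suc i) sv' + t + 5 <= \<phi> i sv) sv"
  and final: "\<And>t sv. I (length xs) sv ==> unch c st sv ==> t + \<phi> (length xs) sv <= \<phi> 0 st + 5 ==> Q t sv"
 shows "wp W (While (pos (V a)) c) Q st"
proof -
 have "wp W (While (pos (V a)) c) (%t sv'. I (length xs) sv' & unch c st sv' & t + \<phi> (length xs) sv' <= \<phi> i sv + 5) sv"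
  if "i <= length xs" "lst ch (sv$a 0) (drop i xs)" "I i sv" "unch c st sv" for i sv
  using that
 proof (induction "length xs - i" arbitrary: i sv)
  case 0
  then have "i = length xs" by simp
  with 0 show ?case by (intro wp_While_unfold) auto
 next
  case (Suc k)
  then have i: "i < length xs" by simp
  then have d: "drop i xs = xs ! i # drop (Suc i) xs" by (simp add: Cons_nth_drop_Suc)
  with Suc have e: "sv$a 0 = Suc (xs ! i)" "lst ch (ch (xs ! i)) (drop (Suc i) xs)" by auto
  show ?case
  proof (rule wp_While_unfold, goal_cases)
   case 1
   show ?case using W[of "xs ! i"] i e by simp
  next
   case 2
   then show ?case using e by simp
  next
   case 3
   show ?case
   proof (rule wp_frame[OF step[OF i Suc.prems(3,4) e(1)]], goal_cases)
    case (1 t sv')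
    then have "wp W (While (pos (V a)) c) (%t sv''. I (length xs) sv'' & unch c st sv'' & t + \<phi> (length xs) sv'' <= \<phi> (Suc i) sv' + 5) sv'"
     using Suc i e unch_trans[OF Suc.prems(4)] by (intro Suc.hyps(1)) auto
    then show ?case by (rule wp_mono) (use 1 in auto)
   qed
  qed
 qed
 from this[of 0 st] show ?thesis using l init unch_refl final by (auto intro: wp_mono)
qed

lemma set_take_Suc_nth: "i < length xs ==> set (take (Suc i) xs) = insert (xs ! i) (set (take i xs))"
 by (simp add: take_Suc_conv_app_nth)

lemma nth_notin_take: "distinct xs ==> i < length xs ==> xs ! i \<notin> set (take i xs)"
 by (auto simp: in_set_conv_nth nth_eq_iff_index_eq)

definition count_loop :: com where
 "count_loop = While (pos (V ''e''))
  (Cond (pos (IElem ''hit'' (IDiv (IMinus (V ''e'') (Lit 1)) (V ''K'')))) Skip (inc ''cc'') ;;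
   ''e'' <- IElem ''ch'' (IMinus (V ''e'') (Lit 1)))"

text \<open>A list that was hit before keeps its first centre. Any choice is good, because the table
  of the owner is complete up to each of the listed vertices.\<close>

definition mark_loop :: com where
 "mark_loop = While (pos (V ''e''))
  (''g'' <- IDiv (IMinus (V ''e'') (Lit 1)) (V ''K'') ;;
   Cond (pos (IElem ''hit'' (V ''g''))) Skip
    (IAssign ''hit'' (V ''g'') (Lit 1) ;; IAssign ''bd'' (IElem ''lv'' (V ''g'')) (IPlus (V ''x'') (Lit 1))) ;;
   ''e'' <- IElem ''ch'' (IMinus (V ''e'') (Lit 1)))"

lemma imods_scan_loops [simp]:
 "imods count_loop = {''cc'', ''e''}" "rmods count_loop = {}"
 "imods mark_loop = {''g'', ''hit'', ''bd'', ''e''}" "rmods mark_loop = {}"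
 by (auto simp: count_loop_def mark_loop_def)

lemma wp_count_loop:
 fixes st
 defines "K \<equiv> st$''K'' 0" and "ch \<equiv> st$''ch''" and "hit \<equiv> st$''hit''"
 assumes l: "lst ch (st$''e'' 0) xs" "distinct xs" and c0: "st$''cc'' 0 = 0"
  and n: "\<And>e. e \<in> set xs ==> e < n & ch e <= n & hit (e div K) <= 1" and W: "n + 2 <= W" "K <= W" "length xs + 1 <= W"
 shows "wp W count_loop (%t st'. st'$''cc'' 0 = card {e \<in> set xs. hit (e div K) = 0} & t <= 60 * length xs + 10) st"
 unfolding count_loop_def
proof (rule wp_lst[where xs = xs and ch = ch and I = "%i sv. sv$''cc'' 0 = card {e \<in> set (take i xs). hit (e div K) = 0} & sv$''cc'' 0 <= i"
   and \<phi> = "%i sv. 60 * (length xs - i)"], goal_cases)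
 case (3 e)
 then show ?case using n[of e] W by auto
next
 case (4 i sv)
 have s: "sv$''K'' 0 = K" "sv$''ch'' = ch" "sv$''hit'' = hit" using 4(3) by (auto simp: unch_def K_def ch_def hit_def)
 define a where "a = xs ! i"
 have a: "a \<in> set xs" "a \<notin> set (take i xs)" using 4(1) nth_notin_take[OF l(2)] by (auto simp: a_def)
 have b: "ch a <= W" "hit (a div K) <= W" "a div K <= W" "Suc a <= W" using n[OF a(1)] W div_le_dividend[of a K] by linarith+
 let ?A = "%i. {e \<in> set (take i xs). hit (e div K) = 0}"
 have "?A (Suc i) = (if hit (a div K) = 0 then insert a (?A i) else ?A i)"
  unfolding set_take_Suc_nth[OF 4(1)] a_def[symmetric] by auto
 then have A: "card (?A (Suc i)) = card (?A i) + (if hit (a div K) = 0 then 1 else 0)" using a by simp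
 have e: "sv$''e'' 0 = Suc a" using 4(4) by (simp add: a_def)
 show ?case
  by (intro wp_basic wp_Cond; (use b s e 4(1,2) W in \<open>simp; fail\<close>)?)
   (use A e 4(1,2) in \<open>auto simp: s a_def[symmetric]\<close>)
qed (use l c0 in auto)

lemma wp_mark_loop:
 fixes st
 defines "K \<equiv> st$''K'' 0" and "ch \<equiv> st$''ch''" and "hit \<equiv> st$''hit''" and "lv \<equiv> st$''lv''" and "x \<equiv> st$''x'' 0"
 assumes l: "lst ch (st$''e'' 0) xs"
  and n: "\<And>e. e \<in> set xs ==> e < n & ch e <= n & hit (e div K) <= 1 & lv (e div K) <= W" and W: "n + 2 <= W" "K <= W" "x + 1 <= W"
 shows "wp W mark_loop (%t st'. (\<forall>g. st'$''hit'' g = (if g \<in> (%e. e div K) ` set xs & hit g = 0 then 1 else hit g)) &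
  (\<forall>v. st'$''bd'' v = (if \<exists>g\<in>(%e. e div K) ` set xs. hit g = 0 & lv g = v then Suc x else st$''bd'' v)) &
  t <= 80 * length xs + 10) st"
 unfolding mark_loop_def
proof (rule wp_lst[where xs = xs and ch = ch and I = "%i sv.
   (\<forall>g. sv$''hit'' g = (if g \<in> (%e. e div K) ` set (take i xs) & hit g = 0 then 1 else hit g)) &
   (\<forall>v. sv$''bd'' v = (if \<exists>g\<in>(%e. e div K) ` set (take i xs). hit g = 0 & lv g = v then Suc x else st$''bd'' v))"
   and \<phi> = "%i sv. 80 * (length xs - i)"], goal_cases)
 case (3 e)
 then show ?case using n[of e] W by auto
next
 case (4 i sv)
 have s: "sv$''K'' 0 = K" "sv$''ch'' = ch" "sv$''lv'' = lv" "sv$''x'' 0 = x"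
  using 4(3) by (auto simp: unch_def K_def ch_def lv_def x_def)
 define a where "a = xs ! i"
 have a: "a \<in> set xs" using 4(1) by (auto simp: a_def)
 have b: "ch a <= W" "hit (a div K) <= 1" "a div K <= W" "Suc a <= W" "lv (a div K) <= W" "2 <= W" using n[OF a(1)] W div_le_dividend[of a K] by linarith+
 let ?A = "%i. (%e. e div K) ` set (take i xs)"
 have A: "?A (Suc i) = insert (a div K) (?A i)" unfolding set_take_Suc_nth[OF 4(1)] a_def[symmetric] by auto
 have e: "sv$''e'' 0 = Suc a" using 4(4) by (simp add: a_def)
 have h: "sv$''hit'' (a div K) = (if a div K \<in> ?A i & hit (a div K) = 0 then 1 else hit (a div K))" using 4(2) by blast
 then have h1: "sv$''hit'' (a div K) <= W" using b by auto
 show ?case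
 proof (cases "sv$''hit'' (a div K) = 0")
  case True
  then have hz: "hit (a div K) = 0" "a div K \<notin> ?A i" using h by (auto split: if_splits)
  show ?thesis
   by (intro wp_basic wp_Cond; (use b s e h1 True 4(1) W in \<open>simp; fail\<close>)?)
    (use hz e 4(1,2) True in \<open>auto simp: s A a_def[symmetric] simp del: image_iff\<close>)
 next
  case False
  then have "a div K \<in> ?A i \<or> hit (a div K) ~= 0" using h by (auto split: if_splits)
  then show ?thesis
   by (intro wp_basic wp_Cond; (use b s e h1 False 4(1) W in \<open>simp; fail\<close>)?)
    (use e 4(1,2) False in \<open>auto simp: s A a_def[symmetric] simp del: image_iff\<close>)
 qed
qed (use l in \<open>auto simp: hit_def\<close>)

text \<open>Greedy selection in one pass. The test compares \<open>cc\<close> with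
  \<open>un * K / (4 * N)\<close>, a quarter of the average number of cells per vertex, without
  dividing.\<close>

definition scan :: com where
 "scan = While (ILess (V ''x'') (V ''N''))
  (''cc'' <- Lit 0 ;; ''e'' <- IElem ''hd'' (V ''x'') ;; count_loop ;;
   Cond (ILess (ITimes (ITimes (Lit 4) (V ''N'')) (V ''cc'')) (ITimes (V ''un'') (V ''K''))) Skip
    (IAssign ''R'' (V ''x'') (Lit 1) ;; ''e'' <- IElem ''hd'' (V ''x'') ;; mark_loop) ;;
   inc ''x'')"

lemma imods_scan [simp]: "imods scan = {''cc'', ''e'', ''R'', ''g'', ''hit'', ''bd'', ''x''}" "rmods scan = {}"
 by (auto simp: scan_def)

lemma div_block:
 assumes "0 < (K::nat)"
 shows "e div K = i \<longleftrightarrow> e \<in> {i * K..<i * K + K}"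
proof
 assume "e div K = i"
 then have "e = i * K + e mod K" using div_mult_mod_eq[of e K] by simp
 moreover have "e mod K < K" using assms by simp
 ultimately have "i * K <= e" "e < i * K + K" by linarith+
 then show "e \<in> {i * K..<i * K + K}" by simp
qed (auto simp: div_nat_eqI ac_simps)

text \<open>\<open>X\<close> is the number of vertices scanned and \<open>P\<close> the set of those
  chosen. The bound on \<open>card P\<close> says that each chosen vertex hit at least
  \<open>un * K / (4 * N)\<close> new lists. The last clause persists for scanned vertices because
  the set of unhit lists only shrinks.\<close>

definition scan_post :: "nat => nat => state => state => nat => bool" where
 "scan_post N lc st sv X \<longleftrightarrow> (let K = st$''K'' 0; un = st$''un'' 0; ls = st$''ls''; lv = st$''lv''; hit = sv$''hit'' in
  (\<forall>i<lc. hit i <= 1) &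
  (\<forall>i<lc. if hit i = 0 then sv$''bd'' (lv i) = 0
   else \<exists>e\<in>{i * K..<i * K + K}. sv$''bd'' (lv i) = Suc (ls e) & sv$''R'' (ls e) ~= 0) &
  (\<forall>v. v \<notin> lv ` {..<lc} --> sv$''bd'' v = st$''bd'' v) &
  (\<exists>P. (\<forall>u. sv$''R'' u = (if u \<in> P then 1 else st$''R'' u)) & P \<subseteq> {..<X} &
   card P * (un * K) <= 4 * N * card {i. i < lc & hit i ~= 0}) &
  (\<forall>x<X. 4 * N * card {e. e < lc * K & ls e = x & hit (e div K) = 0} <= un * K))"

lemma wp_scan:
 fixes st
 defines "K \<equiv> st$''K'' 0" and "un \<equiv> st$''un'' 0" and "ls \<equiv> st$''ls''" and "lv \<equiv> st$''lv''"
 assumes x0: "st$''x'' 0 = 0" and N: "st$''N'' 0 = N" and K: "0 < K" and un: "0 < un"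
  and ch: "chains N ls (lc * K) (st$''hd'') (st$''ch'')" "\<And>x. x < N ==> st$''hd'' x <= lc * K" "\<And>e. e < lc * K ==> st$''ch'' e <= lc * K"
  and ls: "\<And>i. i < lc ==> inj_on ls {i * K..<i * K + K}" "\<And>e. e < lc * K ==> ls e < N"
  and lv: "inj_on lv {..<lc}" "\<And>i. i < lc ==> lv i < N" and hit: "\<And>i. i < lc ==> st$''hit'' i = 0" "\<And>i. i < lc ==> st$''bd'' (lv i) = 0"
  and W: "4 * N * (lc * K) + 4 * N + 4 <= W" "un * K <= W" "lc * K + 2 <= W" "K <= W" "un <= W"
 shows "wp W scan (%t sv. scan_post N lc st sv N & t <= 200 * (lc * K) + 200 * N + 20) st"
proof -
 let ?n = "lc * K"
 define E where "E = (%x. {e. e < ?n & ls e = x})"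
 have Efin: "finite (E x)" for x by (simp add: E_def)
 have div: "e div K < lc" if "e < ?n" for e using that by (simp add: less_mult_imp_div_less)
 \<comment> \<open>A list does not repeat a vertex, so the cells mentioning \<open>x\<close> belong
   to different lists; counting cells is counting lists.\<close>
 have Einj: "inj_on (%e. e div K) (E x)" for x
 proof (rule inj_onI)
  fix a b assume "a \<in> E x" "b \<in> E x" "a div K = b div K"
  then show "a = b" using div[of a] ls(1)[of "a div K"] div_block[OF K, of a "a div K"] div_block[OF K, of b "a div K"]
   by (auto simp: E_def dest: inj_onD)
 qed
 define I where "I = (%sv. sv$''x'' 0 <= N & scan_post N lc st sv (sv$''x'' 0))"
 \<comment> \<open>The cells whose vertex is still to be scanned. Each cell lies in a single chain,
   so the chains traversed have total length \<open>?n\<close>.\<close>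
 define C where "C = (%x. card {e. e < ?n & x <= ls e})"
 have CE: "C x = card (E x) + C (Suc x)" for x
 proof -
  have "{e. e < ?n & x <= ls e} = E x \<union> {e. e < ?n & Suc x <= ls e}" by (auto simp: E_def)
  then show ?thesis unfolding C_def by (simp add: card_Un_disjoint E_def disjoint_iff)
 qed
 have C0: "C 0 = ?n" by (simp add: C_def)
 show ?thesis unfolding scan_def
 proof (rule wp_While[where I = I and \<phi> = "%sv. 200 * C (sv$''x'' 0) + 200 * (N - sv$''x'' 0)"], goal_cases)
  case 1
  have "{i. i < lc & st$''hit'' i ~= 0} = {}" using hit by auto
  then show ?case using x0 hit by (auto simp: I_def scan_post_def Let_def lv_def intro!: exI[of _ "{}"])
 next
  case (2 sv)
  then show ?case using N W by (auto simp: I_def unch_def)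
 next
  case (3 sv)
  let ?x = "sv$''x'' 0"
  have f: "sv$''K'' 0 = K" "sv$''un'' 0 = un" "sv$''lv'' = lv" "sv$''N'' 0 = N"
   "sv$''ch'' = st$''ch''" "sv$''hd'' = st$''hd''"
   using 3(2) N by (simp_all add: unch_def K_def un_def lv_def)
  have x: "?x < N" using 3(3) f by simp
  let ?hit = "sv$''hit''"
  from 3(1) obtain P where J: "\<forall>i<lc. ?hit i <= 1"
   "\<forall>i<lc. if ?hit i = 0 then sv$''bd'' (lv i) = 0
    else \<exists>e\<in>{i * K..<i * K + K}. sv$''bd'' (lv i) = Suc (ls e) & sv$''R'' (ls e) ~= 0"
   "\<forall>v. v \<notin> lv ` {..<lc} --> sv$''bd'' v = st$''bd'' v"
   "\<forall>u. sv$''R'' u = (if u \<in> P then 1 else st$''R'' u)" "P \<subseteq> {..<?x}"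
   "card P * (un * K) <= 4 * N * card {i. i < lc & ?hit i ~= 0}"
   "\<forall>x<?x. 4 * N * card {e. e < ?n & ls e = x & ?hit (e div K) = 0} <= un * K"
   unfolding I_def scan_post_def Let_def K_def un_def ls_def lv_def by blast
  obtain xs where xs: "lst (st$''ch'') (st$''hd'' ?x) xs" "distinct xs" "set xs = E ?x"
   using ch(1) x unfolding chains_def E_def by blast
  have len: "length xs = card (E ?x)" using distinct_card[OF xs(2)] xs(3) by simp
  have lenn: "card (E ?x) <= ?n"
  proof -
   have "card (E ?x) <= card {..<?n}" by (intro card_mono) (auto simp: E_def)
   then show ?thesis by simp
  qed
  define F where "F = {e \<in> E ?x. ?hit (e div K) = 0}"
  have cF: "card F <= card (E ?x)" unfolding F_def using Efin by (intro card_mono) auto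
  have b: "4 * N * card F <= 4 * N * ?n" using cF lenn by (intro mult_left_mono) auto
  define sv1 where "sv1 = iu ''e'' 0 (st$''hd'' ?x) (iu ''cc'' 0 0 sv)"
  have cnt: "wp W count_loop (%t sv'. sv'$''cc'' 0 = card F & t <= 60 * card (E ?x) + 10 & unch count_loop sv1 sv') sv1"
  proof (rule wp_frame[OF wp_count_loop[where xs = xs and n = ?n]], goal_cases)
   case (4 e)
   then have "e < ?n" using xs(3) by (simp add: E_def)
   then show ?case using ch(3) div J(1) by (simp add: sv1_def f)
  qed (use xs len lenn W f F_def in \<open>auto simp: sv1_def\<close>)
  have fin: "I (iu ''x'' 0 (Suc ?x) sv')" if "scan_post N lc st sv' (Suc ?x)" for sv'
  proof -
   have "scan_post N lc st (iu ''x'' 0 (Suc ?x) sv') (Suc ?x) = scan_post N lc st sv' (Suc ?x)" by (simp add: scan_post_def)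
   then show ?thesis using that x by (simp add: I_def)
  qed
  have skip: "scan_post N lc st sv' (Suc ?x)" if "sv'$''hit'' = ?hit" "sv'$''bd'' = sv$''bd''" "sv'$''R'' = sv$''R''"
   and small: "4 * N * card F < un * K" for sv'
  proof -
   have "{e. e < ?n & ls e = ?x & ?hit (e div K) = 0} = F" by (auto simp: F_def E_def)
   then have "\<forall>x<Suc ?x. 4 * N * card {e. e < ?n & ls e = x & ?hit (e div K) = 0} <= un * K"
    using J(7) small by (auto simp: less_Suc_eq)
   moreover have "P \<subseteq> {..<Suc ?x}" using J(5) by auto
   ultimately show ?thesis using J(1-4,6) unfolding scan_post_def Let_def that(1-3) K_def[symmetric] un_def[symmetric] ls_def[symmetric] lv_def[symmetric]
    by blast
  qed
  have pick: "scan_post N lc st sv' (Suc ?x)" if h: "\<forall>g. sv'$''hit'' g = (if g \<in> (%e. e div K) ` E ?x & ?hit g = 0 then 1 else ?hit g)"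
   and bd: "\<forall>v. sv'$''bd'' v = (if \<exists>g\<in>(%e. e div K) ` E ?x. ?hit g = 0 & lv g = v then Suc ?x else sv$''bd'' v)"
   and R: "sv'$''R'' = (sv$''R'')(?x := 1)" and big: "un * K <= 4 * N * card F" for sv'
  proof -
   let ?G = "(%e. e div K) ` E ?x" and ?h' = "sv'$''hit''"
   have G: "g < lc" if "g \<in> ?G" for g using that div by (auto simp: E_def)
   have h0: "?h' g = 0 ==> ?hit g = 0" for g using h by (metis one_neq_zero)
   have a: "\<forall>i<lc. ?h' i <= 1" using h J(1) by auto
   have bdl: "sv'$''bd'' (lv i) = (if i \<in> ?G & ?hit i = 0 then Suc ?x else sv$''bd'' (lv i))" if i: "i < lc" for i
   proof -
    have "(\<exists>g\<in>?G. ?hit g = 0 & lv g = lv i) \<longleftrightarrow> i \<in> ?G & ?hit i = 0"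
     using inj_onD[OF lv(1)] i G by blast
    then show ?thesis using bd by simp
   qed
   have bb: "if ?h' i = 0 then sv'$''bd'' (lv i) = 0
    else \<exists>e\<in>{i * K..<i * K + K}. sv'$''bd'' (lv i) = Suc (ls e) & sv'$''R'' (ls e) ~= 0" if i: "i < lc" for i
   proof (cases "i \<in> ?G & ?hit i = 0")
    case True
    then obtain e where "e \<in> E ?x" "e div K = i" by auto
    then have "e \<in> {i * K..<i * K + K}" "ls e = ?x" using div_block[OF K] by (auto simp: E_def)
    moreover have "?h' i = 1" using h True by simp
    ultimately show ?thesis using bdl[OF i] True R by auto
   next
    case False
    then have "?h' i = ?hit i" using h by metis
    then show ?thesis using bdl[OF i] False J(2)[rule_format, OF i] R by (auto split: if_splits)
   qed
   have cc: "sv'$''bd'' v = st$''bd'' v" if "v \<notin> lv ` {..<lc}" for v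
   proof -
    have "\<not> (\<exists>g\<in>?G. ?hit g = 0 & lv g = v)" using that G by blast
    then show ?thesis using bd J(3) that by metis
   qed
   \<comment> \<open>The newly hit lists correspond one to one to the cells in \<open>F\<close>, so
     the number counted before the decision is exactly the progress made by it.\<close>
   have cardH: "card {i. i < lc & ?h' i ~= 0} = card {i. i < lc & ?hit i ~= 0} + card F"
   proof -
    have "{i. i < lc & ?h' i ~= 0} = {i. i < lc & ?hit i ~= 0} \<union> (%e. e div K) ` F"
    proof (intro set_eqI iffI)
     fix i assume "i \<in> {i. i < lc & ?h' i ~= 0}"
     then show "i \<in> {i. i < lc & ?hit i ~= 0} \<union> (%e. e div K) ` F"
      using h[rule_format, of i] by (cases "?hit i = 0") (auto simp: F_def split: if_splits)
    next
     fix i assume "i \<in> {i. i < lc & ?hit i ~= 0} \<union> (%e. e div K) ` F"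
     then show "i \<in> {i. i < lc & ?h' i ~= 0}"
      using h[rule_format, of i] G[of i] by (auto simp: F_def split: if_splits)
    qed
    moreover have "card ({i. i < lc & ?hit i ~= 0} \<union> (%e. e div K) ` F) = card {i. i < lc & ?hit i ~= 0} + card ((%e. e div K) ` F)"
     using Efin[of ?x] by (intro card_Un_disjoint) (auto simp: F_def)
    moreover have "card ((%e. e div K) ` F) = card F"
     by (rule card_image, rule inj_on_subset[OF Einj[of ?x]]) (auto simp: F_def)
    ultimately show ?thesis by simp
   qed
   have dd: "card (insert ?x P) * (un * K) <= 4 * N * card {i. i < lc & ?h' i ~= 0}"
   proof -
    have "card (insert ?x P) * (un * K) <= Suc (card P) * (un * K)"
     using J(5) finite_subset[OF J(5)] by (intro mult_right_mono) (auto simp: card_insert_if)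
    also have "\<dots> <= 4 * N * card {i. i < lc & ?hit i ~= 0} + 4 * N * card F" using J(6) big by simp
    finally show ?thesis unfolding cardH add_mult_distrib2 .
   qed
   have ee: "4 * N * card {e. e < ?n & ls e = x & ?h' (e div K) = 0} <= un * K" if "x < Suc ?x" for x
   proof (cases "x = ?x")
    case True
    have "?h' (e div K) ~= 0" if "e < ?n" "ls e = ?x" for e
     using that h[rule_format, of "e div K"] by (auto simp: E_def)
    then have "{e. e < ?n & ls e = x & ?h' (e div K) = 0} = {}" using True by blast
    then show ?thesis by (simp only: card.empty mult_0_right le0)
   next
    case False
    then have "4 * N * card {e. e < ?n & ls e = x & ?hit (e div K) = 0} <= un * K" using J(7) that by simp
    moreover have "card {e. e < ?n & ls e = x & ?h' (e div K) = 0} <= card {e. e < ?n & ls e = x & ?hit (e div K) = 0}"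
     using h0 by (intro card_mono) auto
    ultimately show ?thesis by (meson mult_left_mono order.trans zero_le)
   qed
   have "\<exists>P. (\<forall>u. sv'$''R'' u = (if u \<in> P then 1 else st$''R'' u)) & P \<subseteq> {..<Suc ?x} &
    card P * (un * K) <= 4 * N * card {i. i < lc & ?h' i ~= 0}"
    using J(4,5) dd R by (intro exI[of _ "insert ?x P"]) auto
   then show ?thesis using a bb cc ee unfolding scan_post_def Let_def K_def[symmetric] un_def[symmetric] ls_def[symmetric] lv_def[symmetric]
    by blast
  qed
  have mark: "wp W mark_loop (%t sv'. scan_post N lc st sv' (Suc ?x) & sv'$''x'' 0 = ?x & t <= 80 * card (E ?x) + 10) sv3"
   if t3: "sv3$''hit'' = ?hit" "sv3$''bd'' = sv$''bd''" "sv3$''R'' = (sv$''R'')(?x := 1)" "sv3$''x'' 0 = ?x"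
    "sv3$''e'' 0 = st$''hd'' ?x" "sv3$''K'' 0 = K" "sv3$''ch'' = st$''ch''" "sv3$''lv'' = lv"
    and big: "un * K <= 4 * N * card F" for sv3
  proof (rule wp_frame[OF wp_mark_loop[where xs = xs and n = ?n and st = sv3, unfolded t3]], goal_cases)
   case (2 e)
   then have "e < ?n" using xs(3) by (simp add: E_def)
   then show ?case using ch(3) div J(1) lv(2)[of "e div K"] W by (simp add: less_imp_le order.trans)
  next
   case (6 t sv')
   have "sv'$''R'' = (sv$''R'')(?x := 1)" "sv'$''x'' 0 = ?x" using 6(2) t3 by (simp_all add: unch_def)
   then show ?case using 6(1) pick big unfolding xs(3) len by blast
  qed (use xs W x in auto)
  have bW: "st$''hd'' ?x <= W" "?x < W" "Suc ?x <= W" "4 * N <= W" "4 * N * card F <= W" "4 <= W" "card F <= W" "N <= W"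
   using ch(2)[OF x] W x b cF lenn by linarith+
  have CS: "C ?x = card (E ?x) + C (Suc ?x)" by (rule CE)
  show ?case
   apply ((rule wp_ISeq, (use bW f in \<open>simp; fail\<close>)+)+)
   apply (simp add: f)
   apply (rule wp_Seq)
   apply (rule wp_mono[OF cnt[unfolded sv1_def]])
   apply (elim conjE)
   subgoal premises pr for t2 sv2
   proof -
    have g: "sv2$''N'' 0 = N" "sv2$''un'' 0 = un" "sv2$''K'' 0 = K" "sv2$''x'' 0 = ?x" "sv2$''hd'' = st$''hd''"
     "sv2$''hit'' = ?hit" "sv2$''bd'' = sv$''bd''" "sv2$''R'' = sv$''R''" "sv2$''ch'' = st$''ch''" "sv2$''lv'' = lv"
     using pr(3) f by (simp_all add: unch_def)
    have cc: "sv2$''cc'' 0 = card F" by (rule pr(1))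
    show ?thesis
    proof (rule wp_Seq, rule wp_Cond, goal_cases)
     case 1
     show ?case using bW g cc W by simp
    next
     case 2
     then have "4 * N * card F < un * K" using g cc by simp
     then have "I (iu ''x'' 0 (Suc ?x) sv2)" using g by (intro fin skip) auto
     then show ?case
      by (intro wp_Skip wp_IAssign) (use bW g x pr(2) CS in \<open>auto simp: Suc_diff_le\<close>)
    next
     case 3
     then have big: "un * K <= 4 * N * card F" using g cc by simp
     show ?case
      apply ((rule wp_ISeq, (use bW g in \<open>simp; fail\<close>)+)+)
      apply (simp add: g)
      apply (rule wp_mono[OF mark])
      using g big apply (simp_all)
      apply (elim conjE)
      apply (rule wp_IAssign)
      using bW x pr(2) CS by (auto intro!: fin)
    qed
   qed
   done
 next
  case (4 t sv)
  have "sv$''N'' 0 = N" using 4(2) N by (simp add: unch_def)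
  then have "sv$''x'' 0 = N" using 4(1,3) by (simp add: I_def)
  then show ?case using 4(1,4) x0 C0 by (simp add: I_def C_def)
 qed
qed

section \<open>One stage of the selection and its invariant\<close>

definition newU :: com where
 "newU = ''nw'' <- Lit 0 ;; ''g'' <- Lit 0 ;;
  While (ILess (V ''g'') (V ''ln''))
   (Cond (pos (IElem ''hit'' (V ''g''))) Skip (IAssign ''U'' (V ''nw'') (IElem ''lv'' (V ''g'')) ;; inc ''nw'') ;; inc ''g'') ;;
  ''un'' <- V ''nw''"

lemma wp_newU:
 fixes st
 defines "lc \<equiv> st$''ln'' 0" and "lv \<equiv> st$''lv''" and "hit \<equiv> st$''hit''"
 assumes lv: "inj_on lv {..<lc}" "\<And>i. i < lc ==> lv i <= W & hit i <= 1" and W: "lc + 2 <= W"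
 shows "wp W newU (%t st'. wl (st'$''U'') (st'$''un'' 0) (lv ` {i. i < lc & hit i = 0}) & t <= 80 * lc + 40) st"
proof -
 define L where "L = While (ILess (V ''g'') (V ''ln''))
   (Cond (pos (IElem ''hit'' (V ''g''))) Skip (IAssign ''U'' (V ''nw'') (IElem ''lv'' (V ''g'')) ;; inc ''nw'') ;; inc ''g'')"
 have loop: "wp W L (%t st'. wl (st'$''U'') (st'$''nw'' 0) (lv ` {i. i < lc & hit i = 0}) & st'$''nw'' 0 <= lc & t <= 80 * lc + 10)
   (iu ''g'' 0 0 (iu ''nw'' 0 0 st))"
  unfolding L_def
 proof (rule wp_While[where I = "%sv. sv$''g'' 0 <= lc & sv$''nw'' 0 <= sv$''g'' 0 &
    wl (sv$''U'') (sv$''nw'' 0) (lv ` {i. i < sv$''g'' 0 & hit i = 0})"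
    and \<phi> = "%sv. 80 * (lc - sv$''g'' 0)"], goal_cases)
  case (2 sv)
  then show ?case using W by (auto simp: unch_def lc_def)
 next
  case (3 sv)
  then have s: "sv$''ln'' 0 = lc" "sv$''lv'' = lv" "sv$''hit'' = hit" by (auto simp: unch_def lc_def lv_def hit_def)
  let ?g = "sv$''g'' 0"
  have g: "?g < lc" using 3(3) s by simp
  have b: "lv ?g <= W" "hit ?g <= 1" using lv(2)[OF g] by auto
  have bW: "Suc ?g <= W" "Suc (sv$''nw'' 0) <= W" "1 <= W" using g W 3(1) by auto
  have S: "{i. i < Suc ?g & hit i = 0} = (if hit ?g = 0 then insert ?g {i. i < ?g & hit i = 0} else {i. i < ?g & hit i = 0})"
   by (auto simp: less_Suc_eq)
  have ni: "lv ?g \<notin> lv ` {i. i < ?g & hit i = 0}"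
  proof
   assume "lv ?g \<in> lv ` {i. i < ?g & hit i = 0}"
   then obtain i where "i < ?g" "lv i = lv ?g" by auto
   then show False using inj_onD[OF lv(1), of i ?g] g by auto
  qed
  have w: "wl (sv$''U'') (sv$''nw'' 0) (lv ` {i. i < ?g & hit i = 0})" using 3(1) by blast
  show ?case
  proof (cases "hit ?g = 0")
   case True
   then have "wl ((sv$''U'')(sv$''nw'' 0 := lv ?g)) (Suc (sv$''nw'' 0)) (lv ` {i. i < Suc ?g & hit i = 0})"
    using wl_push[OF w ni] S by simp
   then show ?thesis
    by (intro wp_basic wp_Cond; (use b s bW True in \<open>simp; fail\<close>)?) (use 3(1) g True in \<open>auto simp: s\<close>)
  next
   case False
   then have "wl (sv$''U'') (sv$''nw'' 0) (lv ` {i. i < Suc ?g & hit i = 0})" using w S by simp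
   then show ?thesis
    by (intro wp_basic wp_Cond; (use b s bW False in \<open>simp; fail\<close>)?) (use 3(1) g False in \<open>auto simp: s\<close>)
  qed
 next
  case (4 t sv)
  then have "sv$''g'' 0 = lc" by (simp add: unch_def lc_def)
  then show ?case using 4 by simp
 qed (simp add: wl_def)
 show ?thesis unfolding newU_def L_def[symmetric]
  apply ((rule wp_ISeq, (use W in \<open>simp; fail\<close>)+)+)
  apply (simp only: ival.simps)
  apply (rule wp_Seq, rule wp_mono[OF loop])
  apply (rule wp_IAssign)
  using W by auto
qed

lemma time_aux:
 assumes "(t::nat) <= 100 * (a + b) + 160" "a <= c" "b <= c"
 shows "t <= 200 * c + 160"
proof -
 have "t <= 100 * (c + c) + 160"
  using assms(2,3) by (intro order.trans[OF assms(1)] add_mono mult_le_mono) auto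
 then show ?thesis by simp
qed

definition stage :: com where
 "stage = ''u'' <- Lit 0 ;; ''ln'' <- Lit 0 ;; ''lp'' <- Lit 0 ;; exall ;; mkchain ;; ''x'' <- Lit 0 ;; scan ;; newU ;;
  ''K'' <- ITimes (Lit 2) (V ''K'')"

context hgraph
begin

text \<open>Table cells of the vertices that have a centre. An unresolved vertex is explored afresh
  with a larger \<open>K\<close>; its old table stays in memory but is not counted.\<close>

definition sz :: "state => nat" where
 "sz st = (\<Sum>v\<in>{..<N} - st$''U'' ` {..<st$''un'' 0}. st$''te'' v - st$''ta'' v)"

definition rc :: "state => nat" where "rc st = card {x. x < N & st$''R'' x ~= 0}"

text \<open>After \<open>j\<close> stages \<open>K = k * 2 ^ j\<close>. The bound on
  \<open>rc\<close> is \<open>1\<close> plus the sum of \<open>4 * N / (k * 2 ^ i)\<close> over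
  \<open>i < j\<close>, multiplied by \<open>K\<close>. The product \<open>un * K * K\<close> does
  not grow, since \<open>un\<close> falls to a quarter when \<open>K\<close> doubles. In the last
  two bounds \<open>8 * (un * K)\<close> reserves cells for tables still to come: a stage writes at
  most \<open>4 * (un * K)\<close>, and \<open>un * K\<close> halves.\<close>

definition cinv :: "nat => state => bool" where
 "cinv k st \<longleftrightarrow> (let U = st$''U''; un = st$''un'' 0; K = st$''K'' 0; s = st$''src'' 0 in
  clean st & G st & s < N & st$''R'' s ~= 0 & rmem st ''zero'' 0 = 0 &
  st$''bd'' s = Suc s & (\<forall>x<N. st$''R'' x <= 1) &
  inj_on U {..<un} & (\<forall>j<un. U j < N & st$''bd'' (U j) = 0) & (\<forall>v<N. v \<notin> U ` {..<un} --> res st v) &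
  (\<exists>j. K = k * 2 ^ j & rc st * K + 8 * N <= K + 8 * N * 2 ^ j) & un * K * K <= N * k * k &
  st$''tp'' 0 + 8 * (un * K) <= 1 + 8 * (N * k) & sz st + 8 * (un * K) <= 1 + 8 * (N * k))"

text \<open>Dividing by \<open>un\<close> gives \<open>K * K <= (N / un) * k * k\<close>, which is
  below \<open>k ^ 3\<close> while the stages go on. Hence one exponent \<open>l\<close> serves the
  heaps of all stages.\<close>

lemma K_le_kk:
 fixes K k un :: nat
 assumes "un * K * K <= N * k * k" "N < un * k" "0 < k"
 shows "K <= k * k"
proof (rule ccontr)
 assume "\<not> K <= k * k"
 then have "k * k * (k * k) <= K * K" by (intro mult_mono) auto
 have "un * (k * k * (k * k)) <= un * (K * K)" using \<open>k * k * (k * k) <= K * K\<close> by (rule mult_left_mono) simp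
 also have "\<dots> <= N * (k * k)" using assms(1) by (simp add: mult.assoc)
 also have "\<dots> < un * k * (k * k)" using assms(2,3) by (intro mult_strict_right_mono) auto
 finally have "un * (k * k * (k * k)) < un * k * (k * k)" .
 moreover have "un * k * (k * k) * 1 <= un * k * (k * k) * k" using assms(3) by (intro mult_left_mono) auto
 moreover have "un * (k * k * (k * k)) = un * k * (k * k) * k" by (simp only: ac_simps)
 ultimately show False by linarith
qed

text \<open>A stage costs at most half of \<open>104000 * (l + 1) * (un * K)\<close>. The other half
  remains as potential, because \<open>un * K\<close> is at least halved.\<close>

lemma wp_stage:
 fixes st
 defines "un \<equiv> st$''un'' 0" and "K \<equiv> st$''K'' 0"
 assumes CI: "cinv k st" and big: "N < un * k" and k: "0 < k" and l: "3 * (k * k) + 4 <= 2 ^ l"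
  and W: "(4 * (8000 + (6000 * l + 26000) * (k * k)) + 2 * N + 30000) * (N + 1) <= W"
   "16 * (N * k) + 4 * (k * k) + 20 <= W" "4 * N * (N * k) + 4 * N + 4 <= W"
 shows "wp W stage (%t st'. cinv k st' & t + 20 + 104000 * (l + 1) * (st'$''un'' 0 * st'$''K'' 0) <= 104000 * (l + 1) * (un * K)) st"
proof -
 define U where "U = st$''U''"
 define s where "s = st$''src'' 0"
 define tp where "tp = st$''tp'' 0"
 obtain j where c: "clean st" "G st" "s < N" "st$''R'' s ~= 0" "rmem st ''zero'' 0 = 0" "st$''bd'' s = Suc s" "inj_on U {..<un}" 
  "\<forall>j<un. U j < N & st$''bd'' (U j) = 0" "\<forall>v<N. v \<notin> U ` {..<un} --> res st v" "K = k * 2 ^ j" "rc st * K + 8 * N <= K + 8 * N * 2 ^ j"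
  "un * K * K <= N * k * k" "tp + 8 * (un * K) <= 1 + 8 * (N * k)" "sz st + 8 * (un * K) <= 1 + 8 * (N * k)" "\<forall>x<N. st$''R'' x <= 1"
  using CI unfolding cinv_def Let_def un_def K_def U_def s_def tp_def by blast
 have K1: "1 <= K" "k <= K" using k c(10) by auto
 have Kkk: "K <= k * k" by (rule K_le_kk[OF c(12) big k])
 have un0: "0 < un" using big by (cases un) auto
 have unK: "un * K <= N * k" using c(13) by linarith
 have NunK: "N <= un * K"
 proof -
  have "un * k <= un * K" using K1 by (intro mult_left_mono) auto
  then show ?thesis using big by linarith
 qed
 have unU: "un <= un * K" "un <= N"
 proof -
  show "un <= un * K" using K1 by (cases K) auto
  have "card (U ` {..<un}) <= card {..<N}" using c(8) by (intro card_mono) auto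
  then show "un <= N" using card_image[OF c(7)] by simp
 qed
 have ps: "4 * N * lc <= 4 * N * (N * k)" if "lc <= un * K" for lc using that unK by (intro mult_left_mono) auto
 define st1 where "st1 = iu ''lp'' 0 0 (iu ''ln'' 0 0 (iu ''u'' 0 0 st))"
 have f1: "st1$''K'' 0 = K" "st1$''un'' 0 = un" "st1$''tp'' 0 = tp" "st1$''U'' = U" "st1$''src'' 0 = s"
  "clean st1" "G st1" "st1$''R'' = st$''R''" "rmem st1 = rmem st" "st1$''bd'' = st$''bd''"
  "st1$''u'' 0 = 0" "st1$''ln'' 0 = 0" "st1$''lp'' 0 = 0"
  using c(1,2) by (simp_all add: st1_def K_def un_def tp_def U_def s_def clean_def G_def)
 have W1: "(4 * (8000 + (6000 * l + 26000) * K) + 2 * N + 30000) * (N + 1) <= W"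
  using Kkk by (intro order.trans[OF mult_right_mono W(1)] add_mono mult_left_mono) auto
 have u3: "un * (3 * K + 1) <= 4 * (un * K)" using unU by (simp add: algebra_simps)
 have l': "3 * K + 4 <= 2 ^ l" using l Kkk by linarith
 define Bnd where "Bnd = 50100 * (l + 1) * K * un + 20"
 have body: "wp W (exall ;; mkchain ;; ''x'' <- Lit 0 ;; scan ;; newU ;; ''K'' <- ITimes (Lit 2) (V ''K''))
  (%t st'. cinv k st' & st'$''K'' 0 = 2 * K & 4 * st'$''un'' 0 <= un & t <= Bnd + 700 * (un * K) + 300) st1"
 proof (rule wp_Seq, rule wp_frame[OF wp_exall[where st = st1 and l = l, unfolded f1]], goal_cases)
  case (18 t2 st2)
  define lc where "lc = st2$''ln'' 0"
  define lv where "lv = st2$''lv''"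
  define ls where "ls = st2$''ls''"
  have A: "clean st2" "lc <= un" "st2$''lp'' 0 = lc * K" "inj_on lv {..<lc}" "lv ` {..<lc} \<subseteq> U ` {..<un}"
   "\<forall>i<lc. lst_ok st2 K i" "\<forall>v\<in>U ` {..<un} - lv ` {..<lc}. res st2 v"
   "\<forall>v\<in>U ` {..<un}. st2$''te'' v <= st2$''ta'' v + (3 * K + 1)"
   "\<forall>v. v \<notin> U ` {..<un} --> keeps v st1 st2 & st2$''bd'' v = st$''bd'' v"
   "st2$''tp'' 0 <= tp + un * (3 * K + 1)" "t2 <= Bnd"
   using 18(1) unfolding Let_def lc_def lv_def Bnd_def by blast+
  have f2: "st2$''K'' 0 = K" "st2$''un'' 0 = un" "st2$''src'' 0 = s" "st2$''R'' = st$''R''" "G st2" "st2$''U'' = U"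
   "rmem st2 ''zero'' 0 = 0" "st2$''N'' 0 = N"
   using 18(2) f1 c(5) by (simp_all add: unch_def G_def)
  have lcK: "lc * K <= un * K" using A(2) by (rule mult_right_mono) simp
  have lsN: "ls e < N" if "e < lc * K" for e
  proof -
   have "e div K < lc" using that by (simp add: less_mult_imp_div_less)
   moreover have "e \<in> {e div K * K..<e div K * K + K}" using div_block[of K e "e div K"] K1 by simp
   ultimately show ?thesis using A(6) unfolding lst_ok_def ls_def by blast
  qed
  have lvU: "lv i \<in> U ` {..<un}" "lv i < N" if "i < lc" for i using A(5) c(8) that by auto
  have WN: "N + 4 <= W" "lc * K + 4 <= W" "un <= W" "un * K <= W" "K <= W" "2 * K <= W"
   using W(2,3) unK lcK Kkk unU by linarith+
  show ?case
  proof (rule wp_Seq, rule wp_frame[OF wp_mkchain[where st = st2 and N = N, folded ls_def, unfolded A(3)]], goal_cases)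
   case (5 t3 st3)
   have f3: "st3$a = st2$a" if "a \<notin> {''x'', ''hd'', ''e'', ''ch''}" for a using 5(2) that by (simp add: unch_def)
   have r3: "rmem st3 = rmem st2" using 5(2) by (auto simp: unch_def)
   have chn: "chains (Suc N) ls (lc * K) (st3$''hd'') (st3$''ch'')" using 5(1) by blast
   define st4 where "st4 = iu ''x'' 0 0 st3"
   have f4: "st4$''K'' 0 = K" "st4$''un'' 0 = un" "st4$''ls'' = ls" "st4$''lv'' = lv" "st4$''N'' 0 = N"
    "st4$''hd'' = st3$''hd''" "st4$''ch'' = st3$''ch''" "st4$''hit'' = st2$''hit''" "st4$''bd'' = st2$''bd''"
    "st4$''x'' 0 = 0" "st4$''R'' = st$''R''"
    by (simp_all add: st4_def f3 f2 ls_def lv_def)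
   have sc: "wp W (scan ;; newU ;; ''K'' <- ITimes (Lit 2) (V ''K''))
    (%t st'. cinv k st' & st'$''K'' 0 = 2 * K & 4 * st'$''un'' 0 <= un & t <= 500 * (un * K) + 90) st4"
   proof (rule wp_Seq, rule wp_frame[OF wp_scan[where st = st4 and N = N and lc = lc, unfolded f4]], goal_cases)
    case (19 t5 st5)
    define hit where "hit = st5$''hit''"
    have f5: "st5$a = st2$a" if "a \<notin> {''x'', ''hd'', ''e'', ''ch'', ''cc'', ''R'', ''g'', ''hit'', ''bd''}" for a
     using 19(2) f3 that by (simp add: unch_def st4_def)
    have r5: "rmem st5 = rmem st2" using 19(2) r3 by (auto simp: unch_def st4_def)
    obtain P where S: "\<forall>i<lc. hit i <= 1"
     "\<forall>i<lc. if hit i = 0 then st5$''bd'' (lv i) = 0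
      else \<exists>e\<in>{i * K..<i * K + K}. st5$''bd'' (lv i) = Suc (ls e) & st5$''R'' (ls e) ~= 0"
     "\<forall>v. v \<notin> lv ` {..<lc} --> st5$''bd'' v = st2$''bd'' v"
     "\<forall>u. st5$''R'' u = (if u \<in> P then 1 else st$''R'' u)" "P \<subseteq> {..<N}"
     "card P * (un * K) <= 4 * N * card {i. i < lc & hit i ~= 0}"
     "\<forall>x<N. 4 * N * card {e. e < lc * K & ls e = x & hit (e div K) = 0} <= un * K"
     and t5: "t5 <= 200 * (lc * K) + 200 * N + 20"
     using 19(1) unfolding scan_post_def Let_def f4 hit_def by blast
    let ?H = "{i. i < lc & hit i = 0}"
    \<comment> \<open>Double counting of the cells of unhit lists: there are \<open>K\<close> in
      each such list, and by the last clause of \<open>scan_post\<close> at most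
      \<open>un * K / (4 * N)\<close> for each of the \<open>N\<close> vertices.\<close>
    have un': "4 * card ?H <= un"
    proof -
     have "{e. e < lc * K & hit (e div K) = 0} = (\<Union>x<N. {e. e < lc * K & ls e = x & hit (e div K) = 0})" using lsN by auto
     then have "card {e. e < lc * K & hit (e div K) = 0} = (\<Sum>x<N. card {e. e < lc * K & ls e = x & hit (e div K) = 0})"
      by (simp only:) (rule card_UN_disjoint, auto)
     then have "4 * N * card {e. e < lc * K & hit (e div K) = 0} = (\<Sum>x<N. 4 * N * card {e. e < lc * K & ls e = x & hit (e div K) = 0})"
      by (simp add: sum_distrib_left)
     also have "\<dots> <= (\<Sum>x<N. un * K)" using S(7) by (intro sum_mono) auto
     finally have 1: "4 * N * card {e. e < lc * K & hit (e div K) = 0} <= N * (un * K)" by simp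
     have "{e. e < lc * K & hit (e div K) = 0} = (\<Union>i\<in>?H. {i * K..<i * K + K})"
     proof (intro set_eqI iffI)
      fix e assume e: "e \<in> {e. e < lc * K & hit (e div K) = 0}"
      then have "e div K \<in> ?H" by (simp add: less_mult_imp_div_less)
      moreover have "e \<in> {e div K * K..<e div K * K + K}" using div_block[of K e "e div K"] K1 by simp
      ultimately show "e \<in> (\<Union>i\<in>?H. {i * K..<i * K + K})" by blast
     next
      fix e assume "e \<in> (\<Union>i\<in>?H. {i * K..<i * K + K})"
      then obtain i where i: "i < lc" "hit i = 0" "e \<in> {i * K..<i * K + K}" by blast
      then have "e div K = i" using div_block[of K e i] K1 by simp
      moreover have "Suc i * K <= lc * K" using i by (intro mult_right_mono) auto
      ultimately show "e \<in> {e. e < lc * K & hit (e div K) = 0}" using i by auto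
     qed
     moreover have dis: "{i * K..<i * K + K} \<inter> {j * K..<j * K + K} = {}" if "i ~= j" for i j
     proof (rule equals0I)
      fix x assume "x \<in> {i * K..<i * K + K} \<inter> {j * K..<j * K + K}"
      then have "x div K = i" "x div K = j" using div_block[of K x i] div_block[of K x j] K1 by auto
      with that show False by simp
     qed
     moreover have "card (\<Union>i\<in>?H. {i * K..<i * K + K}) = (\<Sum>i\<in>?H. card {i * K..<i * K + K})"
      by (rule card_UN_disjoint, simp, simp, use dis in blast)
     ultimately have "card {e. e < lc * K & hit (e div K) = 0} = (\<Sum>i\<in>?H. card {i * K..<i * K + K})"
      by (simp only:)
     then have "card {e. e < lc * K & hit (e div K) = 0} = card ?H * K" by simp
     with 1 have "N * K * (4 * card ?H) <= N * K * un" by (simp add: ac_simps)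
     moreover have "0 < N * K" using c(3) K1 by simp
     ultimately show ?thesis by (simp only: mult_le_cancel1)
    qed
    \<comment> \<open>Every new centre hit at least \<open>un * K / (4 * N)\<close> lists, and at
      most \<open>un\<close> lists exist.\<close>
    have PK: "card P * K <= 4 * N"
    proof -
     have "card {i. i < lc & hit i ~= 0} <= card {..<lc}" by (intro card_mono) auto
     then have "4 * N * card {i. i < lc & hit i ~= 0} <= 4 * N * un" using A(2) by (intro mult_left_mono) auto
     then have "card P * (un * K) <= 4 * N * un" using S(6) by linarith
     then have "un * (card P * K) <= un * (4 * N)" by (simp add: ac_simps)
     then show ?thesis using un0 by simp
    qed
    have rc5: "card {x. x < N & st5$''R'' x ~= 0} <= rc st + card P"
    proof -
     have "card {x. x < N & st5$''R'' x ~= 0} <= card ({x. x < N & st$''R'' x ~= 0} \<union> P)"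
      using S(4) finite_subset[OF S(5)] by (intro card_mono) auto
     also have "\<dots> <= rc st + card P" unfolding rc_def by (rule card_Un_le)
     finally show ?thesis .
    qed
    have Rm: "st5$''R'' u ~= 0" if "st$''R'' u ~= 0" for u using S(4) that by simp
    have kp: "keeps v st2 st5" for v by (simp add: keeps_def f5 r5)
    have src5: "st5$''src'' 0 = s" by (simp add: f5 f2)
    show ?case
    proof (rule wp_Seq, rule wp_frame[OF wp_newU], goal_cases)
     case 1
     show ?case using A(4) by (simp add: f5 lv_def lc_def)
    next
     case (2 i)
     then have "i < lc" by (simp add: f5 lc_def)
     then show ?case using lvU(2)[of i] S(1) WN by (simp add: f5 lv_def[symmetric] hit_def[symmetric])
    next
     case 3
     have "lc <= lc * K" using K1 by (cases K) auto
     then have "lc + 2 <= W" using WN(2) by linarith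
     then show ?case by (simp add: f5 lc_def[symmetric])
    next
     case (4 t6 st6)
     have w6: "wl (st6$''U'') (st6$''un'' 0) (lv ` ?H)" "t6 <= 80 * lc + 40"
      using 4(1) by (simp_all add: f5 lc_def[symmetric] lv_def[symmetric] hit_def[symmetric])
     have f6: "st6$a = st5$a" if "a \<notin> {''nw'', ''g'', ''U'', ''un''}" for a using 4(2) that by (simp add: unch_def newU_def)
     have r6: "rmem st6 = rmem st5" using 4(2) by (auto simp: unch_def newU_def)
     have cH: "st6$''un'' 0 = card ?H"
     proof -
      have "st6$''un'' 0 = card (lv ` ?H)" using wl_card[OF w6(1)] by simp
      also have "\<dots> = card ?H" by (rule card_image, rule inj_on_subset[OF A(4)]) auto
      finally show ?thesis .
     qed
     define st7 where "st7 = iu ''K'' 0 (2 * K) st6"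
     have f7: "st7$a = st5$a" if "a \<notin> {''nw'', ''g'', ''U'', ''un'', ''K''}" for a using f6 that by (simp add: st7_def)
     have r7: "rmem st7 = rmem st2" using r6 r5 by (simp add: st7_def)
     have U7: "st7$''U'' ` {..<st7$''un'' 0} = lv ` ?H" "inj_on (st7$''U'') {..<st7$''un'' 0}"
      "st7$''un'' 0 = card ?H" "st7$''K'' 0 = 2 * K"
      using w6 cH by (simp_all add: st7_def wl_def)
     have kp7: "keeps v st2 st7" for v by (simp add: keeps_def f7 f5 r7)
     have kp17: "keeps v st st7" if "v \<notin> U ` {..<un}" for v
     proof -
      have "keeps v st1 st2" using A(9) that by blast
      then show ?thesis using kp7[of v] unfolding keeps_def st1_def by (auto intro: order.trans)
     qed
     have res7: "res st7 v" if v: "v < N" "v \<notin> lv ` ?H" for v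
     proof (cases "v \<in> lv ` {..<lc}")
      case True
      then obtain i where i: "i < lc" "lv i = v" by auto
      with v have "hit i ~= 0" by auto
      then obtain e where e: "e \<in> {i * K..<i * K + K}" "st5$''bd'' v = Suc (ls e)" "st5$''R'' (ls e) ~= 0"
       using S(2)[rule_format, OF i(1)] i(2) by auto
      have L: "lst_ok st2 K i" using A(6) i by blast
      then have "tab st2 v" "rch st2 v (ls e)" "ls e < N" using e(1) i(2) by (auto simp: lst_ok_def lv_def ls_def)
      then show ?thesis using e keeps_tab[OF kp7] unfolding res_def by (auto simp: f7)
     next
      case False
      show ?thesis
      proof (cases "v \<in> U ` {..<un}")
       case True
       then have "res st2 v" using A(7) False by blast
       then show ?thesis
        by (rule keeps_res[OF kp7]) (use S(3,4) False f2 in \<open>auto simp: f7 f5\<close>)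
      next
       case F: False
       have "res st v" using c(9) v F by blast
       then show ?thesis
        by (rule keeps_res[OF kp17[OF F]]) (use S(3) A(9) False F Rm src5 in \<open>auto simp: f7 s_def[symmetric]\<close>)
      qed
     qed
     have sU: "s \<notin> U ` {..<un}" using c(6,8) by auto
     have sl: "s \<notin> lv ` {..<lc}" using sU A(5) by blast
     have sz7: "sz st7 <= sz st + un * (3 * K + 1)"
     proof -
      let ?d = "%v. st7$''te'' v - st7$''ta'' v"
      have sub: "lv ` ?H \<subseteq> U ` {..<un}" using A(5) by auto
      have "sz st7 <= sum ?d (({..<N} - U ` {..<un}) \<union> U ` {..<un})"
       unfolding sz_def U7(1) by (rule sum_mono2) auto
      also have "\<dots> = sum ?d ({..<N} - U ` {..<un}) + sum ?d (U ` {..<un})" by (rule sum.union_disjoint) auto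
      also have "sum ?d ({..<N} - U ` {..<un}) = sz st"
       unfolding sz_def U_def[symmetric] un_def[symmetric] using kp17 by (intro sum.cong) (auto simp: keeps_def)
      also have "sum ?d (U ` {..<un}) <= (\<Sum>v\<in>U ` {..<un}. 3 * K + 1)"
      proof (rule sum_mono)
       fix v assume "v \<in> U ` {..<un}"
       then have "st2$''te'' v <= st2$''ta'' v + (3 * K + 1)" using A(8) by blast
       then show "?d v <= 3 * K + 1" by (simp add: f7 f5)
      qed
      also have "\<dots> = un * (3 * K + 1)" using card_image[OF c(7)] by simp
      finally show ?thesis by simp
     qed
     have unK7: "8 * (card ?H * (2 * K)) <= 4 * (un * K)"
      using mult_right_mono[OF un', of "4 * K"] by (simp add: ac_simps)
     have tp7: "st7$''tp'' 0 <= tp + 4 * (un * K)" using order.trans[OF A(10) add_left_mono[OF u3]] by (simp add: f7 f5)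
     have ci: "cinv k st7"
      unfolding cinv_def Let_def U7
     proof (intro conjI)
      show "clean st7" using A(1) unfolding clean_def by (simp add: f7 f5 r7)
      show "G st7" using f2 by (simp add: G_def f7 f5 r7)
      show "st7$''src'' 0 < N" "st7$''R'' (st7$''src'' 0) ~= 0" "rmem st7 ''zero'' 0 = 0"
       using c(3,4) Rm f2 by (simp_all add: f7 src5 r7)
      show "st7$''bd'' (st7$''src'' 0) = Suc (st7$''src'' 0)"
       using S(3) sl A(9) sU c(6) by (simp add: f7 src5)
      show "\<forall>x<N. st7$''R'' x <= 1" using c(15) S(4) by (simp add: f7)
      show "inj_on (st7$''U'') {..<card ?H}" using U7 by simp
      show "\<forall>j<card ?H. st7$''U'' j < N & st7$''bd'' (st7$''U'' j) = 0"
      proof (intro allI impI)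
       fix j assume "j < card ?H"
       then have "st7$''U'' j \<in> lv ` ?H" using U7 by auto
       then obtain i where "i < lc" "hit i = 0" "st7$''U'' j = lv i" by auto
       then show "st7$''U'' j < N & st7$''bd'' (st7$''U'' j) = 0"
        using lvU(2)[of i] S(2)[rule_format, of i] by (simp add: f7)
      qed
      show "\<forall>v<N. v \<notin> st7$''U'' ` {..<card ?H} --> res st7 v" using res7 U7 by simp
      show "\<exists>j. 2 * K = k * 2 ^ j & rc st7 * (2 * K) + 8 * N <= 2 * K + 8 * N * 2 ^ j"
      proof (intro exI[of _ "Suc j"] conjI)
       show "2 * K = k * 2 ^ Suc j" using c(10) by simp
       have "rc st7 <= rc st + card P" using rc5 by (simp add: rc_def f7)
       then have "rc st7 * (2 * K) <= (rc st + card P) * (2 * K)" by (rule mult_right_mono) simp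
       also have "\<dots> = 2 * (rc st * K) + 2 * (card P * K)" by (simp add: algebra_simps)
       finally show "rc st7 * (2 * K) + 8 * N <= 2 * K + 8 * N * 2 ^ Suc j" using c(11) PK by simp
      qed
      show "card ?H * (2 * K) * (2 * K) <= N * k * k"
      proof -
       have "card ?H * (2 * K) * (2 * K) = 4 * card ?H * (K * K)" by simp
       also have "\<dots> <= un * (K * K)" using un' by (rule mult_right_mono) simp
       also have "\<dots> <= N * k * k" using c(12) by (simp only: mult.assoc)
       finally show ?thesis .
      qed
      show "st7$''tp'' 0 + 8 * (card ?H * (2 * K)) <= 1 + 8 * (N * k)" using tp7 unK7 c(13) by linarith
      show "sz st7 + 8 * (card ?H * (2 * K)) <= 1 + 8 * (N * k)" using sz7 u3 unK7 c(14) by linarith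
     qed
     have tt: "t5 + t6 + 20 <= 500 * (un * K) + 90"
     proof -
      have "lc <= un * K" using A(2) unU by linarith
      moreover have "200 * (lc * K) <= 200 * (un * K)" by (intro mult_left_mono lcK) simp
      ultimately show ?thesis using t5 w6(2) NunK by linarith
     qed
     have K6: "st6$''K'' 0 = K" by (simp add: f6 f5 f2)
     show ?case
      by (rule wp_IAssign) (use WN K6 ci tt un' U7 in \<open>auto simp: st7_def\<close>)
    qed
   next
    case (8 i)
    then show ?case using A(6) by (simp add: lst_ok_def ls_def)
   next
    case (12 i)
    then show ?case using A(6) by (simp add: lst_ok_def)
   next
    case (13 i)
    then show ?case using A(6) by (simp add: lst_ok_def lv_def)
   next
    case 14
    then show ?case using ps[OF lcK] W(3) by linarith
   next
    case 5
    then show ?case by (rule chains_mono[OF chn]) simp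
   qed (use 5(1) K1 un0 lsN A(4) lvU WN in auto)
   have "t3 <= 100 * (N + lc * K) + 160" using 5(1) by blast
   then have t3: "t3 <= 200 * (un * K) + 160" using NunK lcK by (rule time_aux)
   show ?case
    apply (rule wp_ISeq)
    using WN apply (simp, simp)
    apply (simp only: ival.simps)
    apply (rule wp_mono[OF sc[unfolded st4_def]])
    using t3 A(11) by auto
  qed (use lsN f2 WN in \<open>auto simp: less_imp_le\<close>)
 qed (use c f1 l' K1 W1 W u3 unK unU Kkk in \<open>auto simp: algebra_simps\<close>)
 have fin: "Bnd + 700 * (un * K) + 300 + 60 <= 52000 * (l + 1) * (un * K)"
 proof -
  have "1 <= un * K" using un0 K1 by simp
  moreover have "un * K <= (l + 1) * (un * K)" by simp
  moreover have "Bnd = 50100 * ((l + 1) * (un * K)) + 20" by (simp only: Bnd_def ac_simps)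
  ultimately have "Bnd + 700 * (un * K) + 300 + 60 <= 52000 * ((l + 1) * (un * K))" by linarith
  then show ?thesis by (simp only: mult.assoc)
 qed
 have W0: "1 <= W" using W by simp
 show ?thesis unfolding stage_def
  apply ((rule wp_ISeq, (use W0 in \<open>simp; fail\<close>)+)+)
  apply (simp only: ival.simps)
  apply (rule wp_mono[OF body[unfolded st1_def]])
  subgoal for t st'
  proof -
   assume h: "cinv k st' & st'$''K'' 0 = 2 * K & 4 * st'$''un'' 0 <= un & t <= Bnd + 700 * (un * K) + 300"
   then have "4 * st'$''un'' 0 * K <= un * K" by (intro mult_right_mono) auto
   then have "2 * (st'$''un'' 0 * st'$''K'' 0) <= un * K" using h by (simp add: ac_simps)
   then have "52000 * (l + 1) * (2 * (st'$''un'' 0 * st'$''K'' 0)) <= 52000 * (l + 1) * (un * K)" by (rule mult_left_mono) simp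
   then show ?thesis using h fin by (simp add: algebra_simps)
  qed
  done
qed

end

text \<open>As a congruence rule, this keeps the simplifier from rewriting inside the program and the state.\<close>

lemma wp_cong: "wp W c Q st = wp W c Q st" ..

lemma wp_IE:
 assumes "ival i st = j" "ival e st = v" "iok W i st" "iok W e st"
  "wp W c (%t. Q (1 + icost i + icost e + t)) (iu a j v st)"
 shows "wp W (Seq (IAssign a i e) c) Q st"
 using assms by (intro wp_ISeq) auto

lemma wp_RE:
 assumes "ival i st = j" "rval e st = v" "iok W i st" "rok W e st"
  "wp W c (%t. Q (1 + icost i + rcost e + t)) (ru a j v st)"
 shows "wp W (Seq (RAssign a i e) c) Q st"
 using assms by (intro wp_RSeq) auto

section \<open>Start and end of the selection\<close>

definition cinit_loop :: com where
 "cinit_loop = While (ILess (V ''x'') (V ''N''))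
  (Cond (BAnd (BNot (ILess (V ''x'') (V ''src''))) (BNot (ILess (V ''src'') (V ''x'')))) Skip
    (IAssign ''U'' (V ''un'') (V ''x'') ;; inc ''un'') ;;
   inc ''x'')"

text \<open>The source is a centre from the beginning, since explorations that exhaust their
  component fall back on it. Its own table has a single cell.\<close>

definition cinit :: com where
 "cinit = IAssign ''R'' (V ''src'') (Lit 1) ;; IAssign ''bd'' (V ''src'') (IPlus (V ''src'') (Lit 1)) ;;
  IAssign ''ta'' (V ''src'') (Lit 0) ;; IAssign ''tz'' (Lit 0) (V ''src'') ;;
  RAssign ''td'' (Lit 0) (RElem ''zero'' (Lit 0)) ;; IAssign ''te'' (V ''src'') (Lit 1) ;;
  ''tp'' <- Lit 1 ;; ''K'' <- V ''k'' ;; ''un'' <- Lit 0 ;; ''x'' <- Lit 0 ;; cinit_loop"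

text \<open>The remaining vertices, at most \<open>N / k\<close> of them, become their own centres.
  Continuing the stages would enlarge \<open>K\<close> without need for the bound on the
  centres.\<close>

definition cfin_loop :: com where
 "cfin_loop = While (ILess (V ''u'') (V ''un''))
  (''x'' <- IElem ''U'' (V ''u'') ;; IAssign ''R'' (V ''x'') (Lit 1) ;; IAssign ''bd'' (V ''x'') (IPlus (V ''x'') (Lit 1)) ;;
   IAssign ''ta'' (V ''x'') (V ''tp'') ;; IAssign ''tz'' (V ''tp'') (V ''x'') ;;
   RAssign ''td'' (V ''tp'') (RElem ''zero'' (Lit 0)) ;; inc ''tp'' ;; IAssign ''te'' (V ''x'') (V ''tp'') ;; inc ''u'')"

definition centres :: com where
 "centres = cinit ;; While (ILess (V ''N'') (ITimes (V ''un'') (V ''k''))) stage ;; ''u'' <- Lit 0 ;; cfin_loop"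

lemma wp_cinit_loop:
 fixes st
 defines "s \<equiv> st$''src'' 0"
 assumes N: "st$''N'' 0 = N" and s: "s < N" and x: "st$''x'' 0 = 0" "st$''un'' 0 = 0" and W: "N + 1 <= W"
 shows "wp W cinit_loop (%t st'. wl (st'$''U'') (st'$''un'' 0) ({..<N} - {s}) & t <= 100 * N + 10) st"
 unfolding cinit_loop_def
proof (rule wp_While[where I = "%sv. sv$''x'' 0 <= N & sv$''un'' 0 <= sv$''x'' 0 &
   wl (sv$''U'') (sv$''un'' 0) ({..<sv$''x'' 0} - {s})"
   and \<phi> = "%sv. 100 * (N - sv$''x'' 0)"], goal_cases)
 case (3 sv)
 then have f: "sv$''N'' 0 = N" "sv$''src'' 0 = s" using N by (auto simp: unch_def s_def)
 let ?x = "sv$''x'' 0"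
 have xN: "?x < N" using 3(3) f by simp
 have b: "Suc ?x <= W" "Suc (sv$''un'' 0) <= W" "s <= W" "1 <= W" using xN 3(1) W s by auto
 have w: "wl (sv$''U'') (sv$''un'' 0) ({..<?x} - {s})" using 3(1) by blast
 show ?case
 proof (cases "?x = s")
  case True
  then have "{..<Suc ?x} - {s} = {..<?x} - {s}" by auto
  with w have "wl (sv$''U'') (sv$''un'' 0) ({..<Suc ?x} - {s})" by simp
  then show ?thesis
   by (intro wp_basic wp_Cond; (use b f True in \<open>simp; fail\<close>)?) (use 3(1) f xN True in auto)
 next
  case False
  then have "{..<Suc ?x} - {s} = insert ?x ({..<?x} - {s})" by auto
  with wl_push[OF w, of ?x] have "wl ((sv$''U'')(sv$''un'' 0 := ?x)) (Suc (sv$''un'' 0)) ({..<Suc ?x} - {s})" by simp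
  then show ?thesis
   by (intro wp_basic wp_Cond; (use b f False in \<open>simp; fail\<close>)?) (use 3(1) f xN False in auto)
 qed
next
 case (2 sv)
 then show ?case using N W by (auto simp: unch_def)
next
 case (4 t sv)
 then have "sv$''x'' 0 = N" using N by (simp add: unch_def)
 then show ?case using 4 x by simp
qed (use x in \<open>auto simp: wl_def\<close>)

context hgraph
begin

definition tsum :: "state => nat" where "tsum st = (\<Sum>v<N. st$''te'' v - st$''ta'' v)"

definition cpost :: "nat => state => bool" where
 "cpost k st \<longleftrightarrow> clean st & G st & st$''src'' 0 < N & rmem st ''zero'' 0 = 0 & st$''bd'' (st$''src'' 0) ~= 0 &
  (\<forall>x<N. st$''R'' x <= 1) & (\<forall>v<N. res st v) & rc st * k <= k + 9 * N &
  tsum st <= 1 + 9 * (N * k) & st$''tp'' 0 <= 1 + 9 * (N * k)"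

text \<open>Completeness is vacuous: a walk from \<open>v\<close> shorter than 0 does not
  exist.\<close>

lemma single_table:
 assumes "v < N" "tz a = v" "td a = 0"
 shows "table tz td v a (Suc a)" "reaches tz td v a (Suc a) v"
 using assms walk_refl by (auto simp: table_def reaches_def less_Suc_eq_le intro!: exI[of _ a] dest: walk_nn)

lemma wp_cinit:
 fixes st
 defines "s \<equiv> st$''src'' 0" and "k \<equiv> st$''k'' 0"
 assumes c: "clean st" "G st" "s < N" "rmem st ''zero'' 0 = 0" and z: "\<And>x. x < N ==> st$''R'' x = 0 & st$''bd'' x = 0"
  and W: "N + k + 2 <= W"
 shows "wp W cinit (%t st'. cinv k st' & st'$''K'' 0 = k & st'$''un'' 0 <= N & t <= 100 * N + 80) st"
proof -
 define st1 where "st1 = iu ''x'' 0 0 (iu ''un'' 0 0 (iu ''K'' 0 k (iu ''tp'' 0 (Suc 0) (iu ''te'' s (Suc 0) (ru ''td'' 0 0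
  (iu ''tz'' 0 s (iu ''ta'' s 0 (iu ''bd'' s (Suc s) (iu ''R'' s (Suc 0) st)))))))))"
 have N: "st$''N'' 0 = N" using c by (simp add: G_def)
 have lp: "wp W cinit_loop (%t st'. cinv k st' & st'$''K'' 0 = k & st'$''un'' 0 <= N & t <= 100 * N + 10) st1"
 proof (rule wp_frame[OF wp_cinit_loop[where st = st1 and N = N]], goal_cases)
  case (6 t st')
  have w: "wl (st'$''U'') (st'$''un'' 0) ({..<N} - {s})" using 6(1) by (simp add: st1_def s_def)
  have f: "st'$a = st1$a" if "a \<notin> {''U'', ''un'', ''x''}" for a using 6(2) that by (simp add: unch_def cinit_loop_def)
  have r: "rmem st' = rmem st1" using 6(2) by (auto simp: unch_def cinit_loop_def)
  have un: "st'$''un'' 0 = N - 1" using wl_card[OF w] c(3) by simp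
  have src: "st'$''src'' 0 = s" by (simp add: f st1_def s_def)
  have U: "st'$''U'' ` {..<N - 1} = {..<N} - {s}" "inj_on (st'$''U'') {..<N - 1}" using w by (simp_all add: wl_def un)
  have K: "st'$''K'' 0 = k" by (simp add: f st1_def)
  note stp = single_table[OF c(3), of "st'$''tz''" 0 "rmem st' ''td''"]
  have g: "st'$''tz'' 0 = s" "rmem st' ''td'' 0 = 0" "st'$''ta'' s = 0" "st'$''te'' s = Suc 0" "st'$''tp'' 0 = Suc 0"
   "st'$''bd'' s = Suc s" "st'$''R'' s ~= 0"
   by (simp_all add: f r st1_def)
  have "tab st' s" "rch st' s s" unfolding tab_def rch_def g by (rule conjI[OF stp(1)[OF g(1,2)]], simp, rule stp(2)[OF g(1,2)])
  then have rs: "res st' s" using g c(3) unfolding res_def by blast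
  have NK: "(N - 1) * k <= N * k" by (rule mult_right_mono) auto
  have "cinv k st'"
   unfolding cinv_def Let_def un src K
  proof (intro conjI)
   show "clean st'" using c(1) unfolding clean_def by (simp add: f r st1_def)
   show "G st'" using c(2) by (simp add: G_def f r st1_def)
   show "s < N" by (rule c)
   show "st'$''R'' s ~= 0" "rmem st' ''zero'' 0 = 0" "st'$''bd'' s = Suc s" using c(4) by (simp_all add: f r st1_def)
   show "\<forall>x<N. st'$''R'' x <= 1" using z by (simp add: f st1_def)
   show "inj_on (st'$''U'') {..<N - 1}" by (rule U)
   show "\<forall>j<N - 1. st'$''U'' j < N & st'$''bd'' (st'$''U'' j) = 0"
   proof (intro allI impI)
    fix j assume "j < N - 1"
    then have "st'$''U'' j \<in> {..<N} - {s}" using U(1) by blast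
    then show "st'$''U'' j < N & st'$''bd'' (st'$''U'' j) = 0" using z by (simp add: f st1_def)
   qed
   show "\<forall>v<N. v \<notin> st'$''U'' ` {..<N - 1} --> res st' v" unfolding U(1) using rs by auto
   have "{x. x < N & st'$''R'' x ~= 0} = {s}" using z c(3) by (auto simp: f st1_def)
   then have "rc st' = 1" unfolding rc_def by (simp only:) simp
   then show "\<exists>j. k = k * 2 ^ j & rc st' * k + 8 * N <= k + 8 * N * 2 ^ j" by (intro exI[of _ 0]) simp
   show "(N - 1) * k * k <= N * k * k" using NK by (rule mult_right_mono) simp
   show "st'$''tp'' 0 + 8 * ((N - 1) * k) <= 1 + 8 * (N * k)" using NK by (simp add: f st1_def)
   have "{..<N} - ({..<N} - {s}) = {s}" using c(3) by auto
   then have "sz st' = 1" unfolding sz_def un U(1) by (simp add: f st1_def)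
   then show "sz st' + 8 * ((N - 1) * k) <= 1 + 8 * (N * k)" using NK by simp
  qed
  then show ?case using 6(1) K un by simp
 qed (use c N W in \<open>auto simp: st1_def s_def\<close>)
 have b: "s <= W" "Suc s <= W" "k <= W" "Suc 0 <= W" "st$''src'' 0 = s" "st$''k'' 0 = k" "rmem st ''zero'' 0 = 0"
  using c(3,4) W by (auto simp: s_def k_def)
 show ?thesis unfolding cinit_def
  apply ((rule wp_IE, (simp add: b cong: wp_cong; fail)+)+)
  apply (rule wp_RE, (simp add: b cong: wp_cong; fail)+)
  apply ((rule wp_IE, (simp add: b cong: wp_cong; fail)+)+)
  apply (rule wp_mono[OF lp[unfolded st1_def]])
  by auto
qed

lemma wp_cfin:
 fixes st k
 defines "un \<equiv> st$''un'' 0"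
 assumes CI: "cinv k st" and un: "un * k <= N" and k: "0 < k" and u: "st$''u'' 0 = 0" and W: "20 * (N * k) + 20 <= W"
 shows "wp W cfin_loop (%t st'. cpost k st' & t <= 200 * N + 10) st"
proof -
 define U where "U = st$''U''"
 define s where "s = st$''src'' 0"
 define tp where "tp = st$''tp'' 0"
 define K where "K = st$''K'' 0"
 obtain j where c: "clean st" "G st" "s < N" "st$''R'' s ~= 0" "rmem st ''zero'' 0 = 0" "st$''bd'' s = Suc s" "inj_on U {..<un}"
  "\<forall>j<un. U j < N & st$''bd'' (U j) = 0" "\<forall>v<N. v \<notin> U ` {..<un} --> res st v" "K = k * 2 ^ j" "rc st * K + 8 * N <= K + 8 * N * 2 ^ j"
  "tp + 8 * (un * K) <= 1 + 8 * (N * k)" "sz st + 8 * (un * K) <= 1 + 8 * (N * k)" "\<forall>x<N. st$''R'' x <= 1"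
  using CI unfolding cinv_def Let_def un_def U_def s_def tp_def K_def by blast
 have Nk: "N <= N * k" using k by (cases k) auto
 have unN: "un <= N" using un k by (cases k) auto
 have unle: "un <= N * k" using unN Nk by linarith
 define X where "X = (%sv :: state. U ` {..<sv$''u'' 0})"
 define I where "I = (%sv. sv$''u'' 0 <= un & clean sv & sv$''tp'' 0 = tp + sv$''u'' 0 &
  (\<forall>x. sv$''R'' x = (if x \<in> X sv then 1 else st$''R'' x)) &
  (\<forall>v. v \<notin> X sv --> keeps v st sv & sv$''bd'' v = st$''bd'' v) &
  (\<forall>v\<in>X sv. res sv v & sv$''te'' v = Suc (sv$''ta'' v)))"
 show ?thesis unfolding cfin_loop_def
 proof (rule wp_While[where I = I and \<phi> = "%sv. 200 * (un - sv$''u'' 0)"], goal_cases)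
  case 1
  show ?case using u c by (auto simp: I_def X_def keeps_def tp_def)
 next
  case (2 sv)
  then show ?case using W unle by (auto simp: I_def unch_def un_def)
 next
  case (3 sv)
  have f: "sv$''un'' 0 = un" "sv$''U'' = U" "sv$''src'' 0 = s" "rmem sv ''zero'' 0 = 0"
   using 3(2) c(5) by (auto simp: unch_def un_def U_def s_def)
  let ?u = "sv$''u'' 0" and ?tp = "sv$''tp'' 0"
  have uu: "?u < un" using 3(3) f by simp
  define v where "v = U ?u"
  have vN: "v < N" using c(8) uu by (simp add: v_def)
  have vX: "v \<notin> X sv" using inj_onD[OF c(7), of ?u] uu by (fastforce simp: X_def v_def)
  have I: "clean sv" "?tp = tp + ?u" "\<forall>x. sv$''R'' x = (if x \<in> X sv then 1 else st$''R'' x)"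
   "\<forall>v. v \<notin> X sv --> keeps v st sv & sv$''bd'' v = st$''bd'' v"
   "\<forall>v\<in>X sv. res sv v & sv$''te'' v = Suc (sv$''ta'' v)"
   using 3(1) unfolding I_def by blast+
  define sv' where "sv' = iu ''u'' 0 (Suc ?u) (iu ''te'' v (Suc ?tp) (iu ''tp'' 0 (Suc ?tp) (ru ''td'' ?tp 0 (iu ''tz'' ?tp v
   (iu ''ta'' v ?tp (iu ''bd'' v (Suc v) (iu ''R'' v (Suc 0) (iu ''x'' 0 v sv))))))))"
  have X': "X sv' = insert v (X sv)" by (simp add: X_def sv'_def v_def lessThan_Suc)
  have kp: "keeps w sv sv'" if "w ~= v" for w using that by (simp add: keeps_def sv'_def)
  have bw: "sv'$''bd'' w = sv$''bd'' w" if "w ~= v" for w using that by (simp add: sv'_def)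
  have Rw: "sv'$''R'' w ~= 0" if "sv$''R'' w ~= 0" for w using that by (simp add: sv'_def)
  have I': "I sv'"
   unfolding I_def X'
  proof (intro conjI)
   show "clean sv'" using I(1) unfolding clean_def by (simp add: sv'_def)
   show "sv'$''u'' 0 <= un" "sv'$''tp'' 0 = tp + sv'$''u'' 0" using uu I(2) by (simp_all add: sv'_def)
   show "\<forall>x. sv'$''R'' x = (if x \<in> insert v (X sv) then 1 else st$''R'' x)" using I(3) by (simp add: sv'_def)
   show "\<forall>w. w \<notin> insert v (X sv) --> keeps w st sv' & sv'$''bd'' w = st$''bd'' w"
   proof (intro allI impI)
    fix w assume w: "w \<notin> insert v (X sv)"
    then have "keeps w st sv" "sv$''bd'' w = st$''bd'' w" using I(4) by auto
    with kp[of w] bw[of w] w show "keeps w st sv' & sv'$''bd'' w = st$''bd'' w"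
     unfolding keeps_def by (auto intro: order.trans)
   qed
   show "\<forall>w\<in>insert v (X sv). res sv' w & sv'$''te'' w = Suc (sv'$''ta'' w)"
   proof
    fix w assume w: "w \<in> insert v (X sv)"
    show "res sv' w & sv'$''te'' w = Suc (sv'$''ta'' w)"
    proof (cases "w = v")
     case True
     have "tab sv' v" "rch sv' v v" using single_table[OF vN, of "sv'$''tz''" ?tp "rmem sv' ''td''"]
      by (simp_all add: tab_def rch_def sv'_def)
     then show ?thesis using True vN by (auto simp: res_def sv'_def)
    next
     case False
     with w have wX: "w \<in> X sv" by auto
     have "res sv' w" by (rule keeps_res[OF kp[OF False]]) (use I(5) wX bw False Rw in \<open>auto simp: sv'_def\<close>)
     then show ?thesis using I(5) wX False by (simp add: sv'_def)
    qed
   qed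
  qed
  have b: "v <= W" "Suc v <= W" "Suc ?tp <= W" "?tp <= W" "Suc ?u <= W" "?u <= W" "Suc 0 <= W" "U ?u = v"
   using vN W Nk I(2) c(12) uu unle v_def by linarith+
  note b = b f
  show ?case
   apply ((rule wp_IE, (simp add: b cong: wp_cong; fail)+)+)
   apply (rule wp_RE, (simp add: b cong: wp_cong; fail)+)
   apply ((rule wp_IE, (simp add: b cong: wp_cong; fail)+)+)
   apply (rule wp_IAssign, simp add: b, simp add: b)
   apply (rule conjI)
   apply (use I' in \<open>simp add: sv'_def b; fail\<close>)
   apply (use uu in \<open>simp add: b\<close>)
   done
 next
  case (4 t sv)
  have f: "sv$''un'' 0 = un" "sv$''src'' 0 = s" "rmem sv ''zero'' 0 = 0" "G sv"
   using 4(2) c(2,5) by (auto simp: unch_def un_def s_def G_def)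
  have uu: "sv$''u'' 0 = un" using 4(1,3) f by (simp add: I_def)
  have X: "X sv = U ` {..<un}" by (simp add: X_def uu)
  have I: "clean sv" "sv$''tp'' 0 = tp + un" "\<forall>x. sv$''R'' x = (if x \<in> U ` {..<un} then 1 else st$''R'' x)"
   "\<forall>v. v \<notin> U ` {..<un} --> keeps v st sv & sv$''bd'' v = st$''bd'' v"
   "\<forall>v\<in>U ` {..<un}. res sv v & sv$''te'' v = Suc (sv$''ta'' v)"
   using 4(1) unfolding I_def X uu by blast+
  have Usub: "U ` {..<un} \<subseteq> {..<N}" using c(8) by auto
  have cU: "card (U ` {..<un}) = un" using card_image[OF c(7)] by simp
  have sU: "s \<notin> U ` {..<un}" using c(6,8) by auto
  have re: "res sv v" if "v < N" for v
  proof (cases "v \<in> U ` {..<un}")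
   case False
   then have "keeps v st sv" "res st v" "sv$''bd'' v = st$''bd'' v" using I(4) c(9) that by auto
   then show ?thesis by (rule keeps_res) (use I(3) f in \<open>auto simp: s_def\<close>)
  qed (use I(5) in blast)
  have "rc sv <= rc st + un"
  proof -
   have "rc sv <= card ({x. x < N & st$''R'' x ~= 0} \<union> U ` {..<un})"
    unfolding rc_def using I(3) by (intro card_mono) auto
   also have "\<dots> <= rc st + un" unfolding rc_def using card_Un_le[of "{x. x < N & st$''R'' x ~= 0}" "U ` {..<un}"] unfolding cU .
   finally show ?thesis .
  qed
  then have "rc sv * k <= (rc st + un) * k" by (rule mult_right_mono) simp
  also have "\<dots> = rc st * k + un * k" by (simp add: algebra_simps)
  \<comment> \<open>This is the clause of \<open>cinv\<close> on \<open>rc\<close> with the common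
    factor \<open>2 ^ j\<close> cancelled.\<close>
  also have "rc st * k <= k + 8 * N"
  proof -
   have "2 ^ j * (rc st * k) <= 2 ^ j * (k + 8 * N)" using c(10,11) by (simp add: algebra_simps)
   then show ?thesis by simp
  qed
  finally have rck: "rc sv * k <= k + 9 * N" using un by linarith
  have "tsum sv <= sz st + un"
  proof -
   let ?d = "%v. sv$''te'' v - sv$''ta'' v"
   have "tsum sv = sum ?d ({..<N} - U ` {..<un}) + sum ?d (U ` {..<un})"
    unfolding tsum_def using Usub by (subst sum.subset_diff[of "U ` {..<un}"]) auto
   also have "sum ?d ({..<N} - U ` {..<un}) = sz st"
    unfolding sz_def U_def[symmetric] un_def[symmetric] using I(4) by (intro sum.cong) (auto simp: keeps_def)
   also have "sum ?d (U ` {..<un}) = (\<Sum>v\<in>U ` {..<un}. 1)" using I(5) by (intro sum.cong) auto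
   finally show ?thesis using cU by simp
  qed
  then have "tsum sv <= 1 + 9 * (N * k)" "sv$''tp'' 0 <= 1 + 9 * (N * k)" using c(12,13) I(2) unle by linarith+
  moreover have "\<forall>x<N. sv$''R'' x <= 1" using I(3) c(14) by simp
  moreover have "sv$''bd'' s ~= 0" using I(4) sU c(6) by simp
  ultimately show ?case using I(1) f re rck c(3) 4(4) u unN by (simp add: cpost_def)
 qed
qed

lemma wp_centres:
 fixes st
 defines "s \<equiv> st$''src'' 0" and "k \<equiv> st$''k'' 0"
 assumes c: "clean st" "G st" "s < N" "rmem st ''zero'' 0 = 0" and z: "\<And>x. x < N ==> st$''R'' x = 0 & st$''bd'' x = 0"
  and k: "0 < k" and l: "3 * (k * k) + 4 <= 2 ^ l"
  and W: "(4 * (8000 + (6000 * l + 26000) * (k * k)) + 2 * N + 30000) * (N + 1) <= W"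
   "20 * (N * k) + 4 * (k * k) + 20 <= W" "4 * N * (N * k) + 4 * N + 4 <= W"
 shows "wp W centres (%t st'. cpost k st' & t <= 104000 * (l + 1) * (N * k) + 400 * N + 120) st"
proof -
 have Nk: "N <= N * k" using k by (cases k) auto
 have kk: "k <= k * k" using k by (cases k) auto
 have W0: "N + k + 2 <= W" using W(2) Nk kk by linarith
 show ?thesis unfolding centres_def
 proof (rule wp_Seq, rule wp_frame[OF wp_cinit[where st = st, folded s_def k_def]], goal_cases)
  case (7 t1 st1)
  have k1: "st1$''k'' 0 = k" using 7(2) by (simp add: unch_def cinit_def cinit_loop_def k_def)
  have unU: "sv$''un'' 0 * k <= N * k" if "cinv k sv" for sv
  proof -
   from that have "\<exists>j. sv$''K'' 0 = k * 2 ^ j" "sv$''tp'' 0 + 8 * (sv$''un'' 0 * sv$''K'' 0) <= 1 + 8 * (N * k)"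
    unfolding cinv_def Let_def by blast+
   then obtain j where j: "sv$''K'' 0 = k * 2 ^ j" "sv$''tp'' 0 + 8 * (sv$''un'' 0 * sv$''K'' 0) <= 1 + 8 * (N * k)"
by blast
   have "sv$''un'' 0 * k <= sv$''un'' 0 * sv$''K'' 0" using j by (intro mult_left_mono) auto
   then show ?thesis using j(2) by linarith
  qed
  show ?case
  proof (rule wp_Seq, rule wp_While[where I = "cinv k" and
     \<phi> = "%sv. 104000 * (l + 1) * (sv$''un'' 0 * sv$''K'' 0)"], goal_cases)
   case 1
   show ?case using 7(1) by blast
  next
   case (2 sv)
   have "sv$''k'' 0 = k" "sv$''N'' 0 = N" using 2 k1 by (simp_all add: unch_def stage_def newU_def cinv_def G_def Let_def)
   moreover have "sv$''un'' 0 <= sv$''un'' 0 * k" using k by (cases k) auto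
   moreover have "sv$''un'' 0 * k <= W" using unU[OF 2(1)] W(2) by linarith
   moreover from calculation have "sv$''un'' 0 <= W" by linarith
   ultimately show ?case using W0 by simp
  next
   case (3 sv)
   have f: "sv$''k'' 0 = k" "sv$''N'' 0 = N" using 3 k1 by (simp_all add: unch_def stage_def newU_def cinv_def G_def Let_def)
   have W': "16 * (N * k) + 4 * (k * k) + 20 <= W" using W(2) by linarith
   have big: "N < sv$''un'' 0 * k" using 3(3) f by simp
   show ?case
   proof (rule wp_mono[OF wp_stage[OF 3(1) big k l W(1) W' W(3)]])
    fix t sv' assume h: "cinv k sv' & t + 20 + 104000 * (l + 1) * (sv'$''un'' 0 * sv'$''K'' 0) <= 104000 * (l + 1) * (sv$''un'' 0 * sv$''K'' 0)"
    show "cinv k sv' & 104000 * (l + 1) * (sv'$''un'' 0 * sv'$''K'' 0) + t + 1 +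
      bcost (ILess (V ''N'') (ITimes (V ''un'') (V ''k''))) <= 104000 * (l + 1) * (sv$''un'' 0 * sv$''K'' 0)"
     using h by simp
   qed
  next
   case (4 t sv)
   have f: "sv$''k'' 0 = k" "sv$''N'' 0 = N" using 4 k1 by (simp_all add: unch_def stage_def newU_def cinv_def G_def Let_def)
   have un: "sv$''un'' 0 * k <= N" using 4(3) f by simp
   have tt: "t + t1 <= 104000 * (l + 1) * (N * k) + 20 * N + 100 * N + 90"
   proof -
    have "st1$''K'' 0 = k" "st1$''un'' 0 <= N" "t1 <= 100 * N + 80" using 7(1) by blast+
    moreover from this have "104000 * (l + 1) * (st1$''un'' 0 * st1$''K'' 0) <= 104000 * (l + 1) * (N * k)"
     by (intro mult_le_mono) auto
    moreover have "t <= 104000 * (l + 1) * (st1$''un'' 0 * st1$''K'' 0) + 9" using 4(4) by simp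
    ultimately show ?thesis by linarith
   qed
   define sv' where "sv' = iu ''u'' 0 0 sv"
   have ci: "cinv k sv'" "sv'$''un'' 0 * k <= N" "sv'$''u'' 0 = 0"
    using 4(1) un by (simp_all add: sv'_def cinv_def clean_def G_def res_def tab_def rch_def rc_def sz_def)
   have W2: "20 * (N * k) + 20 <= W" using W(2) by linarith
   show ?case
    apply (rule wp_IE, (use W0 in force), (use W0 in force), (use W0 in force), (use W0 in force))
    apply (rule wp_mono[OF wp_cfin[OF ci(1,2) k ci(3) W2, unfolded sv'_def]])
    using tt by auto
  qed
 qed (use c z W0 in auto)
qed

end

section \<open>Shortest paths from the bundles\<close>

text \<open>The second phase only reads what \<open>centres\<close> has produced, so the tables,
  centres and marks are constants from here on.\<close>

locale tables = hgraph +
 fixes s :: nat and tz :: "nat => nat" and td :: "nat => real" and ta te bd R :: "nat => nat"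
 assumes s_lt: "s < N" and R_le: "\<And>x. x < N ==> R x <= 1"
  and bd: "\<And>v. v < N ==> bd v = 0 & (\<forall>d. \<not> walk v s d) \<or>
   (\<exists>u<N. bd v = Suc u & R u ~= 0 & table tz td v (ta v) (te v) & reaches tz td v (ta v) (te v) u)"
begin

definition ent :: "nat => nat => bool" where "ent v j \<longleftrightarrow> ta v <= j & j < te v"

text \<open>The promise left by \<open>pushT\<close>: \<open>y\<close> can be reached at cost
  \<open>c\<close>, and the whole table of \<open>y\<close> has been told so. Lowering labels
  further cannot destroy it.\<close>

definition seed :: "(nat => real) => (nat => nat) => nat => real => bool" where
 "seed D r y c \<longleftrightarrow> (\<forall>j. ent y j --> r (tz j) ~= 0 & D (tz j) <= c + td j)"

text \<open>A vertex is done when its centre has been extracted. For a centre this differs from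
  being in \<open>P\<close>, since it may belong to the bundle of another centre.\<close>

definition dn :: "nat set => nat => bool" where "dn P v \<longleftrightarrow> (\<exists>u\<in>P. bd v = Suc u)"

definition lab :: "(nat => real) => (nat => nat) => bool" where
 "lab D r \<longleftrightarrow> (\<forall>x<N. r x ~= 0 --> walk s x (D x))"

definition fin :: "(nat => real) => (nat => nat) => nat => bool" where
 "fin D r x \<longleftrightarrow> r x ~= 0 & (\<forall>d. walk s x d --> D x <= d)"

text \<open>Finality is asserted for done vertices, not for the centres in \<open>P\<close>. The
  seeds at neighbours of done vertices play the part of relaxed edges in Dijkstra's
  algorithm.\<close>

definition sinv :: "(nat => real) => (nat => nat) => nat set => bool" where
 "sinv D r P \<longleftrightarrow> seed D r s 0 & (\<forall>x<N. dn P x --> fin D r x) &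
  (\<forall>q<3 * N. dn P (q div 3) --> seed D r (nb q) (D (q div 3) + wt q))"

definition lower :: "(nat => real) => (nat => nat) => (nat => real) => (nat => nat) => bool" where
 "lower D r D' r' \<longleftrightarrow> (\<forall>x<N. r x ~= 0 --> r' x ~= 0 & D' x <= D x)"

lemma lower_refl: "lower D r D r" by (simp add: lower_def)

lemma lower_trans: "lower D r D' r' ==> lower D' r' D'' r'' ==> lower D r D'' r''"
 unfolding lower_def by (meson order.trans)

lemma centre:
 assumes "walk s v d"
 obtains u where "u < N" "bd v = Suc u" "R u ~= 0" "table tz td v (ta v) (te v)" "reaches tz td v (ta v) (te v) u"
 using bd[of v] walk_lt[OF assms] walk_sym[OF assms] by blast

lemma ent_walk: "walk s v d ==> ent v j ==> walk v (tz j) (td j)"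
 by (erule centre) (auto simp: table_def ent_def)

lemma seed_lower:
 assumes "seed D r y c" "lower D r D' r'" "walk s y d"
 shows "seed D' r' y c"
 unfolding seed_def
proof (intro allI impI)
 fix j assume j: "ent y j"
 then have "tz j < N" using ent_walk[OF assms(3) j] walk_lt by blast
 with j assms(1,2) show "r' (tz j) ~= 0 & D' (tz j) <= c + td j"
  unfolding seed_def lower_def by (meson order.trans)
qed

lemma fin_lower: "fin D r x ==> lower D r D' r' ==> x < N ==> fin D' r' x"
 unfolding fin_def lower_def by (meson order.trans)

text \<open>A final label is a minimum over all walks, and a later label is still the length of a
  walk; so it cannot go below.\<close>

lemma fin_eq: "fin D r x ==> lower D r D' r' ==> x < N ==> lab D r ==> lab D' r' ==> D' x = D x"
 unfolding fin_def lower_def lab_def by (meson order.antisym)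

lemma fin_walk: "fin D r x ==> lab D r ==> x < N ==> walk s x (D x)"
 by (auto simp: fin_def lab_def)

lemma div3_lt: "q < 3 * N ==> q div 3 < N"
 by (simp add: less_mult_imp_div_less mult.commute)

lemma fin_nb: "fin D r (q div 3) ==> lab D r ==> q < 3 * N ==> walk s (nb q) (D (q div 3) + wt q)"
 by (rule walk_step[OF fin_walk]) (auto simp: div3_lt)

lemma sinv_lower:
 assumes "sinv D r P" "lower D r D' r'" "lab D r" "lab D' r'"
 shows "sinv D' r' P"
 unfolding sinv_def
proof (intro conjI allI impI)
 show "seed D' r' s 0" using assms(1) seed_lower[OF _ assms(2) walk_refl[OF s_lt]] by (simp add: sinv_def)
 show "fin D' r' x" if "x < N" "dn P x" for x using assms(1) fin_lower[OF _ assms(2)] that by (simp add: sinv_def)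
 show "seed D' r' (nb q) (D' (q div 3) + wt q)" if q: "q < 3 * N" "dn P (q div 3)" for q
 proof -
  have f: "fin D r (q div 3)" "seed D r (nb q) (D (q div 3) + wt q)" using assms(1) q div3_lt by (auto simp: sinv_def)
  show ?thesis using seed_lower[OF f(2) assms(2) fin_nb[OF f(1) assms(3) q(1)]] fin_eq[OF f(1) assms(2) _ assms(3,4)] div3_lt[OF q(1)] by simp
 qed
qed

text \<open>\<open>p\<close> is the cell of the centre. In the last clause, the first vertex of the
  walk at distance at least \<open>td p\<close> has a closer predecessor, so \<open>reaches\<close>
  provides a cell for it; \<open>l1\<close> is the length of the rest of the walk.\<close>

lemma reaches_entry:
 assumes t: "table tz td v (ta v) (te v)" and u: "reaches tz td v (ta v) (te v) u"
 obtains p where "ent v p" "tz p = u" "\<And>z l. walk v z l ==> l < td p ==> \<exists>j. ent v j & tz j = z & td j <= l"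
  "\<And>z l. walk v z l ==> td p <= l ==> 0 < td p ==> \<exists>j l1. ent v j & td j + l1 <= l & l1 + td p <= l & walk (tz j) z l1"
proof -
 obtain p where p: "ta v <= p" "p < te v" "tz p = u" and
  near: "\<And>z l q. walk v z l ==> l < td p ==> q < 3 * N ==> q div 3 = z ==> \<exists>i. ta v <= i & i < te v & tz i = nb q & td i <= l + wt q"
  using u unfolding reaches_def by blast
 have a: "\<exists>j. ent v j & tz j = z & td j <= l" if "walk v z l" "l < td p" for z l
  using that
 proof (cases rule: walk.cases)
  case walk_refl
  then show ?thesis using t unfolding table_def ent_def by (metis order.refl)
 next
  case (walk_step y d q)
  then have "d < td p" using that wt_nn[of q] by simp
  then show ?thesis using near[OF walk_step(3) _ walk_step(4,5)] walk_step unfolding ent_def by auto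
 qed
 have b: "\<exists>j l1. ent v j & td j + l1 <= l & l1 + td p <= l & walk (tz j) z l1" if "walk v z l" "td p <= l" "0 < td p" for z l
  using that
 proof (induction rule: walk.induct)
  case walk_refl
  then show ?case by simp
 next
  case (walk_step y d q)
  show ?case
  proof (cases "d < td p")
   case True
   obtain i where "ta v <= i" "i < te v" "tz i = nb q" "td i <= d + wt q" using near[OF walk_step(1) True walk_step(2,3)] by blast
   then show ?thesis using walk_step(5) walk_refl[OF nb_lt[OF walk_step(2)]]
    by (intro exI[of _ i] exI[of _ 0]) (auto simp: ent_def intro: walk.walk_refl nb_lt)
  next
   case False
   then obtain j l1 where j: "ent v j" "td j + l1 <= d" "l1 + td p <= d" "walk (tz j) y l1" using walk_step by auto
   then show ?thesis using walk.walk_step[OF j(4) walk_step(2,3)] by (intro exI[of _ j] exI[of _ "l1 + wt q"]) auto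
  qed
 qed
 show thesis using that[of p] p a b by (auto simp: ent_def)
qed

text \<open>\<open>y\<close> follows the last done vertex on the walk, or is the source if there is
  none. In either case \<open>sinv\<close> has seeded its table, with a cost at most the length of
  the walk up to \<open>y\<close>.\<close>

lemma crossing:
 assumes w: "walk s v d" "\<not> dn P v" and S: "sinv D r P" and L: "lab D r"
 shows "\<exists>y c l. seed D r y c & \<not> dn P y & walk s y c & walk y v l & c + l <= d"
 using w
proof (induction rule: walk.induct)
 case walk_refl
 then show ?case using S s_lt by (intro exI[of _ s] exI[of _ 0]) (auto simp: sinv_def intro: walk.walk_refl)
next
 case (walk_step y d q)
 have e: "walk y (nb q) (wt q)" using walk_edge[OF walk_step(2)] walk_step(3) by simp
 show ?case
 proof (cases "dn P y")
  case True
  then have "fin D r y" "seed D r (nb q) (D y + wt q)"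
   using S walk_step(2,3) div3_lt[OF walk_step(2)] by (auto simp: sinv_def)
  moreover from this have "D y <= d" "walk s (nb q) (D y + wt q)" using walk_step fin_nb[OF _ L walk_step(2)] by (auto simp: fin_def)
  ultimately show ?thesis using walk_step nb_lt
   by (intro exI[of _ "nb q"] exI[of _ "D y + wt q"] exI[of _ 0]) (auto intro: walk.walk_refl)
 next
  case False
  then obtain y' c l where "seed D r y' c" "\<not> dn P y'" "walk s y' c" "walk y' y l" "c + l <= d" using walk_step by blast
  then show ?thesis using walk_trans[OF e, of y' l] by (intro exI[of _ y'] exI[of _ c] exI[of _ "l + wt q"]) auto
 qed
qed

text \<open>If \<open>v\<close> were not done, \<open>crossing\<close> would yield a vertex
  \<open>y\<close> that is not done but whose seeded table contains its centre. That centre is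
  labelled, so it was extracted, and \<open>y\<close> would be done.\<close>

lemma heap_exhausted:
 assumes S: "sinv D r P" and L: "lab D r" and no: "\<And>x. x < N ==> R x ~= 0 ==> r x ~= 0 ==> x \<in> P" and w: "walk s v d"
 shows "fin D r v"
proof -
 have "dn P v"
 proof (rule ccontr)
  assume "\<not> dn P v"
  then obtain y c l where y: "seed D r y c" "\<not> dn P y" "walk s y c" using crossing[OF w _ S L] by blast
  obtain u where u: "u < N" "bd y = Suc u" "R u ~= 0" "reaches tz td y (ta y) (te y) u" using centre[OF y(3)] by metis
  then obtain p where "ent y p" "tz p = u" unfolding reaches_def ent_def by blast
  then have "u \<in> P" using y(1) no u by (auto simp: seed_def)
  then show False using y(2) u by (auto simp: dn_def)
 qed
 then show ?thesis using S walk_lt[OF w] by (simp add: sinv_def)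
qed

text \<open>If a shortest path leaves the finished vertices at \<open>y\<close>, the vertex \<open>v\<close> in the bundle of the extracted centre \<open>u\<close>
 is either so far from \<open>y\<close> that the detours over the two centres are short enough, or the tables of \<open>y\<close> and \<open>v\<close> meet on the path.\<close>

lemma pull_correct:
 assumes S: "sinv D r P" and L: "lab D r" and v: "v < N" "bd v = Suc u" "\<not> dn P v" "r u ~= 0"
  and min: "\<And>x. x < N ==> R x ~= 0 ==> r x ~= 0 ==> x \<notin> P ==> D u <= D x" and w: "walk s v d"
 shows "\<exists>j. ent v j & r (tz j) ~= 0 & D (tz j) + td j <= d"
proof -
 obtain y c l where y: "seed D r y c" "\<not> dn P y" "walk s y c" "walk y v l" "c + l <= d" using crossing[OF w v(3) S L] by blast
 have sd: "r (tz j) ~= 0" "D (tz j) <= c + td j" if "ent y j" for j using y(1) that by (auto simp: seed_def)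
 obtain uv where cv: "bd v = Suc uv" "table tz td v (ta v) (te v)" "reaches tz td v (ta v) (te v) uv" using centre[OF w] by metis
 then have "uv = u" using v(2) by simp
 with cv(2,3) obtain pv where pv: "ent v pv" "tz pv = u" "\<And>z l. walk v z l ==> l < td pv ==> \<exists>j. ent v j & tz j = z & td j <= l"
  "\<And>z l. walk v z l ==> td pv <= l ==> 0 < td pv ==> \<exists>j l1. ent v j & td j + l1 <= l & l1 + td pv <= l & walk (tz j) z l1"
  using reaches_entry[OF cv(2), of u] by metis
 obtain uy where cy: "uy < N" "bd y = Suc uy" "R uy ~= 0" "table tz td y (ta y) (te y)" "reaches tz td y (ta y) (te y) uy" using centre[OF y(3)] by metis
 then obtain p where p: "ent y p" "tz p = uy" "\<And>z l. walk y z l ==> l < td p ==> \<exists>j. ent y j & tz j = z & td j <= l"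
  using reaches_entry[OF cy(4,5)] by metis
 have "D u <= D uy" using min[of uy] cy sd[OF p(1)] p(2) y(2) by (auto simp: dn_def)
 \<comment> \<open>The centre of \<open>y\<close> is labelled through the seed and not yet
   extracted, so the extracted \<open>u\<close> has a label that is no larger.\<close>
 then have Du: "D u <= c + td p" using sd[OF p(1)] p(2) by simp
 have v0: "\<exists>j. ent v j & tz j = v & td j <= 0" and y0: "\<exists>j. ent y j & tz j = y & td j <= 0"
  using cv(2) cy(4) unfolding table_def ent_def by (metis order.refl)+
 have vy: "walk v y l" using walk_sym[OF y(4)] .
 show ?thesis
 proof (cases "l < td p")
  \<comment> \<open>\<open>v\<close> lies in the table of \<open>y\<close>, so the seed has already
    labelled \<open>v\<close> itself, and its own cell at distance 0 suffices.\<close>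
  case True
  then obtain j where j: "ent y j" "tz j = v" "td j <= l" using p(3)[OF y(4)] by blast
  obtain i where "ent v i" "tz i = v" "td i <= 0" using v0 by blast
  then show ?thesis using sd[OF j(1)] j y(5) by (intro exI[of _ i]) auto
 next
  case ly: False
  show ?thesis
  proof (cases "td pv + td p <= l")
   \<comment> \<open>The two radii fit into \<open>l\<close>: going over \<open>u\<close> costs at
     most \<open>c + td p + td pv\<close>, which is at most \<open>c + l\<close>.\<close>
   case True
   then show ?thesis using pv(1,2) v(4) Du y(5) by (intro exI[of _ pv]) auto
  next
   case far: False
   show ?thesis
   proof (cases "l < td pv")
    \<comment> \<open>\<open>y\<close> lies in the table of \<open>v\<close>, and the seed has
      labelled \<open>y\<close> by at most \<open>c\<close>.\<close>
    case True
    then obtain j where j: "ent v j" "tz j = y" "td j <= l" using pv(3)[OF vy] by blast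
    obtain i where "ent y i" "tz i = y" "td i <= 0" using y0 by blast
    then show ?thesis using sd[of i] j y(5) by (intro exI[of _ j]) auto
   next
    case False
    \<comment> \<open>The tables meet: \<open>tz j\<close> is the first vertex, seen from
      \<open>v\<close>, at distance at least \<open>td pv\<close>. What remains to \<open>y\<close>
      is \<open>l1 <= l - td pv\<close>, less than \<open>td p\<close>, so \<open>tz j\<close> also
      has a cell in the table of \<open>y\<close>.\<close>
    then obtain j l1 where j: "ent v j" "td j + l1 <= l" "l1 + td pv <= l" "walk (tz j) y l1" using pv(4)[OF vy] far ly by fastforce
    then obtain i where "ent y i" "tz i = tz j" "td i <= l1" using p(3)[OF walk_sym[OF j(4)]] far by fastforce
    then show ?thesis using sd[of i] j y(5) by (intro exI[of _ j]) auto
   qed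
  qed
 qed
qed

end

section \<open>Moving labels through the tables\<close>

definition relaxM_upd :: com where
 "relaxM_upd = Cond (BAnd (pos (IElem ''R'' (V ''x''))) (ILess (IElem ''i'' (V ''x'')) (Lit 2))) update Skip"

text \<open>Only centres enter the heap. A centre that has been extracted may still get a smaller
  label, but is not inserted again.\<close>

definition relaxM :: com where
 "relaxM = Cond (BAnd (pos (IElem ''r'' (V ''x''))) (BNot (RLess (RElem ''nv'' (Lit 0)) (RElem ''D'' (V ''x''))))) Skip
  (RAssign ''D'' (V ''x'') (RElem ''nv'' (Lit 0)) ;; IAssign ''r'' (V ''x'') (Lit 1) ;; relaxM_upd)"

definition pushT_loop :: com where
 "pushT_loop = While (ILess (V ''j'') (IElem ''te'' (V ''yy'')))
  (RAssign ''nv'' (Lit 0) (RPlus (RElem ''bs'' (Lit 0)) (RElem ''td'' (V ''j''))) ;; ''x'' <- IElem ''tz'' (V ''j'') ;; relaxM ;; inc ''j'')"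

definition pushT :: com where "pushT = ''j'' <- IElem ''ta'' (V ''yy'') ;; pushT_loop"

definition pullT_step :: com where
 "pullT_step = Cond (pos (IElem ''r'' (IElem ''tz'' (V ''j''))))
  (RAssign ''nv'' (Lit 0) (RPlus (RElem ''D'' (IElem ''tz'' (V ''j''))) (RElem ''td'' (V ''j''))) ;; ''x'' <- V ''v1'' ;; relaxM) Skip"

definition pullT_loop :: com where
 "pullT_loop = While (ILess (V ''j'') (IElem ''te'' (V ''v1''))) (pullT_step ;; inc ''j'')"

definition pullT :: com where "pullT = ''j'' <- IElem ''ta'' (V ''v1'') ;; pullT_loop"

lemma mods_relaxM [simp]:
 "imods relaxM = {''i'', ''y'', ''b'', ''a'', ''x'', ''p'', ''h'', ''l'', ''c'', ''r''}" "rmods relaxM = {''D''}"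
 by (auto simp: relaxM_def relaxM_upd_def)

lemma mods_pushT [simp]:
 "imods pushT = {''i'', ''y'', ''b'', ''a'', ''x'', ''p'', ''h'', ''l'', ''c'', ''r'', ''j''}" "rmods pushT = {''D'', ''nv''}"
 by (auto simp: pushT_def pushT_loop_def)

lemma mods_pullT [simp]:
 "imods pullT = {''i'', ''y'', ''b'', ''a'', ''x'', ''p'', ''h'', ''l'', ''c'', ''r'', ''j''}" "rmods pullT = {''D'', ''nv''}"
 by (auto simp: pullT_def pullT_loop_def pullT_step_def)

text \<open>Lets \<open>relaxM\<close> change labels of vertices outside the heap, which share the
  array \<open>D\<close> with the keys.\<close>

lemma hinv_key:
 assumes "hinv N S Z key ht pa lo bk cnt" "\<And>y. y \<in> S ==> key' y = key y"
 shows "hinv N S Z key' ht pa lo bk cnt"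
proof -
 have "(\<exists>y\<in>S. pa x = Suc y & ht x < ht y & lo (Suc (ht x) * N + y) = Suc x & key' y <= key' x) =
  (\<exists>y\<in>S. pa x = Suc y & ht x < ht y & lo (Suc (ht x) * N + y) = Suc x & key y <= key x)" if "x \<in> S" for x
  using assms(2) that by auto
 then show ?thesis using assms(1) unfolding hinv_def by simp
qed

context tables
begin

definition tsz :: "nat => nat" where "tsz v = te v - ta v"

definition F :: "state => bool" where
 "F st \<longleftrightarrow> G st & st$''tz'' = tz & st$''ta'' = ta & st$''te'' = te & st$''bd'' = bd & st$''R'' = R & rmem st ''td'' = td"

definition mi :: "nat set => state => bool" where
 "mi P st \<longleftrightarrow> F st & HI N (SS N st) {} st & PP N st = P &
  (\<forall>x<N. st$''i'' x <= 2 & st$''r'' x <= 1 & (st$''i'' x ~= 0 \<longleftrightarrow> R x ~= 0 & st$''r'' x ~= 0)) &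
  lab (rmem st ''D'') (st$''r'')"

abbreviation pS :: "state => nat" where "pS st \<equiv> pot (SS N st) st"
abbreviation low :: "state => state => bool" where
 "low st st' \<equiv> lower (rmem st ''D'') (st$''r'') (rmem st' ''D'') (st'$''r'')"

lemma wp_relaxM:
 fixes st
 defines "x \<equiv> st$''x'' 0" and "nv \<equiv> rmem st ''nv'' 0"
 assumes M: "mi P st" and x: "walk s x nv" and W: "(pS st + 3) * (N + 1) <= W"
 shows "wp W relaxM (%t st'. mi P st' & low st st' & st'$''r'' x ~= 0 & rmem st' ''D'' x <= nv & t + pS st' <= pS st + 7100) st"
proof -
 let ?i = "st$''i''" and ?D = "rmem st ''D''" and ?r = "st$''r''"
 have m: "F st" "HI N (SS N st) {} st" "PP N st = P" "lab ?D ?r"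
  and ir: "\<And>z. z < N ==> ?i z <= 2 & ?r z <= 1 & (?i z ~= 0 \<longleftrightarrow> R z ~= 0 & ?r z ~= 0)"
  using M unfolding mi_def by blast+
 have xN: "x < N" using walk_lt[OF x] by simp
 have W2: "3 < W" "2 * N + 2 < W" using W xN by (auto simp: algebra_simps)
 have f: "st$''N'' 0 = N" "st$''R'' = R" using m(1) by (auto simp: F_def G_def)
 have b: "st$''x'' 0 = x" "rmem st ''nv'' 0 = nv" "x <= W" "?r x <= W" "?i x <= W" "R x <= W" "Suc 0 <= W" "2 <= W" "st$''R'' = R"
  using xN W2 ir[OF xN] R_le[OF xN] f by (auto simp: x_def nv_def)
 define sv where "sv = iu ''r'' x (Suc 0) (ru ''D'' x nv st)"
 have upd: "wp W relaxM_upd (%t st'. mi P st' & low st st' & st'$''r'' x ~= 0 & rmem st' ''D'' x <= nv & t + pS st' <= pS st + 7050) sv"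
  if c: "?r x = 0 \<or> nv < ?D x"
 proof -
  have g: "mi P st' & low st st' & st'$''r'' x ~= 0 & rmem st' ''D'' x <= nv"
   if "F st'" "HI N (SS N st') {} st'" "PP N st' = P" "st'$''r'' = ?r(x := Suc 0)" "rmem st' ''D'' = ?D(x := nv)"
    "\<And>z. z < N ==> st'$''i'' z <= 2 & (st'$''i'' z ~= 0 \<longleftrightarrow> R z ~= 0 & st'$''r'' z ~= 0)" for st'
  proof (intro conjI)
   have "lab (rmem st' ''D'') (st'$''r'')" using m(4) x unfolding lab_def that(4,5) by simp
   then show "mi P st'" unfolding mi_def using that(1-3,6) ir unfolding that(4) by auto
   show "low st st'" using c unfolding lower_def that(4,5) by auto
   show "st'$''r'' x ~= 0" "rmem st' ''D'' x <= nv" by (simp_all add: that)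
  qed
  have tf: "F sv" using m(1) by (simp add: F_def G_def sv_def)
  have tS: "SS N sv = SS N st" "PP N sv = PP N st" "pot (SS N st) sv = pS st" by (simp_all add: sv_def SS_def PP_def pot_def)
  show ?thesis unfolding relaxM_upd_def
  proof (rule wp_Cond, goal_cases)
   case 1
   show ?case using b by (simp add: sv_def)
  next
   case 2
   have xi: "R x ~= 0" "?i x < 2" using 2 b by (simp_all add: sv_def)
   show ?case
   proof (rule wp_frame[OF wp_update[where N = N and S = "SS N st" and key = ?D]], goal_cases)
    case (8 t st')
    have xt: "sv$''x'' 0 = x" using b by (simp add: sv_def)
    have u: "HI N (insert x (SS N st)) {} st'" "st'$''i'' = (sv$''i'')(x := 1)" "t + pot (insert x (SS N st)) st' <= pot (SS N st) sv + 7000"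
     using 8(1) unfolding xt by blast+
    have i': "st'$''i'' = ?i(x := 1)" using u(2) by (simp add: sv_def)
    have S': "SS N st' = insert x (SS N st)" "PP N st' = PP N st" using xN xi by (auto simp: SS_def PP_def i')
    have un: "st'$a = sv$a" if "a \<notin> {''i'', ''y'', ''b'', ''a'', ''x'', ''p'', ''h'', ''l'', ''c''}" for a
     using 8(2) that by (simp add: unch_def)
    have rn: "rmem st' = rmem sv" using 8(2) by (auto simp: unch_def)
    have F': "F st'" using tf by (simp add: F_def G_def un rn)
    have "mi P st' & low st st' & st'$''r'' x ~= 0 & rmem st' ''D'' x <= nv"
    proof (rule g[OF F'])
     show "HI N (SS N st') {} st'" "PP N st' = P" using u(1) m(3) by (simp_all add: S')
     show rr: "st'$''r'' = ?r(x := Suc 0)" "rmem st' ''D'' = ?D(x := nv)" by (simp_all add: un rn sv_def)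
     show "st'$''i'' z <= 2 & (st'$''i'' z ~= 0 \<longleftrightarrow> R z ~= 0 & st'$''r'' z ~= 0)" if "z < N" for z
      using ir[OF that] xi unfolding i' rr by auto
    qed
    then show ?case using u(3) tS by (simp add: S')
   next
    case 1
    show ?case using m(2) by (simp add: sv_def)
   next
    case (2 y)
    then show ?case using b by (simp add: sv_def)
   next
    case 3
    then have "?i x = 1" using b by (simp add: sv_def SS_def)
    then have "nv < ?D x" using c ir[OF xN] by auto
    then show ?case using b by (simp add: sv_def)
   next
    case 5
    show ?case using xi xN b by (auto simp: sv_def SS_def)
   next
    case 7
    have "(mh (SS N st) (st$''h'') + 3) * (N + 1) <= (pS st + 3) * (N + 1)" using mh_pot by (intro mult_right_mono) auto
    then show ?case using W by (simp add: sv_def)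
   qed (use b f xN in \<open>auto simp: sv_def\<close>)
  next
   case 3
   have xi: "R x = 0 \<or> ?i x = 2" using 3 b ir[OF xN] by (auto simp: sv_def)
   then have xS: "x \<notin> SS N st" using ir[OF xN] by (auto simp: SS_def)
   have "mi P sv & low st sv & sv$''r'' x ~= 0 & rmem sv ''D'' x <= nv"
   proof (rule g[OF tf])
    show "HI N (SS N sv) {} sv" unfolding tS by (rule hinv_key[where key = ?D]) (use m(2) xS in \<open>auto simp: sv_def\<close>)
    show "sv$''i'' z <= 2 & (sv$''i'' z ~= 0 \<longleftrightarrow> R z ~= 0 & sv$''r'' z ~= 0)" if "z < N" for z
     using ir[OF that] xi by (auto simp: sv_def)
   qed (use m(3) tS in \<open>auto simp: sv_def\<close>)
   then show ?case using tS by (intro wp_Skip) simp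
  qed
 qed
 show ?thesis unfolding relaxM_def
 proof (rule wp_Cond, goal_cases)
  case 1
  show ?case using b by simp
 next
  case 2
  then show ?case using M b lower_refl by (intro wp_Skip) auto
 next
  case 3
  then have c: "?r x = 0 \<or> nv < ?D x" using b by auto
  show ?case
   apply (rule wp_RE, (simp add: b cong: wp_cong; fail)+)
   apply (rule wp_IE, (simp add: b cong: wp_cong; fail)+)
   apply (rule wp_mono[OF upd[OF c, unfolded sv_def]])
   by auto
 qed
qed

lemma wp_pushT:
 fixes st
 defines "y \<equiv> st$''yy'' 0" and "c \<equiv> rmem st ''bs'' 0"
 assumes M: "mi P st" and y: "walk s y c" and W: "(pS st + 8000 * tsz y + 3) * (N + 1) <= W" "te y <= W"
 shows "wp W pushT (%t st'. mi P st' & low st st' & seed (rmem st' ''D'') (st'$''r'') y c & t + pS st' <= pS st + 8000 * tsz y + 20) st"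
proof -
 have yN: "y < N" using walk_lt[OF y] by simp
 obtain jj where "ent y jj" using centre[OF y] unfolding table_def ent_def by metis
 then have tt: "ta y < te y" by (simp add: ent_def)
 have W2: "N < W" "1 <= W" using W(1) yN by (auto simp: algebra_simps)
 have f: "st$''ta'' = ta" using M by (simp add: mi_def F_def)
 define I where "I = (%sv. ta y <= sv$''j'' 0 & sv$''j'' 0 <= te y & mi P sv & low st sv &
  (\<forall>i. ta y <= i --> i < sv$''j'' 0 --> sv$''r'' (tz i) ~= 0 & rmem sv ''D'' (tz i) <= c + td i) &
  pS sv + 8000 * (te y - sv$''j'' 0) <= pS st + 8000 * tsz y)"
 have "wp W pushT_loop (%t st'. mi P st' & low st st' & seed (rmem st' ''D'') (st'$''r'') y c & t + pS st' <= pS st + 8000 * tsz y + 10) (iu ''j'' 0 (ta y) st)"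
  unfolding pushT_loop_def
 proof (rule wp_While[where I = I and \<phi> = "%sv. pS sv + 8000 * (te y - sv$''j'' 0)"], goal_cases)
  case 1
  have "mi P (iu ''j'' 0 (ta y) st)" using M by (simp add: mi_def F_def G_def SS_def PP_def)
  then show ?case using tt by (simp add: I_def lower_refl tsz_def SS_def pot_def)
 next
  case (2 sv)
  then show ?case using W W2 yN by (auto simp: I_def mi_def F_def unch_def y_def)
 next
  case (3 sv)
  let ?j = "sv$''j'' 0"
  have I: "ta y <= ?j" "?j <= te y" "mi P sv" "low st sv" "pS sv + 8000 * (te y - ?j) <= pS st + 8000 * tsz y"
   "\<forall>i. ta y <= i --> i < ?j --> sv$''r'' (tz i) ~= 0 & rmem sv ''D'' (tz i) <= c + td i" using 3(1) unfolding I_def by blast+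
  have g: "sv$''tz'' = tz" "sv$''te'' = te" "rmem sv ''td'' = td" "sv$''yy'' 0 = y" "rmem sv ''bs'' 0 = c"
   using I(3) 3(2) by (auto simp: mi_def F_def unch_def y_def c_def)
  have j: "?j < te y" using 3(3) g by simp
  then have e: "ent y ?j" using I(1) by (simp add: ent_def)
  have wz: "walk s (tz ?j) (c + td ?j)" using walk_trans[OF ent_walk[OF y e] y] .
  define z where "z = tz ?j"
  have zN: "z < N" using walk_lt[OF wz] z_def by simp
  have b: "?j <= W" "Suc 0 <= W" "z <= W" "Suc ?j <= W" "tz ?j = z" using j W W2 zN z_def by auto
  note b = b g
  define sv1 where "sv1 = iu ''x'' 0 z (ru ''nv'' 0 (c + td ?j) sv)"
  have t1: "mi P sv1" "low st sv1" "pS sv1 = pS sv" "SS N sv1 = SS N sv" using I(3,4) by (simp_all add: sv1_def mi_def F_def G_def SS_def PP_def pot_def)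
  have W3: "(pS sv1 + 3) * (N + 1) <= W" using I(5) t1 by (intro order.trans[OF mult_right_mono W(1)]) auto
  have "wp W relaxM (%t sv'. I (iu ''j'' 0 (Suc ?j) sv') & sv'$''j'' 0 = ?j & t + pS sv' <= pS sv + 7100) sv1"
  proof (rule wp_frame[OF wp_relaxM[OF t1(1) _ W3]], goal_cases)
   case 1
   then show ?case using wz b by (simp add: sv1_def)
  next
   case (2 t sv')
   have x1: "sv1$''x'' 0 = z" "rmem sv1 ''nv'' 0 = c + td ?j" by (simp_all add: sv1_def)
   have p: "mi P sv'" "low sv1 sv'" "sv'$''r'' z ~= 0" "rmem sv' ''D'' z <= c + td ?j" "t + pS sv' <= pS sv + 7100"
    using 2(1) unfolding x1 t1(3) by blast+
   have lo: "low sv sv'" using p(2) by (simp add: sv1_def)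
   have "sv'$''r'' (tz i) ~= 0 & rmem sv' ''D'' (tz i) <= c + td i" if "ta y <= i" "i < Suc ?j" for i
   proof (cases "i = ?j")
    case False
    then have i: "ent y i" "sv$''r'' (tz i) ~= 0" "rmem sv ''D'' (tz i) <= c + td i" using that I(6) j by (auto simp: ent_def)
    then have "tz i < N" using ent_walk[OF y i(1)] walk_lt by blast
    with i lo show ?thesis unfolding lower_def by (meson order.trans)
   qed (use p b in auto)
   moreover have "mi P (iu ''j'' 0 (Suc ?j) sv')" using p(1) by (simp add: mi_def F_def G_def SS_def PP_def)
   moreover have "pS sv' + 8000 * (te y - Suc ?j) <= pS st + 8000 * tsz y" using p(5) I(5) j by linarith
   ultimately have "I (iu ''j'' 0 (Suc ?j) sv')" using j I(1) lower_trans[OF I(4) lo] unfolding I_def by (simp add: SS_def pot_def)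
   then show ?case using p 2(2) by (simp add: unch_def sv1_def)
  qed
  note rl = this[unfolded sv1_def]
  show ?case
   apply (rule wp_RE, (simp add: b cong: wp_cong; fail)+)
   apply (rule wp_IE, (simp add: b cong: wp_cong; fail)+)
   apply (rule wp_Seq, rule wp_mono[OF rl])
   apply (rule wp_IAssign)
   using b j by (auto simp: SS_def pot_def)
 next
  case (4 t sv)
  have "sv$''te'' = te" "sv$''yy'' 0 = y" "pS (iu ''j'' 0 (ta y) st) = pS st" using 4 by (auto simp: I_def mi_def F_def unch_def y_def SS_def pot_def)
  with 4 have "sv$''j'' 0 = te y" by (simp add: I_def)
  then show ?case using 4(1,4) \<open>pS (iu ''j'' 0 (ta y) st) = pS st\<close> by (simp add: I_def seed_def ent_def tsz_def)
 qed
 note lp = this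
 have b: "st$''yy'' 0 = y" "st$''ta'' = ta" "y <= W" "ta y <= W" using f yN W2 tt W by (auto simp: y_def)
 show ?thesis unfolding pushT_def
  apply (rule wp_IE, (simp add: b cong: wp_cong; fail)+)
  apply (rule wp_mono[OF lp])
  by auto
qed

text \<open>The bound refers to the labels before the call. Labels may change while the table is
  read, but only downwards, so a later read is at least as good.\<close>

lemma wp_pullT:
 fixes st
 defines "v \<equiv> st$''v1'' 0"
 assumes M: "mi P st" and v: "walk s v d" and W: "(pS st + 8000 * tsz v + 3) * (N + 1) <= W" "te v <= W"
 shows "wp W pullT (%t st'. mi P st' & low st st' &
  (\<forall>j. ent v j --> st$''r'' (tz j) ~= 0 --> st'$''r'' v ~= 0 & rmem st' ''D'' v <= rmem st ''D'' (tz j) + td j) &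
  t + pS st' <= pS st + 8000 * tsz v + 20) st"
proof -
 have vN: "v < N" using walk_lt[OF v] by simp
 obtain jj where "ent v jj" using centre[OF v] unfolding table_def ent_def by metis
 then have tt: "ta v < te v" by (simp add: ent_def)
 have W2: "N < W" "1 <= W" using W(1) vN by (auto simp: algebra_simps)
 define I where "I = (%sv. ta v <= sv$''j'' 0 & sv$''j'' 0 <= te v & mi P sv & low st sv &
  (\<forall>i. ta v <= i --> i < sv$''j'' 0 --> st$''r'' (tz i) ~= 0 --> sv$''r'' v ~= 0 & rmem sv ''D'' v <= rmem st ''D'' (tz i) + td i) &
  pS sv + 8000 * (te v - sv$''j'' 0) <= pS st + 8000 * tsz v)"
 have "wp W pullT_loop (%t st'. mi P st' & low st st' &
  (\<forall>j. ent v j --> st$''r'' (tz j) ~= 0 --> st'$''r'' v ~= 0 & rmem st' ''D'' v <= rmem st ''D'' (tz j) + td j) &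
  t + pS st' <= pS st + 8000 * tsz v + 10) (iu ''j'' 0 (ta v) st)"
  unfolding pullT_loop_def
 proof (rule wp_While[where I = I and \<phi> = "%sv. pS sv + 8000 * (te v - sv$''j'' 0)"], goal_cases)
  case 1
  have "mi P (iu ''j'' 0 (ta v) st)" using M by (simp add: mi_def F_def G_def SS_def PP_def)
  then show ?case using tt by (simp add: I_def lower_refl tsz_def SS_def pot_def)
 next
  case (2 sv)
  then show ?case using W W2 vN by (auto simp: I_def mi_def F_def unch_def v_def pullT_step_def)
 next
  case (3 sv)
  let ?j = "sv$''j'' 0"
  have I: "ta v <= ?j" "?j <= te v" "mi P sv" "low st sv" "pS sv + 8000 * (te v - ?j) <= pS st + 8000 * tsz v"
   "\<forall>i. ta v <= i --> i < ?j --> st$''r'' (tz i) ~= 0 --> sv$''r'' v ~= 0 & rmem sv ''D'' v <= rmem st ''D'' (tz i) + td i"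
   using 3(1) unfolding I_def by blast+
  have g: "sv$''tz'' = tz" "sv$''te'' = te" "rmem sv ''td'' = td" "sv$''v1'' 0 = v"
   using I(3) 3(2) by (auto simp: mi_def F_def unch_def v_def pullT_step_def)
  have j: "?j < te v" using 3(3) g by simp
  then have e: "ent v ?j" using I(1) by (simp add: ent_def)
  define z where "z = tz ?j"
  have vz: "walk v z (td ?j)" using ent_walk[OF v e] z_def by simp
  have zN: "z < N" using walk_lt[OF vz] by simp
  have rz: "sv$''r'' z <= 1" "sv$''r'' z ~= 0 --> walk s z (rmem sv ''D'' z)" using I(3) zN unfolding mi_def lab_def by blast+
  have b: "?j <= W" "Suc 0 <= W" "z <= W" "v <= W" "Suc ?j <= W" "tz ?j = z" "sv$''r'' z <= W" using j W W2 zN vN z_def rz by auto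
  note b = b g
  have II: "I (iu ''j'' 0 (Suc ?j) sv')" if p: "mi P sv'" "low sv sv'" "pS sv' <= pS sv + 7100"
    "sv$''r'' z ~= 0 ==> sv'$''r'' v ~= 0 & rmem sv' ''D'' v <= rmem sv ''D'' z + td ?j" for sv'
  proof -
   have "sv'$''r'' v ~= 0 & rmem sv' ''D'' v <= rmem st ''D'' (tz i) + td i" if i: "ta v <= i" "i < Suc ?j" "st$''r'' (tz i) ~= 0" for i
   proof (cases "i = ?j")
    case True
    then have "sv$''r'' z ~= 0" "rmem sv ''D'' z <= rmem st ''D'' z" using i(3) I(4) zN unfolding z_def lower_def by auto
    then show ?thesis using p(4) True z_def by auto
   next
    case False
    then have "sv$''r'' v ~= 0" "rmem sv ''D'' v <= rmem st ''D'' (tz i) + td i" using i I(6) by auto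
    then show ?thesis using p(2) vN unfolding lower_def by (meson order.trans)
   qed
   moreover have "mi P (iu ''j'' 0 (Suc ?j) sv')" using p(1) by (simp add: mi_def F_def G_def SS_def PP_def)
   moreover have "pS sv' + 8000 * (te v - Suc ?j) <= pS st + 8000 * tsz v" using p(3) I(5) j by linarith
   ultimately show ?thesis using j I(1) lower_trans[OF I(4) p(2)] unfolding I_def by (simp add: SS_def pot_def)
  qed
  have stp: "wp W pullT_step (%t sv'. I (iu ''j'' 0 (Suc ?j) sv') & sv'$''j'' 0 = ?j & t + pS sv' <= pS sv + 7200) sv"
   unfolding pullT_step_def
  proof (rule wp_Cond, goal_cases)
   case 1
   show ?case by (simp add: b)
  next
   case 2
   then have r0: "sv$''r'' z ~= 0" by (simp add: b)
   let ?nv = "rmem sv ''D'' z + td ?j"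
   have wv: "walk s v ?nv" using walk_trans[OF walk_sym[OF vz]] rz r0 by blast
   define sv1 where "sv1 = iu ''x'' 0 v (ru ''nv'' 0 ?nv sv)"
   have t1: "mi P sv1" "pS sv1 = pS sv" using I(3,4) by (simp_all add: sv1_def mi_def F_def G_def SS_def PP_def pot_def)
   have W3: "(pS sv1 + 3) * (N + 1) <= W" using I(5) t1 by (intro order.trans[OF mult_right_mono W(1)]) auto
   have x1: "sv1$''x'' 0 = v" "rmem sv1 ''nv'' 0 = ?nv" by (simp_all add: sv1_def)
   have "wp W relaxM (%t sv'. I (iu ''j'' 0 (Suc ?j) sv') & sv'$''j'' 0 = ?j & t + pS sv' <= pS sv + 7100) sv1"
   proof (rule wp_frame[OF wp_relaxM[OF t1(1) _ W3]], goal_cases)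
    case 1
    then show ?case using wv by (simp only: x1)
   next
    case (2 t sv')
    have p: "mi P sv'" "low sv1 sv'" "sv'$''r'' v ~= 0" "rmem sv' ''D'' v <= ?nv" "t + pS sv' <= pS sv + 7100"
     using 2(1) unfolding x1 t1(2) by blast+
    then show ?case using II[OF p(1)] 2(2) by (simp add: unch_def sv1_def)
   qed
   note rl = this[unfolded sv1_def]
   show ?case
    apply (rule wp_RE, (simp add: b cong: wp_cong; fail)+)
    apply (rule wp_IE, (simp add: b cong: wp_cong; fail)+)
    apply (rule wp_mono[OF rl])
    by auto
  next
   case 3
   then have "sv$''r'' z = 0" by (simp add: b)
   then show ?case using II[OF I(3) lower_refl] by (intro wp_Skip) simp
  qed
  show ?case
   apply (rule wp_Seq, rule wp_mono[OF stp])
   apply (rule wp_IAssign)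
   using b j by (auto simp: SS_def pot_def)
 next
  case (4 t sv)
  have "sv$''te'' = te" "sv$''v1'' 0 = v" "pS (iu ''j'' 0 (ta v) st) = pS st"
   using 4 by (auto simp: I_def mi_def F_def unch_def v_def SS_def pot_def pullT_step_def)
  with 4 have "sv$''j'' 0 = te v" by (simp add: I_def)
  then show ?case using 4(1,4) \<open>pS (iu ''j'' 0 (ta v) st) = pS st\<close> by (auto simp: I_def ent_def tsz_def)
 qed
 note lp = this
 have b: "st$''v1'' 0 = v" "st$''ta'' = ta" "v <= W" "ta v <= W" using vN W2 tt W M by (auto simp: v_def mi_def F_def)
 show ?thesis unfolding pullT_def
  apply (rule wp_IE, (simp add: b cong: wp_cong; fail)+)
  apply (rule wp_mono[OF lp])
  by auto
qed

end

section \<open>Serving a bundle and the main loop\<close>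

definition ppull_loop :: com where
 "ppull_loop = While (pos (V ''cp'')) (''v1'' <- IMinus (V ''cp'') (Lit 1) ;; pullT ;; ''cp'' <- IElem ''ch'' (V ''v1''))"

definition pushV_loop :: com where
 "pushV_loop = While (ILess (V ''q1'') (IPlus (ITimes (Lit 3) (V ''v1'')) (Lit 3)))
  (''yy'' <- IDiv (IElem ''rv'' (V ''q1'')) (Lit 3) ;;
   RAssign ''bs'' (Lit 0) (RPlus (RElem ''D'' (V ''v1'')) (RElem ''wt'' (V ''q1''))) ;; pushT ;; inc ''q1'')"

definition pushV :: com where "pushV = ''q1'' <- ITimes (Lit 3) (V ''v1'') ;; pushV_loop"

definition ppush_loop :: com where
 "ppush_loop = While (pos (V ''cp'')) (''v1'' <- IMinus (V ''cp'') (Lit 1) ;; pushV ;; ''cp'' <- IElem ''ch'' (V ''v1''))"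

text \<open>Two passes over the bundle. The first makes all its labels final, relying on seeds left
  by earlier bundles; only then are labels passed on, so every seed is based on a final
  label.\<close>

definition serve :: com where
 "serve = ''pu'' <- V ''e'' ;; ''cp'' <- IElem ''hd'' (IPlus (V ''pu'') (Lit 1)) ;; ppull_loop ;;
  ''cp'' <- IElem ''hd'' (IPlus (V ''pu'') (Lit 1)) ;; ppush_loop"

lemma mods_serve [simp]:
 "imods ppull_loop = {''i'', ''y'', ''b'', ''a'', ''x'', ''p'', ''h'', ''l'', ''c'', ''r'', ''j'', ''v1'', ''cp''}" "rmods ppull_loop = {''D'', ''nv''}"
 "imods pushV = {''i'', ''y'', ''b'', ''a'', ''x'', ''p'', ''h'', ''l'', ''c'', ''r'', ''j'', ''q1'', ''yy''}" "rmods pushV = {''D'', ''nv'', ''bs''}"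
 "imods ppush_loop = {''i'', ''y'', ''b'', ''a'', ''x'', ''p'', ''h'', ''l'', ''c'', ''r'', ''j'', ''v1'', ''cp'', ''q1'', ''yy''}" "rmods ppush_loop = {''D'', ''nv'', ''bs''}"
 "imods serve = {''i'', ''y'', ''b'', ''a'', ''x'', ''p'', ''h'', ''l'', ''c'', ''r'', ''j'', ''v1'', ''cp'', ''q1'', ''yy'', ''pu''}" "rmods serve = {''D'', ''nv'', ''bs''}"
 by (auto simp: ppull_loop_def pushV_def pushV_loop_def ppush_loop_def serve_def)

definition mloop :: com where "mloop = While (pos (V ''c'')) (exmin ;; serve)"

definition bdcopy :: com where
 "bdcopy = While (ILess (V ''x'') (V ''N'')) (IAssign ''ls'' (V ''x'') (IElem ''bd'' (V ''x'')) ;; inc ''x'')"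

text \<open>With \<open>bd\<close> copied to \<open>ls\<close>, \<open>mkchain\<close> sorts the
  vertices by centre: chain \<open>Suc u\<close> is the bundle of \<open>u\<close>, which is why
  heads up to index \<open>N\<close> are kept.\<close>

definition mainp :: com where
 "mainp = ''x'' <- Lit 0 ;; bdcopy ;; ''lp'' <- V ''N'' ;; mkchain ;; RAssign ''bs'' (Lit 0) (RElem ''zero'' (Lit 0)) ;; ''yy'' <- V ''src'' ;; pushT ;; mloop"

context tables
begin

text \<open>Budget for the pushes from \<open>v\<close>. They go into the tables of its neighbours,
  whose sizes are unrelated to \<open>v\<close>; a bound exists only for the sum over all vertices,
  in \<open>todo_le\<close>.\<close>

definition pc :: "nat => nat" where "pc v = (\<Sum>q=3 * v..<3 * v + 3. 8000 * tsz (nb q) + 100)"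

definition tW :: "nat => bool" where "tW W \<longleftrightarrow> 3 * N + 3 <= W & (\<forall>v<N. bd v ~= 0 --> te v <= W)"

lemma te_W: "tW W ==> walk s v d ==> te v <= W"
 using walk_lt[of s v d] by (auto simp: tW_def elim!: centre)

lemma wp_ppull:
 fixes st
 assumes M: "mi P st" and xs: "lst cq (st$''cp'' 0) xs" "st$''ch'' = cq" "\<And>e. e < N ==> cq e <= N"
  and v: "\<And>v. v \<in> set xs ==> \<exists>d. walk s v d"
  and W: "(pS st + sum_list (map (%v. 8000 * tsz v + 100) xs) + 3) * (N + 1) <= W" "tW W"
 shows "wp W ppull_loop (%t st'. mi P st' & low st st' &
  (\<forall>v\<in>set xs. \<forall>j. ent v j --> st$''r'' (tz j) ~= 0 --> st'$''r'' v ~= 0 & rmem st' ''D'' v <= rmem st ''D'' (tz j) + td j) &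
  t + pS st' <= pS st + sum_list (map (%v. 8000 * tsz v + 100) xs) + 5) st"
proof -
 define c where "c = (%v. 8000 * tsz v + 100)"
 have W2: "3 * N + 3 <= W" using W(2) by (simp add: tW_def)
 have vN: "v < N" if "v \<in> set xs" for v using v[OF that] walk_lt by blast
 define I where "I = (%i sv. mi P sv & low st sv & (\<forall>v\<in>set (take i xs). \<forall>j. ent v j --> st$''r'' (tz j) ~= 0 -->
   sv$''r'' v ~= 0 & rmem sv ''D'' v <= rmem st ''D'' (tz j) + td j) & pS sv + sum_list (map c (drop i xs)) <= pS st + sum_list (map c xs))"
 show ?thesis unfolding c_def[symmetric] ppull_loop_def
 proof (rule wp_lst[OF xs(1), where I = I and \<phi> = "%i sv. pS sv + sum_list (map c (drop i xs))"], goal_cases)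
  case 1
  then show ?case using M lower_refl by (simp add: I_def)
 next
  case (2 e)
  then show ?case using vN W2 by fastforce
 next
  case (3 i sv)
  define v where "v = xs ! i"
  have vx: "v \<in> set xs" using 3(1) v_def by simp
  obtain d where d: "walk s v d" using v[OF vx] by blast
  have vn: "v < N" using vN[OF vx] .
  have I: "mi P sv" "low st sv" "pS sv + sum_list (map c (drop i xs)) <= pS st + sum_list (map c xs)"
   "\<forall>v\<in>set (take i xs). \<forall>j. ent v j --> st$''r'' (tz j) ~= 0 --> sv$''r'' v ~= 0 & rmem sv ''D'' v <= rmem st ''D'' (tz j) + td j"
   using 3(2) unfolding I_def by blast+
  have dr: "sum_list (map c (drop i xs)) = c v + sum_list (map c (drop (Suc i) xs))" using 3(1) by (simp add: Cons_nth_drop_Suc[symmetric] v_def)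
  define sv1 where "sv1 = iu ''v1'' 0 v sv"
  have t1: "mi P sv1" "pS sv1 = pS sv" "sv1$''v1'' 0 = v" using I(1) by (simp_all add: sv1_def mi_def F_def G_def SS_def PP_def pot_def)
  have W3: "(pS sv1 + 8000 * tsz v + 3) * (N + 1) <= W" using I(3) t1 dr by (intro order.trans[OF mult_right_mono W(1)]) (auto simp: c_def)
  have b: "sv$''cp'' 0 = Suc v" "Suc v <= W" "v <= W" "Suc 0 <= W" using 3(4) vn W2 by (auto simp: v_def)
  have stp: "wp W pullT (%t. wp W (''cp'' <- IElem ''ch'' (V ''v1'')) (%t' sv'. I (Suc i) sv' & sv'$''cp'' 0 = cq (xs ! i) & 
    pS sv' + sum_list (map c (drop (Suc i) xs)) + t + t' + 15 <= pS sv + sum_list (map c (drop i xs)))) sv1"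
  proof (rule wp_frame[OF wp_pullT[OF t1(1), unfolded t1(3), OF d W3 te_W[OF W(2) d]]], goal_cases)
   case (1 t sv')
   have p: "mi P sv'" "low sv1 sv'" "\<forall>j. ent v j --> sv1$''r'' (tz j) ~= 0 --> sv'$''r'' v ~= 0 & rmem sv' ''D'' v <= rmem sv1 ''D'' (tz j) + td j"
    "t + pS sv' <= pS sv + 8000 * tsz v + 20" using 1(1) unfolding t1(2) by blast+
   have lo: "low sv sv'" using p(2) by (simp add: sv1_def)
   have g: "sv'$''v1'' 0 = v" "sv'$''ch'' = cq" "cq v <= W" "v <= W" using 1(2) 3(3) xs(2) xs(3)[OF vn] vn W2 by (auto simp: unch_def sv1_def)
   define sv2 where "sv2 = iu ''cp'' 0 (cq v) sv'"
   have lo2: "lower (rmem sv ''D'') (sv$''r'') (rmem sv2 ''D'') (sv2$''r'')" using lo by (simp add: sv2_def)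
   have "I (Suc i) sv2"
    unfolding I_def
   proof (intro conjI ballI allI impI)
    show "mi P sv2" using p(1) by (simp add: sv2_def mi_def F_def G_def SS_def PP_def)
    show "low st sv2" using lower_trans[OF I(2) lo2] .
    show "pS sv2 + sum_list (map c (drop (Suc i) xs)) <= pS st + sum_list (map c xs)" using p(4) I(3) dr by (simp add: c_def sv2_def SS_def pot_def)
    fix w j assume w: "w \<in> set (take (Suc i) xs)" and j: "ent w j" "st$''r'' (tz j) ~= 0"
    have wx: "w \<in> set xs" using w by (rule in_set_takeD)
    obtain dw where dw: "walk s w dw" using v[OF wx] by blast
    have "tz j < N" using walk_lt[OF ent_walk[OF dw j(1)]] by simp
    then have rj: "sv$''r'' (tz j) ~= 0" "rmem sv ''D'' (tz j) <= rmem st ''D'' (tz j)" using I(2) j(2) unfolding lower_def by auto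
    have "sv2$''r'' w ~= 0 & rmem sv2 ''D'' w <= rmem st ''D'' (tz j) + td j"
    proof (cases "w = v")
     case True
     then show ?thesis using p(3) j rj by (auto simp: sv1_def sv2_def)
    next
     case False
     then have "w \<in> set (take i xs)" using w 3(1) by (simp add: take_Suc_conv_app_nth v_def)
     then show ?thesis using I(4) j lo2 vN[OF wx] unfolding lower_def by (meson order.trans)
    qed
    then show "sv2$''r'' w ~= 0" "rmem sv2 ''D'' w <= rmem st ''D'' (tz j) + td j" by blast+
   qed
   then show ?case using p(4) dr by (intro wp_IAssign) (simp_all add: g sv2_def c_def v_def[symmetric] SS_def pot_def)
  qed
  show ?case
   apply (rule wp_IE, (simp add: b cong: wp_cong; fail)+)
   apply (rule wp_Seq, rule wp_mono[OF stp[unfolded sv1_def]], erule wp_mono)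
   by auto
 next
  case (4 t sv)
  then show ?case by (simp add: I_def)
 qed
qed

lemma wp_pushV:
 fixes st
 defines "v \<equiv> st$''v1'' 0"
 assumes M: "mi P st" and v: "v < N" and f: "fin (rmem st ''D'') (st$''r'') v" and W: "(pS st + pc v + 3) * (N + 1) <= W" "tW W"
 shows "wp W pushV (%t st'. mi P st' & low st st' &
  (\<forall>q. q div 3 = v --> seed (rmem st' ''D'') (st'$''r'') (nb q) (rmem st ''D'' v + wt q)) & t + pS st' <= pS st + pc v + 30) st"
proof -
 let ?d = "rmem st ''D'' v"
 have W2: "3 * N + 3 <= W" using W(2) by (simp add: tW_def)
 have L: "lab (rmem st ''D'') (st$''r'')" using M by (simp add: mi_def)
 define c where "c = (%q. \<Sum>q=q..<3 * v + 3. 8000 * tsz (nb q) + 100)"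
 define I where "I = (%sv. 3 * v <= sv$''q1'' 0 & sv$''q1'' 0 <= 3 * v + 3 & mi P sv & low st sv &
  (\<forall>q. 3 * v <= q --> q < sv$''q1'' 0 --> seed (rmem sv ''D'') (sv$''r'') (nb q) (?d + wt q)) &
  pS sv + c (sv$''q1'' 0) <= pS st + pc v)"
 have wq: "walk s (nb q) (?d + wt q)" "q < 3 * N" if "3 * v <= q" "q < 3 * v + 3" for q
 proof -
  show q: "q < 3 * N" using that v by linarith
  have "q div 3 = v" using that by linarith
  then show "walk s (nb q) (?d + wt q)" using fin_nb[OF _ L q] f by simp
 qed
 have "wp W pushV_loop (%t st'. mi P st' & low st st' &
  (\<forall>q. q div 3 = v --> seed (rmem st' ''D'') (st'$''r'') (nb q) (?d + wt q)) & t + pS st' <= pS st + pc v + 15) (iu ''q1'' 0 (3 * v) st)"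
  unfolding pushV_loop_def
 proof (rule wp_While[where I = I and \<phi> = "%sv. pS sv + c (sv$''q1'' 0)"], goal_cases)
  case 1
  have "mi P (iu ''q1'' 0 (3 * v) st)" using M by (simp add: mi_def F_def G_def SS_def PP_def)
  then show ?case by (simp add: I_def lower_refl c_def pc_def SS_def pot_def)
 next
  case (2 sv)
  have "sv$''v1'' 0 = v" "sv$''q1'' 0 <= 3 * v + 3" using 2 by (auto simp: I_def unch_def v_def)
  then show ?case using W2 v by simp
 next
  case (3 sv)
  let ?q = "sv$''q1'' 0"
  have I: "3 * v <= ?q" "mi P sv" "low st sv" "pS sv + c ?q <= pS st + pc v"
   "\<forall>q. 3 * v <= q --> q < ?q --> seed (rmem sv ''D'') (sv$''r'') (nb q) (?d + wt q)" using 3(1) unfolding I_def by blast+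
  have g: "sv$''v1'' 0 = v" "sv$''rv'' = rv" "rmem sv ''wt'' = wt" using 3(2) I(2) by (auto simp: unch_def v_def mi_def F_def G_def)
  have q: "?q < 3 * v + 3" using 3(3) g by simp
  define y where "y = nb ?q"
  have wy: "walk s y (?d + wt ?q)" "?q < 3 * N" using wq[OF I(1) q] y_def by auto
  have yN: "y < N" using walk_lt[OF wy(1)] by simp
  \<comment> \<open>The pushes may relax \<open>v\<close> itself, but its label is final, so all
    three slots are served with the same value.\<close>
  have dq: "rmem sv ''D'' v = ?d" using fin_eq[OF f I(3) v L] I(2) by (simp add: mi_def)
  have cq: "c ?q = 8000 * tsz y + 100 + c (Suc ?q)" using q by (simp add: c_def y_def sum.atLeast_Suc_lessThan)
  define sv1 where "sv1 = ru ''bs'' 0 (?d + wt ?q) (iu ''yy'' 0 y sv)"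
  have t1: "mi P sv1" "pS sv1 = pS sv" "sv1$''yy'' 0 = y" "rmem sv1 ''bs'' 0 = ?d + wt ?q" using I(2) by (simp_all add: sv1_def mi_def F_def G_def SS_def PP_def pot_def)
  have W3: "(pS sv1 + 8000 * tsz y + 3) * (N + 1) <= W" using I(4) t1 cq by (intro order.trans[OF mult_right_mono W(1)]) auto
  have "rv ?q <= W" using rv_lt[OF wy(2)] W2 by linarith
  then have b: "Suc ?q <= W" "?q <= W" "y <= W" "v <= W" "Suc 0 <= W" "rv ?q <= W" "3 <= W" "rv ?q div 3 = y" "rmem sv ''D'' v = ?d"
   using W2 wy(2) yN v dq y_def by auto
  note b = b g
  have stp: "wp W pushT (%t sv'. I (iu ''q1'' 0 (Suc ?q) sv') & sv'$''q1'' 0 = ?q & t + pS sv' <= pS sv + 8000 * tsz y + 20) sv1"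
  proof (rule wp_frame[OF wp_pushT[OF t1(1), unfolded t1(3,4), OF wy(1) W3 te_W[OF W(2) wy(1)]]], goal_cases)
   case (1 t sv')
   have p: "mi P sv'" "low sv1 sv'" "seed (rmem sv' ''D'') (sv'$''r'') y (?d + wt ?q)" "t + pS sv' <= pS sv + 8000 * tsz y + 20"
    using 1(1) unfolding t1(2) by blast+
   have lo: "low sv sv'" using p(2) by (simp add: sv1_def)
   have "seed (rmem sv' ''D'') (sv'$''r'') (nb q) (?d + wt q)" if "3 * v <= q" "q < Suc ?q" for q
   proof (cases "q = ?q")
    case False
    then have "seed (rmem sv ''D'') (sv$''r'') (nb q) (?d + wt q)" using I(5) that by simp
    then show ?thesis by (rule seed_lower[OF _ lo wq(1)[OF that(1)]]) (use that q in simp)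
   qed (use p(3) y_def in simp)
   moreover have "mi P (iu ''q1'' 0 (Suc ?q) sv')" using p(1) by (simp add: mi_def F_def G_def SS_def PP_def)
   ultimately have "I (iu ''q1'' 0 (Suc ?q) sv')"
    using q I(1,4) cq p(4) lower_trans[OF I(3) lo] unfolding I_def by (simp add: SS_def pot_def)
   then show ?case using p(4) 1(2) by (simp add: unch_def sv1_def)
  qed
  show ?case
   apply (rule wp_IE, (simp add: b cong: wp_cong; fail)+)
   apply (rule wp_RE, (simp add: b cong: wp_cong; fail)+)
   apply (rule wp_Seq, rule wp_mono[OF stp[unfolded sv1_def]])
   apply (rule wp_IAssign)
   using b cq by (auto simp: SS_def pot_def)
 next
  case (4 t sv)
  have pp: "pS (iu ''q1'' 0 (3 * v) st) = pS st" "c (3 * v) = pc v" by (simp_all add: SS_def pot_def c_def pc_def)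
  have g: "sv$''v1'' 0 = v" using 4(2) by (simp add: unch_def v_def)
  then have qq: "sv$''q1'' 0 = 3 * v + 3" using 4(1,3) by (simp add: I_def)
  have "seed (rmem sv ''D'') (sv$''r'') (nb q) (?d + wt q)" if "q div 3 = v" for q
   using 4(1) that unfolding I_def qq by auto
  then show ?case using 4(1,4) pp by (simp add: I_def)
 qed
 note lp = this
 have b: "st$''v1'' 0 = v" "3 <= W" "v <= W" "3 * v <= W" using v W2 by (auto simp: v_def)
 show ?thesis unfolding pushV_def
  apply (rule wp_IE, (simp add: b cong: wp_cong; fail)+)
  apply (rule wp_mono[OF lp])
  by auto
qed

lemma wp_ppush:
 fixes st
 assumes M: "mi P st" and xs: "lst cq (st$''cp'' 0) xs" "st$''ch'' = cq" "\<And>e. e < N ==> cq e <= N"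
  and v: "\<And>v. v \<in> set xs ==> v < N & fin (rmem st ''D'') (st$''r'') v"
  and W: "(pS st + sum_list (map (%v. pc v + 100) xs) + 3) * (N + 1) <= W" "tW W"
 shows "wp W ppush_loop (%t st'. mi P st' & low st st' &
  (\<forall>v\<in>set xs. \<forall>q. q div 3 = v --> seed (rmem st' ''D'') (st'$''r'') (nb q) (rmem st ''D'' v + wt q)) &
  t + pS st' <= pS st + sum_list (map (%v. pc v + 100) xs) + 5) st"
proof -
 define c where "c = (%v. pc v + 100)"
 have W2: "3 * N + 3 <= W" using W(2) by (simp add: tW_def)
 have L: "lab (rmem st ''D'') (st$''r'')" using M by (simp add: mi_def)
 define I where "I = (%i sv. mi P sv & low st sv &
   (\<forall>v\<in>set (take i xs). \<forall>q. q div 3 = v --> seed (rmem sv ''D'') (sv$''r'') (nb q) (rmem st ''D'' v + wt q)) &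
   pS sv + sum_list (map c (drop i xs)) <= pS st + sum_list (map c xs))"
 show ?thesis unfolding c_def[symmetric] ppush_loop_def
 proof (rule wp_lst[OF xs(1), where I = I and \<phi> = "%i sv. pS sv + sum_list (map c (drop i xs))"], goal_cases)
  case 1
  then show ?case using M lower_refl by (simp add: I_def)
 next
  case (2 e)
  then show ?case using v W2 by fastforce
 next
  case (3 i sv)
  define v where "v = xs ! i"
  have vx: "v \<in> set xs" using 3(1) v_def by simp
  have vn: "v < N" and fv: "fin (rmem st ''D'') (st$''r'') v" using v[OF vx] by auto
  have I: "mi P sv" "low st sv" "pS sv + sum_list (map c (drop i xs)) <= pS st + sum_list (map c xs)"
   "\<forall>v\<in>set (take i xs). \<forall>q. q div 3 = v --> seed (rmem sv ''D'') (sv$''r'') (nb q) (rmem st ''D'' v + wt q)"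
   using 3(2) unfolding I_def by blast+
  have Dv: "rmem sv ''D'' v = rmem st ''D'' v" using fin_eq[OF fv I(2) vn L] I(1) by (simp add: mi_def)
  have dr: "sum_list (map c (drop i xs)) = c v + sum_list (map c (drop (Suc i) xs))" using 3(1) by (simp add: Cons_nth_drop_Suc[symmetric] v_def)
  define sv1 where "sv1 = iu ''v1'' 0 v sv"
  have t1: "mi P sv1" "pS sv1 = pS sv" "sv1$''v1'' 0 = v" "rmem sv1 ''D'' v = rmem st ''D'' v"
   using I(1) Dv by (simp_all add: sv1_def mi_def F_def G_def SS_def PP_def pot_def)
  have f1: "fin (rmem sv1 ''D'') (sv1$''r'') v" using fin_lower[OF fv I(2) vn] by (simp add: sv1_def)
  have W3: "(pS sv1 + pc v + 3) * (N + 1) <= W" using I(3) t1 dr by (intro order.trans[OF mult_right_mono W(1)]) (auto simp: c_def)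
  have b: "sv$''cp'' 0 = Suc v" "Suc v <= W" "v <= W" "Suc 0 <= W" using 3(4) vn W2 by (auto simp: v_def)
  have stp: "wp W pushV (%t. wp W (''cp'' <- IElem ''ch'' (V ''v1'')) (%t' sv'. I (Suc i) sv' & sv'$''cp'' 0 = cq (xs ! i) & 
    pS sv' + sum_list (map c (drop (Suc i) xs)) + t + t' + 15 <= pS sv + sum_list (map c (drop i xs)))) sv1"
  proof (rule wp_frame[OF wp_pushV[OF t1(1), unfolded t1(3), OF vn f1 W3 W(2)]], goal_cases)
   case (1 t sv')
   have p: "mi P sv'" "low sv1 sv'" "\<forall>q. q div 3 = v --> seed (rmem sv' ''D'') (sv'$''r'') (nb q) (rmem st ''D'' v + wt q)"
    "t + pS sv' <= pS sv + pc v + 30" using 1(1) unfolding t1(2,4) by blast+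
   have lo: "low sv sv'" using p(2) by (simp add: sv1_def)
   have g: "sv'$''v1'' 0 = v" "sv'$''ch'' = cq" "cq v <= W" "v <= W" using 1(2) 3(3) xs(2) xs(3)[OF vn] vn W2 by (auto simp: unch_def sv1_def)
   define sv2 where "sv2 = iu ''cp'' 0 (cq v) sv'"
   have r2: "rmem sv2 = rmem sv'" "sv2$''r'' = sv'$''r''" by (simp_all add: sv2_def)
   have "I (Suc i) sv2"
    unfolding I_def r2
   proof (intro conjI ballI allI impI)
    show "mi P sv2" using p(1) by (simp add: sv2_def mi_def F_def G_def SS_def PP_def)
    show "low st sv'" using lower_trans[OF I(2) lo] .
    show "pS sv2 + sum_list (map c (drop (Suc i) xs)) <= pS st + sum_list (map c xs)" using p(4) I(3) dr by (simp add: c_def sv2_def SS_def pot_def)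
    fix w q assume w: "w \<in> set (take (Suc i) xs)" and q: "q div 3 = w"
    show "seed (rmem sv' ''D'') (sv'$''r'') (nb q) (rmem st ''D'' w + wt q)"
    proof (cases "w = v")
     case True
     then show ?thesis using p(3) q by simp
    next
     case False
     then have wi: "w \<in> set (take i xs)" using w 3(1) by (simp add: take_Suc_conv_app_nth v_def)
     then have "w \<in> set xs" by (rule in_set_takeD)
     then have ww: "w < N" "fin (rmem st ''D'') (st$''r'') w" using v by auto
     then have "q < 3 * N" using q by linarith
     then have "walk s (nb q) (rmem st ''D'' w + wt q)" using fin_nb[OF _ L, of q] ww q by simp
     then show ?thesis using seed_lower[OF _ lo] I(4) wi q by blast
    qed
   qed
   then show ?case using p(4) dr by (intro wp_IAssign) (simp_all add: g sv2_def c_def v_def[symmetric] SS_def pot_def)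
  qed
  show ?case
   apply (rule wp_IE, (simp add: b cong: wp_cong; fail)+)
   apply (rule wp_Seq, rule wp_mono[OF stp[unfolded sv1_def]], erule wp_mono)
   by auto
 next
  case (4 t sv)
  then show ?case by (simp add: I_def)
 qed
qed

definition cst :: "nat => nat" where "cst v = 8000 * tsz v + pc v + 200"

lemma wp_serve:
 fixes st
 defines "u \<equiv> st$''e'' 0" and "D \<equiv> rmem st ''D''" and "r \<equiv> st$''r''"
 assumes M: "mi (insert u P) st" and S: "sinv D r P" and u: "u < N" "u \<notin> P" "r u ~= 0"
  and min: "\<And>x. x < N ==> R x ~= 0 ==> r x ~= 0 ==> x \<notin> P ==> D u <= D x"
  and ch: "st$''hd'' = hq" "st$''ch'' = cq" "chains (Suc N) bd N hq cq" "\<And>x. x <= N ==> hq x <= N" "\<And>e. e < N ==> cq e <= N"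
  and W: "(pS st + sum cst {v. v < N & bd v = Suc u} + 10) * (N + 1) <= W" "tW W"
 shows "wp W serve (%t st'. mi (insert u P) st' & sinv (rmem st' ''D'') (st'$''r'') (insert u P) &
  t + pS st' <= pS st + sum cst {v. v < N & bd v = Suc u} + 60) st"
proof -
 let ?B = "{v. v < N & bd v = Suc u}"
 obtain xs where xs: "lst cq (hq (Suc u)) xs" "distinct xs" "set xs = ?B" using ch(3) u(1) by (auto simp: chains_def)
 have sl: "sum_list (map f xs) = sum f ?B" for f :: "nat => nat" using xs by (metis sum_list_distinct_conv_sum_set)
 have L: "lab D r" using M by (simp add: mi_def D_def r_def)
 have su: "walk s u (D u)" using L u by (simp add: lab_def)
 \<comment> \<open>The cell of the centre in the table of \<open>v\<close> gives a labelled vertex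
   to pull from and, traversed backwards, a walk from the source to \<open>v\<close>.\<close>
 have ev: "\<exists>j. ent v j & tz j = u" "\<exists>d. walk s v d" if "v \<in> ?B" for v
 proof -
  have tv: "table tz td v (ta v) (te v)" "reaches tz td v (ta v) (te v) u" using bd[of v] that by auto
  then obtain j where j: "ta v <= j" "j < te v" "tz j = u" unfolding reaches_def by blast
  then show "\<exists>j. ent v j & tz j = u" by (auto simp: ent_def)
  have "walk v u (td j)" using tv(1) j by (auto simp: table_def)
  then show "\<exists>d. walk s v d" using walk_trans[OF walk_sym su] by blast
 qed
 have nd: "\<not> dn P v" if "v \<in> ?B" for v using that u(2) by (auto simp: dn_def)
 have W2: "3 * N + 3 <= W" using W(2) by (simp add: tW_def)
 define A where "A = (\<Sum>v\<in>?B. 8000 * tsz v + 100)"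
 define A' where "A' = (\<Sum>v\<in>?B. pc v + 100)"
 have AA: "sum cst ?B = A + A'" by (simp add: A_def A'_def cst_def sum.distrib)
 define st1 where "st1 = iu ''cp'' 0 (hq (Suc u)) (iu ''pu'' 0 u st)"
 have s1: "mi (insert u P) st1" "pS st1 = pS st" "st1$''cp'' 0 = hq (Suc u)" "st1$''ch'' = cq" "rmem st1 ''D'' = D" "st1$''r'' = r"
  using M ch by (simp_all add: st1_def mi_def F_def G_def SS_def PP_def pot_def D_def r_def)
 have W3: "(pS st1 + sum_list (map (%v. 8000 * tsz v + 100) xs) + 3) * (N + 1) <= W"
  unfolding sl A_def[symmetric] s1 using AA by (intro order.trans[OF mult_right_mono W(1)]) auto
 have "wp W ppull_loop (%t. wp W (''cp'' <- IElem ''hd'' (IPlus (V ''pu'') (Lit 1)) ;; ppush_loop)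
   (%t' st'. mi (insert u P) st' & sinv (rmem st' ''D'') (st'$''r'') (insert u P) & t + t' + pS st' <= pS st + sum cst ?B + 40)) st1"
 proof (rule wp_frame[OF wp_ppull[OF s1(1) xs(1)[folded s1(3)] s1(4) ch(5) _ W3 W(2)]], goal_cases)
  case (2 v)
  then show ?case using ev xs(3) by simp
 next
  case (3 t st2)
  define D2 where "D2 = rmem st2 ''D''"
  define r2 where "r2 = st2$''r''"
  have p: "mi (insert u P) st2" "lower D r D2 r2"
   "\<forall>v\<in>?B. \<forall>j. ent v j --> r (tz j) ~= 0 --> r2 v ~= 0 & D2 v <= D (tz j) + td j" "t + pS st2 <= pS st + A + 5"
   using 3(1) unfolding sl A_def[symmetric] s1 xs(3) D2_def r2_def by blast+
  have L2: "lab D2 r2" using p(1) by (simp add: mi_def D2_def r2_def)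
  have fv: "fin D2 r2 v" if v: "v \<in> ?B" for v
  proof -
   have "r2 v ~= 0" using p(3) v ev(1)[OF v] u(3) by blast
   moreover have "D2 v <= d" if d: "walk s v d" for d
   proof -
    obtain j where j: "ent v j" "r (tz j) ~= 0" "D (tz j) + td j <= d"
     \<comment> \<open>Applied to the state before the first pull; \<open>p(3)\<close> was stated
       for just those labels.\<close>
     using pull_correct[OF S L _ _ nd[OF v] u(3) min d] v by blast
    then have "D2 v <= D (tz j) + td j" using p(3) v by blast
    then show ?thesis using j(3) by linarith
   qed
   ultimately show ?thesis by (simp add: fin_def)
  qed
  have g: "st2$''pu'' 0 = u" "st2$''hd'' = hq" "st2$''ch'' = cq" using 3(2) ch by (auto simp: unch_def st1_def)
  define st3 where "st3 = iu ''cp'' 0 (hq (Suc u)) st2"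
  have s3: "mi (insert u P) st3" "pS st3 = pS st2" "st3$''cp'' 0 = hq (Suc u)" "st3$''ch'' = cq" "rmem st3 ''D'' = D2" "st3$''r'' = r2"
   using p(1) g by (simp_all add: st3_def mi_def F_def G_def SS_def PP_def pot_def D2_def r2_def)
  have W4: "(pS st3 + sum_list (map (%v. pc v + 100) xs) + 3) * (N + 1) <= W"
   unfolding sl A'_def[symmetric] s3 using AA p(4) by (intro order.trans[OF mult_right_mono W(1)]) auto
  have stp: "wp W ppush_loop (%t' st'. mi (insert u P) st' & sinv (rmem st' ''D'') (st'$''r'') (insert u P) & t + t' + pS st' <= pS st + sum cst ?B + 20) st3"
  proof (rule wp_mono[OF wp_ppush[OF s3(1) xs(1)[folded s3(3)] s3(4) ch(5) _ W4 W(2)]], goal_cases)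
   case (2 v)
   then show ?case using fv xs(3) by (simp add: s3)
  next
   case (3 t' st')
   define D3 where "D3 = rmem st' ''D''"
   define r3 where "r3 = st'$''r''"
   have h: "mi (insert u P) st'" "lower D2 r2 D3 r3"
    "\<forall>v\<in>?B. \<forall>q. q div 3 = v --> seed D3 r3 (nb q) (D2 v + wt q)" "t' + pS st' <= pS st2 + A' + 5"
    using 3(1) unfolding sl A'_def[symmetric] s3 xs(3) D3_def r3_def by blast+
   have L3: "lab D3 r3" using h(1) by (simp add: mi_def D3_def r3_def)
   have S3: "sinv D3 r3 P" using sinv_lower[OF S lower_trans[OF p(2) h(2)] L L3] .
   have dnu: "dn (insert u P) v \<longleftrightarrow> dn P v \<or> bd v = Suc u" for v by (auto simp: dn_def)
   have "sinv D3 r3 (insert u P)"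
    unfolding sinv_def dnu
   proof (intro conjI allI impI)
    show "seed D3 r3 s 0" using S3 by (simp add: sinv_def)
    show "fin D3 r3 x" if "x < N" "dn P x \<or> bd x = Suc u" for x
     using that S3 fin_lower[OF fv h(2)] by (auto simp: sinv_def)
    show "seed D3 r3 (nb q) (D3 (q div 3) + wt q)" if q: "q < 3 * N" "dn P (q div 3) \<or> bd (q div 3) = Suc u" for q
    proof (cases "dn P (q div 3)")
     case False
     then have vB: "q div 3 \<in> ?B" using q div3_lt by simp
     then have "D3 (q div 3) = D2 (q div 3)" using fin_eq[OF fv h(2) _ L2 L3] by simp
     then show ?thesis using h(3) vB by simp
    qed (use S3 q in \<open>auto simp: sinv_def\<close>)
   qed
   then show ?case using h(1,4) p(4) AA unfolding D3_def r3_def by simp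
  qed
  have b: "st2$''pu'' 0 = u" "st2$''hd'' = hq" "Suc 0 <= W" "u <= W" "Suc u <= W" "hq (Suc u) <= W" using g u(1) ch(4)[of "Suc u"] W2 by auto
  show ?case
   apply (rule wp_IE, (simp add: b cong: wp_cong; fail)+)
   apply (rule wp_mono[OF stp[unfolded st3_def]])
   by auto
 qed
 note lp = this
 have b: "st$''e'' 0 = u" "st$''hd'' = hq" "Suc 0 <= W" "u <= W" "Suc u <= W" "hq (Suc u) <= W" using ch(1) u(1) ch(4)[of "Suc u"] W2 u_def by auto
 show ?thesis unfolding serve_def
  apply (rule wp_IE, (simp add: b cong: wp_cong; fail)+)
  apply (rule wp_IE, (simp add: b cong: wp_cong; fail)+)
  apply (rule wp_Seq, rule wp_mono[OF lp[unfolded st1_def]], erule wp_mono)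
  by auto
qed

text \<open>Time still to be spent: one extraction for each centre outside \<open>P\<close>, and one
  pull with its pushes for each vertex that is not done, as every bundle is served once.\<close>

definition todo :: "nat => nat set => nat" where
 "todo l P = (6000 * l + 3100) * card ({x. x < N & R x ~= 0} - P) + sum cst {v. v < N & \<not> dn P v}"

lemma wp_mloop:
 fixes st l
 defines "B \<equiv> pS st + todo l {}"
 assumes M: "mi {} st" and S: "sinv (rmem st ''D'') (st$''r'') {}" and l: "N <= 2 ^ l"
  and ch: "st$''hd'' = hq" "st$''ch'' = cq" "chains (Suc N) bd N hq cq" "\<And>x. x <= N ==> hq x <= N" "\<And>e. e < N ==> cq e <= N"
  and W: "(4 * B + 2 * N + 20) * (N + 1) <= W" "tW W"
 shows "wp W mloop (%t st'. lab (rmem st' ''D'') (st'$''r'') & (\<forall>x<N. st'$''r'' x <= 1) & (\<forall>v d. walk s v d --> fin (rmem st' ''D'') (st'$''r'') v) & t <= B + 10) st"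
proof -
 define I where "I = (%sv. mi (PP N sv) sv & sinv (rmem sv ''D'') (sv$''r'') (PP N sv) & pS sv + todo l (PP N sv) <= B)"
 have c0: "sv$''c'' 0 = card (SS N sv)" if "mi P sv" for P sv using that unfolding mi_def hinv_def by simp
 have P0: "PP N st = {}" using M by (simp add: mi_def)
 have cS: "card (SS N sv) <= N" "finite (SS N sv)" for sv
 proof -
  have "SS N sv \<subseteq> {..<N}" by (auto simp: SS_def)
  then show "card (SS N sv) <= N" "finite (SS N sv)" using card_mono[of "{..<N}" "SS N sv"] finite_subset by auto
 qed
 have W2: "3 * N + 3 <= W" using W(2) by (simp add: tW_def)
 show ?thesis unfolding mloop_def
 proof (rule wp_While[where I = I and \<phi> = "%sv. pS sv + todo l (PP N sv)"], goal_cases)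
  case 1
  show ?case using M S P0 by (simp add: I_def B_def)
 next
  case (2 sv)
  then have "sv$''c'' 0 <= N" using c0[of "PP N sv" sv] cS(1)[of sv] by (simp add: I_def)
  then show ?case using W2 by simp
 next
  case (3 sv)
  define P where "P = PP N sv"
  define D where "D = rmem sv ''D''"
  define r where "r = sv$''r''"
  have I: "mi P sv" "sinv D r P" "pS sv + todo l P <= B" using 3(1) unfolding I_def P_def D_def r_def by blast+
  have m: "F sv" "HI N (SS N sv) {} sv" "lab D r" and ir: "\<And>x. x < N ==> sv$''i'' x <= 2 & r x <= 1 & (sv$''i'' x ~= 0 \<longleftrightarrow> R x ~= 0 & r x ~= 0)"
   using I(1) unfolding mi_def D_def r_def by blast+
  have ne: "SS N sv ~= {}" using 3(3) c0[OF I(1)] by auto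
  have NN: "sv$''N'' 0 = N" using m(1) by (simp add: F_def G_def)
  have W3: "(4 * mh (SS N sv) (sv$''h'') + 2 * N + 8) * (N + 1) <= W"
   using mh_pot[of "SS N sv" sv] I(3) by (intro order.trans[OF mult_right_mono W(1)]) auto
  show ?case
  proof (rule wp_Seq, rule wp_frame[OF wp_exmin[OF m(2) ne NN order.trans[OF cS(1) l] W3]], goal_cases)
   case (1 t1 st1)
   then obtain e where e: "e \<in> SS N sv" "st1$''e'' 0 = e" "\<forall>z\<in>SS N sv. D e <= D z" "HI N (SS N sv - {e}) {} st1"
    "st1$''i'' = (sv$''i'')(e := 2)" "t1 + pot (SS N sv - {e}) st1 <= pS sv + 6000 * l + 3000" unfolding D_def by blast
   have un: "st1$a = sv$a" if "a \<notin> {''g'', ''bx'', ''x'', ''b'', ''e'', ''tn'', ''y'', ''p'', ''t'', ''c'', ''h'', ''i'', ''a'', ''l'', ''f'', ''tq''}" for a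
    using 1(2) that by (simp add: unch_def)
   have rn: "rmem st1 = rmem sv" using 1(2) by (auto simp: unch_def)
   have eN: "e < N" "sv$''i'' e = 1" using e(1) by (auto simp: SS_def)
   have eP: "e \<notin> P" using eN by (simp add: P_def PP_def)
   have S1: "SS N st1 = SS N sv - {e}" "PP N st1 = insert e P" using eN by (auto simp: SS_def PP_def P_def e(5))
   have re: "R e ~= 0" "r e ~= 0" using ir[OF eN(1)] eN by auto
   have D1: "rmem st1 ''D'' = D" "st1$''r'' = r" by (simp_all add: un rn D_def r_def)
   have M1: "mi (insert e P) st1"
    unfolding mi_def
   proof (intro conjI)
    show "F st1" using m(1) by (simp add: F_def G_def un rn)
    show "HI N (SS N st1) {} st1" "PP N st1 = insert e P" using e(4) S1 by simp_all
    show "\<forall>x<N. st1$''i'' x <= 2 & st1$''r'' x <= 1 & (st1$''i'' x ~= 0 \<longleftrightarrow> R x ~= 0 & st1$''r'' x ~= 0)"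
     using ir re unfolding D1 by (auto simp: e(5))
    show "lab (rmem st1 ''D'') (st1$''r'')" unfolding D1 by (rule m)
   qed
   let ?B = "{v. v < N & bd v = Suc e}"
   have td: "todo l P = 6000 * l + 3100 + sum cst ?B + todo l (insert e P)"
   proof -
    have "{v. v < N & \<not> dn P v} = {v. v < N & \<not> dn (insert e P) v} \<union> ?B" using eP by (auto simp: dn_def)
    then have "sum cst {v. v < N & \<not> dn P v} = sum cst {v. v < N & \<not> dn (insert e P) v} + sum cst ?B"
     by (simp only:) (rule sum.union_disjoint, auto simp: dn_def)
    moreover have "card ({x. x < N & R x ~= 0} - P) = Suc (card ({x. x < N & R x ~= 0} - insert e P))"
     using card_Suc_Diff1[of "{x. x < N & R x ~= 0} - P" e] eN re eP by (simp add: Diff_insert[symmetric])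
    ultimately show ?thesis by (simp add: todo_def algebra_simps)
   qed
   have p1: "t1 + pS st1 <= pS sv + 6000 * l + 3000" using e(6) S1 by simp
   have W4: "(pS st1 + sum cst ?B + 10) * (N + 1) <= W"
    using I(3) td p1 by (intro order.trans[OF mult_right_mono W(1)]) auto
   have mn: "D e <= D x" if "x < N" "R x ~= 0" "r x ~= 0" "x \<notin> P" for x
   proof -
    have "sv$''i'' x = 1" using ir[OF that(1)] that by (auto simp: P_def PP_def)
    then show ?thesis using e(3) that(1) by (simp add: SS_def)
   qed
   have h1: "st1$''hd'' = hq" "st1$''ch'' = cq" using 3(2) ch by (auto simp: un unch_def)
   show ?case
   proof (rule wp_mono[OF wp_serve[where P = P and st = st1, unfolded e(2) D1, OF M1 I(2) eN(1) eP re(2) mn h1 ch(3-5) W4 W(2)]], goal_cases)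
    case (7 t st')
    then have h: "mi (insert e P) st'" "sinv (rmem st' ''D'') (st'$''r'') (insert e P)" "t + pS st' <= pS st1 + sum cst ?B + 60" by blast+
    have PP': "PP N st' = insert e P" using h(1) by (simp add: mi_def)
    have "pS st' + todo l (insert e P) + (t1 + t) + 30 <= pS sv + todo l P" using h(3) p1 td by linarith
    then show ?case using h I(3) unfolding I_def PP' P_def[symmetric] by simp
   qed
  qed
 next
  case (4 t sv)
  have I: "mi (PP N sv) sv" "sinv (rmem sv ''D'') (sv$''r'') (PP N sv)" using 4(1) unfolding I_def by blast+
  have L: "lab (rmem sv ''D'') (sv$''r'')" using I(1) unfolding mi_def by blast
  have "SS N sv = {}" using 4(3) c0[OF I(1)] cS(2)[of sv] by simp
  then have "x \<in> PP N sv" if "x < N" "R x ~= 0" "sv$''r'' x ~= 0" for x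
  proof -
   have "sv$''i'' x ~= 0" "sv$''i'' x <= 2" using I(1) that unfolding mi_def by blast+
   moreover have "sv$''i'' x ~= 1" using \<open>SS N sv = {}\<close> that(1) by (auto simp: SS_def)
   ultimately show ?thesis using that(1) by (simp add: PP_def)
  qed
  moreover have "\<forall>x<N. sv$''r'' x <= 1" using I(1) unfolding mi_def by blast
  ultimately show ?case using L heap_exhausted[OF I(2) L] 4(4) P0 by (simp add: B_def)
 qed
qed

text \<open>\<open>rv\<close> permutes the slots, so summing table sizes over the far ends of all
  slots counts every table three times. With the pull this makes four times 8000.\<close>

lemma todo_le: "todo l {} <= (6000 * l + 3100) * card {x. x < N & R x ~= 0} + 32000 * (\<Sum>v<N. tsz v) + 500 * N"
proof -
 have g: "(\<Sum>v<N. \<Sum>q=3 * v..<3 * v + 3. f q) = (\<Sum>q<3 * N. f q)" for f :: "nat => nat"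
  using sum.nat_group[of f 3 N] by (simp add: mult.commute)
 have "bij_betw rv {..<3 * N} {..<3 * N}"
  by (rule bij_betw_byWitness[where f' = rv]) (use rv_rv rv_lt in auto)
 then have "(\<Sum>q<3 * N. tsz (rv q div 3)) = (\<Sum>q<3 * N. tsz (q div 3))" by (rule sum.reindex_bij_betw)
 also have "\<dots> = (\<Sum>v<N. \<Sum>q=3 * v..<3 * v + 3. tsz (q div 3))" by (rule g[symmetric])
 also have "\<dots> = (\<Sum>v<N. \<Sum>q=3 * v..<3 * v + 3. tsz v)" by (intro sum.cong) (auto simp: div_nat_eqI)
 finally have "(\<Sum>q<3 * N. tsz (rv q div 3)) = 3 * (\<Sum>v<N. tsz v)" by (simp add: sum_distrib_left)
 then have "(\<Sum>v<N. pc v) = 8000 * (3 * (\<Sum>v<N. tsz v)) + 300 * N"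
  unfolding pc_def g by (simp add: sum.distrib sum_distrib_left[symmetric])
 then have "sum cst {..<N} = 32000 * (\<Sum>v<N. tsz v) + 500 * N" unfolding cst_def by (simp add: sum.distrib sum_distrib_left[symmetric])
 moreover have "{v. v < N & \<not> dn {} v} = {..<N}" by (auto simp: dn_def)
 ultimately show ?thesis by (simp add: todo_def)
qed

lemma wp_bdcopy:
 assumes N: "st$''N'' 0 = N" "st$''bd'' = bd" and x: "st$''x'' 0 = 0" and W: "N + 1 <= W"
 shows "wp W bdcopy (%t sv. (\<forall>x<N. sv$''ls'' x = bd x) & t <= 50 * N + 10) st"
 unfolding bdcopy_def
proof (rule wp_While[where I = "%sv. sv$''x'' 0 <= N & (\<forall>x<sv$''x'' 0. sv$''ls'' x = bd x)"
   and \<phi> = "%sv. 50 * (N - sv$''x'' 0)"], goal_cases)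
 case (3 sv)
 let ?x = "sv$''x'' 0"
 have g: "sv$''N'' 0 = N" "sv$''bd'' = bd" using 3(2) N by (auto simp: unch_def)
 have xN: "?x < N" using 3(3) g by simp
 then have "bd ?x <= N" using bd[OF xN] by auto
 with xN 3(1) W show ?case by (intro wp_basic) (auto simp: g less_Suc_eq)
next
 case (4 t sv)
 have "sv$''N'' 0 = N" using 4(2) N by (simp add: unch_def)
 then show ?case using 4 x by auto
qed (use N W x in \<open>auto simp: unch_def\<close>)

lemma wp_mainp:
 fixes st l
 defines "B \<equiv> 8000 * tsz s + 20 + todo l {}"
 assumes F: "F st" and C: "clean st" and z: "rmem st ''zero'' 0 = 0" "st$''src'' 0 = s" and l: "N <= 2 ^ l"
  and W: "(4 * B + 2 * N + 20) * (N + 1) <= W" "tW W"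
 shows "wp W mainp (%t st'. lab (rmem st' ''D'') (st'$''r'') & (\<forall>x<N. st'$''r'' x <= 1) & (\<forall>v d. walk s v d --> fin (rmem st' ''D'') (st'$''r'') v) &
  t <= B + 250 * N + 250) st"
proof -
 have W2: "3 * N + 3 <= W" using W(2) by (simp add: tW_def)
 have bdN: "bd x <= N" if "x < N" for x using bd[OF that] by auto
 have fs: "st$''N'' 0 = N" "st$''bd'' = bd" using F by (auto simp: F_def G_def)
 define st0 where "st0 = iu ''x'' 0 0 st"
 have b: "N <= W" "s <= W" using W2 s_lt by auto
 have "wp W (bdcopy ;; ''lp'' <- V ''N'' ;; mkchain ;; RAssign ''bs'' (Lit 0) (RElem ''zero'' (Lit 0)) ;; ''yy'' <- V ''src'' ;; pushT ;; mloop)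
  (%t st'. lab (rmem st' ''D'') (st'$''r'') & (\<forall>x<N. st'$''r'' x <= 1) & (\<forall>v d. walk s v d --> fin (rmem st' ''D'') (st'$''r'') v) &
  t <= B + 250 * N + 220) st0"
 proof (rule wp_Seq, rule wp_frame[OF wp_bdcopy], goal_cases)
  case (5 t1 st1)
  have u1: "st1$a = st$a" if "a \<notin> {''ls'', ''x''}" for a using 5(2) that by (simp add: unch_def bdcopy_def st0_def)
  have r1: "rmem st1 = rmem st" using 5(2) by (auto simp: unch_def bdcopy_def st0_def)
  have b1: "st1$''N'' 0 = N" by (simp add: u1 fs)
  define st2 where "st2 = iu ''lp'' 0 N st1"
  have mk: "wp W mkchain (%t. wp W (RAssign ''bs'' (Lit 0) (RElem ''zero'' (Lit 0)) ;; ''yy'' <- V ''src'' ;; pushT ;; mloop)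
   (%t' st'. lab (rmem st' ''D'') (st'$''r'') & (\<forall>x<N. st'$''r'' x <= 1) & (\<forall>v d. walk s v d --> fin (rmem st' ''D'') (st'$''r'') v) &
   t + t' <= B + 200 * N + 200)) st2"
  proof (rule wp_frame[OF wp_mkchain[where N = N]], goal_cases)
   case (5 t3 st3)
   have lp: "st2$''lp'' 0 = N" by (simp add: st2_def)
   define hq where "hq = st3$''hd''"
   define cq where "cq = st3$''ch''"
   have ls: "\<And>x. x < N ==> st2$''ls'' x = bd x" using \<open>(\<forall>x<N. st1$''ls'' x = bd x) & _\<close> by (simp add: st2_def)
   have c: "chains (Suc N) (st2$''ls'') N hq cq" "\<And>x. x <= N ==> hq x <= N" "\<And>e. e < N ==> cq e <= N" "t3 <= 100 * (N + N) + 160"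
    using 5(1) unfolding lp hq_def cq_def by blast+
   have "{e. e < N & st2$''ls'' e = x} = {e. e < N & bd e = x}" for x using ls by auto
   then have ch: "chains (Suc N) bd N hq cq" using c(1) by (simp only: chains_def)
   have u3: "st3$a = st$a" if "a \<notin> {''ls'', ''x'', ''hd'', ''e'', ''ch'', ''lp''}" for a using 5(2) u1 that by (simp add: unch_def st2_def)
   have r3: "rmem st3 = rmem st" using 5(2) r1 by (auto simp: unch_def st2_def)
   define st4 where "st4 = iu ''yy'' 0 s (ru ''bs'' 0 0 st3)"
   have S4: "SS N st4 = {}" "PP N st4 = {}" using C by (auto simp: st4_def SS_def PP_def u3 clean_def)
   have M4: "mi {} st4" unfolding mi_def S4 using F C by (auto simp: st4_def u3 r3 F_def G_def clean_def lab_def)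
   have p4: "pS st4 = 0" by (simp add: S4 pot_empty)
   have y4: "st4$''yy'' 0 = s" "rmem st4 ''bs'' 0 = 0" by (simp_all add: st4_def)
   note ws = walk_refl[OF s_lt]
   have W3: "(pS st4 + 8000 * tsz s + 3) * (N + 1) <= W" unfolding p4 by (intro order.trans[OF mult_right_mono W(1)]) (auto simp: B_def)
   have pu: "wp W pushT (%t. wp W mloop (%t' st'. lab (rmem st' ''D'') (st'$''r'') & (\<forall>x<N. st'$''r'' x <= 1) & (\<forall>v d. walk s v d --> fin (rmem st' ''D'') (st'$''r'') v) &
     t + t' <= B + 20)) st4"
   proof (rule wp_frame[OF wp_pushT[OF M4, unfolded y4, OF ws W3 te_W[OF W(2) ws]]], goal_cases)
    case (1 t st5)
    have p: "mi {} st5" "seed (rmem st5 ''D'') (st5$''r'') s 0" "t + pS st5 <= 8000 * tsz s + 20" using 1(1) unfolding p4 by auto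
    have S5: "sinv (rmem st5 ''D'') (st5$''r'') {}" using p(2) by (simp add: sinv_def dn_def)
    have h: "st5$''hd'' = hq" "st5$''ch'' = cq" using 1(2) by (simp_all add: unch_def st4_def hq_def cq_def)
    have W5: "(4 * (pS st5 + todo l {}) + 2 * N + 20) * (N + 1) <= W" using p(3) by (intro order.trans[OF mult_right_mono W(1)]) (auto simp: B_def)
    show ?case
     by (rule wp_mono[OF wp_mloop[OF p(1) S5 l h ch c(2,3) W5 W(2)]]) (use p(3) in \<open>auto simp: B_def\<close>)
   qed
   have b: "rmem st3 ''zero'' 0 = 0" "st3$''src'' 0 = s" "s <= W" using z b by (simp_all add: u3 r3)
   show ?case
    apply (rule wp_RE, (simp add: b cong: wp_cong; fail)+)
    apply (rule wp_IE, (simp add: b cong: wp_cong; fail)+)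
    apply (rule wp_Seq, rule wp_mono[OF pu[unfolded st4_def]], erule wp_mono)
    using c(4) by auto
  qed (use 5(1) b1 bdN W2 in \<open>auto simp: st2_def\<close>)
  note b = b b1
  show ?case
   apply (rule wp_IE, (simp add: b cong: wp_cong; fail)+)
   apply (rule wp_Seq, rule wp_mono[OF mk[unfolded st2_def]], erule wp_mono)
   using 5(1) by auto
 qed (use fs W2 in \<open>auto simp: st0_def\<close>)
 note lp = this
 show ?thesis unfolding mainp_def
  apply (rule wp_IE, (simp add: b cong: wp_cong; fail)+)
  apply (rule wp_mono[OF lp[unfolded st0_def]])
  by auto
qed

end

section \<open>Both phases together\<close>

context hgraph
begin

text \<open>There are two logarithms: \<open>l\<close> belongs to the heaps of the explorations,
  with \<open>O(k * k)\<close> elements, and \<open>L\<close> to the heap of centres.\<close>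

lemma wp_sssp:
 fixes st
 defines "s \<equiv> st$''src'' 0" and "k \<equiv> st$''k'' 0"
 assumes c: "clean st" "G st" "s < N" "rmem st ''zero'' 0 = 0" and z: "\<And>x. x < N ==> st$''R'' x = 0 & st$''bd'' x = 0"
  and k: "0 < k" and l: "3 * (k * k) + 4 <= 2 ^ l" and L: "N <= 2 ^ L"
  and W: "(4 * (8000 + (6000 * l + 26000) * (k * k)) + 2 * N + 30000) * (N + 1) <= W"
   "20 * (N * k) + 4 * (k * k) + 20 <= W" "4 * N * (N * k) + 4 * N + 4 <= W"
   "(4 * (360000 * (N * k) + (6000 * L + 3100) * (k + 9 * N) + 41000 + 500 * N) + 2 * N + 20) * (N + 1) <= W"
 shows "wp W (centres ;; mainp) (%t st'. (\<forall>v<N. st'$''r'' v ~= 0 --> walk s v (rmem st' ''D'' v)) &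
  (\<forall>v<N. st'$''r'' v <= 1) & (\<forall>v d. walk s v d --> st'$''r'' v ~= 0 & rmem st' ''D'' v <= d) &
  (\<exists>rc. rc * k <= k + 9 * N & t <= 104000 * (l + 1) * (N * k) + 360000 * (N * k) + (6000 * L + 3100) * rc + 1150 * N + 42000)) st"
proof (rule wp_Seq, rule wp_frame[OF wp_centres[where st = st, folded s_def k_def, OF c z k l W(1-3)]], goal_cases)
 case (2 t1 sv)
 note 3 = 2
 have Nk: "N <= N * k" using k by (cases k) auto
 have C: "clean sv" "G sv" "rmem sv ''zero'' 0 = 0" "\<forall>x<N. sv$''R'' x <= 1" "\<forall>v<N. res sv v" "rc sv * k <= k + 9 * N"
  "tsum sv <= 1 + 9 * (N * k)" "sv$''tp'' 0 <= 1 + 9 * (N * k)"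
  using 3(1) unfolding cpost_def by blast+
 have src: "sv$''src'' 0 = s"
  using 3(2) by (simp add: unch_def s_def centres_def cinit_def cinit_loop_def cfin_loop_def stage_def newU_def)
 define tz where "tz = sv$''tz''"
 define td where "td = rmem sv ''td''"
 define ta where "ta = sv$''ta''"
 define te where "te = sv$''te''"
 define bd where "bd = sv$''bd''"
 define R where "R = sv$''R''"
 have rs: "bd v = 0 & (\<forall>d. \<not> walk v s d) \<or> (\<exists>u<N. bd v = Suc u & R u ~= 0 & table tz td v (ta v) (te v) & reaches tz td v (ta v) (te v) u)"
  "bd v ~= 0 ==> te v <= 1 + 9 * (N * k)" if "v < N" for v
  using C(5,8) that unfolding res_def tab_def rch_def src bd_def R_def tz_def td_def ta_def te_def by fastforce+
 interpret tables N rv wt s tz td ta te bd R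
  by unfold_locales (use c(3) C(4) rs(1) R_def in auto)
 have F: "F sv" using C(2) unfolding F_def by (simp add: tz_def td_def ta_def te_def bd_def R_def)
 have ts: "(\<Sum>v<N. tsz v) <= 1 + 9 * (N * k)" using C(7) unfolding tsz_def by (simp add: tsum_def ta_def te_def)
 have "tsz s <= (\<Sum>v<N. tsz v)" by (rule member_le_sum) (use c(3) in auto)
 then have ss: "tsz s <= 1 + 9 * (N * k)" using ts by linarith
 define rcc where "rcc = rc sv"
 have cr: "card {x. x < N & R x ~= 0} = rcc" by (simp add: rcc_def rc_def R_def)
 have "rcc * 1 <= rcc * k" using k by (intro mult_left_mono) auto
 then have rck: "rcc * k <= k + 9 * N" "rcc <= k + 9 * N" using C(6) unfolding rcc_def by linarith+
 define B where "B = 8000 * tsz s + 20 + todo L {}"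
 have B: "B <= 360000 * (N * k) + (6000 * L + 3100) * rcc + 41000 + 500 * N"
  using todo_le[of L] ss ts unfolding cr B_def by linarith
 have pq: "(6000 * L + 3100) * rcc <= (6000 * L + 3100) * (k + 9 * N)" using rck(2) by (rule mult_left_mono) simp
 have "B <= 360000 * (N * k) + (6000 * L + 3100) * (k + 9 * N) + 41000 + 500 * N"
  by (rule order.trans[OF B]) (intro add_mono order.refl pq)
 then have "4 * B + 2 * N + 20 <= 4 * (360000 * (N * k) + (6000 * L + 3100) * (k + 9 * N) + 41000 + 500 * N) + 2 * N + 20"
  by (intro add_mono mult_le_mono order.refl)
 then have W5: "(4 * B + 2 * N + 20) * (N + 1) <= W" by (rule order.trans[OF mult_right_mono W(4)]) simp
 have "3 * N + 3 <= W" "1 + 9 * (N * k) <= W" using W(2) Nk by linarith+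
 then have tw: "tW W" unfolding tW_def using rs(2) order.trans by blast
 show ?case
 proof (rule wp_mono[OF wp_mainp[OF F C(1,3) src L W5[unfolded B_def] tw]], goal_cases)
  case (1 t st')
  have "t1 + t <= 104000 * (l + 1) * (N * k) + 360000 * (N * k) + (6000 * L + 3100) * rcc + 1150 * N + 42000"
   using 1 3(1) B unfolding B_def by linarith
  then show ?case using 1 rck(1) unfolding lab_def fin_def by blast
 qed
qed auto

end

section \<open>The graph of half-edges\<close>

text \<open>Half-edge \<open>h\<close> has the tail \<open>t h\<close>; \<open>2 e\<close> and \<open>2 e + 1\<close> are the two halves of edge \<open>e\<close>. Slot \<open>3 h\<close> leads to the
 other half, and the slots \<open>3 h + 1\<close> and \<open>3 h + 2\<close> to the previous and next half-edge with the same tail.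
 The first \<open>H\<close> half-edges are allocated and the first \<open>A\<close> of them linked; \<open>la a\<close> is one more than the last one at \<open>a\<close>.\<close>

definition twin :: "nat => nat" where "twin h = (if even h then Suc h else h - 1)"

text \<open>Two counters are needed because the halves of an edge refer to each other and are
  allocated together, while they are linked to their tails one at a time. Slots not linked yet are
  fixed points of \<open>rv\<close>.\<close>

definition BI :: "(nat => nat) => (nat => real) => nat => nat => (nat => nat) => (nat => real) => (nat => nat) => bool" where
 "BI t ww H A rv wt la \<longleftrightarrow> (\<forall>q<3 * H. rv q < 3 * H & rv (rv q) = q) &
  (\<forall>h<H. rv (3 * h) = 3 * twin h & wt (3 * h) = ww (h div 2)) &
  (\<forall>q<3 * H. q mod 3 ~= 0 --> wt q = 0 & t (rv q div 3) = t (q div 3)) &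
  (\<forall>h<A. la (t h) = Suc h \<or> (\<exists>h'. h < h' & h' < A & t h' = t h & rv (3 * h + 2) = 3 * h' + 1)) &
  (\<forall>h<A. la (t h) ~= 0) & (\<forall>a h. la a = Suc h --> h < A & t h = a & rv (3 * h + 2) = 3 * h + 2) &
  (\<forall>h. A <= h --> h < H --> rv (3 * h + 1) = 3 * h + 1 & rv (3 * h + 2) = 3 * h + 2) & (\<forall>q\<ge>3 * H. wt q = 0)"

lemma BI_D:
 assumes "BI t ww H A rv wt la"
 shows "\<And>q. q < 3 * H ==> rv q < 3 * H & rv (rv q) = q" "\<And>h. h < H ==> rv (3 * h) = 3 * twin h & wt (3 * h) = ww (h div 2)"
  "\<And>q. q < 3 * H ==> q mod 3 ~= 0 ==> wt q = 0 & t (rv q div 3) = t (q div 3)"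
  "\<And>h. h < A ==> la (t h) = Suc h \<or> (\<exists>h'. h < h' & h' < A & t h' = t h & rv (3 * h + 2) = 3 * h' + 1)"
  "\<And>h. h < A ==> la (t h) ~= 0" "\<And>a h. la a = Suc h ==> h < A & t h = a & rv (3 * h + 2) = 3 * h + 2"
  "\<And>h. A <= h ==> h < H ==> rv (3 * h + 1) = 3 * h + 1 & rv (3 * h + 2) = 3 * h + 2" "\<And>q. 3 * H <= q ==> wt q = 0"
 using assms unfolding BI_def by blast+

lemma mod3_cases: "q < 3 * (H :: nat) ==> \<exists>h<H. q = 3 * h \<or> q = 3 * h + 1 \<or> q = 3 * h + 2"
 by presburger

lemma BI_alloc:
 assumes B: "BI t ww (2 * e) (2 * e) rv wt la"
  and rv': "\<And>q. q < 6 * e ==> rv' q = rv q" "rv' (6 * e) = 6 * e + 3" "rv' (6 * e + 3) = 6 * e" "rv' (6 * e + 1) = 6 * e + 1" "rv' (6 * e + 2) = 6 * e + 2"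
   "rv' (6 * e + 4) = 6 * e + 4" "rv' (6 * e + 5) = 6 * e + 5"
 shows "BI t ww (2 * e + 2) (2 * e) rv' (wt(6 * e := ww e, 6 * e + 3 := ww e)) la"
proof -
 note D = BI_D[OF B]
 have rl: "rv q < 6 * e" "rv (rv q) = q" if "q < 6 * e" for q using D(1)[of q] that by simp_all
 have "rv' (3 + 6 * e) = 6 * e" "rv' (4 + 6 * e) = 4 + 6 * e" "rv' (5 + 6 * e) = 5 + 6 * e" using rv'(3,6,7) by (simp_all add: add.commute)
 note rv'' = this rv' rv'(4,5)[simplified]
 have sp: "q < 6 * e \<or> q = 6 * e \<or> q = 6 * e + 1 \<or> q = 6 * e + 2 \<or> q = 6 * e + 3 \<or> q = 6 * e + 4 \<or> q = 6 * e + 5" if "q < 3 * (2 * e + 2)" for q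
  using that by presburger
 have sph: "h < 2 * e \<or> h = 2 * e \<or> h = 2 * e + 1" if "h < 2 * e + 2" for h using that by linarith
 show ?thesis unfolding BI_def
 proof (intro conjI allI impI)
  fix q assume q: "q < 3 * (2 * e + 2)"
  show "rv' q < 3 * (2 * e + 2)" using sp[OF q] rl(1)[of q] by (elim disjE) (simp_all add: rv'')
  show "rv' (rv' q) = q" using sp[OF q] rl[of q] by (elim disjE) (simp_all add: rv'')
  assume "q mod 3 ~= 0"
  moreover have "(6 * e + 3) mod 3 = 0" "6 * e mod 3 = 0" by presburger+
  ultimately have n: "q ~= 6 * e" "q ~= 6 * e + 3" by auto
  show "(wt(6 * e := ww e, 6 * e + 3 := ww e)) q = 0" using sp[OF q] n D(3)[of q] D(8)[of q] \<open>q mod 3 ~= 0\<close> by auto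
  show "t (rv' q div 3) = t (q div 3)" using sp[OF q] n D(3)[of q] \<open>q mod 3 ~= 0\<close> by (elim disjE) (simp_all add: rv'')
 next
  fix h assume h: "h < 2 * e + 2"
  have "3 * (2 * e + 1) = 6 * e + 3" by simp
  then show "rv' (3 * h) = 3 * twin h" using sph[OF h] D(2)[of h] by (elim disjE) (simp_all add: rv'' twin_def)
  show "(wt(6 * e := ww e, 6 * e + 3 := ww e)) (3 * h) = ww (h div 2)" using sph[OF h] D(2)[of h] by auto
 next
  fix h assume h: "h < 2 * e"
  have "rv' (3 * h + 2) = rv (3 * h + 2)" using rv'(1) h by simp
  then show "la (t h) = Suc h \<or> (\<exists>h'. h < h' & h' < 2 * e & t h' = t h & rv' (3 * h + 2) = 3 * h' + 1)" using D(4)[OF h] by simp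
  show "la (t h) ~= 0" using D(5)[OF h] .
 next
  fix a h assume "la a = Suc h"
  then show "h < 2 * e" "t h = a" "rv' (3 * h + 2) = 3 * h + 2" using D(6)[of a h] rv'(1)[of "3 * h + 2"] by auto
 next
  fix h assume "2 * e <= h" "h < 2 * e + 2"
  then have "h = 2 * e \<or> h = 2 * e + 1" by linarith
  then have "rv' (3 * h + 1) = 3 * h + 1 & rv' (3 * h + 2) = 3 * h + 2" by (elim disjE) (simp_all add: rv'')
  then show "rv' (3 * h + 1) = 3 * h + 1" "rv' (3 * h + 2) = 3 * h + 2" by blast+
 next
  fix q assume "3 * (2 * e + 2) <= q"
  then show "(wt(6 * e := ww e, 6 * e + 3 := ww e)) q = 0" using D(8)[of q] by simp
 qed
qed

text \<open>If \<open>la (t A) = Suc p\<close>, then \<open>3 * la (t A) - 1\<close> is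
  \<open>3 * p + 2\<close>, the forward slot of the half-edge that was last at this tail.\<close>

lemma BI_link:
 assumes B: "BI t ww H A rv wt la" and A: "A < H"
  and rv': "rv' = (if la (t A) = 0 then rv else rv(3 * A + 1 := 3 * la (t A) - 1, 3 * la (t A) - 1 := 3 * A + 1))"
 shows "BI t ww H (Suc A) rv' wt (la(t A := Suc A))"
proof -
 note D = BI_D[OF B]
 show ?thesis
 proof (cases "la (t A)")
  case 0
  then have r: "rv' = rv" using rv' by simp
  have n: "t h ~= t A" if "h < A" for h using D(5)[OF that] 0 by auto
  show ?thesis unfolding BI_def r
  proof (intro conjI allI impI)
   fix h assume "h < Suc A"
   then show "(la(t A := Suc A)) (t h) = Suc h \<or> (\<exists>h'. h < h' & h' < Suc A & t h' = t h & rv (3 * h + 2) = 3 * h' + 1)"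
    using n D(4)[of h] by (cases "h = A") (auto simp: less_Suc_eq)
   show "(la(t A := Suc A)) (t h) ~= 0" using n D(5)[of h] \<open>h < Suc A\<close> by (auto simp: less_Suc_eq)
  next
   fix a h assume "(la(t A := Suc A)) a = Suc h"
   then show "h < Suc A" "t h = a" "rv (3 * h + 2) = 3 * h + 2" using D(6)[of a h] D(7)[of A] A by (auto split: if_splits)
  qed (use D in auto)
 next
  case (Suc p)
  have p: "p < A" "t p = t A" "rv (3 * p + 2) = 3 * p + 2" using D(6)[OF Suc] by auto
  have r: "rv' = rv(3 * A + 1 := 3 * p + 2, 3 * p + 2 := 3 * A + 1)" using rv' Suc by simp
  have fA: "rv (3 * A + 1) = 3 * A + 1" "rv (3 * A + 2) = 3 * A + 2" using D(7)[of A] A by auto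
  have ne: "3 * h ~= 3 * A + 1" "3 * h ~= 3 * p + 2" "3 * h + 2 ~= 3 * A + 1" "3 * h + 1 ~= 3 * p + 2" for h by presburger+
  \<comment> \<open>Both slots to be joined are fixed points of the involution so far, so no other
    slot is mapped to them.\<close>
  have inv: "rv q ~= 3 * A + 1 & rv q ~= 3 * p + 2" if "q < 3 * H" "q ~= 3 * A + 1" "q ~= 3 * p + 2" for q
   using D(1)[OF that(1)] that fA p by metis
  have b: "3 * A + 1 < 3 * H" "3 * p + 2 < 3 * H" using A p by auto
  have dv: "(3 * A + 1) div 3 = A" "(3 * p + 2) div 3 = p" by presburger+
  show ?thesis unfolding BI_def
  proof (intro conjI allI impI)
   fix q assume q: "q < 3 * H"
   show "rv' q < 3 * H" using D(1)[OF q] b by (auto simp: r)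
   show "rv' (rv' q) = q" using D(1)[OF q] inv[OF q] ne(3)[of p] by (auto simp: r)
   assume "q mod 3 ~= 0"
   then show "wt q = 0" "t (rv' q div 3) = t (q div 3)" using D(3)[OF q] p(2) dv by (auto simp: r)
  next
   fix h assume h: "h < H"
   show "rv' (3 * h) = 3 * twin h" "wt (3 * h) = ww (h div 2)" using D(2)[OF h] ne[of h] by (auto simp: r)
  next
   fix h assume h: "h < Suc A"
   show "(la(t A := Suc A)) (t h) = Suc h \<or> (\<exists>h'. h < h' & h' < Suc A & t h' = t h & rv' (3 * h + 2) = 3 * h' + 1)"
   proof (cases "h = p")
    case True
    then show ?thesis using p by (auto simp: r)
   next
    case False
    have e: "rv' (3 * h + 2) = rv (3 * h + 2)" using False ne(3)[of h] by (simp add: r)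
    show ?thesis
    proof (cases "h = A")
     case hA: False
     then have "h < A" using h by simp
     moreover have "la (t h) = Suc h ==> t h ~= t A" using Suc False by auto
     ultimately show ?thesis using D(4)[of h] unfolding e by (metis fun_upd_other less_SucI)
    qed simp
   qed
   show "(la(t A := Suc A)) (t h) ~= 0" using D(5)[of h] h by (auto simp: less_Suc_eq)
  next
   fix a h assume la: "(la(t A := Suc A)) a = Suc h"
   show "h < Suc A" "t h = a" using la D(6)[of a h] by (auto split: if_splits)
   show "rv' (3 * h + 2) = 3 * h + 2"
   proof (cases "a = t A")
    case True
    then show ?thesis using la fA(2) p ne(3)[of A] by (simp add: r)
   next
    case False
    then have "t h = a" "rv (3 * h + 2) = 3 * h + 2" using la D(6)[of a h] by auto
    then show ?thesis using False p(2) ne(3)[of h] by (auto simp: r)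
   qed
  next
   fix h assume h: "Suc A <= h" "h < H"
   then show "rv' (3 * h + 1) = 3 * h + 1" "rv' (3 * h + 2) = 3 * h + 2" using D(7)[of h] ne[of h] p(1) by (auto simp: r)
  qed (use D(8) in auto)
 qed
qed

lemma BI_hgraph:
 assumes B: "BI t ww N N rv wt la" and ww: "\<And>e. 2 * e < N ==> 0 <= ww e" and ev: "even N"
 shows "hgraph N rv wt"
proof
 note D = BI_D[OF B]
 fix q assume q: "q < 3 * N"
 show "rv q < 3 * N" "rv (rv q) = q" using D(1)[OF q] by auto
 obtain h where h: "h < N" "q = 3 * h \<or> q mod 3 ~= 0" using mod3_cases[OF q] by fastforce
 show "0 <= wt q" using h(2)
 proof
  assume "q = 3 * h"
  then show ?thesis using D(2)[OF h(1)] ww[of "h div 2"] h(1) by auto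
 qed (use D(3)[OF q] in simp)
 show "wt (rv q) = wt q" using h(2)
 proof
  assume "q = 3 * h"
  moreover have "twin h < N" "twin h div 2 = h div 2" using h(1) ev unfolding twin_def by (auto elim!: oddE evenE)
  ultimately show ?thesis using D(2)[OF h(1)] D(2)[of "twin h"] by simp
 next
  assume m: "q mod 3 ~= 0"
  have "rv q mod 3 ~= 0"
  proof
   assume "rv q mod 3 = 0"
   then obtain g where g: "rv q = 3 * g" by (metis mod_0_imp_dvd dvdE)
   then have "g < N" using D(1)[OF q] by simp
   then have "q = 3 * twin g" using D(1)[OF q] D(2)[of g] g by simp
   then show False using m by simp
  qed
  then show ?thesis using D(3)[OF q m] D(3)[of "rv q"] D(1)[OF q] by simp
 qed
qed

section \<open>Walks of the input graph and walks of half-edges\<close>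

inductive gwalk :: "(nat \<times> nat) set => (nat \<times> nat => real) => nat => nat => real => bool" for E w a where
 gwalk_refl: "gwalk E w a a 0"
| gwalk_step: "gwalk E w a b d ==> (b, c) \<in> E ==> gwalk E w a c (d + w (b, c))"

locale halfedges = hgraph +
 fixes t :: "nat => nat" and ww :: "nat => real" and la :: "nat => nat" and E :: "(nat \<times> nat) set" and w :: "nat \<times> nat => real"
 assumes B: "BI t ww N N rv wt la" and ev: "even N"
  and arcs: "\<And>h. h < N ==> (t h, t (twin h)) \<in> E & w (t h, t (twin h)) = ww (h div 2)"
   "\<And>a b. (a, b) \<in> E ==> \<exists>h<N. t h = a & t (twin h) = b"
begin

lemma walk_gwalk: "walk x y d ==> gwalk E w (t x) (t y) d"
proof (induction rule: walk.induct)
 case (walk_step y d q)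
 note D = BI_D[OF B]
 obtain h where h: "h < N" "q = 3 * h \<or> q mod 3 ~= 0" using mod3_cases[OF walk_step(2)] by fastforce
 show ?case using h(2)
 proof
  assume q: "q = 3 * h"
  then have "h = y" using walk_step(3) by simp
  then show ?thesis using gwalk_step[OF walk_step.IH, of "t (twin h)"] arcs(1)[OF h(1)] D(2)[OF h(1)] q by simp
 next
  assume "q mod 3 ~= 0"
  then show ?thesis using walk_step D(3)[OF walk_step(2)] by simp
 qed
qed (rule gwalk_refl)

text \<open>Forward slots lead to larger half-edges of the same tail at cost 0, so the chain ends,
  and it can only end at the last one.\<close>

lemma walk_last: "h < N ==> walk h (la (t h) - 1) 0"
proof (induction "N - h" arbitrary: h rule: less_induct)
 case less
 note D = BI_D[OF B]
 show ?case
 proof (cases "la (t h) = Suc h")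
  case True
  then show ?thesis using walk_refl[OF less.prems] by simp
 next
  case False
  then obtain h' where h': "h < h'" "h' < N" "t h' = t h" "rv (3 * h + 2) = 3 * h' + 1" using D(4)[OF less.prems] by blast
  have "(3 * h + 2) mod 3 ~= 0" by presburger
  then have "wt (3 * h + 2) = 0" using D(3)[of "3 * h + 2"] less.prems by simp
  moreover have "(3 * h + 2) div 3 = h" "(3 * h' + 1) div 3 = h'" by presburger+
  ultimately have "walk h h' 0" using walk_edge[of "3 * h + 2"] less.prems unfolding h'(4) by simp
  moreover have "walk h' (la (t h) - 1) 0" using less.hyps[of h'] h' by simp
  ultimately show ?thesis using walk_trans by fastforce
 qed
qed

text \<open>Both half-edges are connected to the last one of their common tail, and the second
  connection is reversed.\<close>

lemma walk_same_tail:
 assumes "x < N" "y < N" "t x = t y"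
 shows "walk x y 0"
 using walk_trans[OF walk_sym[OF walk_last[OF assms(2)]], of x 0] walk_last[OF assms(1)] assms(3) by simp

lemma gwalk_walk: "gwalk E w a b d ==> x < N ==> t x = a ==> y < N ==> t y = b ==> walk x y d"
proof (induction arbitrary: y rule: gwalk.induct)
 case gwalk_refl
 then show ?case using walk_same_tail by simp
next
 case (gwalk_step b d c)
 obtain h where h: "h < N" "t h = b" "t (twin h) = c" using arcs(2)[OF gwalk_step(2)] by blast
 have "walk x h d" using gwalk_step h by simp
 moreover have "walk h (twin h) (w (b, c))" using walk_edge[of "3 * h"] h BI_D(2)[OF B h(1)] arcs(1)[OF h(1)] by simp
 moreover have "twin h < N" using walk_lt[OF calculation(2)] by simp
 then have "walk (twin h) y 0" using walk_same_tail gwalk_step.prems h by simp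
 with walk_trans[OF this walk_trans[OF calculation(2,1)]] show ?case by simp
qed

end

section \<open>Building the graph of half-edges\<close>

definition link :: com where
 "link = Cond (pos (IElem ''last'' (V ''tt'')))
  (IAssign ''rv'' (IPlus (ITimes (Lit 3) (V ''hh'')) (Lit 1)) (IMinus (ITimes (Lit 3) (IElem ''last'' (V ''tt''))) (Lit 1)) ;;
   IAssign ''rv'' (IMinus (ITimes (Lit 3) (IElem ''last'' (V ''tt''))) (Lit 1)) (IPlus (ITimes (Lit 3) (V ''hh'')) (Lit 1))) Skip ;;
 IAssign ''last'' (V ''tt'') (IPlus (V ''hh'') (Lit 1)) ;; inc ''hh''"

definition alloc :: com where
 "alloc = ''f6'' <- ITimes (Lit 6) (V ''be'') ;; IAssign ''rv'' (V ''f6'') (IPlus (V ''f6'') (Lit 3)) ;;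
  IAssign ''rv'' (IPlus (V ''f6'') (Lit 3)) (V ''f6'') ;;
  IAssign ''rv'' (IPlus (V ''f6'') (Lit 1)) (IPlus (V ''f6'') (Lit 1)) ;; IAssign ''rv'' (IPlus (V ''f6'') (Lit 2)) (IPlus (V ''f6'') (Lit 2)) ;;
  IAssign ''rv'' (IPlus (V ''f6'') (Lit 4)) (IPlus (V ''f6'') (Lit 4)) ;; IAssign ''rv'' (IPlus (V ''f6'') (Lit 5)) (IPlus (V ''f6'') (Lit 5)) ;;
  RAssign ''wt'' (V ''f6'') (RElem ''weight'' (V ''be'')) ;; RAssign ''wt'' (IPlus (V ''f6'') (Lit 3)) (RElem ''weight'' (V ''be''))"

definition build :: com where
 "build = While (ILess (V ''be'') (V ''m'')) (alloc ;; ''tt'' <- IElem ''end1'' (V ''be'') ;; link ;; ''tt'' <- IElem ''end2'' (V ''be'') ;; link ;; inc ''be'')"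

lemma mods_build [simp]:
 "imods link = {''rv'', ''last'', ''hh''}" "rmods link = {}" "imods alloc = {''f6'', ''rv''}" "rmods alloc = {''wt''}"
 "imods build = {''rv'', ''last'', ''hh'', ''f6'', ''tt'', ''be''}" "rmods build = {''wt''}"
 by (auto simp: link_def alloc_def build_def)

abbreviation BS :: "(nat => nat) => (nat => real) => nat => nat => state => bool" where
 "BS t ww H A st \<equiv> BI t ww H A (st$''rv'') (rmem st ''wt'') (st$''last'')"

lemma wp_link:
 fixes st
 defines "A \<equiv> st$''hh'' 0"
 assumes B: "BS t ww H A st" and A: "A < H" and tt: "st$''tt'' 0 = t A" and W: "3 * H + 3 <= W" "t A <= W"
 shows "wp W link (%T st'. BS t ww H (Suc A) st' & st'$''hh'' 0 = Suc A & T <= 60) st"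
proof -
 let ?la = "st$''last'' (t A)"
 have la: "?la <= A"
 proof (cases ?la)
  case (Suc p)
  then show ?thesis using BI_D(6)[OF B Suc] by simp
 qed simp
 have b: "st$''tt'' 0 = t A" "st$''hh'' 0 = A" "t A <= W" "?la <= W" "3 * ?la <= W" "3 * ?la - Suc 0 <= W" "Suc (3 * A) <= W" "A <= W" "3 * A <= W" "Suc A <= W" "Suc 0 <= W" "3 <= W"
  using la A W tt A_def by auto
 have BB: "BI t ww H (Suc A) rv' (rmem st ''wt'') ((st$''last'')(t A := Suc A))"
  if "rv' = (if ?la = 0 then st$''rv'' else (st$''rv'')(3 * A + 1 := 3 * ?la - 1, 3 * ?la - 1 := 3 * A + 1))" for rv'
  using BI_link[OF B A that] .
 have en: "wp W (IAssign ''last'' (V ''tt'') (IPlus (V ''hh'') (Lit 1)) ;; inc ''hh'') (%T st'. BS t ww H (Suc A) st' & st'$''hh'' 0 = Suc A & T <= 20) sv"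
  if g: "sv$''tt'' 0 = t A" "sv$''hh'' 0 = A" "sv$''last'' = st$''last''" "rmem sv = rmem st"
   "sv$''rv'' = (if ?la = 0 then st$''rv'' else (st$''rv'')(3 * A + 1 := 3 * ?la - 1, 3 * ?la - 1 := 3 * A + 1))" for sv
  using BB[OF g(5)] b by (intro wp_basic) (simp_all add: g(1-4))
 show ?thesis unfolding link_def
 proof (rule wp_Seq, rule wp_Cond, goal_cases)
  case 1
  show ?case by (simp add: b)
 next
  case 2
  then have "?la ~= 0" by (simp add: b)
  then show ?case
   apply -
   apply (rule wp_IE, (simp add: b cong: wp_cong; fail)+)
   apply (rule wp_IAssign, (simp add: b; fail), (simp add: b; fail))
   apply (rule wp_mono[OF en])
   by (auto simp: b)
 next
  case 3
  then have "?la = 0" by (simp add: b)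
  then show ?case
   apply -
   apply (rule wp_Skip)
   apply (rule wp_mono[OF en])
   by (auto simp: b)
 qed
qed

lemma wp_alloc:
 fixes st
 defines "e \<equiv> st$''be'' 0"
 assumes B: "BS t ww (2 * e) (2 * e) st" and w: "rmem st ''weight'' e = ww e" and W: "6 * e + 6 <= W"
 shows "wp W alloc (%T st'. BS t ww (2 * e + 2) (2 * e) st' & T <= 100) st"
proof -
 have b: "st$''be'' 0 = e" "e <= W" "6 * e <= W" "6 * e + 3 <= W" "Suc (6 * e) <= W" "Suc (Suc (6 * e)) <= W" "6 * e + 4 <= W" "6 * e + 5 <= W"
  "Suc 0 <= W" "2 <= W" "3 <= W" "4 <= W" "5 <= W" "6 <= W" "rmem st ''weight'' e = ww e" using W e_def w by auto
 define rv' where "rv' = (st$''rv'')(6 * e := 6 * e + 3, 6 * e + 3 := 6 * e, Suc (6 * e) := Suc (6 * e), Suc (Suc (6 * e)) := Suc (Suc (6 * e)), 6 * e + 4 := 6 * e + 4, 6 * e + 5 := 6 * e + 5)"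
 have B': "BI t ww (2 * e + 2) (2 * e) rv' ((rmem st ''wt'')(6 * e := ww e, 6 * e + 3 := ww e)) (st$''last'')"
  by (rule BI_alloc[OF B]) (simp_all add: rv'_def)
 show ?thesis unfolding alloc_def
  apply ((rule wp_IE, (simp add: b cong: wp_cong; fail)+)+)
  apply (rule wp_RE, (simp add: b cong: wp_cong; fail)+)
  apply (rule wp_RAssign, (simp add: b; fail), (simp add: b; fail))
  using B' by (simp add: b rv'_def)
qed

lemma wp_build:
 fixes st
 defines "m \<equiv> st$''m'' 0"
 assumes B: "BS t ww 0 0 st" and z: "st$''be'' 0 = 0" "st$''hh'' 0 = 0"
  and w: "\<And>e. e < m ==> rmem st ''weight'' e = ww e & st$''end1'' e = t (2 * e) & st$''end2'' e = t (2 * e + 1) & t (2 * e) <= W & t (2 * e + 1) <= W"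
  and W: "6 * m + 9 <= W"
 shows "wp W build (%T st'. BS t ww (2 * m) (2 * m) st' & T <= 300 * m + 10) st"
 unfolding build_def
proof (rule wp_While[where I = "%sv. sv$''be'' 0 <= m & sv$''hh'' 0 = 2 * sv$''be'' 0 & BS t ww (2 * sv$''be'' 0) (2 * sv$''be'' 0) sv"
   and \<phi> = "%sv. 300 * (m - sv$''be'' 0)"], goal_cases)
 case (3 sv)
 define e where "e = sv$''be'' 0"
 have I: "e <= m" "sv$''hh'' 0 = 2 * e" "BS t ww (2 * e) (2 * e) sv" using 3(1) unfolding e_def by blast+
 have f: "sv$''m'' 0 = m" "rmem sv ''weight'' = rmem st ''weight''" "sv$''end1'' = st$''end1''" "sv$''end2'' = st$''end2''"
  using 3(2) by (auto simp: unch_def m_def)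
 have em: "e < m" using 3(3) f by (simp add: e_def)
 note we = w[OF em]
 have We: "6 * e + 6 <= W" "3 * (2 * e + 2) + 3 <= W" using em W by simp_all
 show ?case
 proof (rule wp_Seq, rule wp_frame[OF wp_alloc[where st = sv, folded e_def, OF I(3) _ We(1)]], goal_cases)
  case 1
  then show ?case using we f by simp
 next
  case (2 T1 sv1)
  have f1: "sv1$a = sv$a" if "a \<notin> {''f6'', ''rv''}" for a using 2(2) that by (simp add: unch_def)
  define sv2 where "sv2 = iu ''tt'' 0 (t (2 * e)) sv1"
  have l1: "wp W link (%T. wp W (''tt'' <- IElem ''end2'' (V ''be'') ;; link ;; inc ''be'') (%T' sv'. (sv'$''be'' 0 = Suc e & sv'$''hh'' 0 = 2 * Suc e & BS t ww (2 * Suc e) (2 * Suc e) sv') & T + T' <= 150)) sv2"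
  proof (rule wp_frame[OF wp_link[where H = "2 * e + 2" and t = t and ww = ww]], goal_cases)
   case (6 T3 sv3)
   have h2: "sv2$''hh'' 0 = 2 * e" using I(2) by (simp add: sv2_def f1)
   have p: "BS t ww (2 * e + 2) (2 * e + 1) sv3" "sv3$''hh'' 0 = 2 * e + 1" "T3 <= 60" using 6(1) unfolding h2 by auto
   have f3: "sv3$a = sv$a" if "a \<notin> {''f6'', ''rv'', ''last'', ''hh'', ''tt''}" for a using 6(2) that f1 by (simp add: unch_def sv2_def)
   have b: "sv3$''be'' 0 = e" "sv3$''end2'' e = t (Suc (2 * e))" "e <= W" "t (Suc (2 * e)) <= W" "Suc e <= W" "Suc 0 <= W" using we f em W by (auto simp: f3 e_def)
   define sv4 where "sv4 = iu ''tt'' 0 (t (Suc (2 * e))) sv3"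
   have l2: "wp W link (%T. wp W (inc ''be'') (%T' sv'. (sv'$''be'' 0 = Suc e & sv'$''hh'' 0 = 2 * Suc e & BS t ww (2 * Suc e) (2 * Suc e) sv') & T + T' <= 80)) sv4"
   proof (rule wp_frame[OF wp_link[where H = "2 * e + 2" and t = t and ww = ww]], goal_cases)
    case (6 T5 sv5)
    have h4: "sv4$''hh'' 0 = 2 * e + 1" using p by (simp add: sv4_def)
    have q: "BS t ww (2 * Suc e) (2 * Suc e) sv5" "sv5$''hh'' 0 = 2 * Suc e" "T5 <= 60" using 6(1) unfolding h4 by auto
    have "sv5$''be'' 0 = e" using 6(2) b(1) by (simp add: unch_def sv4_def)
    then show ?case using q b by (intro wp_IAssign) simp_all
   qed (use p We b in \<open>auto simp: sv4_def\<close>)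
   show ?case
    apply (rule wp_IE, (simp add: b cong: wp_cong; fail)+)
    apply (rule wp_Seq, rule wp_mono[OF l2[unfolded sv4_def]], erule wp_mono)
    using p(3) by auto
  qed (use 2(1) I(2) We we in \<open>auto simp: sv2_def f1\<close>)
  have b: "sv1$''be'' 0 = e" "sv1$''end1'' e = t (2 * e)" "e <= W" "t (2 * e) <= W" using we f em W by (auto simp: f1 e_def)
  show ?case
   apply (rule wp_IE, (simp add: b cong: wp_cong; fail)+)
   apply (rule wp_Seq, rule wp_mono[OF l1[unfolded sv2_def]], erule wp_mono)
   using 2(1) em by (auto simp: e_def)
 qed
next
 case (4 T sv)
 have "sv$''m'' 0 = m" using 4(2) by (simp add: unch_def m_def)
 then have "sv$''be'' 0 = m" using 4(1,3) by simp
 then show ?case using 4 z by auto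
qed (use z B W in \<open>auto simp: unch_def m_def\<close>)

section \<open>Computing the parameters\<close>

definition plog :: "name => name => com" where
 "plog a b = b <- Lit 0 ;; ''pw'' <- Lit 1 ;; While (ILess (V ''pw'') (V a)) (''pw'' <- ITimes (Lit 2) (V ''pw'') ;; inc b)"

text \<open>The binary logarithm rounded up, for positive \<open>x\<close>; the second part says
  that no smaller exponent will do.\<close>

definition is_log :: "nat => nat => bool" where "is_log x y \<longleftrightarrow> x <= 2 ^ y & (y = 0 \<or> 2 ^ (y - 1) < x)"

lemma is_log_le: "is_log x y ==> y <= x"
proof -
 assume a: "is_log x y"
 have "y - 1 < 2 ^ (y - 1)" by (rule less_exp)
 with a show "y <= x" unfolding is_log_def by linarith
qed

lemma wp_plog:
 assumes ab: "a ~= b" "a ~= ''pw''" "b ~= ''pw''" and W: "2 * st$a 0 + 3 <= W"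
 shows "wp W (plog a b) (%T st'. is_log (st$a 0) (imem st' b 0) & T <= 30 * imem st' b 0 + 20) st"
proof -
 define x where "x = st$a 0"
 define st1 where "st1 = iu ''pw'' 0 (Suc 0) (iu b 0 0 st)"
 have stp: "imem sv b 0 < x" if "sv$''pw'' 0 = 2 ^ imem sv b 0" "sv$''pw'' 0 < x" for sv :: state
  using that less_exp[of "imem sv b 0"] by linarith
 define I where "I = (%sv :: state. sv$''pw'' 0 = 2 ^ imem sv b 0 & (imem sv b 0 = 0 \<or> 2 ^ (imem sv b 0 - 1) < x))"
 have pwb: "sv$''pw'' 0 <= 2 * x + 1" "imem sv b 0 <= x" if "I sv" for sv
 proof -
  show "sv$''pw'' 0 <= 2 * x + 1" using that by (cases "imem sv b 0") (auto simp: I_def)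
  show "imem sv b 0 <= x" using that is_log_le[of x "imem sv b 0"] less_exp[of "imem sv b 0 - 1"] unfolding I_def by linarith
 qed
 \<comment> \<open>The potential has to count down to the final exponent, so that exponent is fixed
   before the loop is analysed.\<close>
 obtain y where y: "is_log x y"
 proof -
  define y where "y = (LEAST y. x <= 2 ^ y)"
  have 1: "x <= 2 ^ y" unfolding y_def using less_exp[of x] by (metis LeastI less_imp_le)
  have "y = 0 \<or> 2 ^ (y - 1) < x"
  proof (rule ccontr)
   assume "\<not> ?thesis"
   then have "y - 1 < y" "x <= 2 ^ (y - 1)" by auto
   then show False unfolding y_def using not_less_Least by blast
  qed
  with 1 that show thesis by (auto simp: is_log_def)
 qed
 have by': "imem sv b 0 <= y" if "I sv" for sv
 proof (rule ccontr)
  assume "\<not> ?thesis"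
  then have "y <= imem sv b 0 - 1" "imem sv b 0 ~= 0" by auto
  then have "2 ^ y <= (2 :: nat) ^ (imem sv b 0 - 1)" by (intro power_increasing) auto
  then show False using that y \<open>imem sv b 0 ~= 0\<close> unfolding I_def is_log_def by linarith
 qed
 have "wp W (While (ILess (V ''pw'') (V a)) (''pw'' <- ITimes (Lit 2) (V ''pw'') ;; inc b)) (%T st'. is_log x (imem st' b 0) & T <= 30 * imem st' b 0 + 10) st1"
 proof (rule wp_While[where I = I and \<phi> = "%sv. 30 * (y - imem sv b 0)"], goal_cases)
  case 1
  show ?case using ab by (simp add: I_def st1_def)
 next
  case (2 sv)
  have "sv$a 0 = x" using 2(2) ab by (simp add: unch_def st1_def x_def)
  then show ?case using pwb[OF 2(1)] W x_def by simp
 next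
  case (3 sv)
  have a: "sv$a 0 = x" using 3(2) ab by (simp add: unch_def st1_def x_def)
  have p: "sv$''pw'' 0 < x" using 3(3) a by simp
  let ?sv' = "iu b 0 (Suc (imem sv b 0)) (iu ''pw'' 0 (2 * sv$''pw'' 0) sv)"
  have I': "I ?sv'" using 3(1) p ab by (simp add: I_def)
  have "Suc (imem sv b 0) <= y" using by'[OF I'] by simp
  then show ?case using I' pwb[OF I'] p W ab x_def pwb[OF 3(1)] by (intro wp_basic) auto
 next
  case (4 T sv)
  have a: "sv$a 0 = x" using 4(2) ab by (simp add: unch_def st1_def x_def)
  have lx: "x <= 2 ^ imem sv b 0" using 4(1,3) a by (simp add: I_def)
  then have il: "is_log x (imem sv b 0)" using 4(1) by (auto simp: I_def is_log_def)
  have "y <= imem sv b 0"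
  proof (rule ccontr)
   assume "\<not> ?thesis"
   then have "imem sv b 0 <= y - 1" "y ~= 0" by auto
   then have "2 ^ imem sv b 0 <= (2 :: nat) ^ (y - 1)" by (intro power_increasing) auto
   then show False using lx y \<open>y ~= 0\<close> unfolding is_log_def by linarith
  qed
  then show ?case using il 4(4) ab by (simp add: st1_def)
 qed
 note lp = this
 have b: "Suc 0 <= W" using W by simp
 show ?thesis unfolding plog_def x_def[symmetric]
  apply ((rule wp_IE, (simp add: b cong: wp_cong; fail)+)+)
  apply (rule wp_mono[OF lp[unfolded st1_def]])
  by auto
qed

definition kcalc :: com where
 "kcalc = ''k'' <- Lit 1 ;; While (ILess (ITimes (ITimes (V ''k'') (V ''k'')) (IPlus (V ''lg'') (Lit 1))) (V ''L'')) (inc ''k'')"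

text \<open>The least \<open>k\<close> with \<open>k * k >= L / (g + 1)\<close>, that is the
  balancing root rounded up, expressed without division. Minimality bounds \<open>k\<close> from
  above, the other inequality from below; both are used for the running time.\<close>

definition is_k :: "nat => nat => nat => bool" where
 "is_k L g k \<longleftrightarrow> 0 < k & L <= k * k * (g + 1) & (k = 1 \<or> (k - 1) * (k - 1) * (g + 1) < L)"

lemma wp_kcalc:
 fixes st
 defines "L \<equiv> st$''L'' 0" and "g \<equiv> st$''lg'' 0"
 assumes W: "(L + 1) * (L + 1) * (g + 1) + 3 <= W"
 shows "wp W kcalc (%T st'. is_k L g (st'$''k'' 0) & st'$''k'' 0 <= L + 1 & T <= 40 * (L + 1) + 20) st"
proof -
 define I where "I = (%sv :: state. let k = sv$''k'' 0 in 0 < k & (k = 1 \<or> (k - 1) * (k - 1) * (g + 1) < L))"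
 have kL: "k <= L + 1" if "k = 1 \<or> (k - 1) * (k - 1) * (g + 1) < L" for k :: nat
 proof (cases "k = 1")
  case False
  then have l: "(k - 1) * (k - 1) * (g + 1) < L" using that by simp
  have "(k - 1) * 1 <= (k - 1) * ((k - 1) * (g + 1))" by (cases "k - 1") auto
  also have "\<dots> = (k - 1) * (k - 1) * (g + 1)" by (simp only: mult.assoc)
  finally show ?thesis using l by linarith
 qed simp
 have bd: "k * k * (g + 1) <= W" "k * k <= W" "k <= W" if "k <= L + 1" for k
 proof -
  have "k * k <= (L + 1) * (L + 1)" using that by (intro mult_mono) auto
  then have 1: "k * k * (g + 1) <= (L + 1) * (L + 1) * (g + 1)" by (rule mult_right_mono) simp
  moreover have "k * k <= k * k * (g + 1)" "k <= k * k" by (simp_all add: le_square)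
  ultimately show "k * k * (g + 1) <= W" "k * k <= W" "k <= W" using W by linarith+
 qed
 have gW: "g + 1 <= W" "L <= W" "1 <= W" "L + 2 <= W"
 proof -
  define Z where "Z = (L + 1) * (L + 1) * (g + 1)"
  have "1 * (g + 1) <= Z" unfolding Z_def by (intro mult_right_mono) auto
  moreover have "L * 1 <= (L + 1) * ((L + 1) * (g + 1))" by (intro mult_mono) auto
  then have "L <= Z" by (simp only: Z_def mult.assoc mult_1_right)
  moreover have "Z + 3 <= W" using W by (simp only: Z_def)
  ultimately have "g + 1 <= W & L <= W & 1 <= W & L + 2 <= W" by auto
  then show "g + 1 <= W" "L <= W" "1 <= W" "L + 2 <= W" by blast+
 qed
 have "wp W (While (ILess (ITimes (ITimes (V ''k'') (V ''k'')) (IPlus (V ''lg'') (Lit 1))) (V ''L'')) (inc ''k''))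
  (%T st'. is_k L g (st'$''k'' 0) & st'$''k'' 0 <= L + 1 & T <= 40 * (L + 1) + 15) (iu ''k'' 0 (Suc 0) st)"
 proof (rule wp_While[where I = I and \<phi> = "%sv. 40 * (L + 1 - sv$''k'' 0)"], goal_cases)
  case 1
  show ?case by (simp add: I_def)
 next
  case (2 sv)
  have "sv$''k'' 0 <= L + 1" using 2(1) kL by (simp add: I_def Let_def)
  moreover have "sv$''L'' 0 = L" "sv$''lg'' 0 = g" using 2(2) by (auto simp: unch_def L_def g_def)
  ultimately show ?case using bd gW by simp
 next
  case (3 sv)
  let ?k = "sv$''k'' 0"
  have e: "sv$''L'' 0 = L" "sv$''lg'' 0 = g" using 3(2) by (auto simp: unch_def L_def g_def)
  have l: "?k * ?k * (g + 1) < L" using 3(3) e by simp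
  then have "Suc ?k <= L + 1" using kL[of "Suc ?k"] by simp
  then show ?case using l gW by (intro wp_IAssign) (auto simp: I_def)
 next
  case (4 T sv)
  have e: "sv$''L'' 0 = L" "sv$''lg'' 0 = g" using 4(2) by (auto simp: unch_def L_def g_def)
  then show ?case using 4 kL by (auto simp: I_def is_k_def Let_def)
 qed
 note lp = this
 have b: "Suc 0 <= W" using gW by simp
 show ?thesis unfolding kcalc_def
  apply (rule wp_IE, (simp add: b cong: wp_cong; fail)+)
  apply (rule wp_mono[OF lp])
  by auto
qed

section \<open>Output\<close>

definition out_step :: com where
 "out_step = Cond (pos (IElem ''r'' (V ''hh''))) (IAssign ''reached'' (V ''tt'') (Lit 1) ;; RAssign ''dist'' (V ''tt'') (RElem ''D'' (V ''hh''))) Skip ;; inc ''hh''"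

definition outp :: com where
 "outp = ''hh'' <- Lit 0 ;; ''be'' <- Lit 0 ;;
  While (ILess (V ''be'') (V ''m'')) (''tt'' <- IElem ''end1'' (V ''be'') ;; out_step ;; ''tt'' <- IElem ''end2'' (V ''be'') ;; out_step ;; inc ''be'')"

text \<open>The source is marked beforehand, as it may have no half-edge. Several half-edges write
  to the cell of their common tail; it suffices that the value comes from one of them.\<close>

definition OI :: "(nat => nat) => nat => nat => state => bool" where
 "OI t s H st \<longleftrightarrow> st$''hh'' 0 = H & (\<forall>v. st$''reached'' v ~= 0 \<longleftrightarrow> v = s \<or> (\<exists>h<H. t h = v & st$''r'' h ~= 0)) &
  (\<forall>v. st$''reached'' v ~= 0 --> v = s & rmem st ''dist'' v = 0 \<or> (\<exists>h<H. t h = v & st$''r'' h ~= 0 & rmem st ''dist'' v = rmem st ''D'' h))"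

lemma mods_out [simp]: "imods out_step = {''reached'', ''hh''}" "rmods out_step = {''dist''}"
 by (auto simp: out_step_def)

lemma wp_out_step:
 assumes O: "OI t s H st" and tt: "st$''tt'' 0 = t H" and W: "H + 1 <= W" "t H <= W" "st$''r'' H <= W"
 shows "wp W out_step (%T st'. OI t s (Suc H) st' & T <= 40) st"
proof -
 have hh: "st$''hh'' 0 = H" using O by (simp add: OI_def)
 show ?thesis
 proof (cases "st$''r'' H = 0")
  case True
  have e: "(\<exists>h<Suc H. t h = v & st$''r'' h ~= 0 & P h) \<longleftrightarrow> (\<exists>h<H. t h = v & st$''r'' h ~= 0 & P h)" for v P
   using True by (auto simp: less_Suc_eq)
  have "OI t s (Suc H) (iu ''hh'' 0 (Suc H) st)" using O e[of _ "%_. True"] e[of _ "%h. rmem st ''dist'' v = rmem st ''D'' h" for v]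
   unfolding OI_def by simp
  then show ?thesis unfolding out_step_def using True hh tt W by (intro wp_basic wp_Cond) auto
 next
  case False
  let ?st' = "iu ''hh'' 0 (Suc H) (ru ''dist'' (t H) (rmem st ''D'' H) (iu ''reached'' (t H) (Suc 0) st))"
  have O1: "st$''reached'' v ~= 0 \<longleftrightarrow> v = s \<or> (\<exists>h<H. t h = v & st$''r'' h ~= 0)"
   "st$''reached'' v ~= 0 --> v = s & rmem st ''dist'' v = 0 \<or> (\<exists>h<H. t h = v & st$''r'' h ~= 0 & rmem st ''dist'' v = rmem st ''D'' h)" for v
   using O unfolding OI_def by blast+
  have "OI t s (Suc H) ?st'"
   unfolding OI_def
  proof (intro conjI allI)
   fix v
   have s: "rmem ?st' ''D'' = rmem st ''D''" "?st'$''r'' = st$''r''" by simp_all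
   show "?st'$''reached'' v ~= 0 \<longleftrightarrow> v = s \<or> (\<exists>h<Suc H. t h = v & ?st'$''r'' h ~= 0)"
    using False O1(1)[of v] unfolding s by (cases "v = t H") (auto simp: less_Suc_eq)
   show "?st'$''reached'' v ~= 0 --> v = s & rmem ?st' ''dist'' v = 0 \<or>
     (\<exists>h<Suc H. t h = v & ?st'$''r'' h ~= 0 & rmem ?st' ''dist'' v = rmem ?st' ''D'' h)"
    using False O1(2)[of v] unfolding s by (cases "v = t H") (auto simp: less_Suc_eq)
  qed simp
  then show ?thesis unfolding out_step_def using False hh tt W by (intro wp_basic wp_Cond) auto
 qed
qed

lemma wp_outp:
 fixes st
 defines "m \<equiv> st$''m'' 0"
 assumes z: "\<And>v. st$''reached'' v ~= 0 \<longleftrightarrow> v = s" "rmem st ''dist'' s = 0"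
  and w: "\<And>e. e < m ==> st$''end1'' e = t (2 * e) & st$''end2'' e = t (2 * e + 1) & t (2 * e) <= W & t (2 * e + 1) <= W"
  and r: "\<And>h. h < 2 * m ==> st$''r'' h <= W" and W: "2 * m + 2 <= W"
 shows "wp W outp (%T st'. OI t s (2 * m) st' & st'$''r'' = st$''r'' & rmem st' ''D'' = rmem st ''D'' & T <= 200 * m + 20) st"
proof -
 define st1 where "st1 = iu ''be'' 0 0 (iu ''hh'' 0 0 st)"
 have "wp W (While (ILess (V ''be'') (V ''m'')) (''tt'' <- IElem ''end1'' (V ''be'') ;; out_step ;; ''tt'' <- IElem ''end2'' (V ''be'') ;; out_step ;; inc ''be''))
  (%T st'. OI t s (2 * m) st' & st'$''r'' = st$''r'' & rmem st' ''D'' = rmem st ''D'' & T <= 200 * m + 10) st1"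
 proof (rule wp_While[where I = "%sv. sv$''be'' 0 <= m & OI t s (2 * sv$''be'' 0) sv" and \<phi> = "%sv. 200 * (m - sv$''be'' 0)"], goal_cases)
  case 1
  show ?case using z by (auto simp: OI_def st1_def)
 next
  case (2 sv)
  then show ?case using W by (auto simp: unch_def st1_def m_def)
 next
  case (3 sv)
  define e where "e = sv$''be'' 0"
  have f: "sv$a = st$a" if "a \<notin> {''be'', ''hh'', ''tt'', ''reached''}" for a using 3(2) that by (simp add: unch_def st1_def)
  have em: "e < m" using 3(3) by (simp add: f e_def m_def)
  note we = w[OF em]
  have O: "OI t s (2 * e) sv" using 3(1) e_def by simp
  have b: "sv$''be'' 0 = e" "sv$''end1'' e = t (2 * e)" "e <= W" "t (2 * e) <= W" using we em W by (auto simp: f e_def)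
  have o1: "wp W out_step (%T. wp W (''tt'' <- IElem ''end2'' (V ''be'') ;; out_step ;; inc ''be'') (%T' sv'. (sv'$''be'' 0 = Suc e & OI t s (2 * Suc e) sv') & T + T' <= 120)) (iu ''tt'' 0 (t (2 * e)) sv)"
  proof (rule wp_frame[OF wp_out_step[where H = "2 * e" and t = t and s = s]], goal_cases)
   case (6 T1 sv1)
   have f1: "sv1$a = sv$a" if "a \<notin> {''hh'', ''tt'', ''reached''}" for a using 6(2) that by (simp add: unch_def)
   have b1: "sv1$''be'' 0 = e" "sv1$''end2'' e = t (Suc (2 * e))" "e <= W" "t (Suc (2 * e)) <= W" "Suc e <= W" "Suc 0 <= W" using we em W b by (auto simp: f1 f)
   have o2: "wp W out_step (%T. wp W (inc ''be'') (%T' sv'. (sv'$''be'' 0 = Suc e & OI t s (2 * Suc e) sv') & T + T' <= 60)) (iu ''tt'' 0 (t (Suc (2 * e))) sv1)"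
   proof (rule wp_frame[OF wp_out_step[where H = "Suc (2 * e)" and t = t and s = s]], goal_cases)
    case (6 T2 sv2)
    have "sv2$''be'' 0 = e" using 6(2) b1(1) by (simp add: unch_def)
    then show ?case using 6(1) b1 by (intro wp_IAssign) (auto simp: OI_def)
   qed (use 6(1) we em W r[of "Suc (2 * e)"] b1 in \<open>auto simp: f1 f OI_def\<close>)
   note b = b1
   show ?case
    apply (rule wp_IE, (simp add: b cong: wp_cong; fail)+)
    apply (rule wp_Seq, rule wp_mono[OF o2], erule wp_mono)
    using 6(1) by auto
  qed (use O we em W r[of "2 * e"] in \<open>auto simp: f OI_def\<close>)
  show ?case
   apply (rule wp_IE, (simp add: b cong: wp_cong; fail)+)
   apply (rule wp_Seq, rule wp_mono[OF o1], erule wp_mono)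
   using em by (auto simp: e_def)
 next
  case (4 T sv)
  have "sv$''m'' 0 = m" "sv$''r'' = st$''r''" "rmem sv ''D'' = rmem st ''D''" using 4(2) by (auto simp: unch_def m_def st1_def)
  moreover from this have "sv$''be'' 0 = m" using 4(1,3) by simp
  ultimately show ?case using 4 by (auto simp: st1_def)
 qed
 note lp = this
 show ?thesis unfolding outp_def
  apply ((rule wp_IE, simp, simp, simp, simp)+)
  apply (rule wp_mono[OF lp[unfolded st1_def]])
  by auto
qed

section \<open>Distances in the input graph\<close>

lemma gwalk_Cons: "gwalk E w b v d ==> (a, b) \<in> E ==> gwalk E w a v (w (a, b) + d)"
proof (induction rule: gwalk.induct)
 case gwalk_refl
 show ?case using gwalk_step[OF gwalk.gwalk_refl gwalk_refl, of w] by simp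
next
 case (gwalk_step x d c)
 then show ?case using gwalk.gwalk_step[of E w a x "w (a, b) + d" c] by (simp add: add.assoc)
qed

text \<open>Both notions give the same set of lengths. An \<open>awalk\<close> is a list decomposed
  at its first arc, whereas \<open>gwalk\<close> grows at its last; \<open>gwalk_Cons\<close> and
  appending one arc translate between them.\<close>

lemma mu_gwalk:
 assumes "pair_graph G" and u: "u \<in> pverts G"
 shows "wf_digraph.\<mu> (with_proj G) w u v = (INF d\<in>{d. gwalk (parcs G) w u v d}. ereal d)"
proof -
 interpret pair_graph G by fact
 have wf: "wf_digraph (with_proj G)" by unfold_locales
 have 1: "gwalk (parcs G) w a v (awalk_cost w p)" if "awalk a p v" for a p
  using that
 proof (induction p arbitrary: a)
  case Nil
  then show ?case by (auto simp: awalk_Nil_iff intro: gwalk_refl)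
 next
  case (Cons e p)
  then have "e \<in> parcs G" "a = fst e" "awalk (snd e) p v" by (auto simp: awalk_Cons_iff)
  then show ?case using gwalk_Cons[OF Cons.IH, of "snd e" a] by simp
 qed
 have 2: "\<exists>p. awalk u p v & awalk_cost w p = d" if "gwalk (parcs G) w u v d" for d
  using that
 proof (induction rule: gwalk.induct)
  case gwalk_refl
  show ?case using u by (intro exI[of _ "[]"]) (simp add: awalk_Nil_iff)
 next
  case (gwalk_step b d c)
  then obtain p where p: "awalk u p b" "awalk_cost w p = d" by blast
  have "awalk b [(b, c)] c" using gwalk_step(2) arc_snd_in_verts[OF gwalk_step(2)] by (simp add: awalk_Cons_iff awalk_Nil_iff)
  then have "awalk u (p @ [(b, c)]) c" using awalk_appendI[OF p(1)] by blast
  then show ?case using p(2) by (intro exI[of _ "p @ [(b, c)]"]) simp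
 qed
 have "(%p. ereal (awalk_cost w p)) ` {p. awalk u p v} = ereal ` {d. gwalk (parcs G) w u v d}"
 proof (intro set_eqI iffI)
  fix x assume "x \<in> (%p. ereal (awalk_cost w p)) ` {p. awalk u p v}"
  then show "x \<in> ereal ` {d. gwalk (parcs G) w u v d}" using 1 by auto
 next
  fix x assume "x \<in> ereal ` {d. gwalk (parcs G) w u v d}"
  then show "x \<in> (%p. ereal (awalk_cost w p)) ` {p. awalk u p v}" using 2 by fastforce
 qed
 then show ?thesis by (simp only: \<mu>_def)
qed

lemma INF_ereal_min:
 assumes "d \<in> X" "\<And>x. x \<in> X ==> d <= x"
 shows "(INF x\<in>X. ereal x) = ereal d"
 by (rule antisym) (use assms in \<open>auto intro!: INF_lower2[of d] INF_greatest\<close>)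

lemma gwalk_nn: "gwalk E w a b d ==> (\<And>x y. (x, y) \<in> E ==> 0 <= w (x, y)) ==> 0 <= d"
 by (induction rule: gwalk.induct) force+

lemma gwalk_first: "gwalk E w a b d ==> a ~= b ==> \<exists>c. (a, c) \<in> E"
 by (induction rule: gwalk.induct) blast+

definition tl_of :: "(nat \<times> nat) list => nat => nat" where
 "tl_of es h = (if even h then fst (es ! (h div 2)) else snd (es ! (h div 2)))"

lemma twin_lt: "h < 2 * m ==> twin h < 2 * m" unfolding twin_def by (auto elim!: evenE)

lemma edge_list_arcs:
 assumes E: "edge_list G es" and w: "\<forall>(u, v)\<in>parcs G. 0 <= w (u, v) & w (u, v) = w (v, u)"
 shows "h < 2 * length es ==> (tl_of es h, tl_of es (twin h)) \<in> parcs G & w (tl_of es h, tl_of es (twin h)) = w (es ! (h div 2))"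
  "(a, b) \<in> parcs G ==> \<exists>h<2 * length es. tl_of es h = a & tl_of es (twin h) = b"
proof -
 have P: "parcs G = set es \<union> (set es)\<inverse>" using E by (simp add: edge_list_def)
 {
  assume h: "h < 2 * length es"
  define e where "e = es ! (h div 2)"
  have e: "e \<in> set es" using h by (simp add: e_def)
  have t: "(tl_of es h, tl_of es (twin h)) = (if even h then (fst e, snd e) else (snd e, fst e))"
   by (auto simp: tl_of_def twin_def e_def elim!: oddE evenE)
  have p: "(fst e, snd e) \<in> parcs G" "(snd e, fst e) \<in> parcs G" using e P by auto
  moreover have "w (snd e, fst e) = w (fst e, snd e)" using bspec[OF w p(1)] by (simp add: split_beta)
  ultimately have "(fst e, snd e) \<in> parcs G" "(snd e, fst e) \<in> parcs G" "w (snd e, fst e) = w (fst e, snd e)" by blast+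
  then show "(tl_of es h, tl_of es (twin h)) \<in> parcs G & w (tl_of es h, tl_of es (twin h)) = w (es ! (h div 2))"
   unfolding t e_def[symmetric] by auto
 }
 {
  assume "(a, b) \<in> parcs G"
  then have "(a, b) \<in> set es \<or> (b, a) \<in> set es" using P by auto
  then show "\<exists>h<2 * length es. tl_of es h = a & tl_of es (twin h) = b"
  proof
   assume "(a, b) \<in> set es"
   then obtain i where "i < length es" "es ! i = (a, b)" by (auto simp: in_set_conv_nth)
   then show ?thesis by (intro exI[of _ "2 * i"]) (auto simp: tl_of_def twin_def)
  next
   assume "(b, a) \<in> set es"
   then obtain i where "i < length es" "es ! i = (b, a)" by (auto simp: in_set_conv_nth)
   then show ?thesis by (intro exI[of _ "2 * i + 1"]) (auto simp: tl_of_def twin_def)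
  qed
 }
qed

section \<open>The running time\<close>

lemma log_bounds:
 assumes "3 <= n"
 shows "11 / 7 <= log 2 (real n)" "7 / 11 <= log 2 (log 2 (real n))"
proof -
 have "11 / 7 <= log 2 (3::real)"
 proof -
  have "11 = log 2 ((2::real) ^ 11)" by (subst log_pow_cancel) auto
  also have "\<dots> <= log 2 (3 ^ 7)" by (subst log_le_cancel_iff) auto
  also have "\<dots> = 7 * log 2 3" by (subst log_nat_power) auto
  finally show ?thesis by simp
 qed
 also have "log 2 3 <= log 2 (real n)" using assms by (subst log_le_cancel_iff) auto
 finally show a: "11 / 7 <= log 2 (real n)" .
 have "7 / 11 <= log 2 (11 / 7 :: real)"
 proof -
  have "7 = log 2 ((2::real) ^ 7)" by (subst log_pow_cancel) auto
  also have "\<dots> <= log 2 ((11 / 7) ^ 11)" by (subst log_le_cancel_iff) (auto simp: field_simps)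
  also have "\<dots> = 11 * log 2 (11 / 7)" by (subst log_nat_power) auto
  finally show ?thesis by simp
 qed
 also have "\<dots> <= log 2 (log 2 (real n))" using a by (subst log_le_cancel_iff) auto
 finally show "7 / 11 <= log 2 (log 2 (real n))" .
qed

lemma is_log_real:
 assumes "is_log x y" "real x <= z" "1 <= z"
 shows "real y <= 1 + log 2 z"
proof (cases "y = 0")
 case False
 then have "2 ^ (y - 1) < x" using assms(1) by (simp add: is_log_def)
 then have "real (2 ^ (y - 1)) <= z" using assms(2) by linarith
 then have "log 2 (2 ^ (y - 1)) <= log 2 z" using assms(3) by (subst log_le_cancel_iff) auto
 then show ?thesis using False by (simp add: of_nat_diff)
qed (use assms(3) in simp)

text \<open>A simple graph has \<open>m <= n * n\<close>, so the rounded logarithms of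
  \<open>2 * m\<close> are of order \<open>log n\<close> and \<open>log log n\<close>. For
  \<open>n <= 2\<close> everything is bounded and absorbed by the maximum with 1 in
  \<open>time_bound\<close>.\<close>

lemma time_bound_ge:
 assumes "m <= n * n"
 shows "real m <= 4 * time_bound n m"
  and "is_log (2 * m) L ==> is_log L g ==> real (2 * m) * sqrt (real L * (real g + 1)) <= 100 * time_bound n m"
proof -
 define l1 where "l1 = log 2 (real n)"
 define l2 where "l2 = log 2 l1"
 have tb: "real m * sqrt (l1 * l2) <= time_bound n m" "1 <= time_bound n m" by (simp_all add: time_bound_def l1_def l2_def)
 have small: "m <= 4" if "\<not> 3 <= n"
 proof -
  have "n * n <= 2 * 2" using that by (intro mult_mono) auto
  then show ?thesis using assms by linarith
 qed
 have S1: "1 <= l1 * l2" "11 / 7 <= l1" "7 / 11 <= l2" if "3 <= n"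
 proof -
  show l: "11 / 7 <= l1" "7 / 11 <= l2" using log_bounds[OF that] by (simp_all add: l1_def l2_def)
  have "(11 / 7) * (7 / 11) <= l1 * l2" using l by (intro mult_mono) auto
  then show "1 <= l1 * l2" by simp
 qed
 show "real m <= 4 * time_bound n m"
 proof (cases "3 <= n")
  case True
  then have "real m * 1 <= real m * sqrt (l1 * l2)" using S1 by (intro mult_left_mono) auto
  then show ?thesis using tb by linarith
 next
  case False
  then have "real m <= 4" using small by simp
  then show ?thesis using tb(2) by linarith
 qed
 assume L: "is_log (2 * m) L" and g: "is_log L g"
 show "real (2 * m) * sqrt (real L * (real g + 1)) <= 100 * time_bound n m"
 proof (cases "3 <= n")
  case True
  note S = S1[OF True]
  have "real m <= real n * real n" using assms by (metis of_nat_le_iff of_nat_mult)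
  then have "real (2 * m) <= 2 * (real n * real n)" by simp
  moreover have "1 <= 2 * (real n * real n)"
  proof -
   have "1 * 1 <= real n * real n" using True by (intro mult_mono) auto
   then show ?thesis by simp
  qed
  ultimately have "real L <= 1 + log 2 (2 * (real n * real n))" using is_log_real[OF L] by blast
  also have "log 2 (2 * (real n * real n)) = 1 + (l1 + l1)" using True by (simp add: log_mult l1_def)
  finally have L4: "real L <= 4 * l1" using S by linarith
  have "real g <= 1 + log 2 (4 * l1)" using is_log_real[OF g L4] S by simp
  also have "log 2 (4 * l1) = 2 + l2"
  proof -
   have "log 2 (4 * l1) = log 2 (2 ^ 2 :: real) + log 2 l1" using S(2) by (subst log_mult) auto
   also have "log 2 (2 ^ 2 :: real) = 2" by (subst log_pow_cancel) auto
   finally show ?thesis by (simp add: l2_def)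
  qed
  finally have "real g + 1 <= 8 * l2" using S by linarith
  then have "real L * (real g + 1) <= 4 * l1 * (8 * l2)" using L4 S by (intro mult_mono) auto
  \<comment> \<open>The factor 32 is rounded up to a square, so that the root is a number.\<close>
  also have "\<dots> <= 36 * (l1 * l2)" using S by simp
  finally have "sqrt (real L * (real g + 1)) <= sqrt (36 * (l1 * l2))" by simp
  also have "\<dots> = 6 * sqrt (l1 * l2)" by (simp add: real_sqrt_mult)
  finally have "real (2 * m) * sqrt (real L * (real g + 1)) <= real (2 * m) * (6 * sqrt (l1 * l2))" by (intro mult_left_mono) auto
  also have "\<dots> = 12 * (real m * sqrt (l1 * l2))" by simp
  finally show ?thesis using tb by linarith
 next
  case False
  then have m: "2 * m <= 8" using small by simp
  have "L <= 8" "g <= 8" using is_log_le[OF L] is_log_le[OF g] m by auto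
  then have "real L * (real g + 1) <= 9 * 9" by (intro mult_mono) auto
  then have "sqrt (real L * (real g + 1)) <= sqrt (9 * 9)" by (intro real_sqrt_le_mono) auto
  also have "sqrt (9 * 9) = (9 :: real)" by (rule real_sqrt_unique) (auto simp: power2_eq_square)
  finally have "real (2 * m) * sqrt (real L * (real g + 1)) <= 8 * 9" using m by (intro mult_mono) auto
  then show ?thesis using tb(2) by linarith
 qed
qed

text \<open>Both main terms become multiples of \<open>N * Y\<close>:
  \<open>k * (g + 1) <= 3 * Y\<close> bounds the explorations and bundles, and
  \<open>L <= k * Y\<close> together with \<open>rc * k <= k + 9 * N\<close> bounds the extraction
  of the centres.\<close>

lemma sssp_time:
 fixes N L g k rc :: nat
 defines "Y \<equiv> sqrt (real L * (real g + 1))"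
 assumes N: "2 <= N" and L: "is_log N L" and g: "is_log L g" and k: "is_k L g k" and rc: "rc * k <= k + 9 * N"
  and T: "T <= 104000 * (g + 5) * (N * k) + 360000 * (N * k) + (6000 * L + 3100) * rc + 1150 * N + 42000 + (30 * L + 30 * g + 40 * (L + 1) + 1000 + 300 * N)"
 shows "real T <= 3000000 * (real N * Y)"
proof -
 have L1: "1 <= L" using L N by (cases L) (auto simp: is_log_def)
 have LN: "L <= N" "g <= L" using is_log_le[OF L] is_log_le[OF g] by auto
 define G where "G = real g + 1"
 have G1: "1 <= G" by (simp add: G_def)
 have Yd: "Y = sqrt (real L * G)" by (simp add: Y_def G_def)
 have Y0: "0 <= Y" unfolding Yd using G1 by simp
 have "1 * 1 <= real L * G" using L1 G1 by (intro mult_mono) auto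
 then have Y1: "1 <= Y" by (simp add: Yd)
 have G2: "G <= 2 * Y"
 proof -
  have "G * G <= (4 * real L) * G" using LN L1 G1 by (intro mult_right_mono) (auto simp: G_def)
  then have "sqrt (G * G) <= sqrt (2 * 2 * (real L * G))" by (intro real_sqrt_le_mono) simp
  also have "\<dots> = 2 * sqrt (real L * G)" by (subst real_sqrt_mult) simp
  finally show ?thesis using G1 by (simp add: Yd)
 qed
 have k1: "0 < k" "L <= k * k * (g + 1)" "k = 1 \<or> (k - 1) * (k - 1) * (g + 1) < L" using k by (auto simp: is_k_def)
 \<comment> \<open>Minimality of \<open>k\<close> gives \<open>(k - 1) * (k - 1) * G <= L\<close>;
   multiplying by \<open>G\<close> and taking the root bounds \<open>(k - 1) * G\<close> by
   \<open>Y\<close>, and the missing \<open>G\<close> is at most \<open>2 * Y\<close>.\<close>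
 have kG: "real k * G <= 3 * Y"
 proof (cases "k = 1")
  case True
  then show ?thesis using G2 Y0 by simp
 next
  case False
  then have "real ((k - 1) * (k - 1) * (g + 1)) <= real L" using k1 by linarith
  moreover obtain j where "k = Suc j" using k1(1) by (cases k) auto
  ultimately have "(real k - 1) * (real k - 1) * G <= real L" by (simp add: G_def algebra_simps)
  then have "(real k - 1) * (real k - 1) * G * G <= real L * G" using G1 by (intro mult_right_mono) auto
  then have "((real k - 1) * G) * ((real k - 1) * G) <= real L * G" by (simp add: ac_simps)
  then have "sqrt (((real k - 1) * G) * ((real k - 1) * G)) <= Y" unfolding Yd by (rule real_sqrt_le_mono)
  moreover have "0 <= (real k - 1) * G" using k1(1) G1 by simp
  ultimately have "(real k - 1) * G <= Y" by simp
  then show ?thesis using G2 by (simp add: algebra_simps)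
 qed
 \<comment> \<open>Multiply \<open>L <= k * k * G\<close> by \<open>L\<close> and take the
   root.\<close>
 have LkY: "real L <= real k * Y"
 proof -
  have "real L <= real k * real k * G" using k1(2) unfolding G_def by (metis of_nat_1 of_nat_add of_nat_le_iff of_nat_mult)
  then have "real L * real L <= real L * (real k * real k * G)" by (intro mult_left_mono) auto
  also have "\<dots> = (real k * real k) * (real L * G)" by (simp add: ac_simps)
  finally have "sqrt (real L * real L) <= sqrt ((real k * real k) * (real L * G))" by (rule real_sqrt_le_mono)
  then show ?thesis by (simp add: Yd real_sqrt_mult)
 qed
 have kN: "k <= 2 * N"
 proof -
  have "k <= L + 1"
  proof (cases "k = 1")
   case False
   have "(k - 1) * 1 <= (k - 1) * ((k - 1) * (g + 1))" by (cases "k - 1") auto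
   also have "\<dots> = (k - 1) * (k - 1) * (g + 1)" by (simp only: mult.assoc)
   finally show ?thesis using k1(3) False by linarith
  qed simp
  then show ?thesis using LN N by linarith
 qed
 define NY where "NY = real N * Y"
 have N1: "real N <= NY" using Y1 N unfolding NY_def by (simp add: mult_le_cancel_left1)
 have Nk: "real N * (real k * G) <= 3 * NY" unfolding NY_def using mult_left_mono[OF kG, of "real N"] by simp
 have Nk1: "real N * real k <= 3 * NY"
 proof -
  have "real N * real k * 1 <= real N * real k * G" using G1 by (intro mult_left_mono) auto
  then show ?thesis using Nk by (simp add: mult.assoc)
 qed
 have Lrc: "real L * real rc <= 11 * NY"
 proof -
  have "real L * real rc <= real k * Y * real rc" using LkY by (intro mult_right_mono) auto
  also have "\<dots> = real (rc * k) * Y" by simp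
  also have "rc * k <= 11 * N" using rc kN by linarith
  then have "real (rc * k) * Y <= real (11 * N) * Y" using Y0 by (intro mult_right_mono) (simp_all only: of_nat_le_iff)
  finally show ?thesis by (simp add: NY_def)
 qed
 have r1: "real rc <= real L * real rc" using L1 by (simp add: mult_le_cancel_right1)
 have "real (104000 * (g + 5) * (N * k)) <= 104000 * (5 * (real N * (real k * G)))"
 proof -
  have "(real g + 5) * (real N * real k) <= (5 * G) * (real N * real k)" by (intro mult_right_mono) (auto simp: G_def)
  also have "\<dots> = 5 * (real N * (real k * G))" by (simp add: ac_simps)
  finally have "104000 * ((real g + 5) * (real N * real k)) <= 104000 * (5 * (real N * (real k * G)))" by (rule mult_left_mono) simp
  then show ?thesis by (simp only: of_nat_mult of_nat_add of_nat_numeral mult.assoc)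
 qed
 then have a: "real (104000 * (g + 5) * (N * k)) <= 1560000 * NY" using Nk by linarith
 have b: "real (360000 * (N * k)) <= 1080000 * NY" using Nk1 by simp
 have c: "real ((6000 * L + 3100) * rc) <= 100100 * NY"
 proof -
  have "real ((6000 * L + 3100) * rc) = 6000 * (real L * real rc) + 3100 * real rc" by (simp add: algebra_simps)
  then show ?thesis using Lrc r1 by linarith
 qed
 have d: "real (1150 * N + 42000 + (30 * L + 30 * g + 40 * (L + 1) + 1000 + 300 * N)) <= 25000 * NY"
 proof -
  have "1150 * N + 42000 + (30 * L + 30 * g + 40 * (L + 1) + 1000 + 300 * N) <= 25000 * N"
   unfolding distrib_left using LN N by linarith
  then have "real (1150 * N + 42000 + (30 * L + 30 * g + 40 * (L + 1) + 1000 + 300 * N)) <= 25000 * real N" by linarith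
  then show ?thesis using N1 by linarith
 qed
 have "real T <= real (104000 * (g + 5) * (N * k)) + real (360000 * (N * k)) + real ((6000 * L + 3100) * rc) + real (1150 * N + 42000 + (30 * L + 30 * g + 40 * (L + 1) + 1000 + 300 * N))"
  using T by (simp only: of_nat_add[symmetric] of_nat_le_iff)
 then have "real T <= 3000000 * NY" using a b c d N1 by linarith
 then show ?thesis by (simp add: NY_def)
qed

section \<open>The complete program\<close>

definition core :: com where
 "core = ''src'' <- IMinus (IElem ''last'' (V ''source'')) (Lit 1) ;; ''N'' <- ITimes (Lit 2) (V ''m'') ;;
  plog ''N'' ''L'' ;; plog ''L'' ''lg'' ;; kcalc ;; (centres ;; mainp) ;; outp"

text \<open>If \<open>last\<close> is 0 at the source, the source has no incident edge and reaches
  only itself; \<open>dist\<close> is 0 there from the initial memory.\<close>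

definition prog :: com where
 "prog = IAssign ''reached'' (V ''source'') (Lit 1) ;; build ;; Cond (pos (IElem ''last'' (V ''source''))) core Skip"

lemma mods_params [simp]: "imods (plog a b) = {''pw'', b}" "rmods (plog a b) = {}" "imods kcalc = {''k''}" "rmods kcalc = {}"
 by (auto simp: plog_def kcalc_def)

lemma unch_sssp:
 assumes "unch (centres ;; mainp) st st'" "a \<in> {''m'', ''end1'', ''end2'', ''reached'', ''source''}"
 shows "st'$a = st$a" "rmem st' ''dist'' = rmem st ''dist''"
proof -
 note d = centres_def cinit_def cinit_loop_def cfin_loop_def stage_def newU_def mainp_def bdcopy_def mloop_def
 have "a \<notin> imods (centres ;; mainp)" using assms(2) by (elim insertE emptyE) (simp_all add: d)
 then show "st'$a = st$a" using assms(1) by (simp add: unch_def)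
 have "''dist'' \<notin> rmods (centres ;; mainp)" by (simp add: d)
 then show "rmem st' ''dist'' = rmem st ''dist''" using assms(1) by (simp add: unch_def)
qed

text \<open>As \<open>(k - 1) * (k - 1) < L <= 2 ^ g\<close>, the logarithm of \<open>k * k\<close>
  exceeds \<open>g\<close> by a constant at most. So \<open>l = g + 4\<close> is admissible for the
  explorations.\<close>

lemma is_k_exp:
 assumes "is_log L g" "is_k L g k"
 shows "3 * (k * k) + 4 <= 2 ^ (g + 4)"
proof (cases "k = 1")
 case True
 have "(1 :: nat) <= 2 ^ g" by simp
 then have "7 <= 16 * (2 :: nat) ^ g" by linarith
 then show ?thesis using True by (simp add: power_add mult.commute)
next
 case False
 define j where "j = k - 1"
 have k: "k = j + 1" "1 <= j" using False assms(2) by (auto simp: is_k_def j_def)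
 have "j * j * 1 <= j * j * (g + 1)" by (rule mult_left_mono) auto
 also have "\<dots> < L" using assms(2) False by (auto simp: is_k_def j_def)
 also have "L <= 2 ^ g" using assms(1) by (simp add: is_log_def)
 finally have "j * j + 1 <= 2 ^ g" by simp
 moreover have "j <= j * j" by (simp add: le_square)
 moreover have "k * k = j * j + 2 * j + 1" by (simp add: k algebra_simps)
 ultimately have "3 * (k * k) + 4 <= 16 * 2 ^ g" by linarith
 then show ?thesis by (simp add: power_add)
qed

text \<open>All integers that occur are \<open>O(N ^ 4)\<close>. Working with
  \<open>M = N + 4\<close> absorbs the additive constants into powers of \<open>M\<close>.\<close>

lemma word_bounds:
 fixes N k l L M :: nat
 assumes M: "N + 4 = M" and k: "k <= N + 1" and l: "l <= M" and L: "L <= N" and W: "2000000 * (M * M * M * M) <= W"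
 shows "(4 * (8000 + (6000 * l + 26000) * (k * k)) + 2 * N + 30000) * (N + 1) <= W" "20 * (N * k) + 4 * (k * k) + 20 <= W"
  "4 * N * (N * k) + 4 * N + 4 <= W" "(4 * (360000 * (N * k) + (6000 * L + 3100) * (k + 9 * N) + 41000 + 500 * N) + 2 * N + 20) * (N + 1) <= W"
  "1000 * M <= W"
proof -
 define M2 where "M2 = M * M"
 define M3 where "M3 = M * M * M"
 define M4 where "M4 = M * M * M * M"
 have b: "N <= M" "k <= M" "L <= M" "1 <= M" "N + 1 <= M" using M k L by auto
 have m: "M <= M2" "M2 <= M3" "M3 <= M4" using b(4) by (auto simp: M2_def M3_def M4_def)
 have W': "2000000 * M4 <= W" using W by (simp add: M4_def)
 have kk: "k * k <= M2" "N * k <= M2" unfolding M2_def using b by (intro mult_mono; simp)+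
 show "20 * (N * k) + 4 * (k * k) + 20 <= W" using kk W' m b by linarith
 have "N * (N * k) <= M3" unfolding M3_def mult.assoc using b by (intro mult_mono) auto
 then have "4 * N * (N * k) <= 4 * M3" by simp
 then show "4 * N * (N * k) + 4 * N + 4 <= W" using W' m b by linarith
 show "1000 * M <= W" using W' m b by linarith
 have "(6000 * l + 26000) * (k * k) <= (32000 * M) * M2" using kk l b by (intro mult_mono) auto
 also have "\<dots> = 32000 * M3" by (simp add: M2_def M3_def)
 finally have x: "(6000 * l + 26000) * (k * k) <= 32000 * M3" .
 have "4 * (8000 + x) + 2 * N + 30000 <= 2000000 * M3" if "x <= 32000 * M3" for x
  unfolding distrib_left using that m b by linarith
 from this[OF x] have "4 * (8000 + (6000 * l + 26000) * (k * k)) + 2 * N + 30000 <= 2000000 * M3" .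
 then have "(4 * (8000 + (6000 * l + 26000) * (k * k)) + 2 * N + 30000) * (N + 1) <= 2000000 * M3 * M" using b by (intro mult_mono) auto
 also have "\<dots> = 2000000 * M4" by (simp add: M3_def M4_def)
 finally show "(4 * (8000 + (6000 * l + 26000) * (k * k)) + 2 * N + 30000) * (N + 1) <= W" using W' by linarith
 have "(6000 * L + 3100) * (k + 9 * N) <= (9100 * M) * (10 * M)" using b by (intro mult_mono) auto
 also have "\<dots> = 91000 * M2" by (simp add: M2_def)
 finally have x: "(6000 * L + 3100) * (k + 9 * N) <= 91000 * M2" .
 have "4 * (360000 * (N * k) + x + 41000 + 500 * N) + 2 * N + 20 <= 2000000 * M2" if "x <= 91000 * M2" for x
  unfolding distrib_left using that kk m b by linarith
 from this[OF x] have "4 * (360000 * (N * k) + (6000 * L + 3100) * (k + 9 * N) + 41000 + 500 * N) + 2 * N + 20 <= 2000000 * M2" .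
 then have "(4 * (360000 * (N * k) + (6000 * L + 3100) * (k + 9 * N) + 41000 + 500 * N) + 2 * N + 20) * (N + 1) <= 2000000 * M2 * M"
  using b by (intro mult_mono) auto
 also have "\<dots> = 2000000 * M3" by (simp add: M2_def M3_def)
 finally show "(4 * (360000 * (N * k) + (6000 * L + 3100) * (k + 9 * N) + 41000 + 500 * N) + 2 * N + 20) * (N + 1) <= W" using W' m by linarith
qed

lemma wp_core:
 fixes st
 defines "m \<equiv> st$''m'' 0" and "s \<equiv> st$''source'' 0"
 defines "N \<equiv> 2 * m"
 assumes H: "halfedges N (st$''rv'') (rmem st ''wt'') t ww (st$''last'') E w"
  and ls: "st$''last'' s ~= 0"
  and z: "\<And>a x. a \<in> {''b'', ''c'', ''i'', ''r'', ''R'', ''bd''} ==> st$a x = 0" "rmem st ''zero'' 0 = 0"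
  and rd: "\<And>v. st$''reached'' v ~= 0 \<longleftrightarrow> v = s" "rmem st ''dist'' s = 0"
  and en: "\<And>e. e < m ==> st$''end1'' e = t (2 * e) & st$''end2'' e = t (2 * e + 1) & t (2 * e) <= W & t (2 * e + 1) <= W"
  and W: "2000000 * ((N + 4) * (N + 4) * (N + 4) * (N + 4)) <= W" "s <= W"
 shows "wp W core (%T st'. (\<forall>v. if st'$''reached'' v = 0 then \<forall>d. \<not> gwalk E w s v d
   else gwalk E w s v (rmem st' ''dist'' v) & (\<forall>d. gwalk E w s v d --> rmem st' ''dist'' v <= d)) &
  (\<exists>L g. is_log N L & is_log L g & real (T + 300 * m + 100) <= 3000000 * (real N * sqrt (real L * (real g + 1))))) st"
proof -
 define rv where "rv = st$''rv''"
 define wt where "wt = rmem st ''wt''"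
 define la where "la = st$''last''"
 interpret halfedges N rv wt t ww la E w using H by (simp add: rv_def wt_def la_def)
 obtain src where src: "la s = Suc src" using ls unfolding la_def by (cases "st$''last'' s") auto
 have sr: "src < N" "t src = s" using BI_D(6)[OF B src] by auto
 have N2: "2 <= N" using sr(1) by (simp add: N_def)
 have N4: "1000 * (N + 4) <= W" using word_bounds(5)[OF refl _ _ _ W(1), where k = 0 and l = 0 and L = 0] by simp
 define st1 where "st1 = iu ''N'' 0 N (iu ''src'' 0 src st)"
 have "wp W (plog ''N'' ''L'' ;; plog ''L'' ''lg'' ;; kcalc ;; (centres ;; mainp) ;; outp) (%T st'. (\<forall>v. if st'$''reached'' v = 0 then \<forall>d. \<not> gwalk E w s v d
   else gwalk E w s v (rmem st' ''dist'' v) & (\<forall>d. gwalk E w s v d --> rmem st' ''dist'' v <= d)) &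
  (\<exists>L g. is_log N L & is_log L g & real (T + 300 * m + 150) <= 3000000 * (real N * sqrt (real L * (real g + 1))))) st1"
 proof (rule wp_Seq, rule wp_frame[OF wp_plog], goal_cases)
  case (5 T2 st2)
  define L where "L = st2$''L'' 0"
  have L: "is_log N L" "T2 <= 30 * L + 20" using 5(1) by (simp_all add: L_def st1_def)
  have LN: "L <= N" using is_log_le[OF L(1)] .
  have f2: "st2$a = st1$a" if "a \<notin> {''L'', ''pw''}" for a using 5(2) that by (simp add: unch_def)
  have r2: "rmem st2 = rmem st" using 5(2) by (auto simp: unch_def st1_def)
  show ?case
  proof (rule wp_Seq, rule wp_frame[OF wp_plog], goal_cases)
   case (5 T3 st3)
   define g where "g = st3$''lg'' 0"
   have g: "is_log L g" "T3 <= 30 * g + 20" using 5(1) by (simp_all add: L_def g_def)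
   have gL: "g <= L" using is_log_le[OF g(1)] .
   have f3: "st3$a = st1$a" if "a \<notin> {''L'', ''pw'', ''lg''}" for a using 5(2) that f2 by (simp add: unch_def)
   have r3: "rmem st3 = rmem st" using 5(2) r2 by (auto simp: unch_def)
   have L3: "st3$''L'' 0 = L" using 5(2) by (simp add: unch_def L_def)
   have "(L + 1) * (L + 1) * (g + 1) + 3 <= W"
   proof -
    have "(L + 1) * (L + 1) * (g + 1) <= (N + 4) * (N + 4) * (N + 4)" using LN gL by (intro mult_mono) auto
    also have "\<dots> * 1 <= (N + 4) * (N + 4) * (N + 4) * (N + 4)" by (intro mult_left_mono) auto
    finally have "(L + 1) * (L + 1) * (g + 1) <= (N + 4) * (N + 4) * (N + 4) * (N + 4)" by simp
    moreover have "1 * 1 * 1 * 1 <= (N + 4) * (N + 4) * (N + 4) * (N + 4)" by (intro mult_mono) auto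
    ultimately have "(L + 1) * (L + 1) * (g + 1) + 3 <= 2000000 * ((N + 4) * (N + 4) * (N + 4) * (N + 4))"
     if "x = (N + 4) * (N + 4) * (N + 4) * (N + 4)" for x unfolding that[symmetric] by linarith
    from this[OF refl] show ?thesis using W(1) by (rule order.trans)
   qed
   note Wk = this
   show ?case
   proof (rule wp_Seq, rule wp_frame[OF wp_kcalc[where st = st3, unfolded L3 g_def[symmetric], OF Wk]], goal_cases)
    case (1 T4 st4)
    define k where "k = st4$''k'' 0"
    have k: "is_k L g k" "k <= L + 1" "T4 <= 40 * (L + 1) + 20" using 1(1) by (simp_all add: k_def)
    have f4: "st4$a = st1$a" if "a \<notin> {''L'', ''pw'', ''lg'', ''k''}" for a using 1(2) that f3 by (simp add: unch_def)
    have r4: "rmem st4 = rmem st" using 1(2) r3 by (auto simp: unch_def)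
    have src4: "st4$''src'' 0 = src" by (simp add: f4 st1_def)
    have kN: "k <= N + 1" "g + 4 <= N + 4" using k(2) LN gL by auto
    note wb = word_bounds[OF refl kN LN W(1)]
    have cl: "clean st4" unfolding clean_def hinv_def using z(1) by (simp add: f4 st1_def)
    have G4: "G st4" unfolding G_def by (simp add: f4 r4 st1_def rv_def wt_def)
    have k0: "0 < k" using k(1) by (simp add: is_k_def)
    have NL: "N <= 2 ^ L" using L(1) by (simp add: is_log_def)
    note sp = wp_sssp[where st = st4 and W = W, unfolded src4 k_def[symmetric], OF cl G4 sr(1) _ _ k0 is_k_exp[OF g(1) k(1)] NL wb(1-4)]
    show ?case
    proof (rule wp_Seq, rule wp_frame[OF sp], goal_cases)
     case 1
     then show ?case using z(2) by (simp add: r4)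
    next
     case (2 x)
     then show ?case using z(1) by (simp add: f4 st1_def)
    next
     case (3 T5 st5)
     define D where "D = rmem st5 ''D''"
     define r where "r = st5$''r''"
     have p: "\<And>v. v < N ==> r v ~= 0 ==> walk src v (D v)" "\<And>v. v < N ==> r v <= 1" "\<And>v d. walk src v d ==> r v ~= 0 & D v <= d"
      using 3(1) unfolding D_def r_def by blast+
     obtain rc where rc: "rc * k <= k + 9 * N"
      "T5 <= 104000 * (g + 4 + 1) * (N * k) + 360000 * (N * k) + (6000 * L + 3100) * rc + 1150 * N + 42000" using 3(1) by blast
     have f5: "st5$a = st$a" if "a \<in> {''m'', ''end1'', ''end2'', ''reached'', ''source''}" for a
      using unch_sssp(1)[OF 3(2) that] that by (auto simp: f4 st1_def)
     have d5: "rmem st5 ''dist'' = rmem st ''dist''" using unch_sssp(2)[OF 3(2), of "''m''"] r4 by simp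
     have m5: "st5$''m'' 0 = m" by (simp add: f5 m_def)
     have W1: "1 <= W" "2 * m + 2 <= W" using N4 by (simp_all add: N_def)
     show ?case
     proof (rule wp_mono[OF wp_outp[where st = st5 and t = t and s = s, unfolded m5]], goal_cases)
      case 1
      then show ?case using rd(1) by (simp add: f5)
     next
      case 2
      then show ?case using rd(2) by (simp add: d5)
     next
      case (3 e)
      then show ?case using en[of e] by (simp add: f5)
     next
      case (4 h)
      then show ?case using p(2)[of h] W1 by (simp add: N_def r_def)
     next
      case 5
      then show ?case using W1 by simp
     next
      case (6 T6 st6)
      have O: "OI t s N st6" "st6$''r'' = r" "rmem st6 ''D'' = D" "T6 <= 200 * m + 20" using 6 unfolding N_def r_def D_def by blast+
      have O1: "\<And>v. st6$''reached'' v ~= 0 \<longleftrightarrow> v = s \<or> (\<exists>h<N. t h = v & r h ~= 0)"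
       "\<And>v. st6$''reached'' v ~= 0 ==> v = s & rmem st6 ''dist'' v = 0 \<or> (\<exists>h<N. t h = v & r h ~= 0 & rmem st6 ''dist'' v = D h)"
       using O(1) unfolding OI_def O(2,3) by blast+
      have "if st6$''reached'' v = 0 then \<forall>d. \<not> gwalk E w s v d
       else gwalk E w s v (rmem st6 ''dist'' v) & (\<forall>d. gwalk E w s v d --> rmem st6 ''dist'' v <= d)" for v
      proof (cases "st6$''reached'' v = 0")
       case True
       then have nv: "v ~= s" "\<And>h. h < N ==> t h = v ==> r h = 0" using O1(1)[of v] by blast+
       have "False" if gw: "gwalk E w s v d" for d
        using gw
       proof (cases rule: gwalk.cases)
        case (gwalk_step b d' )
        \<comment> \<open>As \<open>v\<close> is not the source, the walk ends with an arc into
          \<open>v\<close>. The twin of its half-edge has tail \<open>v\<close> and is reachable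
          among the half-edges, hence labelled, which contradicts the output.\<close>
        obtain h where h: "h < N" "t (twin h) = v" using arcs(2)[OF gwalk_step(3)] by blast
        have tw: "twin h < N" using twin_lt[of h m] h(1) by (simp add: N_def)
        then have "walk src (twin h) d" using gwalk_walk[OF gw sr] h by simp
        then show False using p(3) nv(2)[OF tw h(2)] by blast
       qed (use nv in simp)
       then show ?thesis using True by auto
      next
       case False
       then consider "v = s" "rmem st6 ''dist'' v = 0" | h where "h < N" "t h = v" "r h ~= 0" "rmem st6 ''dist'' v = D h" using O1(2) by blast
       then have "gwalk E w s v (rmem st6 ''dist'' v) & (\<forall>d. gwalk E w s v d --> rmem st6 ''dist'' v <= d)"
       proof cases
        case 1
        then show ?thesis using gwalk_refl walk_nn[OF gwalk_walk[OF _ sr sr]] by auto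
       next
        case (2 h)
        have "gwalk E w s v (D h)" using walk_gwalk[OF p(1)[OF 2(1,3)]] sr 2 by simp
        then show ?thesis using p(3) gwalk_walk[OF _ sr 2(1,2)] 2 by auto
       qed
       then show ?thesis using False by simp
      qed
      moreover have "real (T2 + (T3 + (T4 + (T5 + T6))) + 300 * m + 150) <= 3000000 * (real N * sqrt (real L * (real g + 1)))"
      proof (rule sssp_time[OF N2 L(1) g(1) k(1) rc(1)])
       have g5: "g + 4 + 1 = g + 5" by simp
       have m2: "200 * m <= 100 * N" "300 * m <= 150 * N" by (simp_all add: N_def)
       have "T2 + (T3 + (T4 + (T5 + T6))) + 300 * m + 150 <= A + B + C + 1150 * N + 42000 + (30 * L + 30 * g + 40 * (L + 1) + 1000 + 300 * N)"
        if "T5 <= A + B + C + 1150 * N + 42000" for A B C using m2 that L(2) g(2) k(3) O(4) by linarith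
       moreover have "T5 <= 104000 * (g + 5) * (N * k) + 360000 * (N * k) + (6000 * L + 3100) * rc + 1150 * N + 42000" using rc(2) by (simp only: g5)
       ultimately show "T2 + (T3 + (T4 + (T5 + T6))) + 300 * m + 150 <= 104000 * (g + 5) * (N * k) + 360000 * (N * k) + (6000 * L + 3100) * rc + 1150 * N + 42000 +
         (30 * L + 30 * g + 40 * (L + 1) + 1000 + 300 * N)" by blast
      qed
      ultimately show ?case using L(1) g(1) by blast
     qed
    qed
   qed
  qed (use N4 LN in \<open>auto simp: L_def\<close>)
 qed (use N4 in \<open>auto simp: st1_def\<close>)
 note lp = this
 have b: "st$''source'' 0 = s" "st$''last'' s = Suc src" "st$''m'' 0 = m" "s <= W" "Suc 0 <= W" "src <= W" "Suc src <= W" "2 <= W" "m <= W" "N <= W" "2 * m = N"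
  using src sr N4 W(2) by (auto simp: la_def s_def m_def N_def)
 show ?thesis unfolding core_def
  apply (rule wp_IE, (simp add: b cong: wp_cong; fail)+)
  apply (rule wp_IE, (simp add: b cong: wp_cong; fail)+)
  apply (rule wp_mono[OF lp[unfolded st1_def]])
  by fastforce
qed

lemma wp_prog:
 fixes G :: "nat pair_pre_digraph" and w :: "nat \<times> nat => real"
 defines "E \<equiv> parcs G"
 assumes G: "pair_graph G" "pverts G = {..<n}" "num_edges G = m" "edge_list G es" and w: "\<forall>(u, v)\<in>parcs G. 0 <= w (u, v) & w (u, v) = w (v, u)"
  and s: "s < n" and W: "2000000 * ((2 * m + 4) * (2 * m + 4) * (2 * m + 4) * (2 * m + 4)) <= W" "n <= W"
 shows "wp W prog (%T st'. (\<forall>v. if st'$''reached'' v = 0 then \<forall>d. \<not> gwalk E w s v d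
   else gwalk E w s v (rmem st' ''dist'' v) & (\<forall>d. gwalk E w s v d --> rmem st' ''dist'' v <= d)) &
  real T <= 400000000 * time_bound n m) (init_state n es w s)"
proof -
 interpret pair_graph G by fact
 define t where "t = tl_of es"
 define ww where "ww = (%e. w (es ! e))"
 have len: "length es = m" using G(3,4) by (simp add: edge_list_def)
 have arc: "\<And>h. h < 2 * m ==> (t h, t (twin h)) \<in> E & w (t h, t (twin h)) = ww (h div 2)"
  "\<And>a b. (a, b) \<in> E ==> \<exists>h<2 * m. t h = a & t (twin h) = b"
  using edge_list_arcs[OF G(4) w] unfolding len t_def ww_def E_def by blast+
 have nn: "0 <= w (x, y)" if "(x, y) \<in> E" for x y using w that unfolding E_def by auto
 have tn: "t h < n" if "h < 2 * m" for h using arc_fst_in_verts[of "(t h, t (twin h))"] arc(1)[OF that] G(2) by (simp add: E_def)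
 have mn: "m <= n * n"
 proof -
  have sub: "parcs G \<subseteq> {..<n} \<times> {..<n}" using arc_fst_in_verts arc_snd_in_verts G(2) by fastforce
  then have fin: "finite (parcs G)" by (rule finite_subset) simp
  have "m <= card (parcs G)" using G(3) card_image_le[OF fin] unfolding num_edges_def by blast
  also have "\<dots> <= card ({..<n} \<times> {..<n})" using sub by (intro card_mono) auto
  finally show ?thesis by simp
 qed
 have mW: "1000 * (2 * m + 4) <= W" using word_bounds(5)[OF refl _ _ _ W(1), where k = 0 and l = 0 and L = 0] by simp
 define st1 where "st1 = iu ''reached'' s (Suc 0) (init_state n es w s)"
 have m1: "st1$''m'' 0 = m" by (simp add: st1_def init_state_def len)
 have B0: "BS t ww 0 0 st1" by (simp add: BI_def st1_def init_state_def)
 have en: "st1$''end1'' e = t (2 * e) & st1$''end2'' e = t (2 * e + 1) & t (2 * e) <= W & t (2 * e + 1) <= W" if "e < m" for e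
  using that tn[of "2 * e"] tn[of "2 * e + 1"] W(2) by (simp add: st1_def init_state_def len t_def tl_of_def)
 note tb = time_bound_ge[OF mn]
 have tb1: "1 <= time_bound n m" by (simp add: time_bound_def)
 have "wp W (build ;; Cond (pos (IElem ''last'' (V ''source''))) core Skip) (%T st'. (\<forall>v. if st'$''reached'' v = 0 then \<forall>d. \<not> gwalk E w s v d
   else gwalk E w s v (rmem st' ''dist'' v) & (\<forall>d. gwalk E w s v d --> rmem st' ''dist'' v <= d)) &
  real (T + 10) <= 400000000 * time_bound n m) st1"
 proof (rule wp_Seq, rule wp_frame[OF wp_build[where st = st1 and t = t and ww = ww and W = W, unfolded m1]], goal_cases)
  case 1
  show ?case by (rule B0)
 next
  case (4 e)
  then show ?case using en[of e] by (simp add: st1_def init_state_def len ww_def)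
 next
  case 5
  show ?case using mW by simp
 next
  case (6 T2 st2)
  have B2: "BS t ww (2 * m) (2 * m) st2" "T2 <= 300 * m + 10" using 6(1) by blast+
  have f2: "st2$a = st1$a" if "a \<notin> {''rv'', ''last'', ''hh'', ''f6'', ''tt'', ''be''}" for a using 6(2) that by (simp add: unch_def)
  have r2: "rmem st2 a = rmem st1 a" if "a ~= ''wt''" for a using 6(2) that by (simp add: unch_def)
  have ww0: "0 <= ww e" if "2 * e < 2 * m" for e using arc(1)[of "2 * e"] nn that by fastforce
  have hg: "halfedges (2 * m) (st2$''rv'') (rmem st2 ''wt'') t ww (st2$''last'') E w"
   by (intro halfedges.intro halfedges_axioms.intro BI_hgraph[OF B2(1) ww0] B2(1) arc) simp_all
  have s2: "st2$''source'' 0 = s" "st2$''m'' 0 = m" by (simp_all add: f2 st1_def init_state_def len)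
  have rd: "st2$''reached'' v ~= 0 \<longleftrightarrow> v = s" "rmem st2 ''dist'' s = 0" for v by (simp_all add: f2 r2 st1_def init_state_def)
  have z: "st2$a x = 0" if "a \<in> {''b'', ''c'', ''i'', ''r'', ''R'', ''bd''}" for a x
   using that by (elim insertE emptyE) (simp_all add: f2 st1_def init_state_def)
  have z0: "rmem st2 ''zero'' 0 = 0" by (simp add: r2 st1_def init_state_def)
  have en2: "st2$''end1'' e = t (2 * e) & st2$''end2'' e = t (2 * e + 1) & t (2 * e) <= W & t (2 * e + 1) <= W" if "e < m" for e
   using en[OF that] by (simp add: f2)
  have ls: "st2$''last'' s <= W"
  proof (cases "st2$''last'' s")
   case (Suc h)
   then show ?thesis using BI_D(6)[OF B2(1) Suc] mW by simp
  qed simp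
  have sW: "s <= W" using s W(2) by linarith
  show ?case
  proof (rule wp_Cond, goal_cases)
   case 1
   show ?case using s2 ls sW by simp
  next
   case 2
   then have l0: "st2$''last'' s ~= 0" using s2 by simp
   show ?case
   \<comment> \<open>The summand \<open>300 * m + 100\<close> in the bound of \<open>wp_core\<close>
     leaves room for the time of \<open>build\<close> and the initial assignments.\<close>
   proof (rule wp_mono[OF wp_core[where st = st2 and W = W and t = t, unfolded s2, OF hg l0 z z0 rd en2 W(1) sW]], goal_cases)
    case (3 T3 st3)
    then obtain L g where Lg: "is_log (2 * m) L" "is_log L g" "real (T3 + 300 * m + 100) <= 3000000 * (real (2 * m) * sqrt (real L * (real g + 1)))" by blast
    have "real (T2 + (1 + bcost (pos (IElem ''last'' (V ''source''))) + T3) + 10) <= real (T3 + 300 * m + 100)" using B2(2) by simp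
    also have "\<dots> <= 400000000 * time_bound n m" using Lg(3) tb(2)[OF Lg(1,2)] tb1 by linarith
    finally show ?case using 3 by blast
   qed
  next
   case 3
   then have l0: "st2$''last'' s = 0" using s2 by simp
   have nn0: "0 <= d" if "gwalk E w s v d" for v d using gwalk_nn[OF that] nn by blast
   have no: "(s, c) \<notin> E" for c
   proof
    assume "(s, c) \<in> E"
    then obtain h where "h < 2 * m" "t h = s" using arc(2) by blast
    then show False using BI_D(5)[OF B2(1), of h] l0 by simp
   qed
   have "if st2$''reached'' v = 0 then \<forall>d. \<not> gwalk E w s v d
    else gwalk E w s v (rmem st2 ''dist'' v) & (\<forall>d. gwalk E w s v d --> rmem st2 ''dist'' v <= d)" for v
   proof (cases "v = s")
    case True
    then show ?thesis using rd(1)[of s] rd(2) gwalk_refl nn0 by auto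
   next
    case False
    then show ?thesis using rd(1)[of v] gwalk_first[of E w s v] no by auto
   qed
   moreover have "real (T2 + (1 + bcost (pos (IElem ''last'' (V ''source''))) + 1) + 10) <= 400000000 * time_bound n m"
   proof -
    have "real (T2 + (1 + bcost (pos (IElem ''last'' (V ''source''))) + 1) + 10) <= 300 * real m + 100" using B2(2) by simp
    then show ?thesis using tb(1) tb1 by linarith
   qed
   ultimately show ?case by (intro wp_Skip) blast
  qed
 qed (simp_all add: st1_def init_state_def)
 note lp = this
 have b: "imem (init_state n es w s) ''source'' 0 = s" "s <= W" "Suc 0 <= W" using s W(2) by (auto simp: init_state_def)
 show ?thesis unfolding prog_def
  apply (rule wp_IE, (simp add: b cong: wp_cong; fail)+)
  apply (rule wp_mono[OF lp[unfolded st1_def]])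
  by simp
qed

theorem theorem1p2:
  shows "\<exists>(prog :: com) (c :: nat) (C :: real).
    \<forall>(G :: nat pair_pre_digraph) (w :: nat \<times> nat \<Rightarrow> real) (s :: nat) (es :: (nat \<times> nat) list)
     (n :: nat) (m :: nat).
      pair_graph G \<and> pverts G = {..<n} \<and> num_edges G = m \<and>
      (\<forall>(u, v) \<in> parcs G. 0 \<le> w (u, v) \<and> w (u, v) = w (v, u)) \<and>
      s \<in> pverts G \<and> edge_list G es \<longrightarrow>
      (\<exists>t \<sigma>. exec ((n + m + 1) ^ c) prog (init_state n es w s) t \<sigma> \<and>
             real t \<le> C * time_bound n m \<and>
             (\<forall>v \<in> pverts G. output_dist \<sigma> v = wf_digraph.\<mu> (with_proj G) w s v))"
proof (rule exI[of _ prog], rule exI[of _ 30], rule exI[of _ 400000000], intro allI impI, elim conjE)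
 fix G :: "nat pair_pre_digraph" and w :: "nat \<times> nat => real" and s :: nat and es n m
 assume G: "pair_graph G" "pverts G = {..<n}" "num_edges G = m" and w: "\<forall>(u, v)\<in>parcs G. 0 <= w (u, v) & w (u, v) = w (v, u)"
  and s: "s \<in> pverts G" and es: "edge_list G es"
 define X where "X = n + m + 1"
 have sn: "s < n" using s G(2) by simp
 have X: "2 * m + 4 <= 2 * X" "2 <= X" using sn by (auto simp: X_def)
 \<comment> \<open>The source lies below \<open>n\<close>, so \<open>X >= 2\<close>. The words need
   \<open>2000000 * 16 = 32000000\<close> times the fourth power of \<open>X\<close>; 26 of the 30
   factors \<open>X\<close> cover this constant.\<close>
 have "2 ^ 26 <= X ^ 26" using X(2) by (rule power_mono) simp
 then have "32000000 <= X ^ 26" by simp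
 then have "32000000 * (X * X * X * X) <= X ^ 26 * (X * X * X * X)" by (rule mult_right_mono) simp
 also have "\<dots> = X ^ 30" by (simp add: power_numeral_reduce)
 finally have X30: "32000000 * (X * X * X * X) <= X ^ 30" .
 have "(2 * m + 4) * (2 * m + 4) * (2 * m + 4) * (2 * m + 4) <= (2 * X) * (2 * X) * (2 * X) * (2 * X)" using X(1) by (intro mult_mono) auto
 also have "\<dots> = 16 * (X * X * X * X)" by simp
 finally have W1: "2000000 * ((2 * m + 4) * (2 * m + 4) * (2 * m + 4) * (2 * m + 4)) <= X ^ 30" using X30 by linarith
 have "X ^ 1 <= X ^ 30" using X(2) by (intro power_increasing) auto
 then have W2: "n <= X ^ 30" by (simp add: X_def)
 obtain t st where t: "exec (X ^ 30) prog (init_state n es w s) t st" "real t <= 400000000 * time_bound n m"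
  and o: "\<And>v. if st$''reached'' v = 0 then \<forall>d. \<not> gwalk (parcs G) w s v d
   else gwalk (parcs G) w s v (rmem st ''dist'' v) & (\<forall>d. gwalk (parcs G) w s v d --> rmem st ''dist'' v <= d)"
  using wp_prog[OF G es w sn W1 W2] unfolding wp_def by blast
 have "output_dist st v = wf_digraph.\<mu> (with_proj G) w s v" for v
 proof (cases "st$''reached'' v = 0")
  case True
  then have e: "{d. gwalk (parcs G) w s v d} = {}" using o[of v] by auto
  show ?thesis unfolding mu_gwalk[OF G(1) s] output_dist_def e using True by (simp add: top_ereal_def)
 next
  case False
  then show ?thesis unfolding mu_gwalk[OF G(1) s] output_dist_def
   using o[of v] INF_ereal_min[of "rmem st ''dist'' v" "{d. gwalk (parcs G) w s v d}"] by simp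
 qed
 with t show "\<exists>t st. exec ((n + m + 1) ^ 30) prog (init_state n es w s) t st & real t <= 400000000 * time_bound n m &
   (\<forall>v\<in>pverts G. output_dist st v = wf_digraph.\<mu> (with_proj G) w s v)" unfolding X_def by blast
qed

end
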